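(* Let $R$ be a commutative ring. The category of abelian affine $R$-monoid schemes $G=\mathrm{Spec}\,A$ with $A$ a free $R$-module is anti-equivalent to the category of abelian formal monoids $\mathrm{Spec}\,\mathcal A^*$ with $A$ a free $R$-module. The functor $\mathbb G\mapsto\mathbb G^\vee$ gives the categorical anti-equivalence.
   Context: $R$ is a commutative ring with unit. All functors are covariant functors from the category of commutative $R$-algebras to sets; affine $R$-schemes are identified with their functors of points. $\mathcal R$ is the functor of rings $\mathcal R(S)=S$. A functor of $\mathcal R$-modules is a functor $\mathbb M$ with morphisms of functors $\mathbb M\times\mathbb M\to\mathbb M$, $\mathcal R\times\mathbb M\to\mathbb M$ making each $\mathbb M(S)$ an $S$-module. $\mathbb M^*(S)=\mathrm{Hom}_{\mathcal S}(\mathbb M_{|S},\mathcal S)$, where $_{|S}$ is restriction to commutative $S$-algebras. For an $R$-module $A$, $\mathcal A(S)=A\otimes_RS$. A functor of $\mathcal R$-algebras is a functor of (associative, unital) rings $\mathbb A$ with a morphism of functors of rings $\mathcal R\to\mathbb A$ with central image. For a functor of commutative algebras $\mathbb B$, $(\mathrm{Spec}\,\mathbb B)(S)=\mathrm{Hom}_{\mathcal R\text{-alg}}(\mathbb B,\mathcal S)$, where $\mathcal S(R')=S\otimes_RR'$. A formal scheme is a functor $\mathrm{Spec}\,\mathcal C^*$, where $C$ is a free $R$-module and $\mathcal C^*$ is a functor of commutative $\mathcal R$-algebras; a formal monoid is a formal scheme that is a functor of monoids. Morphisms in both categories are morphisms of functors of monoids. For a functor of abelian monoids $\mathbb G$,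 the dual monoid is $\mathbb G^\vee=\underline{\mathrm{Hom}}_{mon}(\mathbb G,\mathcal R)$, i.e. $\mathbb G^\vee(S)=\mathrm{Hom}_{mon}(\mathbb G_{|S},\mathcal R_{|S})$, where $\mathcal R$ is regarded as a functor of monoids under multiplication. *)

theory Defs
  imports "HOL-Algebra.Module" "HOL-Algebra.Free_Abelian_Groups"
begin

(* Universe convention.  A commutative R-algebra is a record T with "algebra R T" (HOL-Algebra)
   whose carrier is a set of elements of the type 'u; the type 'u, which is also the type of the
   elements of R and of free R-modules, plays the role of the universe over which functors are
   defined.  If 'u is infinite, this universe is closed, up to isomorphism, under tensor products,
   polynomial rings and quotients.  The values of a functor are sets of elements of a type 'v, not
   tied to 'u; 'v is large enough to contain a copy of every affine scheme as soon as the type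
   'u => 'u embeds into it.  Dualizing a functor of monoids changes the type of its values. *)

type_synonym 'u alg = "('u, 'u) module"

definition Algs :: "('u, 'm) ring_scheme \<Rightarrow> 'u alg set" where
  "Algs R = {T. algebra R T}"

definition alg_hom ::
  "('u, 'm) ring_scheme \<Rightarrow> ('u, 'a, 'x) module_scheme \<Rightarrow> ('u, 'b, 'y) module_scheme \<Rightarrow> ('a \<Rightarrow> 'b) set"
  where
  "alg_hom R S T = {f \<in> extensional (carrier S). f \<in> ring_hom S T \<and>
     (\<forall>r\<in>carrier R. \<forall>x\<in>carrier S. f (r \<odot>\<^bsub>S\<^esub> x) = r \<odot>\<^bsub>T\<^esub> f x)}"

definition monoid_homs :: "('a, 'x) monoid_scheme \<Rightarrow> ('b, 'y) monoid_scheme \<Rightarrow> ('a \<Rightarrow> 'b) set" where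
  "monoid_homs M N = {f \<in> hom M N. f \<one>\<^bsub>M\<^esub> = \<one>\<^bsub>N\<^esub>}"

(* Restriction of scalars along a ring map phi from A to the base ring of T.  The new scalar
   multiplication is made undefined for scalars outside the carrier of A, so that iterated
   restrictions of scalars are equal as records, and not just isomorphic. *)
definition restrict_scalars ::
  "('u, 'm) ring_scheme \<Rightarrow> ('u \<Rightarrow> 'u) \<Rightarrow> 'u alg \<Rightarrow> 'u alg" where
  "restrict_scalars A \<phi> T = T\<lparr>smult := (\<lambda>a\<in>carrier A. \<lambda>x. \<phi> a \<odot>\<^bsub>T\<^esub> x)\<rparr>"

definition as_base_alg :: "('u, 'm) ring_scheme \<Rightarrow> 'u alg \<Rightarrow> 'u alg \<Rightarrow> 'u alg" where
  "as_base_alg R S T = restrict_scalars R (\<lambda>r. r \<odot>\<^bsub>S\<^esub> \<one>\<^bsub>S\<^esub>) T"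

definition free_mod :: "('u, 'm) ring_scheme \<Rightarrow> ('u, 'a, 'x) module_scheme \<Rightarrow> bool" where
  "free_mod R M \<longleftrightarrow> module R M \<and>
     (\<exists>B\<subseteq>carrier M. \<forall>m\<in>carrier M. \<exists>!c. c \<in> B \<rightarrow>\<^sub>E carrier R \<and> finite {b \<in> B. c b \<noteq> \<zero>\<^bsub>R\<^esub>} \<and>
        m = finsum M (\<lambda>b. c b \<odot>\<^bsub>M\<^esub> b) {b \<in> B. c b \<noteq> \<zero>\<^bsub>R\<^esub>})"


section \<open>Functors on commutative algebras\<close>

(* A functor to sets, monoids, rings or modules is given by its values on objects, which are
   records with at least a carrier, and by its values on arrows: Ar F S T f is the map induced by
   an algebra homomorphism f from S to T. *)
record ('u, 'o, 'v) alg_functor =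
  Ob :: "'u alg \<Rightarrow> 'o"
  Ar :: "'u alg \<Rightarrow> 'u alg \<Rightarrow> ('u \<Rightarrow> 'u) \<Rightarrow> 'v \<Rightarrow> 'v"

definition set_functor ::
  "('u, 'm) ring_scheme \<Rightarrow> ('u, ('v, 'x) partial_object_scheme, 'v) alg_functor \<Rightarrow> bool" where
  "set_functor R F \<longleftrightarrow>
     (\<forall>S\<in>Algs R. \<forall>T\<in>Algs R. \<forall>f\<in>alg_hom R S T. Ar F S T f \<in> carrier (Ob F S) \<rightarrow> carrier (Ob F T)) \<and>
     (\<forall>S\<in>Algs R. \<forall>x\<in>carrier (Ob F S). Ar F S S (\<lambda>s\<in>carrier S. s) x = x) \<and>
     (\<forall>S\<in>Algs R. \<forall>T\<in>Algs R. \<forall>U\<in>Algs R. \<forall>f\<in>alg_hom R S T. \<forall>g\<in>alg_hom R T U.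
        \<forall>x\<in>carrier (Ob F S). Ar F S U (compose (carrier S) g f) x = Ar F T U g (Ar F S T f x))"

definition comm_monoid_functor ::
  "('u, 'm) ring_scheme \<Rightarrow> ('u, 'v monoid, 'v) alg_functor \<Rightarrow> bool" where
  "comm_monoid_functor R G \<longleftrightarrow> set_functor R G \<and>
     (\<forall>S\<in>Algs R. comm_monoid (Ob G S)) \<and>
     (\<forall>S\<in>Algs R. \<forall>T\<in>Algs R. \<forall>f\<in>alg_hom R S T. Ar G S T f \<in> monoid_homs (Ob G S) (Ob G T))"

(* The morphism from the structure ring functor to B sends s to s * 1; it is natural because the
   maps of B are ring homomorphisms semilinear over f. *)
definition comm_algebra_functor ::
  "('u, 'm) ring_scheme \<Rightarrow> ('u, ('u, 'v) module, 'v) alg_functor \<Rightarrow> bool" where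
  "comm_algebra_functor R B \<longleftrightarrow> set_functor R B \<and>
     (\<forall>S\<in>Algs R. algebra S (Ob B S)) \<and>
     (\<forall>S\<in>Algs R. \<forall>T\<in>Algs R. \<forall>f\<in>alg_hom R S T. Ar B S T f \<in> ring_hom (Ob B S) (Ob B T) \<and>
        (\<forall>s\<in>carrier S. \<forall>x\<in>carrier (Ob B S).
           Ar B S T f (s \<odot>\<^bsub>Ob B S\<^esub> x) = f s \<odot>\<^bsub>Ob B T\<^esub> Ar B S T f x))"

definition nat_trans ::
  "('u, 'm) ring_scheme \<Rightarrow> ('u, ('v, 'x) partial_object_scheme, 'v) alg_functor \<Rightarrow>
   ('u, ('w, 'y) partial_object_scheme, 'w) alg_functor \<Rightarrow> ('u alg \<Rightarrow> 'v \<Rightarrow> 'w) set" where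
  "nat_trans R F G = {\<eta> \<in> extensional (Algs R).
     (\<forall>T\<in>Algs R. \<eta> T \<in> carrier (Ob F T) \<rightarrow>\<^sub>E carrier (Ob G T)) \<and>
     (\<forall>T\<in>Algs R. \<forall>U\<in>Algs R. \<forall>f\<in>alg_hom R T U. \<forall>x\<in>carrier (Ob F T).
        \<eta> U (Ar F T U f x) = Ar G T U f (\<eta> T x))}"

definition monoid_trans where
  "monoid_trans R F G = {\<eta> \<in> nat_trans R F G. \<forall>T\<in>Algs R. \<eta> T \<in> monoid_homs (Ob F T) (Ob G T)}"

definition linear_trans where
  "linear_trans R M N = {\<eta> \<in> nat_trans R M N. \<forall>T\<in>Algs R.
     (\<forall>x\<in>carrier (Ob M T). \<forall>y\<in>carrier (Ob M T).
        \<eta> T (x \<oplus>\<^bsub>Ob M T\<^esub> y) = \<eta> T x \<oplus>\<^bsub>Ob N T\<^esub> \<eta> T y) \<and>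
     (\<forall>t\<in>carrier T. \<forall>x\<in>carrier (Ob M T). \<eta> T (t \<odot>\<^bsub>Ob M T\<^esub> x) = t \<odot>\<^bsub>Ob N T\<^esub> \<eta> T x)}"

definition algebra_trans where
  "algebra_trans R A B = {\<eta> \<in> nat_trans R A B. \<forall>T\<in>Algs R. \<eta> T \<in> alg_hom T (Ob A T) (Ob B T)}"

definition functor_iso ::
  "('u, 'm) ring_scheme \<Rightarrow> ('u, ('v, 'x) partial_object_scheme, 'v) alg_functor \<Rightarrow>
   ('u, ('w, 'y) partial_object_scheme, 'w) alg_functor \<Rightarrow> bool" where
  "functor_iso R F G \<longleftrightarrow>
     (\<exists>\<eta>\<in>nat_trans R F G. \<forall>T\<in>Algs R. bij_betw (\<eta> T) (carrier (Ob F T)) (carrier (Ob G T)))"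

definition restrict_functor ::
  "('u, 'm) ring_scheme \<Rightarrow> 'u alg \<Rightarrow> ('u, 'o, 'v) alg_functor \<Rightarrow> ('u, 'o, 'v) alg_functor" where
  "restrict_functor R S F = \<lparr>Ob = \<lambda>T. Ob F (as_base_alg R S T),
     Ar = \<lambda>T U. Ar F (as_base_alg R S T) (as_base_alg R S U)\<rparr>"

(* The functor T |-> T; as a functor of monoids it is taken with the multiplication of T.
   Scalars of Ob struct_ring T are the elements of T itself. *)
definition struct_ring :: "('u, 'u alg, 'u) alg_functor" where
  "struct_ring = \<lparr>Ob = \<lambda>T. T\<lparr>smult := monoid.mult T\<rparr>, Ar = \<lambda>T U f. f\<rparr>"

(* An S'-algebra T is regarded as an S-algebra through f : S -> S'. *)
definition base_change_trans ::
  "'u alg \<Rightarrow> 'u alg \<Rightarrow> ('u \<Rightarrow> 'u) \<Rightarrow> ('u alg \<Rightarrow> 'v \<Rightarrow> 'w) \<Rightarrow> ('u alg \<Rightarrow> 'v \<Rightarrow> 'w)" where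
  "base_change_trans S S' f \<eta> = (\<lambda>T\<in>Algs S'. \<eta> (restrict_scalars S f T))"


section \<open>Tensor products\<close>

(* The free abelian group on M x S modulo the bilinearity and balancing relations; elements are
   cosets. *)
type_synonym ('a, 'b) tensor = "(('a \<times> 'b) \<Rightarrow>\<^sub>0 int) set"

definition tensor_pre ::
  "('a, 'b, 'x) module_scheme \<Rightarrow> ('a, 'c, 'y) module_scheme \<Rightarrow> (('b \<times> 'c) \<Rightarrow>\<^sub>0 int) monoid" where
  "tensor_pre M S = free_Abelian_group (carrier M \<times> carrier S)"

definition tensor_rel ::
  "('a, 'm) ring_scheme \<Rightarrow> ('a, 'b, 'x) module_scheme \<Rightarrow> ('a, 'c, 'y) module_scheme \<Rightarrow>
   ('b, 'c) tensor" where
  "tensor_rel R M S = generate (tensor_pre M S)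
     ({frag_of (x \<oplus>\<^bsub>M\<^esub> y, s) - frag_of (x, s) - frag_of (y, s) | x y s.
         x \<in> carrier M \<and> y \<in> carrier M \<and> s \<in> carrier S} \<union>
      {frag_of (x, s \<oplus>\<^bsub>S\<^esub> t) - frag_of (x, s) - frag_of (x, t) | x s t.
         x \<in> carrier M \<and> s \<in> carrier S \<and> t \<in> carrier S} \<union>
      {frag_of (r \<odot>\<^bsub>M\<^esub> x, s) - frag_of (x, r \<odot>\<^bsub>S\<^esub> s) | r x s.
         r \<in> carrier R \<and> x \<in> carrier M \<and> s \<in> carrier S})"

definition tensor_class where
  "tensor_class R M S z = tensor_rel R M S #>\<^bsub>tensor_pre M S\<^esub> z"

(* For an R-module M and an R-algebra S, the S-module obtained from M by base change; S acts on
   the right factor.  If M is an R-algebra too, mult and one make it an S-algebra; otherwise these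
   two fields are meaningless.  Each of the unions below is a union of equal cosets. *)
definition tensor ::
  "('a, 'm) ring_scheme \<Rightarrow> ('a, 'b, 'x) module_scheme \<Rightarrow> ('a, 'c, 'y) module_scheme \<Rightarrow>
   ('c, ('b, 'c) tensor) module" where
  "tensor R M S =
     \<lparr>carrier = carrier (tensor_pre M S Mod tensor_rel R M S),
      mult = (\<lambda>X Y. \<Union>x\<in>X. \<Union>y\<in>Y. tensor_class R M S
        (frag_extend (\<lambda>(m, s). frag_extend (\<lambda>(n, t). frag_of (m \<otimes>\<^bsub>M\<^esub> n, s \<otimes>\<^bsub>S\<^esub> t)) y) x)),
      one = tensor_class R M S (frag_of (\<one>\<^bsub>M\<^esub>, \<one>\<^bsub>S\<^esub>)),
      ring.zero = \<one>\<^bsub>tensor_pre M S Mod tensor_rel R M S\<^esub>,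
      add = monoid.mult (tensor_pre M S Mod tensor_rel R M S),
      smult = (\<lambda>s X. \<Union>x\<in>X. tensor_class R M S
        (frag_extend (\<lambda>(m, t). frag_of (m, s \<otimes>\<^bsub>S\<^esub> t)) x))\<rparr>"

definition tensor_map where
  "tensor_map R M S M' S' g f X =
     (\<Union>x\<in>X. tensor_class R M' S' (frag_extend (\<lambda>(m, s). frag_of (g m, f s)) x))"

definition quasi_coherent ::
  "('u, 'm) ring_scheme \<Rightarrow> 'u alg \<Rightarrow> ('u, ('u, ('u, 'u) tensor) module, ('u, 'u) tensor) alg_functor"
  where
  "quasi_coherent R M =
     \<lparr>Ob = \<lambda>S. tensor R M S, Ar = \<lambda>S T f. tensor_map R M S M T (\<lambda>m. m) f\<rparr>"


section \<open>Spectra, formal schemes\<close>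

definition Spec ::
  "('u, 'm) ring_scheme \<Rightarrow> 'u alg \<Rightarrow> ('u, ('u \<Rightarrow> 'u) partial_object, 'u \<Rightarrow> 'u) alg_functor" where
  "Spec R A = \<lparr>Ob = \<lambda>S. \<lparr>carrier = alg_hom R A S\<rparr>, Ar = \<lambda>S T f \<phi>. compose (carrier A) f \<phi>\<rparr>"

definition Spec_functor ::
  "('u, 'm) ring_scheme \<Rightarrow> ('u, ('u, 'v) module, 'v) alg_functor \<Rightarrow>
   ('u, ('u alg \<Rightarrow> 'v \<Rightarrow> ('u, 'u) tensor) partial_object, 'u alg \<Rightarrow> 'v \<Rightarrow> ('u, 'u) tensor) alg_functor"
  where
  "Spec_functor R B =
     \<lparr>Ob = \<lambda>S. \<lparr>carrier = algebra_trans R B (quasi_coherent R S)\<rparr>,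
      Ar = \<lambda>S T f \<eta>. \<lambda>U\<in>Algs R. compose (carrier (Ob B U)) (tensor_map R S U T U f (\<lambda>u. u)) (\<eta> U)\<rparr>"

(* The fields mult and one of the values are irrelevant here. *)
definition dual_module ::
  "('u, 'm) ring_scheme \<Rightarrow> ('u, ('u, 'v) module, 'v) alg_functor \<Rightarrow>
   ('u, ('u, 'u alg \<Rightarrow> 'v \<Rightarrow> 'u) module, 'u alg \<Rightarrow> 'v \<Rightarrow> 'u) alg_functor" where
  "dual_module R M =
     \<lparr>Ob = \<lambda>S. let M' = restrict_functor R S M in
        \<lparr>carrier = linear_trans S M' struct_ring,
         mult = undefined, one = undefined,
         ring.zero = (\<lambda>T\<in>Algs S. \<lambda>x\<in>carrier (Ob M' T). \<zero>\<^bsub>T\<^esub>),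
         add = (\<lambda>\<eta> \<theta>. \<lambda>T\<in>Algs S. \<lambda>x\<in>carrier (Ob M' T). \<eta> T x \<oplus>\<^bsub>T\<^esub> \<theta> T x),
         smult = (\<lambda>s \<eta>. \<lambda>T\<in>Algs S. \<lambda>x\<in>carrier (Ob M' T). s \<odot>\<^bsub>T\<^esub> \<eta> T x)\<rparr>,
      Ar = base_change_trans\<rparr>"

(* B is the dual of the quasi-coherent module of C, equipped with a multiplication and a unit
   turning it into a functor of commutative algebras. *)
definition formal_scheme ::
  "('u, 'm) ring_scheme \<Rightarrow> ('u, ('v, 'x) partial_object_scheme, 'v) alg_functor \<Rightarrow> bool" where
  "formal_scheme R F \<longleftrightarrow> (\<exists>(C :: 'u alg) B. free_mod R C \<and> comm_algebra_functor R B \<and>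
     (\<forall>S\<in>Algs R. Ob B S = (Ob (dual_module R (quasi_coherent R C)) S)
        \<lparr>mult := monoid.mult (Ob B S), one := monoid.one (Ob B S)\<rparr>) \<and>
     Ar B = Ar (dual_module R (quasi_coherent R C)) \<and>
     functor_iso R F (Spec_functor R B))"

definition affine_free_scheme ::
  "('u, 'm) ring_scheme \<Rightarrow> ('u, ('v, 'x) partial_object_scheme, 'v) alg_functor \<Rightarrow> bool" where
  "affine_free_scheme R F \<longleftrightarrow> (\<exists>A. algebra R A \<and> free_mod R A \<and> functor_iso R F (Spec R A))"


section \<open>The dual monoid\<close>

definition dual_monoid ::
  "('u, 'm) ring_scheme \<Rightarrow> ('u, 'v monoid, 'v) alg_functor \<Rightarrow>
   ('u, ('u alg \<Rightarrow> 'v \<Rightarrow> 'u) monoid, 'u alg \<Rightarrow> 'v \<Rightarrow> 'u) alg_functor" where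
  "dual_monoid R G =
     \<lparr>Ob = \<lambda>S. let G' = restrict_functor R S G in
        \<lparr>carrier = monoid_trans S G' (restrict_functor R S struct_ring),
         mult = (\<lambda>\<eta> \<theta>. \<lambda>T\<in>Algs S. \<lambda>x\<in>carrier (Ob G' T). \<eta> T x \<otimes>\<^bsub>T\<^esub> \<theta> T x),
         one = (\<lambda>T\<in>Algs S. \<lambda>x\<in>carrier (Ob G' T). \<one>\<^bsub>T\<^esub>)\<rparr>,
      Ar = base_change_trans\<rparr>"

definition dual_monoid_map ::
  "('u, 'm) ring_scheme \<Rightarrow> ('u, 'v monoid, 'v) alg_functor \<Rightarrow> ('u, 'v monoid, 'v) alg_functor \<Rightarrow>
   ('u alg \<Rightarrow> 'v \<Rightarrow> 'v) \<Rightarrow> ('u alg \<Rightarrow> ('u alg \<Rightarrow> 'v \<Rightarrow> 'u) \<Rightarrow> ('u alg \<Rightarrow> 'v \<Rightarrow> 'u))" where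
  "dual_monoid_map R G H \<phi> = (\<lambda>S\<in>Algs R. \<lambda>\<eta>\<in>carrier (Ob (dual_monoid R H) S).
     \<lambda>T\<in>Algs S. compose (carrier (Ob G (as_base_alg R S T))) (\<eta> T) (\<phi> (as_base_alg R S T)))"


section \<open>Categories and anti-equivalences\<close>

record ('o, 'a) cat =
  Obj :: "'o set"
  Mor :: "'o \<Rightarrow> 'o \<Rightarrow> 'a set"
  Idt :: "'o \<Rightarrow> 'a"
  Cmp :: "'o \<Rightarrow> 'o \<Rightarrow> 'o \<Rightarrow> 'a \<Rightarrow> 'a \<Rightarrow> 'a"  (* Cmp C X Y Z g f is g after f, for f : X -> Y, g : Y -> Z *)

definition is_category :: "('o, 'a) cat \<Rightarrow> bool" where
  "is_category C \<longleftrightarrow>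
     (\<forall>X\<in>Obj C. Idt C X \<in> Mor C X X) \<and>
     (\<forall>X\<in>Obj C. \<forall>Y\<in>Obj C. \<forall>Z\<in>Obj C. \<forall>f\<in>Mor C X Y. \<forall>g\<in>Mor C Y Z. Cmp C X Y Z g f \<in> Mor C X Z) \<and>
     (\<forall>X\<in>Obj C. \<forall>Y\<in>Obj C. \<forall>f\<in>Mor C X Y.
        Cmp C X X Y f (Idt C X) = f \<and> Cmp C X Y Y (Idt C Y) f = f) \<and>
     (\<forall>W\<in>Obj C. \<forall>X\<in>Obj C. \<forall>Y\<in>Obj C. \<forall>Z\<in>Obj C. \<forall>f\<in>Mor C W X. \<forall>g\<in>Mor C X Y. \<forall>h\<in>Mor C Y Z.
        Cmp C W X Z (Cmp C X Y Z h g) f = Cmp C W Y Z h (Cmp C W X Y g f))"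

definition contravariant_functor ::
  "('o, 'a) cat \<Rightarrow> ('p, 'b) cat \<Rightarrow> ('o \<Rightarrow> 'p) \<Rightarrow> ('o \<Rightarrow> 'o \<Rightarrow> 'a \<Rightarrow> 'b) \<Rightarrow> bool" where
  "contravariant_functor C D F Fm \<longleftrightarrow>
     (\<forall>X\<in>Obj C. F X \<in> Obj D) \<and>
     (\<forall>X\<in>Obj C. \<forall>Y\<in>Obj C. \<forall>f\<in>Mor C X Y. Fm X Y f \<in> Mor D (F Y) (F X)) \<and>
     (\<forall>X\<in>Obj C. Fm X X (Idt C X) = Idt D (F X)) \<and>
     (\<forall>X\<in>Obj C. \<forall>Y\<in>Obj C. \<forall>Z\<in>Obj C. \<forall>f\<in>Mor C X Y. \<forall>g\<in>Mor C Y Z.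
        Fm X Z (Cmp C X Y Z g f) = Cmp D (F Z) (F Y) (F X) (Fm X Y f) (Fm Y Z g))"

definition isomorphism :: "('o, 'a) cat \<Rightarrow> 'o \<Rightarrow> 'o \<Rightarrow> 'a \<Rightarrow> bool" where
  "isomorphism C X Y f \<longleftrightarrow> f \<in> Mor C X Y \<and>
     (\<exists>g\<in>Mor C Y X. Cmp C X Y X g f = Idt C X \<and> Cmp C Y X Y f g = Idt C Y)"

(* The identity functor of C is naturally isomorphic to the covariant endofunctor (F, Fm). *)
definition iso_to_identity ::
  "('o, 'a) cat \<Rightarrow> ('o \<Rightarrow> 'o) \<Rightarrow> ('o \<Rightarrow> 'o \<Rightarrow> 'a \<Rightarrow> 'a) \<Rightarrow> bool" where
  "iso_to_identity C F Fm \<longleftrightarrow> (\<exists>\<alpha>. (\<forall>X\<in>Obj C. isomorphism C X (F X) (\<alpha> X)) \<and>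
     (\<forall>X\<in>Obj C. \<forall>Y\<in>Obj C. \<forall>f\<in>Mor C X Y.
        Cmp C X Y (F Y) (\<alpha> Y) f = Cmp C X (F X) (F Y) (Fm X Y f) (\<alpha> X)))"

definition anti_equivalence ::
  "('o, 'a) cat \<Rightarrow> ('p, 'b) cat \<Rightarrow> ('o \<Rightarrow> 'p) \<Rightarrow> ('o \<Rightarrow> 'o \<Rightarrow> 'a \<Rightarrow> 'b) \<Rightarrow> bool" where
  "anti_equivalence C D F Fm \<longleftrightarrow>
     is_category C \<and> is_category D \<and> contravariant_functor C D F Fm \<and>
     (\<exists>G Gm. contravariant_functor D C G Gm \<and>
        iso_to_identity C (\<lambda>X. G (F X)) (\<lambda>X Y f. Gm (F Y) (F X) (Fm X Y f)) \<and>
        iso_to_identity D (\<lambda>X. F (G X)) (\<lambda>X Y g. Fm (G Y) (G X) (Gm X Y g)))"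

definition monoid_functor_cat ::
  "('u, 'm) ring_scheme \<Rightarrow> ('u, 'v monoid, 'v) alg_functor set \<Rightarrow>
   (('u, 'v monoid, 'v) alg_functor, 'u alg \<Rightarrow> 'v \<Rightarrow> 'v) cat" where
  "monoid_functor_cat R Objs =
     \<lparr>Obj = Objs,
      Mor = monoid_trans R,
      Idt = (\<lambda>F. \<lambda>T\<in>Algs R. \<lambda>x\<in>carrier (Ob F T). x),
      Cmp = (\<lambda>F G H \<theta> \<eta>. \<lambda>T\<in>Algs R. compose (carrier (Ob F T)) (\<theta> T) (\<eta> T))\<rparr>"

definition affine_monoids ::
  "('u, 'm) ring_scheme \<Rightarrow> (('u, 'v monoid, 'v) alg_functor, 'u alg \<Rightarrow> 'v \<Rightarrow> 'v) cat" where
  "affine_monoids R = monoid_functor_cat R {G. comm_monoid_functor R G \<and> affine_free_scheme R G}"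

definition formal_monoids ::
  "('u, 'm) ring_scheme \<Rightarrow> (('u, 'v monoid, 'v) alg_functor, 'u alg \<Rightarrow> 'v \<Rightarrow> 'v) cat" where
  "formal_monoids R = monoid_functor_cat R {G. comm_monoid_functor R G \<and> formal_scheme R G}"

end

theory Submission
  imports Defs
begin

text \<open>
  A basis \<^term>\<open>B\<close> of \<^term>\<open>C\<close> identifies \<open>C \<otimes> T\<close> with the finitely supported functions
  from \<^term>\<open>B\<close> to \<^term>\<open>T\<close>, and the module of linear forms on \<open>C\<close> over \<^term>\<open>T\<close> with all of
  them; the flag \<open>k\<close> below tells the second kind from the first. Natural linear forms exchange the
  two kinds, so either functor of modules is reflexive. An affine or a formal scheme consists of the multiplicative
  forms on an algebra of vectors of the respective kind, and every natural function on such a scheme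
  is again given by a unique vector. Hence the dual of a commutative monoid scheme \<open>G\<close> consists of the
  multiplicative functions, which form a scheme of the other kind whose algebra of vectors is the convolution
  algebra of distributions on \<open>G\<close>. A distribution that is multiplicative on the dual comes
  from a unique point of \<open>G\<close>, so evaluation from \<open>G\<close> to its bidual is bijective, and this gives the anti-equivalence.
\<close>

\<comment> \<open>Two obstacles shape the proof. A linear form on all families indexed by an
  infinite \<open>B\<close> has no reason to be a finite sum, since unit vectors do not span;
  finiteness has to come from naturality, by testing the form over an algebra whose elements are
  finite sums. Moreover \<open>Algs R\<close> contains only algebras whose elements lie in
  \<open>'u\<close>. Its place is taken by quotients that see only finitely many basis vectors, and
  a function on the scheme is glued from them coordinate by coordinate. The flag is a parameter of
  the theory rather than a case distinction, so that what is proved for a monoid can be applied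
  again to its dual. Since dualizing changes the type of values, the bidual does not have the type
  of the original functor; the quasi-inverse is therefore obtained from full faithfulness and
  essential surjectivity, not from the dual functor itself.\<close>
text \<open>Subscripts without closing delimiter for the structure arguments of algebraic operations.\<close>

syntax "_index" :: "logic \<Rightarrow> index" ("\<^sub>_" [1000] 1000)

section \<open>Algebras, their homomorphisms, and algebra structures on images\<close>

abbreviation (input) vals where "vals F T \<equiv> carrier (Ob F T)"

abbreviation (input) idm where "idm S \<equiv> \<lambda>s\<in>carrier S. s"

abbreviation (input) over where "over \<equiv> as_base_alg"

text \<open>The initial object of \<open>Algs S\<close>. As \<open>S\<close> may be a record with
  other fields than those of \<open>'u alg\<close>, this copy is what makes the base ring itself an
  admissible argument of functors and a source of algebra homomorphisms.\<close>

definition self_alg :: "('u, 'm) ring_scheme => 'u alg" where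
 "self_alg S = \<lparr>carrier = carrier S, mult = monoid.mult S, one = monoid.one S,
   ring.zero = ring.zero S, add = ring.add S, smult = monoid.mult S\<rparr>"

definition struct_map :: "('u, 'm) ring_scheme => ('u, 'a, 'x) module_scheme => 'u => 'a" where
 "struct_map S T = (\<lambda>s\<in>carrier S. s \<odot>\<^sub>T \<one>\<^sub>T)"

lemma self_alg_simps [simp]:
 "carrier (self_alg S) = carrier S" "monoid.mult (self_alg S) = monoid.mult S"
 "monoid.one (self_alg S) = monoid.one S" "ring.zero (self_alg S) = ring.zero S"
 "ring.add (self_alg S) = ring.add S" "smult (self_alg S) = monoid.mult S" by (simp_all add: self_alg_def)

lemma Algs_iff: "T : Algs R \<longleftrightarrow> algebra R T" by (simp add: Algs_def)

lemma cring_of: "T : Algs R ==> cring T" by (simp add: Algs_iff algebra.M_cring)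

lemma Algs_base_cring: "T : Algs R ==> cring R" by (simp add: Algs_iff algebra.R_cring)

lemma smult_eq_struct_map:
 assumes "algebra S T" "s : carrier S" "t : carrier T"
 shows "s \<odot>\<^sub>T t = struct_map S T s \<otimes>\<^sub>T t"
proof -
 interpret algebra S T by fact
 show ?thesis using assms by (simp add: struct_map_def smult_assoc2)
qed

lemma cring_self_alg: assumes "cring S" shows "cring (self_alg S)"
proof -
 interpret cring S by fact
 show ?thesis
 proof (intro cringI abelian_groupI comm_monoidI)
  fix x assume "x : carrier (self_alg S)"
  then have "\<ominus>\<^sub>S x : carrier (self_alg S) \<and> \<ominus>\<^sub>S x \<oplus>\<^sub>(self_alg S) x = \<zero>\<^sub>(self_alg S)"
   by (simp add: l_neg)
  then show "\<exists>y\<in>carrier (self_alg S). y \<oplus>\<^sub>(self_alg S) x = \<zero>\<^sub>(self_alg S)" by blast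
 qed (auto simp: a_ac m_ac l_distr r_distr)
qed

lemma algebra_self: assumes "cring S" shows "algebra S (self_alg S)"
proof -
 interpret cring S by fact
 show ?thesis
  by (rule algebraI) (auto simp: assms cring_self_alg l_distr r_distr m_assoc)
qed

lemma self_Algs: "cring S ==> self_alg S : Algs S" by (simp add: Algs_iff algebra_self)

lemma alg_homD:
 assumes "f : alg_hom R S T"
 shows "f : extensional (carrier S)" "f : ring_hom S T"
  "x : carrier S ==> f x : carrier T" "f \<one>\<^sub>S = \<one>\<^sub>T"
  "[|x : carrier S; y : carrier S|] ==> f (x \<oplus>\<^sub>S y) = f x \<oplus>\<^sub>T f y"
  "[|x : carrier S; y : carrier S|] ==> f (x \<otimes>\<^sub>S y) = f x \<otimes>\<^sub>T f y"
  "[|r : carrier R; x : carrier S|] ==> f (r \<odot>\<^sub>S x) = r \<odot>\<^sub>T f x"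
 using assms by (auto simp: alg_hom_def ring_hom_def)

lemma ring_hom_0: "[|f : ring_hom S T; cring S; cring T|] ==> f \<zero>\<^sub>S = \<zero>\<^sub>T"
 by (simp add: cring.axioms(1) ring_hom_zero)

lemma alg_homI:
 assumes "f : extensional (carrier S)" "\<And>x. x : carrier S ==> f x : carrier T"
  "f \<one>\<^sub>S = \<one>\<^sub>T"
  "\<And>x y. [|x : carrier S; y : carrier S|] ==> f (x \<oplus>\<^sub>S y) = f x \<oplus>\<^sub>T f y"
  "\<And>x y. [|x : carrier S; y : carrier S|] ==> f (x \<otimes>\<^sub>S y) = f x \<otimes>\<^sub>T f y"
  "\<And>r x. [|r : carrier R; x : carrier S|] ==> f (r \<odot>\<^sub>S x) = r \<odot>\<^sub>T f x"
 shows "f : alg_hom R S T" using assms by (auto simp: alg_hom_def ring_hom_def)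

lemma alg_hom_id [simp]: "(idm S) : alg_hom R S S" if "algebra R S"
proof -
 interpret algebra R S by fact
 show ?thesis by (rule alg_homI) auto
qed

lemma alg_hom_compose:
 assumes "f : alg_hom R S T" "g : alg_hom R T U" "algebra R S"
 shows "compose (carrier S) g f : alg_hom R S U"
proof -
 interpret algebra R S by fact
 show ?thesis
  by (rule alg_homI) (auto simp: compose_def alg_homD[OF assms(1)] alg_homD[OF assms(2)])
qed

lemma struct_map_alg_hom:
 assumes "algebra S T" shows "struct_map S T : alg_hom S (self_alg S) T"
proof -
 interpret algebra S T by fact
 show ?thesis
  by (rule alg_homI)
   (auto simp: struct_map_def smult_l_distr smult_assoc1 smult_assoc2)
qed

lemma struct_map_closed [simp]:
 assumes "algebra S T" "s : carrier S" shows "struct_map S T s : carrier T"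
 using alg_homD(3)[OF struct_map_alg_hom[OF assms(1)]] assms(2) by simp

lemma alg_hom_struct_map:
 assumes "f : alg_hom R S T" "r : carrier R" "algebra R S"
 shows "f (struct_map R S r) = struct_map R T r"
proof -
 interpret algebra R S by fact
 show ?thesis using assms by (simp add: struct_map_def alg_homD[OF assms(1)])
qed

text \<open>The operations are computed on representatives chosen by \<open>inv_into\<close>;
  compatibility of \<open>q\<close> with them makes the result independent of the choice. An
  injective \<open>q\<close> yields a copy of an algebra inside another type, in particular inside
  \<open>'u\<close>; a general \<open>q\<close> yields a quotient.\<close>

lemma image_algebra:
 fixes A :: "('r, 'a, 'x) module_scheme" and q :: "'a => 'b"
 assumes A: "algebra R A"
  and add: "\<And>x x' y y'. [|x : carrier A; x' : carrier A; y : carrier A; y' : carrier A; q x = q x'; q y = q y'|]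
   ==> q (x \<oplus>\<^sub>A y) = q (x' \<oplus>\<^sub>A y')"
  and mult: "\<And>x x' y y'. [|x : carrier A; x' : carrier A; y : carrier A; y' : carrier A; q x = q x'; q y = q y'|]
   ==> q (x \<otimes>\<^sub>A y) = q (x' \<otimes>\<^sub>A y')"
  and smult: "\<And>r x x'. [|r : carrier R; x : carrier A; x' : carrier A; q x = q x'|]
   ==> q (r \<odot>\<^sub>A x) = q (r \<odot>\<^sub>A x')"
 obtains T :: "('r, 'b) module" where "algebra R T" "carrier T = q ` carrier A" "q : ring_hom A T"
  "\<And>r x. [|r : carrier R; x : carrier A|] ==> q (r \<odot>\<^sub>A x) = r \<odot>\<^sub>T q x"
proof -
 interpret A: algebra R A by fact
 define s where "s = inv_into (carrier A) q"
 have s: "s (q x) : carrier A" "q (s (q x)) = q x" if "x : carrier A" for x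
  using that by (auto simp: s_def inv_into_into f_inv_into_f)
 define T :: "('r, 'b) module" where
  "T = \<lparr>carrier = q ` carrier A, mult = (\<lambda>a b. q (s a \<otimes>\<^sub>A s b)), one = q \<one>\<^sub>A,
   ring.zero = q \<zero>\<^sub>A, add = (\<lambda>a b. q (s a \<oplus>\<^sub>A s b)), smult = (\<lambda>r a. q (r \<odot>\<^sub>A s a))\<rparr>"
 have c: "carrier T = q ` carrier A" "q \<zero>\<^sub>A = \<zero>\<^sub>T" "q \<one>\<^sub>A = \<one>\<^sub>T" by (simp_all add: T_def)
 have h1: "q x \<oplus>\<^sub>T q y = q (x \<oplus>\<^sub>A y)" if "x : carrier A" "y : carrier A" for x y
  using that by (auto simp: T_def s intro: add)
 have h2: "q x \<otimes>\<^sub>T q y = q (x \<otimes>\<^sub>A y)" if "x : carrier A" "y : carrier A" for x y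
  using that by (auto simp: T_def s intro: mult)
 have h3: "r \<odot>\<^sub>T q x = q (r \<odot>\<^sub>A x)" if "r : carrier R" "x : carrier A" for r x
  using that by (auto simp: T_def s intro: smult)
 have ring: "cring T"
 proof (intro cringI abelian_groupI comm_monoidI)
  fix x assume "x : carrier T"
  then obtain a where a: "x = q a" "a : carrier A" by (auto simp: c)
  then have "q (\<ominus>\<^sub>A a) : carrier T \<and> q (\<ominus>\<^sub>A a) \<oplus>\<^sub>T x = \<zero>\<^sub>T"
   by (auto simp: c h1 A.M.l_neg simp flip: c(2))
  then show "\<exists>y\<in>carrier T. y \<oplus>\<^sub>T x = \<zero>\<^sub>T" by blast
 qed (auto simp: c(1) h1 h2 A.M.a_ac A.m_ac A.l_distr A.r_distr simp flip: c(2,3))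
 have "algebra R T" by (rule algebraI)
   (auto simp: c(1) h1 h2 h3 ring A.R_cring A.smult_l_distr A.smult_r_distr A.smult_assoc1 A.smult_assoc2)
 then show thesis using that[of T] by (simp add: c h1 h2 h3 ring_hom_def)
qed

lemma alg_hom_factor:
 assumes A: "algebra R A" and T: "carrier T = q ` carrier A" "q : ring_hom A T"
   "\<And>r x. [|r : carrier R; x : carrier A|] ==> q (r \<odot>\<^sub>A x) = r \<odot>\<^sub>T q x"
  and h: "h : ring_hom A E"
   "\<And>r x. [|r : carrier R; x : carrier A|] ==> h (r \<odot>\<^sub>A x) = r \<odot>\<^sub>E h x"
  and fib: "\<And>x y. [|x : carrier A; y : carrier A; q x = q y|] ==> h x = h y"
 obtains g where "g : alg_hom R T E" "\<And>x. x : carrier A ==> g (q x) = h x"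
proof -
 interpret A: algebra R A by fact
 define g where "g = (\<lambda>t\<in>carrier T. h (inv_into (carrier A) q t))"
 have g: "g (q x) = h x" if "x : carrier A" for x
  using that T(1) by (auto simp: g_def inv_into_into f_inv_into_f intro!: fib)
 note q = ring_hom_add[OF T(2), symmetric] ring_hom_mult[OF T(2), symmetric]
  ring_hom_one[OF T(2), symmetric] T(3)[symmetric]
 note h' = ring_hom_closed[OF h(1)] ring_hom_add[OF h(1)] ring_hom_mult[OF h(1)] ring_hom_one[OF h(1)] h(2)
 have "g : alg_hom R T E"
 proof (rule alg_homI)
  show "g : extensional (carrier T)" by (simp add: g_def)
 qed (auto simp: T(1) q g h')
 then show thesis using g that by blast
qed

section \<open>Vectors and their natural linear forms\<close>

lemma inj_prod_infinite:
 assumes "infinite (UNIV :: 'u set)"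
 obtains e :: "'u \<times> 'u => 'u" where "inj e"
proof -
 have "|UNIV \<times> UNIV :: ('u \<times> 'u) set| =o |UNIV :: 'u set|" using assms by (rule card_of_Times_same_infinite)
 then obtain e :: "'u \<times> 'u => 'u" where "bij_betw e (UNIV \<times> UNIV) UNIV" using card_of_ordIso by blast
 then show thesis using that by (auto simp: bij_betw_def)
qed

lemma inj_Fpow_infinite:
 assumes "infinite (UNIV :: 'u set)"
 obtains e :: "'u set => 'u" where "inj_on e (Fpow UNIV)" using eqpoll_Fpow[OF assms] by (auto simp: eqpoll_def bij_betw_def)

section \<open>Vectors of both kinds, their operations and their pairing\<close>

definition vec :: "bool => 'b set => ('a, 'x) ring_scheme => ('b => 'a) set" where
 "vec k B T = {v : B \<rightarrow>\<^sub>E carrier T. k \<or> finite {b\<in>B. v b \<noteq> \<zero>\<^sub>T}}"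

definition vadd :: "'b set => ('a, 'x) ring_scheme => ('b => 'a) => ('b => 'a) => 'b => 'a" where
 "vadd B T v w = (\<lambda>b\<in>B. v b \<oplus>\<^sub>T w b)"

definition vscale :: "'b set => ('a, 'x) ring_scheme => 'a => ('b => 'a) => 'b => 'a" where
 "vscale B T t v = (\<lambda>b\<in>B. t \<otimes>\<^sub>T v b)"

definition vzero :: "'b set => ('a, 'x) ring_scheme => 'b => 'a" where
 "vzero B T = (\<lambda>b\<in>B. \<zero>\<^sub>T)"

definition vunit :: "'b set => ('a, 'x) ring_scheme => 'b => 'b => 'a" where
 "vunit B T b = (\<lambda>c\<in>B. if c = b then \<one>\<^sub>T else \<zero>\<^sub>T)"

definition vmap :: "'b set => ('a => 'c) => ('b => 'a) => 'b => 'c" where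
 "vmap B f v = (\<lambda>b\<in>B. f (v b))"

text \<open>\<open>finsum\<close> returns zero over an infinite index set, so the sum runs over the
  nonzero terms only. These are finitely many as soon as one of the two vectors has finite support,
  which is why additivity and homogeneity are stated for kind \<open>k\<close> against kind
  \<open>\<not> k\<close>.\<close>

definition pair :: "'b set => ('a, 'x) ring_scheme => ('b => 'a) => ('b => 'a) => 'a" where
 "pair B T v w = finsum T (\<lambda>b. v b \<otimes>\<^sub>T w b) {b\<in>B. v b \<otimes>\<^sub>T w b \<noteq> \<zero>\<^sub>T}"

lemma vec_closed: "[|v : vec k B T; b : B|] ==> v b : carrier T" by (auto simp: vec_def)

lemma vec_eqI: "[|v : vec k B T; w : vec k' B T'; \<And>b. b : B ==> v b = w b|] ==> v = w"
 by (rule extensionalityI[of v B]) (auto simp: vec_def PiE_def)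

lemma vec_extensional: "v : vec k B T ==> v : extensional B" by (auto simp: vec_def PiE_def)

lemma vec_finite: "v : vec False B T ==> finite {b\<in>B. v b \<noteq> \<zero>\<^sub>T}" by (simp add: vec_def)

lemma vecI:
 "[|v : extensional B; \<And>b. b : B ==> v b : carrier T; \<not> k ==> finite {b\<in>B. v b \<noteq> \<zero>\<^sub>T}|] ==> v : vec k B T"
 by (auto simp: vec_def PiE_def)

lemma vecI_subset:
 "[|v : extensional B; \<And>b. b : B ==> v b : carrier T; {b\<in>B. v b \<noteq> \<zero>\<^sub>T} \<subseteq> F; \<not> k ==> finite F|] ==> v : vec k B T"
 using finite_subset by (intro vecI) blast+

lemma vec_support: "v : vec k B T ==> \<not> k ==> finite {b\<in>B. v b \<noteq> \<zero>\<^sub>T}" by (simp add: vec_def)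

lemma vec_False_subset: "v : vec False B T ==> v : vec k B T" by (auto simp: vec_def)

lemma vec_subset_True: "v : vec k B T ==> v : vec True B T" by (auto simp: vec_def)

lemma vec_self [simp]: "vec k B (self_alg T) = vec k B T" by (simp add: vec_def)

lemma vadd_apply [simp]: "b : B ==> vadd B T v w b = v b \<oplus>\<^sub>T w b" by (simp add: vadd_def)
lemma vscale_apply [simp]: "b : B ==> vscale B T t v b = t \<otimes>\<^sub>T v b" by (simp add: vscale_def)
lemma vzero_apply [simp]: "b : B ==> vzero B T b = \<zero>\<^sub>T" by (simp add: vzero_def)
lemma vmap_apply [simp]: "b : B ==> vmap B f v b = f (v b)" by (simp add: vmap_def)
lemma vunit_apply: "c : B ==> vunit B T b c = (if c = b then \<one>\<^sub>T else \<zero>\<^sub>T)" by (simp add: vunit_def)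

lemma ops_extensional [simp]:
 "vadd B T v w : extensional B" "vscale B T t v : extensional B" "vzero B T : extensional B"
 "vunit B T b : extensional B" "vmap B f v : extensional B"
 by (simp_all add: vadd_def vscale_def vzero_def vunit_def vmap_def)

lemma ops_self [simp]:
 "vadd B (self_alg T) = vadd B T" "vscale B (self_alg T) = vscale B T"
 "vzero B (self_alg T) = vzero B T" "vunit B (self_alg T) = vunit B T"
 by (auto simp: vadd_def vscale_def vzero_def vunit_def fun_eq_iff)

lemma vadd_closed [simp]:
 assumes "cring T" "v : vec k B T" "w : vec k B T" shows "vadd B T v w : vec k B T"
proof -
 interpret cring T by fact
 have "{b\<in>B. vadd B T v w b \<noteq> \<zero>\<^sub>T} \<subseteq> {b\<in>B. v b \<noteq> \<zero>\<^sub>T} \<union> {b\<in>B. w b \<noteq> \<zero>\<^sub>T}" by auto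
 with assms(2,3) show ?thesis by (intro vecI_subset) (auto simp: vec_closed vec_support vadd_def)
qed

lemma vscale_closed [simp]:
 assumes "cring T" "t : carrier T" "v : vec k B T" shows "vscale B T t v : vec k B T"
proof -
 interpret cring T by fact
 have "{b\<in>B. vscale B T t v b \<noteq> \<zero>\<^sub>T} \<subseteq> {b\<in>B. v b \<noteq> \<zero>\<^sub>T}" using assms(2) by auto
 with assms(2,3) show ?thesis by (intro vecI_subset) (auto simp: vec_closed vec_support vscale_def)
qed

lemma vzero_closed [simp]: assumes "cring T" shows "vzero B T : vec k B T"
proof -
 interpret cring T by fact
 show ?thesis by (rule vecI) (auto simp: vzero_def)
qed

lemma vunit_closed [simp]: assumes "cring T" shows "vunit B T b : vec k B T"
proof -
 interpret cring T by fact
 show ?thesis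
  by (rule vecI) (auto simp: vunit_def intro!: finite_subset[of _ "{b}"])
qed

lemma vmap_closed [simp]:
 assumes "f : ring_hom T U" "cring T" "cring U" "v : vec k B T" shows "vmap B f v : vec k B U"
proof -
 have "{b\<in>B. vmap B f v b \<noteq> \<zero>\<^sub>U} \<subseteq> {b\<in>B. v b \<noteq> \<zero>\<^sub>T}"
  using ring_hom_0[OF assms(1-3)] by auto
 with assms show ?thesis by (intro vecI_subset) (auto simp: vec_closed vec_support vmap_def ring_hom_closed)
qed

lemma vmap_vadd:
 assumes "f : ring_hom T U" "v : vec k B T" "w : vec k' B T"
 shows "vmap B f (vadd B T v w) = vadd B U (vmap B f v) (vmap B f w)"
 using assms by (auto simp: vmap_def vadd_def fun_eq_iff vec_closed ring_hom_add)

lemma vmap_vscale: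
 assumes "f : ring_hom T U" "t : carrier T" "v : vec k B T"
 shows "vmap B f (vscale B T t v) = vscale B U (f t) (vmap B f v)"
 using assms by (auto simp: vmap_def vscale_def fun_eq_iff vec_closed ring_hom_mult)

lemma vmap_vunit:
 assumes "f : ring_hom T U" "cring T" "cring U"
 shows "vmap B f (vunit B T b) = vunit B U b"
 using assms by (auto simp: vmap_def vunit_def fun_eq_iff ring_hom_one ring_hom_0)

lemma vmap_vzero:
 assumes "f : ring_hom T U" "cring T" "cring U"
 shows "vmap B f (vzero B T) = vzero B U" using assms by (auto simp: vmap_def vzero_def fun_eq_iff ring_hom_0)

lemma vmap_compose:
 assumes "v : vec k B S"
 shows "vmap B (compose (carrier S) g f) v = vmap B g (vmap B f v)"
 using assms by (auto simp: vmap_def fun_eq_iff compose_def vec_closed)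

lemma vmap_id [simp]:
 assumes "v : vec k B S" shows "vmap B (idm S) v = v"
 by (rule extensionalityI[of _ B]) (use assms in "auto simp: vmap_def vec_closed, auto simp: vec_def PiE_def")

lemma pair_eq_finsum:
 assumes "cring T" "v : vec k B T" "w : vec k' B T" "finite K" "K \<subseteq> B"
  "\<And>b. b : B - K ==> v b \<otimes>\<^sub>T w b = \<zero>\<^sub>T"
 shows "pair B T v w = finsum T (\<lambda>b. v b \<otimes>\<^sub>T w b) K"
proof -
 interpret cring T by fact
 show ?thesis unfolding pair_def by (rule add.finprod_mono_neutral_cong_left) (use assms in "auto simp: vec_closed")
qed

lemma pair_finite:
 assumes "cring T" "v : vec k B T" "w : vec (\<not> k) B T"
 shows "finite {b\<in>B. v b \<otimes>\<^sub>T w b \<noteq> \<zero>\<^sub>T}"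
proof -
 interpret cring T by fact
 have "{b\<in>B. v b \<otimes>\<^sub>T w b \<noteq> \<zero>\<^sub>T} \<subseteq> {b\<in>B. v b \<noteq> \<zero>\<^sub>T}"
  "{b\<in>B. v b \<otimes>\<^sub>T w b \<noteq> \<zero>\<^sub>T} \<subseteq> {b\<in>B. w b \<noteq> \<zero>\<^sub>T}"
  using assms by (auto simp: vec_closed)
 then show ?thesis using assms(2,3) finite_subset by (cases k) (auto simp: vec_def)
qed

lemma pair_closed [simp]:
 assumes "cring T" "v : vec k B T" "w : vec k' B T" shows "pair B T v w : carrier T"
proof -
 interpret cring T by fact
 show ?thesis unfolding pair_def by (rule finsum_closed) (use assms in "auto simp: vec_closed")
qed

lemma pair_commute:
 assumes "cring T" "v : vec k B T" "w : vec k' B T" shows "pair B T v w = pair B T w v"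
proof -
 interpret cring T by fact
 have *: "v b \<otimes>\<^sub>T w b = w b \<otimes>\<^sub>T v b" if "b : B" for b
  using that assms by (simp add: vec_closed m_comm)
 have "{b\<in>B. v b \<otimes>\<^sub>T w b \<noteq> \<zero>\<^sub>T} = {b\<in>B. w b \<otimes>\<^sub>T v b \<noteq> \<zero>\<^sub>T}" using * by auto
 then show ?thesis unfolding pair_def by (intro finsum_cong') (use assms * in "auto simp: vec_closed")
qed

lemma pair_vadd:
 assumes "cring T" "v : vec k B T" "v' : vec k B T" "w : vec (\<not> k) B T"
 shows "pair B T (vadd B T v v') w = pair B T v w \<oplus>\<^sub>T pair B T v' w"
proof -
 interpret cring T by fact
 define K where "K = {b\<in>B. v b \<otimes>\<^sub>T w b \<noteq> \<zero>\<^sub>T} \<union> {b\<in>B. v' b \<otimes>\<^sub>T w b \<noteq> \<zero>\<^sub>T}"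
 have K: "finite K" "K \<subseteq> B" using assms pair_finite unfolding K_def by auto
 have "pair B T (vadd B T v v') w = finsum T (\<lambda>b. vadd B T v v' b \<otimes>\<^sub>T w b) K"
  by (rule pair_eq_finsum[where k = k]) (use assms K in "auto simp: K_def l_distr vec_closed")
 also have "\<dots> = finsum T (\<lambda>b. v b \<otimes>\<^sub>T w b \<oplus>\<^sub>T v' b \<otimes>\<^sub>T w b) K"
  by (rule finsum_cong') (use assms K in "auto simp: l_distr vec_closed subset_iff")
 also have "\<dots> = finsum T (\<lambda>b. v b \<otimes>\<^sub>T w b) K \<oplus>\<^sub>T finsum T (\<lambda>b. v' b \<otimes>\<^sub>T w b) K"
  by (rule finsum_addf) (use assms K in "auto simp: vec_closed subset_iff")
 also have "finsum T (\<lambda>b. v b \<otimes>\<^sub>T w b) K = pair B T v w"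
  by (rule pair_eq_finsum[symmetric, where k = k]) (use assms K in "auto simp: K_def")
 also have "finsum T (\<lambda>b. v' b \<otimes>\<^sub>T w b) K = pair B T v' w"
  by (rule pair_eq_finsum[symmetric, where k = k]) (use assms K in "auto simp: K_def")
 finally show ?thesis .
qed

lemma pair_vscale:
 assumes "cring T" "t : carrier T" "v : vec k B T" "w : vec (\<not> k) B T"
 shows "pair B T (vscale B T t v) w = t \<otimes>\<^sub>T pair B T v w"
proof -
 interpret cring T by fact
 define K where "K = {b\<in>B. v b \<otimes>\<^sub>T w b \<noteq> \<zero>\<^sub>T}"
 have K: "finite K" "K \<subseteq> B" using assms pair_finite unfolding K_def by auto
 have "pair B T (vscale B T t v) w = finsum T (\<lambda>b. vscale B T t v b \<otimes>\<^sub>T w b) K"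
  by (rule pair_eq_finsum[where k = k]) (use assms K in "auto simp: K_def m_assoc vec_closed")
 also have "\<dots> = finsum T (\<lambda>b. t \<otimes>\<^sub>T (v b \<otimes>\<^sub>T w b)) K"
  by (rule finsum_cong') (use assms K in "auto simp: m_assoc vec_closed subset_iff")
 also have "\<dots> = t \<otimes>\<^sub>T finsum T (\<lambda>b. v b \<otimes>\<^sub>T w b) K"
  by (rule finsum_rdistr[symmetric]) (use assms K in "auto simp: vec_closed subset_iff")
 finally show ?thesis by (simp add: pair_def K_def)
qed

lemma pair_vadd_right:
 assumes "cring T" "v : vec k B T" "w : vec (\<not> k) B T" "w' : vec (\<not> k) B T"
 shows "pair B T v (vadd B T w w') = pair B T v w \<oplus>\<^sub>T pair B T v w'"
 using pair_vadd[of T w "\<not> k" B w' v] assms by (simp add: pair_commute[OF assms(1,2,3)] pair_commute[OF assms(1,2,4)]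
   pair_commute[OF assms(1,2) vadd_closed[OF assms(1,3,4)]])

lemma pair_vscale_right:
 assumes "cring T" "t : carrier T" "v : vec k B T" "w : vec (\<not> k) B T"
 shows "pair B T v (vscale B T t w) = t \<otimes>\<^sub>T pair B T v w" using pair_vscale[of T t w "\<not> k" B v] assms
 by (simp add: pair_commute[OF assms(1,3,4)] pair_commute[OF assms(1,3) vscale_closed[OF assms(1,2,4)]])

lemma pair_vunit:
 assumes "cring T" "v : vec k B T" "b : B"
 shows "pair B T v (vunit B T b) = v b"
proof -
 interpret cring T by fact
 have "pair B T v (vunit B T b) = finsum T (\<lambda>c. v c \<otimes>\<^sub>T vunit B T b c) {b}"
  by (rule pair_eq_finsum[where k = k and k' = True])
   (use assms in "auto simp: vunit_apply vec_closed")
 then show ?thesis using assms by (simp add: vec_closed vunit_apply)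
qed

lemma pair_vunit_left:
 assumes "cring T" "v : vec k B T" "b : B"
 shows "pair B T (vunit B T b) v = v b"
 using pair_vunit[OF assms] pair_commute[OF assms(1,2) vunit_closed[OF assms(1), where k = True and b = b]] by simp

text \<open>Unit vectors have finite support and so belong to both kinds; pairing with them reads
  off the coordinates.\<close>

lemma pair_eqI:
 assumes "cring T" "w : vec (\<not> k) B T" "w' : vec (\<not> k) B T"
  "\<And>v. v : vec k B T ==> pair B T v w = pair B T v w'"
 shows "w = w'"
proof (rule vec_eqI[OF assms(2,3)])
 fix b assume b: "b : B"
 show "w b = w' b" using assms(4)[OF vunit_closed[OF assms(1), of B b]] b assms by (simp add: pair_vunit_left)
qed

lemma pair_hom:
 assumes "f : ring_hom T U" "cring T" "cring U" "v : vec k B T" "w : vec (\<not> k) B T"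
 shows "f (pair B T v w) = pair B U (vmap B f v) (vmap B f w)"
proof -
 interpret T: cring T by fact
 interpret U: cring U by fact
 interpret f: ring_hom_cring T U f by unfold_locales (rule assms(1))
 define K where "K = {b\<in>B. v b \<otimes>\<^sub>T w b \<noteq> \<zero>\<^sub>T}"
 have K: "finite K" "K \<subseteq> B" using assms pair_finite unfolding K_def by auto
 have z: "f (v b) \<otimes>\<^sub>U f (w b) = \<zero>\<^sub>U" if "b : B - K" for b
  using that assms f.hom_zero unfolding K_def by (auto simp: vec_closed simp flip: f.hom_mult)
 have "pair B U (vmap B f v) (vmap B f w) = finsum U (\<lambda>b. vmap B f v b \<otimes>\<^sub>U vmap B f w b) K"
  by (rule pair_eq_finsum[where k = k and k' = "\<not> k"]) (use assms K z vmap_closed[OF assms(1-3)] in auto)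
 also have "\<dots> = finsum U (f \<circ> (\<lambda>b. v b \<otimes>\<^sub>T w b)) K"
  by (rule U.finsum_cong') (use assms K in "auto simp: vec_closed subset_iff")
 also have "\<dots> = f (finsum T (\<lambda>b. v b \<otimes>\<^sub>T w b) K)"
  by (rule f.hom_finsum[symmetric]) (use assms K in "auto simp: vec_closed subset_iff")
 finally show ?thesis by (simp add: pair_def K_def)
qed

lemma finsum_self: "finsum (self_alg T) = finsum T" by (intro ext) (simp add: finsum_def finprod_def)

lemma pair_self [simp]: "pair B (self_alg T) v w = pair B T v w" by (simp add: pair_def finsum_self)

lemma pair_cong:
 assumes "cring T" "v : vec k B T" "w : vec k B T" "y : vec k' B T"
  "\<And>b. [|b : B; y b \<noteq> \<zero>\<^sub>T|] ==> v b = w b"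
 shows "pair B T v y = pair B T w y"
proof -
 interpret cring T by fact
 have *: "v b \<otimes>\<^sub>T y b = w b \<otimes>\<^sub>T y b" if "b : B" for b
  using that assms(2-5) by (cases "y b = \<zero>\<^sub>T") (auto simp: vec_closed)
 show ?thesis
  unfolding pair_def using * assms(2-4) by (intro finsum_cong') (auto simp: vec_closed)
qed

lemma vec_fin_induct [consumes 2, case_names zero add]:
 assumes T: "cring T" and v: "v : vec False B T"
  and zero: "P (vzero B T)"
  and add: "\<And>t b w. [|t : carrier T; b : B; w : vec False B T; P w|]
   ==> P (vadd B T (vscale B T t (vunit B T b)) w)"
 shows "P v"
proof -
 interpret cring T by fact
 have "\<forall>v\<in>vec False B T. {b\<in>B. v b \<noteq> \<zero>\<^sub>T} \<subseteq> K \<longrightarrow> P v" if "finite K" for K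
  using that
 proof (induction K)
  case empty
  show ?case
  proof (intro ballI impI)
   fix v assume "v : vec False B T" "{b\<in>B. v b \<noteq> \<zero>\<^sub>T} \<subseteq> {}"
   then have "v = vzero B T" by (intro vec_eqI[OF _ vzero_closed[OF T]]) auto
   then show "P v" using zero by simp
  qed
 next
  case (insert b K)
  show ?case
  proof (intro ballI impI)
   fix v assume v: "v : vec False B T" "{b\<in>B. v b \<noteq> \<zero>\<^sub>T} \<subseteq> insert b K"
   show "P v"
   proof (cases "b : B")
    case True
    define w where "w = (\<lambda>c\<in>B. if c = b then \<zero>\<^sub>T else v c)"
    have "{c\<in>B. w c \<noteq> \<zero>\<^sub>T} \<subseteq> {c\<in>B. v c \<noteq> \<zero>\<^sub>T} - {b}" by (auto simp: w_def)
    then have w: "w : vec False B T" "{c\<in>B. w c \<noteq> \<zero>\<^sub>T} \<subseteq> K"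
     using v by (auto intro!: vecI_subset[of w B T "{c\<in>B. v c \<noteq> \<zero>\<^sub>T}"] vec_finite)
      (auto simp: w_def vec_closed)
    have "v = vadd B T (vscale B T (v b) (vunit B T b)) w" by (rule vec_eqI[OF v(1) vadd_closed[of _ _ False]])
      (use True v w T in "auto simp: vec_closed vunit_apply w_def")
    then show ?thesis using add[of "v b" b w] insert.IH w True v by (simp add: vec_closed)
   next
    case False
    then show ?thesis using insert.IH v by blast
   qed
  qed
 qed
 then show ?thesis using v vec_finite[OF v] by blast
qed

text \<open>A finitely supported vector is recovered from the finite set of its pairs of an index
  and a nonzero value, and an infinite \<open>'u\<close> has no more finite subsets than elements.
  Families with arbitrary support need not fit into \<open>'u\<close>, so they are never copied as a
  whole.\<close>

lemma inj_vec_False: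
 assumes "infinite (UNIV :: 'u set)"
 obtains e :: "('u => 'u) => 'u" where "inj_on e (vec False B T)"
proof -
 obtain p :: "'u \<times> 'u => 'u" where p: "inj p" using inj_prod_infinite[OF assms] .
 obtain q :: "'u set => 'u" where q: "inj_on q (Fpow UNIV)" using inj_Fpow_infinite[OF assms] .
 define g where "g v = (\<lambda>b. p (b, v b)) ` {b\<in>B. v b \<noteq> \<zero>\<^sub>T}" for v
 have fin: "g v : Fpow UNIV" if "v : vec False B T" for v using vec_finite[OF that] by (auto simp: g_def Fpow_def)
 have inj: "v = w" if vw: "v : vec False B T" "w : vec False B T" "g v = g w" for v w
 proof (rule vec_eqI[OF vw(1,2)])
  fix b assume b: "b : B"
  have *: "p (b, x) : g v \<longleftrightarrow> x = v b \<and> x \<noteq> \<zero>\<^sub>T" for x v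
   using b by (auto simp: g_def inj_eq[OF p])
  have "x = v b \<and> x \<noteq> \<zero>\<^sub>T \<longleftrightarrow> x = w b \<and> x \<noteq> \<zero>\<^sub>T" for x
   using *[of x v] *[of x w] vw(3) by simp
  then show "v b = w b" by metis
 qed
 have "inj_on (q \<circ> g) (vec False B T)" using fin inj q by (auto simp: inj_on_def)
 then show thesis using that by blast
qed

section \<open>Modules and algebras of vectors, square-zero extensions\<close>

definition vec_mod ::
 "('r => 'a) => bool => 'b set => ('a, 'x) ring_scheme => (('b => 'a) => ('b => 'a) => 'b => 'a) => ('b => 'a) =>
  ('r, 'b => 'a) module" where
 "vec_mod j k B T m u = \<lparr>carrier = vec k B T, mult = m, one = u, ring.zero = vzero B T,
   add = vadd B T, smult = (\<lambda>r. vscale B T (j r))\<rparr>"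

lemma vec_mod_simps [simp]:
 "carrier (vec_mod j k B T m u) = vec k B T" "monoid.mult (vec_mod j k B T m u) = m"
 "monoid.one (vec_mod j k B T m u) = u" "ring.zero (vec_mod j k B T m u) = vzero B T"
 "ring.add (vec_mod j k B T m u) = vadd B T" "smult (vec_mod j k B T m u) = (\<lambda>r. vscale B T (j r))"
 by (simp_all add: vec_mod_def)

lemma vec_mod_abelian_group:
 assumes "cring T" shows "abelian_group (vec_mod j k B T m u)"
proof -
 interpret cring T by fact
 show ?thesis
 proof (rule abelian_groupI)
  fix v assume v: "v : carrier (vec_mod j k B T m u)"
  have "vscale B T (\<ominus>\<^sub>T \<one>\<^sub>T) v : vec k B T" using v assms by simp
  moreover have "vadd B T (vscale B T (\<ominus>\<^sub>T \<one>\<^sub>T) v) v = vzero B T"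
   by (rule vec_eqI[OF vadd_closed vzero_closed])
    (use v assms in "auto simp: vec_closed l_minus l_neg")
  ultimately show "\<exists>w\<in>carrier (vec_mod j k B T m u). w \<oplus>\<^sub>(vec_mod j k B T m u) v = \<zero>\<^sub>(vec_mod j k B T m u)"
   by auto
 qed (use assms in \<open>auto simp: a_ac vec_closed intro: vec_extensional intro!: extensionalityI[of _ B]\<close>)
qed

lemma vec_mod_module:
 assumes "cring R" "cring T" "j : ring_hom R T" shows "module R (vec_mod j k B T m u)"
proof -
 interpret T: cring T by fact
 interpret R: cring R by fact
 interpret V: abelian_group "vec_mod j k B T m u" by (rule vec_mod_abelian_group) fact
 note j = ring_hom_closed[OF assms(3)] ring_hom_add[OF assms(3)] ring_hom_mult[OF assms(3)] ring_hom_one[OF assms(3)]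
 show ?thesis
  by (rule moduleI)
   (use assms in \<open>auto simp: j V.abelian_group_axioms vec_closed T.l_distr T.r_distr T.m_assoc
    intro: vec_extensional intro!: extensionalityI[of _ B]\<close>)
qed

lemma vec_mod_algebra:
 assumes "cring R" "cring T" "j : ring_hom R T"
  and u: "u : vec k B T" and m: "\<And>v w. [|v : vec k B T; w : vec k B T|] ==> m v w : vec k B T"
   "\<And>v w. [|v : vec k B T; w : vec k B T|] ==> m v w = m w v"
   "\<And>v w z. [|v : vec k B T; w : vec k B T; z : vec k B T|] ==> m (m v w) z = m v (m w z)"
   "\<And>v. v : vec k B T ==> m u v = v"
   "\<And>v w z. [|v : vec k B T; w : vec k B T; z : vec k B T|] ==> m (vadd B T v w) z = vadd B T (m v z) (m w z)"
   "\<And>t v w. [|t : carrier T; v : vec k B T; w : vec k B T|] ==> m (vscale B T t v) w = vscale B T t (m v w)"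
 shows "algebra R (vec_mod j k B T m u)"
proof -
 interpret module R "vec_mod j k B T m u" by (rule vec_mod_module) fact+
 have cring: "cring (vec_mod j k B T m u)" by (intro cringI comm_monoidI)
   (auto simp: m(1,3-6) u M.abelian_group_axioms m(2)[of _ u] intro: m(2))
 show ?thesis
  by (rule algebraI)
   (use assms cring smult_l_distr smult_r_distr smult_assoc1 smult_one in "auto simp: ring_hom_closed")
qed

text \<open>The trivial extension of \<open>T\<close> by the module \<open>N\<close>, in which
  \<open>N\<close> is an ideal of square zero. For \<open>N\<close> equal to \<open>T\<close> it is
  the ring of dual numbers over \<open>T\<close>.\<close>

definition sqzero :: "('r, 'm) ring_scheme => ('r, 'a, 'x) module_scheme => ('a, 'n, 'y) module_scheme =>
  ('r, 'a \<times> 'n) module" where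
 "sqzero R T N = \<lparr>carrier = carrier T \<times> carrier N,
   mult = (\<lambda>(s, x) (t, y). (s \<otimes>\<^sub>T t, s \<odot>\<^sub>N y \<oplus>\<^sub>N t \<odot>\<^sub>N x)),
   one = (\<one>\<^sub>T, \<zero>\<^sub>N), ring.zero = (\<zero>\<^sub>T, \<zero>\<^sub>N),
   add = (\<lambda>(s, x) (t, y). (s \<oplus>\<^sub>T t, x \<oplus>\<^sub>N y)),
   smult = (\<lambda>r (s, x). (r \<odot>\<^sub>T s, struct_map R T r \<odot>\<^sub>N x))\<rparr>"

lemma sqzero_simps [simp]:
 "carrier (sqzero R T N) = carrier T \<times> carrier N"
 "(s, x) \<otimes>\<^sub>(sqzero R T N) (t, y) = (s \<otimes>\<^sub>T t, s \<odot>\<^sub>N y \<oplus>\<^sub>N t \<odot>\<^sub>N x)"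
 "\<one>\<^sub>(sqzero R T N) = (\<one>\<^sub>T, \<zero>\<^sub>N)" "\<zero>\<^sub>(sqzero R T N) = (\<zero>\<^sub>T, \<zero>\<^sub>N)"
 "(s, x) \<oplus>\<^sub>(sqzero R T N) (t, y) = (s \<oplus>\<^sub>T t, x \<oplus>\<^sub>N y)"
 "r \<odot>\<^sub>(sqzero R T N) (s, x) = (r \<odot>\<^sub>T s, struct_map R T r \<odot>\<^sub>N x)"
 by (simp_all add: sqzero_def)

lemma sqzero_algebra:
 assumes "algebra R T" "module T N" shows "algebra R (sqzero R T N)"
proof -
 interpret c: cring T by (rule algebra.M_cring[OF assms(1)])
 interpret T: algebra R T by fact
 interpret N: module T N by fact
 note j = alg_homD[OF struct_map_alg_hom[OF assms(1)], simplified]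
 have ring: "cring (sqzero R T N)"
 proof (intro cringI comm_monoidI abelian_groupI)
  fix x assume "x : carrier (sqzero R T N)"
  then obtain s n where "x = (s, n)" "s : carrier T" "n : carrier N" by auto
  then have "(\<ominus>\<^sub>T s, \<ominus>\<^sub>N n) : carrier (sqzero R T N)"
   "(\<ominus>\<^sub>T s, \<ominus>\<^sub>N n) \<oplus>\<^sub>(sqzero R T N) x = \<zero>\<^sub>(sqzero R T N)"
   by (auto simp: c.l_neg N.M.l_neg)
  then show "\<exists>y\<in>carrier (sqzero R T N). y \<oplus>\<^sub>(sqzero R T N) x = \<zero>\<^sub>(sqzero R T N)" by blast
 qed (auto simp: c.a_ac N.M.a_ac c.l_distr c.r_distr c.m_ac N.smult_l_distr N.smult_r_distr N.smult_assoc1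
   simp flip: N.smult_assoc1)
 show ?thesis
  by (rule algebraI)
   (auto simp: ring T.R_cring T.smult_l_distr T.smult_r_distr T.smult_assoc1 T.smult_assoc2 j
    N.smult_l_distr N.smult_r_distr N.smult_assoc1 smult_eq_struct_map[OF assms(1)] c.l_distr c.r_distr c.m_ac
    simp flip: N.smult_assoc1)
qed

text \<open>An algebra over \<open>S\<close> is encoded as an \<open>R\<close>-algebra
  \<open>T\<close> with a homomorphism \<open>f\<close> from \<open>S\<close>, instead of as an
  object of \<open>Algs S\<close>. All algebras then stay in the one category \<open>Algs R\<close>,
  and base change is composition with \<open>f\<close>; the passage to \<open>Algs S\<close> is left
  to \<open>slice_fun\<close>.\<close>

definition natlin ::
 "bool => ('u, 'm) ring_scheme => 'b set => 'u alg => ('u alg => ('u => 'u) => ('b => 'u) => 'u) => bool" where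
 "natlin k R B S l \<longleftrightarrow> (\<forall>T\<in>Algs R. \<forall>f\<in>alg_hom R S T.
   (\<forall>v\<in>vec k B T. l T f v : carrier T) \<and>
   (\<forall>v\<in>vec k B T. \<forall>w\<in>vec k B T. l T f (vadd B T v w) = l T f v \<oplus>\<^sub>T l T f w) \<and>
   (\<forall>t\<in>carrier T. \<forall>v\<in>vec k B T. l T f (vscale B T t v) = t \<otimes>\<^sub>T l T f v) \<and>
   (\<forall>U\<in>Algs R. \<forall>g\<in>alg_hom R T U. \<forall>v\<in>vec k B T.
    l U (compose (carrier S) g f) (vmap B g v) = g (l T f v)))"

lemma natlinD:
 assumes "natlin k R B S l" "T : Algs R" "f : alg_hom R S T" "v : vec k B T"
 shows "l T f v : carrier T"
  "w : vec k B T ==> l T f (vadd B T v w) = l T f v \<oplus>\<^sub>T l T f w"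
  "t : carrier T ==> l T f (vscale B T t v) = t \<otimes>\<^sub>T l T f v"
  "[|U : Algs R; g : alg_hom R T U|] ==> l U (compose (carrier S) g f) (vmap B g v) = g (l T f v)"
 using assms unfolding natlin_def by blast+

lemma compose_id_alg_hom [simp]: "f : alg_hom R S T ==> compose (carrier S) f (idm S) = f"
 by (rule extensionalityI[of _ "carrier S"]) (auto simp: compose_def alg_homD)

lemma compose_alg_hom_id [simp]: "f : alg_hom R S T ==> compose (carrier S) (idm T) f = f"
 by (rule extensionalityI[of _ "carrier S"]) (auto simp: compose_def alg_homD)

text \<open>The coordinates of the representing vector are the values of the form at the unit
  vectors over \<open>S\<close>. Naturality carries these values to every \<open>T\<close>, and
  linearity does the rest because the argument is a finite combination of unit vectors; the
  representing vector itself may have arbitrary support.\<close>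

lemma natlin_rep_False:
 assumes R: "cring R" and S: "S : Algs R" and l: "natlin False R B S l"
 obtains x where "x : vec True B S"
  "\<And>T f v. [|T : Algs R; f : alg_hom R S T; v : vec False B T|] ==> l T f v = pair B T v (vmap B f x)"
proof
 let ?id = "\<lambda>s\<in>carrier S. s"
 have id: "?id : alg_hom R S S" using S by (simp add: Algs_iff)
 have cS: "cring S" by (rule cring_of[OF S])
 define x where "x = (\<lambda>b\<in>B. l S ?id (vunit B S b))"
 show x: "x : vec True B S" by (rule vecI) (auto simp: x_def cS intro!: natlinD[OF l S id])
 fix T f v assume T: "T : Algs R" and f: "f : alg_hom R S T" and v: "v : vec False B T"
 have cT: "cring T" by (rule cring_of[OF T])
 interpret cring T by (rule cT)
 note fr = alg_homD(2)[OF f]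
 have fx: "vmap B f x : vec True B T" using x fr cS cT by simp
 have unit: "l T f (vunit B T b) = f (x b)" if "b : B" for b
  using natlinD(4)[OF l S id vunit_closed[OF cS] T f, of b] that f by (simp add: vmap_vunit[OF fr cS cT] x_def)
 from cT v show "l T f v = pair B T v (vmap B f x)"
 proof (induction rule: vec_fin_induct)
  case zero
  have z: "vscale B T \<zero>\<^sub>T (vzero B T) = vzero B T"
   by (rule vec_eqI[OF vscale_closed[of _ _ _ True] vzero_closed[of _ _ True]]) (auto simp: cT)
  have vz: "vzero B T : vec False B T" by (simp add: cT)
  have "l T f (vzero B T) = \<zero>\<^sub>T"
   using natlinD(3)[OF l T f vz, of "\<zero>\<^sub>T"] natlinD(1)[OF l T f vz] by (simp add: z)
  moreover have "pair B T (vzero B T) (vmap B f x) = \<zero>\<^sub>T"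
   using pair_vscale[OF cT zero_closed vz, of "vmap B f x"] pair_closed[OF cT vz fx] fx by (simp add: z)
  ultimately show ?case by simp
 next
  case (add t b w)
  have u: "vunit B T b : vec False B T" by (simp add: cT)
  have s: "vscale B T t (vunit B T b) : vec False B T" using add by (simp add: cT)
  show ?case using add natlinD(2)[OF l T f s, of w] natlinD(3)[OF l T f u, of t]
    pair_vadd[OF cT s, of w "vmap B f x"] pair_vscale[OF cT _ u, of t "vmap B f x"]
    pair_vunit_left[OF cT fx, of b] fx by (simp add: unit)
 qed
qed

text \<open>Every vector becomes, after multiplication by a number \<^term>\<open>eps\<close> of square zero, an image of the
 generic vector \<^term>\<open>gen\<close> of the square-zero extension of \<^term>\<open>S\<close> by the free module on \<^term>\<open>B\<close>.
 As the elements of that extension are finite sums, this is what makes linear forms on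
 arbitrary vectors finite.\<close>

lemma generic_nilpotent_vector:
 fixes S :: "'u alg" and B :: "'u set"
 assumes R: "cring R" and inf: "infinite (UNIV :: 'u set)" and S: "S : Algs R"
 obtains D jD gen X where "D : Algs R" "jD : alg_hom R S D" "gen : vec True B D"
  "\<And>d. d : carrier D ==> X d : vec False B S"
  "\<And>T f v. [|T : Algs R; f : alg_hom R S T; v : vec True B T|] ==>
   \<exists>E jE eps g. E : Algs R \<and> jE : alg_hom R T E \<and> eps : carrier E \<and> g : alg_hom R D E \<and>
    compose (carrier S) g jD = compose (carrier S) jE f \<and>
    vmap B g gen = vscale B E eps (vmap B jE v) \<and>
    inj_on (\<lambda>t. eps \<otimes>\<^sub>E jE t) (carrier T) \<and>
    (\<forall>d\<in>carrier D. \<forall>t\<in>carrier T. g d = eps \<otimes>\<^sub>E jE t \<longrightarrow> t = pair B T v (vmap B f (X d)))"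
proof -
 obtain p :: "'u \<times> 'u => 'u" where p: "inj p" using inj_prod_infinite[OF inf] .
 obtain e :: "('u => 'u) => 'u" where e: "inj_on e (vec False B S)" using inj_vec_False[OF inf] .
 note cS = cring_of[OF S]
 interpret S: algebra R S using S by (simp add: Algs_iff)
 \<comment> \<open>The free \<open>S\<close>-module on \<open>B\<close>, in which every element is a
   finite combination. Finite support is also what keeps the extension small enough to be copied
   into \<open>'u\<close>.\<close>
 define N where "N = vec_mod (\<lambda>s. s) False B S (\<lambda>_ _. undefined) undefined"
 have N: "module S N" unfolding N_def by (rule vec_mod_module) (auto simp: cS ring_hom_def)
 define X where "X = sqzero R S N"
 have X: "algebra R X" unfolding X_def by (rule sqzero_algebra[OF _ N]) (use S in "simp add: Algs_iff")
 have cX: "carrier X = carrier S \<times> vec False B S" by (simp add: X_def N_def)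
 define q where "q = (\<lambda>(s, v). p (s, e v))"
 have q_inj: "inj_on q (carrier X)" using e by (auto simp: inj_on_def q_def cX dest!: injD[OF p])
 obtain D :: "'u alg" where D: "algebra R D" "carrier D = q ` carrier X" "q : ring_hom X D"
  "\<And>r x. [|r : carrier R; x : carrier X|] ==> q (r \<odot>\<^sub>X x) = r \<odot>\<^sub>D q x"
  by (rule image_algebra[of R X q, OF X]) (use inj_on_eq_iff[OF q_inj] in blast)+
 have DA: "D : Algs R" using D(1) by (simp add: Algs_iff)
 note cD = cring_of[OF DA]
 have z: "vzero B S : vec False B S" using cS by simp
 define jD where "jD = (\<lambda>s\<in>carrier S. q (s, vzero B S))"
 have jD: "jD : alg_hom R S D"
 proof (rule alg_homI)
  show "jD : extensional (carrier S)" by (simp add: jD_def)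
  interpret N: module S N by (rule N)
  have z0: "vzero B S = \<zero>\<^sub>N" by (simp add: N_def)
  have zz: "(s, \<zero>\<^sub>N) : carrier X" if "s : carrier S" for s using that z by (simp add: cX z0)
  show "jD s : carrier D" if "s : carrier S" for s using that zz[OF that] by (auto simp: jD_def D(2) z0)
  show "jD \<one>\<^sub>S = \<one>\<^sub>D" using ring_hom_one[OF D(3)] by (simp add: jD_def X_def z0)
  show "jD (x \<oplus>\<^sub>S y) = jD x \<oplus>\<^sub>D jD y" if "x : carrier S" "y : carrier S" for x y
   using that ring_hom_add[OF D(3) zz zz, of x y] by (simp add: jD_def X_def z0)
  show "jD (x \<otimes>\<^sub>S y) = jD x \<otimes>\<^sub>D jD y" if "x : carrier S" "y : carrier S" for x y
   using that ring_hom_mult[OF D(3) zz zz, of x y] by (simp add: jD_def X_def z0)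
  show "jD (r \<odot>\<^sub>S x) = r \<odot>\<^sub>D jD x" if "r : carrier R" "x : carrier S" for r x
   using that D(4)[OF that(1) zz[OF that(2)]] S.algebra_axioms by (simp add: jD_def X_def z0)
 qed
 \<comment> \<open>All basis elements of \<open>N\<close> at once, as one family in
   \<open>D\<close>: each entry is a finite combination, while the family itself has no finite
   support.\<close>
 define gen where "gen = (\<lambda>b\<in>B. q (\<zero>\<^sub>S, vunit B S b))"
 have gen: "gen : vec True B D" by (rule vecI) (auto simp: gen_def D(2) cX cS)
 define X' where "X' d = snd (inv_into (carrier X) q d)" for d
 have X'q: "X' (q a) = snd a" if "a : carrier X" for a using that by (simp add: X'_def inv_into_f_f[OF q_inj])
 have X': "X' d : vec False B S" if "d : carrier D" for d using that by (auto simp: D(2) X'q cX)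
 have "\<exists>E jE eps g. E : Algs R \<and> jE : alg_hom R T E \<and> eps : carrier E \<and> g : alg_hom R D E \<and>
    compose (carrier S) g jD = compose (carrier S) jE f \<and>
    vmap B g gen = vscale B E eps (vmap B jE v) \<and>
    inj_on (\<lambda>t. eps \<otimes>\<^sub>E jE t) (carrier T) \<and>
    (\<forall>d\<in>carrier D. \<forall>t\<in>carrier T. g d = eps \<otimes>\<^sub>E jE t \<longrightarrow> t = pair B T v (vmap B f (X' d)))"
  if T: "T : Algs R" and f: "f : alg_hom R S T" and v: "v : vec True B T" for T f v
 proof -
  note cT = cring_of[OF T]
  interpret T: algebra R T using T by (simp add: Algs_iff)
  \<comment> \<open>The dual numbers over \<open>T\<close>. The injection \<open>p\<close> supplies
    the copy \<open>E\<close> inside \<open>'u\<close>, and \<open>eps\<close> below is the copy of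
    the generator of square zero.\<close>
  define Y where "Y = sqzero R T (self_alg T)"
  have mT: "module T (self_alg T)" using algebra_self[OF cT] by (simp add: algebra_def)
  have Y: "algebra R Y" unfolding Y_def by (rule sqzero_algebra[OF _ mT]) (use T in "simp add: Algs_iff")
  have cY: "carrier Y = carrier T \<times> carrier T" by (simp add: Y_def)
  obtain E :: "'u alg" where E: "algebra R E" "carrier E = p ` carrier Y" "p : ring_hom Y E"
   "\<And>r x. [|r : carrier R; x : carrier Y|] ==> p (r \<odot>\<^sub>Y x) = r \<odot>\<^sub>E p x"
   by (rule image_algebra[of R Y p, OF Y]) (auto dest!: injD[OF p])
  have EA: "E : Algs R" using E(1) by (simp add: Algs_iff)
  note cE = cring_of[OF EA]
  note fr = alg_homD(2)[OF f]
  define jE where "jE = (\<lambda>t\<in>carrier T. p (t, \<zero>\<^sub>T))"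
  have pY: "(t, t') : carrier Y" if "t : carrier T" "t' : carrier T" for t t' using that by (simp add: cY)
  have pE: "p (t, t') : carrier E" if "t : carrier T" "t' : carrier T" for t t'
   using that by (auto simp: E(2) cY)
  note [simp] = Y_def
  have jE: "jE : alg_hom R T E"
  proof (rule alg_homI)
   show "jE (x \<oplus>\<^sub>T y) = jE x \<oplus>\<^sub>E jE y" if "x : carrier T" "y : carrier T" for x y
    using that ring_hom_add[OF E(3) pY pY, of x "\<zero>\<^sub>T" y "\<zero>\<^sub>T"] by (simp add: jE_def)
   show "jE (x \<otimes>\<^sub>T y) = jE x \<otimes>\<^sub>E jE y" if "x : carrier T" "y : carrier T" for x y
    using that ring_hom_mult[OF E(3) pY pY, of x "\<zero>\<^sub>T" y "\<zero>\<^sub>T"] by (simp add: jE_def)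
   show "jE (r \<odot>\<^sub>T x) = r \<odot>\<^sub>E jE x" if "r : carrier R" "x : carrier T" for r x
    using that E(4)[OF that(1) pY, of x "\<zero>\<^sub>T"] T.algebra_axioms by (simp add: jE_def)
  qed (use ring_hom_one[OF E(3)] in "auto simp: jE_def pE")
  \<comment> \<open>This map applies \<open>f\<close> on \<open>S\<close> and sends \<open>y\<close>
    in \<open>N\<close> to \<open>eps\<close> times its pairing with \<open>v\<close>. The basis
    element with index \<open>b\<close> goes to \<open>eps\<close> times \<open>v b\<close>, so
    \<open>gen\<close> is specialized to \<open>eps\<close> times \<open>v\<close>.\<close>
  define h where "h = (\<lambda>(s, y). p (f s, pair B T v (vmap B f y)))"
  have vf: "vmap B f y : vec False B T" if "y : vec False B S" for y using that fr cS cT by simp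
  note pr = pair_vadd_right[OF cT v] pair_vscale_right[OF cT _ v] pair_closed[OF cT v]
  have prc: "pair B T v (vmap B f y) : carrier T" if "y : vec False B S" for y by (rule pr(3)[OF vf[OF that]])
  note fD = alg_homD(3-7)[OF f]
  have hr: "h : ring_hom X E"
  proof (rule ring_hom_memI)
   show "h a : carrier E" if "a : carrier X" for a using that vf by (auto simp: cX h_def fD intro!: pE pr)
   show "h \<one>\<^sub>X = \<one>\<^sub>E"
   proof -
    have "vscale B T \<zero>\<^sub>T (vzero B T) = vzero B T"
     by (rule vec_eqI[OF vscale_closed[of _ _ _ True] vzero_closed[of _ _ True]]) (auto simp: cT)
    then have "pair B T v (vzero B T) = \<zero>\<^sub>T"
     using pr(2)[of "\<zero>\<^sub>T" "vzero B T"] pr(3)[of "vzero B T" False] by (simp add: cT)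
    then show ?thesis using ring_hom_one[OF E(3)] by (simp add: h_def X_def N_def fD vmap_vzero[OF fr cS cT])
   qed
   fix a b assume ab: "a : carrier X" "b : carrier X"
   then obtain s y t w where [simp]: "a = (s, y)" "b = (t, w)" and
    st: "s : carrier S" "t : carrier S" "y : vec False B S" "w : vec False B S" by (auto simp: cX)
   show "h (a \<oplus>\<^sub>X b) = h a \<oplus>\<^sub>E h b"
    using st vf prc ring_hom_add[OF E(3) pY pY, of "f s" "pair B T v (vmap B f y)" "f t" "pair B T v (vmap B f w)"]
    by (simp add: h_def X_def N_def fD vmap_vadd[OF fr] pr)
   show "h (a \<otimes>\<^sub>X b) = h a \<otimes>\<^sub>E h b"
    using st vf prc ring_hom_mult[OF E(3) pY pY, of "f s" "pair B T v (vmap B f y)" "f t" "pair B T v (vmap B f w)"]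
    by (simp add: h_def X_def N_def fD vmap_vadd[OF fr, where k = False and k' = False] vmap_vscale[OF fr] pr cT cS)
  qed
  have hs: "h (r \<odot>\<^sub>X a) = r \<odot>\<^sub>E h a" if "r : carrier R" "a : carrier X" for r a
  proof -
   obtain s y where [simp]: "a = (s, y)" and sy: "s : carrier S" "y : vec False B S"
    using \<open>a : carrier X\<close> by (auto simp: cX)
   show ?thesis
    using sy vf prc that E(4)[OF that(1) pY, of "f s" "pair B T v (vmap B f y)"] S.algebra_axioms T.algebra_axioms
    by (simp add: h_def X_def N_def fD vmap_vscale[OF fr] pr alg_hom_struct_map[OF f])
  qed
  obtain g where g: "g : alg_hom R D E" "\<And>a. a : carrier X ==> g (q a) = h a"
   by (rule alg_hom_factor[OF X D(2,3,4) hr hs]) (auto dest: inj_onD[OF q_inj])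
  have comp: "compose (carrier S) g jD = compose (carrier S) jE f"
  proof (rule extensionalityI[of _ "carrier S"])
   fix s assume s: "s : carrier S"
   have "h \<zero>\<^sub>X = \<zero>\<^sub>E" by (rule ring_hom_0[OF hr algebra.M_cring[OF X] cE])
   moreover have "\<zero>\<^sub>E = p (\<zero>\<^sub>T, \<zero>\<^sub>T)" using ring_hom_0[OF E(3) algebra.M_cring[OF Y] cE] by simp
   ultimately have "pair B T v (vmap B f (vzero B S)) = \<zero>\<^sub>T" by (auto simp: h_def X_def N_def dest!: injD[OF p])
   then show "compose (carrier S) g jD s = compose (carrier S) jE f s"
    using s z g(2)[of "(s, vzero B S)"] by (simp add: compose_def jD_def jE_def h_def cX fD)
  qed auto
  define eps where "eps = p (\<zero>\<^sub>T, \<one>\<^sub>T)"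
  have eps: "eps : carrier E" by (simp add: eps_def pE)
  have jEv: "vmap B jE v : vec True B E" using v alg_homD(2)[OF jE] cT cE by simp
  have eps_mult: "eps \<otimes>\<^sub>E jE t = p (\<zero>\<^sub>T, t)" if "t : carrier T" for t
   using that ring_hom_mult[OF E(3) pY pY, of "\<zero>\<^sub>T" "\<one>\<^sub>T" t "\<zero>\<^sub>T"] by (simp add: jE_def eps_def)
  have "vmap B g gen = vscale B E eps (vmap B jE v)"
  proof (rule vec_eqI[OF vmap_closed[OF alg_homD(2)[OF g(1)] cD cE gen] vscale_closed[OF cE eps jEv]])
   fix b assume b: "b : B"
   have "h (\<zero>\<^sub>S, vunit B S b) = p (\<zero>\<^sub>T, v b)"
    using b by (simp add: h_def vmap_vunit[OF fr cS cT] pair_vunit[OF cT v] ring_hom_0[OF fr cS cT])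
   then show "vmap B g gen b = vscale B E eps (vmap B jE v) b"
    using b g(2)[of "(\<zero>\<^sub>S, vunit B S b)"] vec_closed[OF v b] by (simp add: gen_def cX cS eps_mult)
  qed
  moreover have "inj_on (\<lambda>t. eps \<otimes>\<^sub>E jE t) (carrier T)"
   by (auto simp: inj_on_def eps_mult dest!: injD[OF p])
  \<comment> \<open>Comparison of the coefficients of \<open>eps\<close>; in this way the value of a
    form at \<open>v\<close> will be recovered from its value at \<open>gen\<close>.\<close>
  moreover have "t = pair B T v (vmap B f (X' d))"
   if "d : carrier D" "t : carrier T" "g d = eps \<otimes>\<^sub>E jE t" for d t
   using that g(2) by (auto simp: D(2) X'q eps_mult h_def split: prod.splits dest!: injD[OF p])
  ultimately show ?thesis using EA jE eps g(1) comp by blast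
 qed
 then show thesis by (intro that[of D jD gen X'] DA jD gen X')
qed

text \<open>The value of the form at the generic vector is a single element of \<open>D\<close>, and
  its component in the free module, which has finite support, is the representing vector.
  Specializing \<open>gen\<close> to \<open>eps\<close> times \<open>v\<close> turns that value into
  \<open>eps\<close> times the value at \<open>v\<close>, by naturality and homogeneity; comparison
  of the coefficients of \<open>eps\<close> identifies the latter with the pairing.\<close>

lemma natlin_rep_True:
 fixes S :: "'u alg" and B :: "'u set"
 assumes R: "cring R" and inf: "infinite (UNIV :: 'u set)"
  and S: "S : Algs R" and l: "natlin True R B S l"
 obtains x where "x : vec False B S"
  "\<And>T f v. [|T : Algs R; f : alg_hom R S T; v : vec True B T|] ==> l T f v = pair B T v (vmap B f x)"
proof -
 obtain D jD gen X where D: "D : Algs R" "jD : alg_hom R S D" "gen : vec True B D"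
  "\<And>d. d : carrier D ==> X d : vec False B S"
  and E: "\<And>T f v. [|T : Algs R; f : alg_hom R S T; v : vec True B T|] ==>
   \<exists>E jE eps g. E : Algs R \<and> jE : alg_hom R T E \<and> eps : carrier E \<and> g : alg_hom R D E \<and>
    compose (carrier S) g jD = compose (carrier S) jE f \<and>
    vmap B g gen = vscale B E eps (vmap B jE v) \<and>
    inj_on (\<lambda>t. eps \<otimes>\<^sub>E jE t) (carrier T) \<and>
    (\<forall>d\<in>carrier D. \<forall>t\<in>carrier T. g d = eps \<otimes>\<^sub>E jE t \<longrightarrow> t = pair B T v (vmap B f (X d)))"
  by (rule generic_nilpotent_vector[OF assms(1-3)]) blast
 have d: "l D jD gen : carrier D" by (rule natlinD[OF l D(1-3)])
 have "l T f v = pair B T v (vmap B f (X (l D jD gen)))"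
  if T: "T : Algs R" and f: "f : alg_hom R S T" and v: "v : vec True B T" for T f v
 proof -
  obtain E' jE eps g where E': "E' : Algs R" "jE : alg_hom R T E'" "eps : carrier E'" "g : alg_hom R D E'"
    "compose (carrier S) g jD = compose (carrier S) jE f"
    "vmap B g gen = vscale B E' eps (vmap B jE v)"
    "\<forall>d\<in>carrier D. \<forall>t\<in>carrier T. g d = eps \<otimes>\<^sub>E' jE t \<longrightarrow> t = pair B T v (vmap B f (X d))"
   using E[OF T f v] by blast
  have jEf: "compose (carrier S) jE f : alg_hom R S E'"
   by (rule alg_hom_compose[OF f E'(2)]) (use S in "simp add: Algs_iff")
  have jEv: "vmap B jE v : vec True B E'" using v alg_homD(2)[OF E'(2)] cring_of[OF T] cring_of[OF E'(1)] by simp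
  have "g (l D jD gen) = l E' (compose (carrier S) jE f) (vscale B E' eps (vmap B jE v))"
   using natlinD(4)[OF l D(1-3) E'(1,4)] E'(5,6) by simp
  also have "\<dots> = eps \<otimes>\<^sub>E' jE (l T f v)"
   using natlinD(3)[OF l E'(1) jEf jEv E'(3)] natlinD(4)[OF l T f v E'(1,2)] by simp
  finally show ?thesis using E'(7) d natlinD(1)[OF l T f v] by blast
 qed
 then show thesis using that D(4)[OF d] by blast
qed

lemma natlin_rep:
 fixes S :: "'u alg" and B :: "'u set"
 assumes "cring R" "infinite (UNIV :: 'u set)" "S : Algs R" "natlin k R B S l"
 obtains x where "x : vec (\<not> k) B S"
  "\<And>T f v. [|T : Algs R; f : alg_hom R S T; v : vec k B T|] ==> l T f v = pair B T v (vmap B f x)"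
proof (cases k)
 case True
 show thesis by (rule natlin_rep_True[of R S B l]) (use assms True that in auto)
next
 case False
 show thesis by (rule natlin_rep_False[of R S B l]) (use assms False that in auto)
qed

section \<open>Algebras of vectors and their schemes of points\<close>

lemma natlinI:
 assumes "\<And>T f v. [|T : Algs R; f : alg_hom R S T; v : vec k B T|] ==> l T f v : carrier T"
  "\<And>T f v w. [|T : Algs R; f : alg_hom R S T; v : vec k B T; w : vec k B T|]
   ==> l T f (vadd B T v w) = l T f v \<oplus>\<^sub>T l T f w"
  "\<And>T f t v. [|T : Algs R; f : alg_hom R S T; t : carrier T; v : vec k B T|]
   ==> l T f (vscale B T t v) = t \<otimes>\<^sub>T l T f v"
  "\<And>T f U g v. [|T : Algs R; f : alg_hom R S T; U : Algs R; g : alg_hom R T U; v : vec k B T|]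
   ==> l U (compose (carrier S) g f) (vmap B g v) = g (l T f v)"
 shows "natlin k R B S l" using assms unfolding natlin_def by blast

lemma vmap_alg_hom [simp]:
 assumes "f : alg_hom R S T" "S : Algs R" "T : Algs R" "v : vec k B S"
 shows "vmap B f v : vec k B T"
 by (rule vmap_closed[OF alg_homD(2)[OF assms(1)] cring_of[OF assms(2)] cring_of[OF assms(3)] assms(4)])

lemma pair_alg_hom:
 assumes "f : alg_hom R S T" "S : Algs R" "T : Algs R" "v : vec k B S" "w : vec (\<not> k) B S"
 shows "pair B T (vmap B f v) (vmap B f w) = f (pair B S v w)"
 using assms pair_hom[OF alg_homD(2)[OF assms(1)], of v k B w] by (simp add: cring_of)

lemma alg_hom_comp [simp]:
 assumes "f : alg_hom R S T" "g : alg_hom R T U" "S : Algs R"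
 shows "compose (carrier S) g f : alg_hom R S U" using alg_hom_compose[OF assms(1,2)] assms(3) by (simp add: Algs_iff)

lemma id_alg_hom [simp]: "S : Algs R ==> (idm S) : alg_hom R S S" by (simp add: Algs_iff)

lemma natlin_pair:
 assumes S: "S : Algs R" and x: "x : vec (\<not> k) B S"
 shows "natlin k R B S (\<lambda>T f v. pair B T v (vmap B f x))"
proof (rule natlinI)
 fix T f v assume T: "T : Algs R" and f: "f : alg_hom R S T" and v: "v : vec k B T"
 note cT = cring_of[OF T]
 have fx: "vmap B f x : vec (\<not> k) B T" using f S T x by simp
 show "pair B T v (vmap B f x) : carrier T" by (rule pair_closed[OF cT v fx])
 show "pair B T (vadd B T v w) (vmap B f x) = pair B T v (vmap B f x) \<oplus>\<^sub>T pair B T w (vmap B f x)"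
  if "w : vec k B T" for w by (rule pair_vadd[OF cT v that fx])
 show "pair B T (vscale B T t v) (vmap B f x) = t \<otimes>\<^sub>T pair B T v (vmap B f x)"
  if "t : carrier T" for t by (rule pair_vscale[OF cT that v fx])
 show "pair B U (vmap B g v) (vmap B (compose (carrier S) g f) x) = g (pair B T v (vmap B f x))"
  if "U : Algs R" "g : alg_hom R T U" for U g
  using pair_alg_hom[OF that(2) T that(1) v fx] by (simp add: vmap_compose[OF x])
qed

lemma natlin_mult:
 assumes l: "natlin k R B S l" and c: "c : carrier S"
 shows "natlin k R B S (\<lambda>T f v. f c \<otimes>\<^sub>T l T f v)"
proof (rule natlinI)
 fix T f v assume T: "T : Algs R" and f: "f : alg_hom R S T" and v: "v : vec k B T"
 interpret cring T by (rule cring_of[OF T])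
 have fc: "f c : carrier T" using f c by (rule alg_homD(3))
 note n = natlinD[OF l T f v]
 show "f c \<otimes>\<^sub>T l T f v : carrier T" using fc n by simp
 show "f c \<otimes>\<^sub>T l T f (vadd B T v w) = f c \<otimes>\<^sub>T l T f v \<oplus>\<^sub>T f c \<otimes>\<^sub>T l T f w" if "w : vec k B T" for w
  using fc n(1) n(2)[OF that] natlinD(1)[OF l T f that] by (simp add: r_distr)
 show "f c \<otimes>\<^sub>T l T f (vscale B T t v) = t \<otimes>\<^sub>T (f c \<otimes>\<^sub>T l T f v)" if "t : carrier T" for t
  using fc n(1) n(3)[OF that] that by (simp add: m_lcomm)
 show "compose (carrier S) g f c \<otimes>\<^sub>U l U (compose (carrier S) g f) (vmap B g v) = g (f c \<otimes>\<^sub>T l T f v)"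
  if "U : Algs R" "g : alg_hom R T U" for U g
  using n(4)[OF that] n(1) fc c by (simp add: compose_def alg_homD(6)[OF that(2)])
qed

text \<open>The values at the unit vectors over \<open>S\<close> are the coordinates of the
  representing vector. Agreement there therefore suffices even for families of arbitrary support,
  which unit vectors do not span; this replaces linear extension from a basis.\<close>

lemma natlin_eqI:
 fixes S :: "'u alg" and B :: "'u set"
 assumes "cring R" "infinite (UNIV :: 'u set)" and S: "S : Algs R"
  and l: "natlin k R B S l" and l': "natlin k R B S l'"
  and eq: "\<And>b. b : B ==> l S (idm S) (vunit B S b) = l' S (idm S) (vunit B S b)"
  and T: "T : Algs R" "f : alg_hom R S T" "v : vec k B T"
 shows "l T f v = l' T f v"
proof -
 obtain x where x: "x : vec (\<not> k) B S"
  "\<And>T f v. [|T : Algs R; f : alg_hom R S T; v : vec k B T|] ==> l T f v = pair B T v (vmap B f x)"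
  using natlin_rep[OF assms(1-4)] by metis
 obtain x' where x': "x' : vec (\<not> k) B S"
  "\<And>T f v. [|T : Algs R; f : alg_hom R S T; v : vec k B T|] ==> l' T f v = pair B T v (vmap B f x')"
  using natlin_rep[OF assms(1-3,5)] by metis
 have u: "vunit B S b : vec k B S" for b using S by (simp add: cring_of)
 have "x = x'"
 proof (rule vec_eqI[OF x(1) x'(1)])
  fix b assume b: "b : B"
  show "x b = x' b" using eq[OF b] x(2)[OF S id_alg_hom[OF S] u] x'(2)[OF S id_alg_hom[OF S] u] b x(1) x'(1)
    pair_vunit_left[OF cring_of[OF S] x(1) b] pair_vunit_left[OF cring_of[OF S] x'(1) b] by simp
 qed
 then show ?thesis using x(2)[OF T] x'(2)[OF T] by simp
qed

text \<open>Functions on \<open>F\<close> over \<open>S\<close>, that is natural transformations to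
  the affine line, in the encoding of \<open>S\<close>-algebras used for
  \<open>natlin\<close>.\<close>

definition natfun ::
 "('u, 'm) ring_scheme => ('u, ('v, 'x) partial_object_scheme, 'v) alg_functor => 'u alg =>
  ('u alg => ('u => 'u) => 'v => 'u) => bool" where
 "natfun R F S h \<longleftrightarrow> (\<forall>T\<in>Algs R. \<forall>f\<in>alg_hom R S T. \<forall>x\<in>vals F T. h T f x : carrier T \<and>
   (\<forall>U\<in>Algs R. \<forall>g\<in>alg_hom R T U. h U (compose (carrier S) g f) (Ar F T U g x) = g (h T f x)))"

lemma natfunD:
 assumes "natfun R F S h" "T : Algs R" "f : alg_hom R S T" "x : vals F T"
 shows "h T f x : carrier T"
  "[|U : Algs R; g : alg_hom R T U|] ==> h U (compose (carrier S) g f) (Ar F T U g x) = g (h T f x)"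
 using assms unfolding natfun_def by blast+

text \<open>A functor of commutative algebras whose underlying functor of modules consists of
  vectors. For \<open>k\<close> false it is \<open>A \<otimes> T\<close> with a free algebra
  \<open>A\<close>, for \<open>k\<close> true the dual of a free module together with a product.
  Laws in the second argument follow from commutativity.\<close>

locale vec_algebra =
 fixes R :: "('u, 'm) ring_scheme" and k :: bool and B :: "'u set"
  and mul :: "'u alg => ('u => 'u) => ('u => 'u) => 'u => 'u" and unt :: "'u alg => 'u => 'u"
 assumes R: "cring R" and inf: "infinite (UNIV :: 'u set)"
  and mul_closed: "[|T : Algs R; v : vec k B T; w : vec k B T|] ==> mul T v w : vec k B T"
  and mul_comm: "[|T : Algs R; v : vec k B T; w : vec k B T|] ==> mul T v w = mul T w v"
  and mul_assoc: "[|T : Algs R; v : vec k B T; w : vec k B T; z : vec k B T|]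
   ==> mul T (mul T v w) z = mul T v (mul T w z)"
  and mul_vadd: "[|T : Algs R; v : vec k B T; w : vec k B T; z : vec k B T|]
   ==> mul T (vadd B T v w) z = vadd B T (mul T v z) (mul T w z)"
  and mul_vscale: "[|T : Algs R; t : carrier T; v : vec k B T; w : vec k B T|]
   ==> mul T (vscale B T t v) w = vscale B T t (mul T v w)"
  and one_closed: "T : Algs R ==> unt T : vec k B T"
  and one_mul: "[|T : Algs R; v : vec k B T|] ==> mul T (unt T) v = v"
  and mul_natural: "[|T : Algs R; U : Algs R; f : alg_hom R T U; v : vec k B T; w : vec k B T|]
   ==> vmap B f (mul T v w) = mul U (vmap B f v) (vmap B f w)"
  and one_natural: "[|T : Algs R; U : Algs R; f : alg_hom R T U|] ==> vmap B f (unt T) = unt U"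

text \<open>Multiplicative linear forms on the algebra of vectors, each given by its representing
  vector of the opposite kind. Quantifying over all algebras under \<open>S\<close> makes
  functoriality immediate; \<open>Char_unitsI\<close> reduces the condition to unit vectors over
  \<open>S\<close>.\<close>

definition Char where
 "Char R k B mul unt S = {x : vec (\<not> k) B S. \<forall>T\<in>Algs R. \<forall>f\<in>alg_hom R S T.
   (\<forall>v\<in>vec k B T. \<forall>w\<in>vec k B T.
    pair B T (mul T v w) (vmap B f x) = pair B T v (vmap B f x) \<otimes>\<^sub>T pair B T w (vmap B f x)) \<and>
   pair B T (unt T) (vmap B f x) = \<one>\<^sub>T}"

definition Char_functor where
 "Char_functor R k B mul unt = \<lparr>Ob = \<lambda>T. \<lparr>carrier = Char R k B mul unt T\<rparr>, Ar = \<lambda>T U. vmap B\<rparr>"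

lemma Char_functor_simps [simp]:
 "vals (Char_functor R k B mul unt) T = Char R k B mul unt T"
 "Ar (Char_functor R k B mul unt) T U = vmap B" by (simp_all add: Char_functor_def)

lemma Char_vec: "x : Char R k B mul unt S ==> x : vec (\<not> k) B S" by (simp add: Char_def)

lemma CharI:
 assumes "x : vec (\<not> k) B S"
  "\<And>T f v w. [|T : Algs R; f : alg_hom R S T; v : vec k B T; w : vec k B T|] ==>
   pair B T (mul T v w) (vmap B f x) = pair B T v (vmap B f x) \<otimes>\<^sub>T pair B T w (vmap B f x)"
  "\<And>T f. [|T : Algs R; f : alg_hom R S T|] ==> pair B T (unt T) (vmap B f x) = \<one>\<^sub>T"
 shows "x : Char R k B mul unt S" using assms unfolding Char_def by blast

lemma CharD:
 assumes "x : Char R k B mul unt S" "T : Algs R" "f : alg_hom R S T"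
 shows "[|v : vec k B T; w : vec k B T|] ==>
   pair B T (mul T v w) (vmap B f x) = pair B T v (vmap B f x) \<otimes>\<^sub>T pair B T w (vmap B f x)"
  "pair B T (unt T) (vmap B f x) = \<one>\<^sub>T" using assms unfolding Char_def by blast+

lemma Char_vmap:
 assumes "S : Algs R" "S' : Algs R" "h : alg_hom R S S'" "x : Char R k B mul unt S"
 shows "vmap B h x : Char R k B mul unt S'"
proof (rule CharI)
 show "vmap B h x : vec (\<not> k) B S'" using assms Char_vec[OF assms(4)] by simp
 fix T f assume T: "T : Algs R" and f: "f : alg_hom R S' T"
 have eq: "vmap B f (vmap B h x) = vmap B (compose (carrier S) f h) x"
  "compose (carrier S) f h : alg_hom R S T" using f assms by (simp_all add: vmap_compose[OF Char_vec[OF assms(4)]])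
 show "pair B T (mul T v w) (vmap B f (vmap B h x)) =
   pair B T v (vmap B f (vmap B h x)) \<otimes>\<^sub>T pair B T w (vmap B f (vmap B h x))"
  if "v : vec k B T" "w : vec k B T" for v w using CharD(1)[OF assms(4) T eq(2) that] by (simp add: eq)
 show "pair B T (unt T) (vmap B f (vmap B h x)) = \<one>\<^sub>T" using CharD(2)[OF assms(4) T eq(2)] by (simp add: eq)
qed

lemma Char_mul:
 assumes "S : Algs R" "x : Char R k B mul unt S" "v : vec k B S" "w : vec k B S"
 shows "pair B S (mul S v w) x = pair B S v x \<otimes>\<^sub>S pair B S w x"
 using CharD(1)[OF assms(2,1) id_alg_hom[OF assms(1)] assms(3,4)] Char_vec[OF assms(2)] by simp

lemma Char_one:
 assumes "S : Algs R" "x : Char R k B mul unt S"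
 shows "pair B S (unt S) x = \<one>\<^sub>S"
 using CharD(2)[OF assms(2,1) id_alg_hom[OF assms(1)]] Char_vec[OF assms(2)] by simp

context vec_algebra
begin

abbreviation "V \<equiv> vec k B"
abbreviation "V' \<equiv> vec (\<not> k) B"
abbreviation "points \<equiv> Char R k B mul unt"

lemma natlin_mul:
 assumes S: "S : Algs R" and l: "natlin k R B S l" and w: "w : V S"
 shows "natlin k R B S (\<lambda>T f v. l T f (mul T v (vmap B f w)))"
proof (rule natlinI)
 fix T f v assume T: "T : Algs R" and f: "f : alg_hom R S T" and v: "v : V T"
 have fw: "vmap B f w : V T" using f S T w by simp
 note m = mul_closed[OF T v fw]
 note n = natlinD[OF l T f m]
 show "l T f (mul T v (vmap B f w)) : carrier T" by (rule n)
 show "l T f (mul T (vadd B T v w') (vmap B f w)) =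
   l T f (mul T v (vmap B f w)) \<oplus>\<^sub>T l T f (mul T w' (vmap B f w))" if "w' : V T" for w'
  using n(2)[OF mul_closed[OF T that fw]] by (simp add: mul_vadd[OF T v that fw])
 show "l T f (mul T (vscale B T t v) (vmap B f w)) = t \<otimes>\<^sub>T l T f (mul T v (vmap B f w))"
  if "t : carrier T" for t using n(3)[OF that] by (simp add: mul_vscale[OF T that v fw])
 show "l U (compose (carrier S) g f) (mul U (vmap B g v) (vmap B (compose (carrier S) g f) w)) =
   g (l T f (mul T v (vmap B f w)))" if "U : Algs R" "g : alg_hom R T U" for U g
  using n(4)[OF that] by (simp add: vmap_compose[OF w] mul_natural[OF T that v fw])
qed

text \<open>Both sides of the multiplicativity law are natural linear forms in each factor, so
  \<open>natlin_eqI\<close> applies twice: it first frees one factor while the other is a unit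
  vector, and then frees the remaining one.\<close>

lemma Char_unitsI:
 assumes D: "D : Algs R" and x: "x : V' D"
  and mul: "\<And>b c. [|b : B; c : B|] ==> pair B D (mul D (vunit B D b) (vunit B D c)) x = x b \<otimes>\<^sub>D x c"
  and one: "pair B D (unt D) x = \<one>\<^sub>D"
 shows "x : points D"
proof -
 have *: "pair B T (mul T v w) (vmap B f x) = pair B T w (vmap B f x) \<otimes>\<^sub>T pair B T v (vmap B f x)"
  if T: "T : Algs R" and f: "f : alg_hom R D T" and v: "v : V T" and w: "w : V T" for T f v w
 proof -
  note cT = cring_of[OF T]
  interpret cring T by (rule cT)
  have fx: "vmap B f x : V' T" using f D T x by simp
  have u: "vunit B T b : V T" for b by (simp add: cT)
  have uu: "vmap B f (vunit B D b) = vunit B T b" for b by (rule vmap_vunit[OF alg_homD(2)[OF f] cring_of[OF D] cT])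
  have uD: "vunit B D b : V D" for b using D by (simp add: cring_of)
  have p: "pair B T w (vmap B f x) : carrier T" if "w : V T" for w by (rule pair_closed[OF cT that fx])
  have lin: "natlin k R B T (\<lambda>U g v. pair B U v (vmap B g (vmap B f x)))" by (rule natlin_pair[OF T fx])
  have units: "pair B T (mul T (vunit B T b) (vunit B T c)) (vmap B f x) = f (x b) \<otimes>\<^sub>T f (x c)"
   if "b : B" "c : B" for b c
  proof -
   have "pair B T (mul T (vunit B T b) (vunit B T c)) (vmap B f x)
     = f (pair B D (mul D (vunit B D b) (vunit B D c)) x)" using pair_alg_hom[OF f D T mul_closed[OF D uD uD] x, of b c]
    by (simp add: mul_natural[OF D T f uD uD] uu)
   then show ?thesis using mul[OF that] that f x by (simp add: alg_homD(6) vec_closed)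
  qed
  have unit: "pair B T (mul T (vunit B T b) w) (vmap B f x) = f (x b) \<otimes>\<^sub>T pair B T w (vmap B f x)"
   if b: "b : B" and w: "w : V T" for b w
  proof -
   have "pair B T (mul T w (vmap B (idm T) (vunit B T b))) (vmap B (idm T) (vmap B f x))
    = (idm T) (f (x b)) \<otimes>\<^sub>T pair B T w (vmap B (idm T) (vmap B f x))"
    by (rule natlin_eqI[OF R inf T natlin_mul[OF T lin u] natlin_mult[OF lin] _ T id_alg_hom[OF T] w])
     (use b x f fx in \<open>simp_all add: vec_closed alg_homD(3) vmap_id[OF u] vmap_id[OF fx] units
       mul_comm[OF T u u, of _ b] pair_vunit_left[OF cT fx]\<close>)
   then show ?thesis using b x f fx w by (simp add: vec_closed alg_homD(3) vmap_id[OF u] vmap_id[OF fx] mul_comm[OF T u w])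
  qed
  have "pair B T (mul T v (vmap B (idm T) w)) (vmap B (idm T) (vmap B f x))
   = (idm T) (pair B T w (vmap B f x)) \<otimes>\<^sub>T pair B T v (vmap B (idm T) (vmap B f x))"
   by (rule natlin_eqI[OF R inf T natlin_mul[OF T lin w] natlin_mult[OF lin p[OF w]] _ T id_alg_hom[OF T] v])
    (use w x f fx p in \<open>simp_all add: vec_closed alg_homD(3) vmap_id[OF w] vmap_id[OF fx] unit
      pair_vunit_left[OF cT fx] m_comm\<close>)
  then show ?thesis using w fx p[OF w] by (simp add: vmap_id[OF w] vmap_id[OF fx])
 qed
 have "pair B T (unt T) (vmap B f x) = \<one>\<^sub>T" if T: "T : Algs R" and f: "f : alg_hom R D T" for T f
  using pair_alg_hom[OF f D T one_closed[OF D] x] one alg_homD(4)[OF f] one_natural[OF D T f] by simp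
 moreover have "pair B T w x' \<otimes>\<^sub>T pair B T v x' = pair B T v x' \<otimes>\<^sub>T pair B T w x'"
  if "T : Algs R" "x' : V' T" "v : V T" "w : V T" for T v w x'
  using that cring_of[OF that(1)] comm_monoid.m_comm[of T] pair_closed[of T _ k B x' "\<not> k"] by (simp add: cring_def)
 ultimately show ?thesis unfolding Char_def using x D * by simp
qed

end

section \<open>Quotients with a universal point, and functions on the scheme of points\<close>

context vec_algebra
begin

abbreviation "ring_of S \<equiv> vec_mod (struct_map R S) k B S (mul S) (unt S)"

lemma struct_ring_hom: "S : Algs R ==> struct_map R S : ring_hom R S"
 using alg_homD(2)[OF struct_map_alg_hom[of R S]] by (simp add: Algs_iff ring_hom_def)

lemma ring_of_algebra:
 assumes S: "S : Algs R" shows "algebra R (ring_of S)" by (rule vec_mod_algebra)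
  (use S in "auto simp: R cring_of struct_ring_hom mul_closed mul_assoc mul_vadd mul_vscale one_closed one_mul
   intro: mul_comm")

text \<open>\<^term>\<open>q\<close> presents a quotient algebra of the ring \<^term>\<open>V S\<close> in which only finitely many
 basis vectors survive if \<^term>\<open>k\<close> holds. It carries a generic point.\<close>

lemma quotient_point:
 assumes S: "S : Algs R"
  and add: "\<And>x x' y y'. [|x : V S; x' : V S; y : V S; y' : V S; q x = q x'; q y = q y'|]
   ==> q (vadd B S x y) = q (vadd B S x' y')"
  and mult: "\<And>x x' y y'. [|x : V S; x' : V S; y : V S; y' : V S; q x = q x'; q y = q y'|]
   ==> q (mul S x y) = q (mul S x' y')"
  and scale: "\<And>s x x'. [|s : carrier S; x : V S; x' : V S; q x = q x'|]
   ==> q (vscale B S s x) = q (vscale B S s x')"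
  and fin: "k ==> finite {b\<in>B. q (vunit B S b) \<noteq> q (vzero B S)}"
  and red: "\<And>v. v : V S ==> \<exists>w\<in>vec False B S. q v = q w \<and>
   (\<forall>b\<in>B. q (vunit B S b) \<noteq> q (vzero B S) \<longrightarrow> v b = w b)"
 obtains D j x where "D : Algs R" "j : alg_hom R S D" "x : points D"
  "\<And>v. v : V S ==> pair B D (vmap B j v) x = q v" "carrier D = q ` V S"
  "\<And>T f y. [|T : Algs R; f : alg_hom R S T; y : points T;
    \<And>v w. [|v : V S; w : V S; q v = q w|] ==> pair B T (vmap B f v) y = pair B T (vmap B f w) y|]
   ==> \<exists>g\<in>alg_hom R D T. compose (carrier S) g j = f \<and> vmap B g x = y \<and>
    (\<forall>v\<in>V S. g (q v) = pair B T (vmap B f v) y)"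
proof -
 note cS = cring_of[OF S]
 interpret S: algebra R S using S by (simp add: Algs_iff)
 note O = ring_of_algebra[OF S]
 interpret O: algebra R "ring_of S" by (rule O)
 have sR: "struct_map R S r : carrier S" if "r : carrier R" for r using that S.algebra_axioms by simp
 have add': "q (x \<oplus>\<^sub>(ring_of S) y) = q (x' \<oplus>\<^sub>(ring_of S) y')"
  and mult': "q (x \<otimes>\<^sub>(ring_of S) y) = q (x' \<otimes>\<^sub>(ring_of S) y')"
  if "x : carrier (ring_of S)" "x' : carrier (ring_of S)" "y : carrier (ring_of S)" "y' : carrier (ring_of S)"
   "q x = q x'" "q y = q y'" for x x' y y' using add[of x x' y y'] mult[of x x' y y'] that by simp_all
 have scale': "q (r \<odot>\<^sub>(ring_of S) x) = q (r \<odot>\<^sub>(ring_of S) x')"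
  if "r : carrier R" "x : carrier (ring_of S)" "x' : carrier (ring_of S)" "q x = q x'" for r x x'
  unfolding vec_mod_simps by (rule scale[OF sR]) (use that in "simp_all only: vec_mod_simps")
 obtain D :: "'u alg" where D: "algebra R D" "carrier D = q ` carrier (ring_of S)" "q : ring_hom (ring_of S) D"
  "\<And>r x. [|r : carrier R; x : carrier (ring_of S)|] ==> q (r \<odot>\<^sub>(ring_of S) x) = r \<odot>\<^sub>D q x"
  by (rule image_algebra[of R "ring_of S" q, OF O add' mult' scale']) (assumption+, blast)
 have DA: "D : Algs R" using D(1) by (simp add: Algs_iff)
 note cD = cring_of[OF DA]
 interpret D: cring D by (rule cD)
 have u: "vunit B S b : vec k' B S" for b k' by (simp add: cS)
 have qc: "q v : carrier D" if "v : V S" for v using that D(2) by simp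
 have qm: "q (mul S v w) = q v \<otimes>\<^sub>D q w" if "v : V S" "w : V S" for v w
  using that ring_hom_mult[OF D(3)] by simp
 have qa: "q (vadd B S v w) = q v \<oplus>\<^sub>D q w" if "v : V S" "w : V S" for v w
  using that ring_hom_add[OF D(3)] by simp
 have q1: "q (unt S) = \<one>\<^sub>D" using ring_hom_one[OF D(3)] by simp
 have q0: "q (vzero B S) = \<zero>\<^sub>D" using ring_hom_0[OF D(3) O.M_cring cD] by simp
 define j where "j = (\<lambda>s\<in>carrier S. q (vscale B S s (unt S)))"
 have sone: "vscale B S s (unt S) : V S" if "s : carrier S" for s using that one_closed[OF S] cS by simp
 have sone_mul: "mul S (vscale B S s (unt S)) v = vscale B S s v" if "s : carrier S" "v : V S" for s v
  using that S by (simp add: mul_vscale one_closed one_mul)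
 have qs: "q (vscale B S s v) = j s \<otimes>\<^sub>D q v" if "s : carrier S" "v : V S" for s v
  using qm[OF sone[OF that(1)] that(2)] sone_mul[OF that] that by (simp add: j_def)
 have j: "j : alg_hom R S D"
 proof (rule alg_homI)
  have 1: "vscale B S \<one>\<^sub>S (unt S) = unt S"
   by (rule vec_eqI[OF sone one_closed[OF S]]) (auto simp: vec_closed[OF one_closed[OF S]])
  show "j \<one>\<^sub>S = \<one>\<^sub>D" by (simp add: j_def 1 q1)
  fix s t assume st: "s : carrier S" "t : carrier S"
  have "vscale B S (s \<oplus>\<^sub>S t) (unt S) = vadd B S (vscale B S s (unt S)) (vscale B S t (unt S))"
   by (rule vec_eqI[OF sone vadd_closed[OF cS sone sone]])
    (use st in "auto simp: S.l_distr vec_closed[OF one_closed[OF S]]")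
  then show "j (s \<oplus>\<^sub>S t) = j s \<oplus>\<^sub>D j t" using st by (simp add: j_def qa sone)
  have "vscale B S (s \<otimes>\<^sub>S t) (unt S) = vscale B S s (vscale B S t (unt S))"
   by (rule vec_eqI[OF sone vscale_closed[OF cS _ sone]])
    (use st in "auto simp: S.m_assoc vec_closed[OF one_closed[OF S]]")
  then show "j (s \<otimes>\<^sub>S t) = j s \<otimes>\<^sub>D j t" using st qs[OF st(1) sone[OF st(2)]] by (simp add: j_def)
 next
  fix r s assume rs: "r : carrier R" "s : carrier S"
  have "vscale B S (r \<odot>\<^sub>S s) (unt S) = vscale B S (struct_map R S r) (vscale B S s (unt S))"
   by (rule vec_eqI[OF sone vscale_closed[OF cS _ sone]])
    (use rs sR in \<open>auto simp: S.m_assoc smult_eq_struct_map[OF S.algebra_axioms] vec_closed[OF one_closed[OF S]]\<close>)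
  then show "j (r \<odot>\<^sub>S s) = r \<odot>\<^sub>D j s" using rs D(4)[OF rs(1), of "vscale B S s (unt S)"] sone
   by (simp add: j_def)
 qed (auto simp: j_def sone qc)
 note jr = alg_homD(2)[OF j]
 \<comment> \<open>The universal point. Its coordinates are the classes of the unit vectors, so that
   pairing with it is meant to be the quotient map \<open>q\<close>. The hypothesis
   \<open>fin\<close> makes it a vector of the right kind.\<close>
 define x where "x = (\<lambda>b\<in>B. q (vunit B S b))"
 have x: "x : V' D"
  by (rule vecI) (use fin in \<open>auto simp: x_def qc u q0[symmetric] elim!: rev_finite_subset\<close>)
 have fp: "pair B D (vmap B j v) x = q v" if v: "v : vec False B S" for v using cS v
 proof (induction rule: vec_fin_induct)
  have xT: "x : vec True B D" by (rule vec_subset_True[OF x])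
  case zero
  have "pair B D (vzero B D) x = \<zero>\<^sub>D"
  proof -
   have "vscale B D \<zero>\<^sub>D (vzero B D) = vzero B D"
    by (rule vec_eqI[OF vscale_closed[of _ _ _ True] vzero_closed[of _ _ True]]) (auto simp: cD)
   then show ?thesis
    using pair_vscale[OF cD D.zero_closed vzero_closed[OF cD] x] pair_closed[OF cD vzero_closed[OF cD, of B k] x] by simp
  qed
  then show ?case by (simp add: vmap_vzero[OF jr cS cD] q0)
 next
  case (add t b w)
  have w: "w : V S" using add(3) by (rule vec_False_subset)
  have su: "vscale B S t (vunit B S b) : V S" using add u cS by simp
  have jt: "j t : carrier D" using alg_homD(3)[OF j add(1)] .
  have jw: "vmap B j w : V D" using j S DA w by simp
  have "vmap B j (vadd B S (vscale B S t (vunit B S b)) w)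
   = vadd B D (vscale B D (j t) (vunit B D b)) (vmap B j w)"
   by (simp add: vmap_vadd[OF jr su w] vmap_vscale[OF jr add(1) u] vmap_vunit[OF jr cS cD])
  then show ?case using add jt x cD pair_vadd[OF cD vscale_closed[OF cD jt vunit_closed[OF cD]] jw x, of b]
    pair_vscale[OF cD jt vunit_closed[OF cD] x, of b] pair_vunit_left[OF cD x, of b]
   by (simp add: qa[OF su w] qs[OF add(1) u]) (simp add: x_def)
 qed
 \<comment> \<open>An arbitrary vector is replaced by the finitely supported one that
   \<open>red\<close> supplies. The two have the same class and agree at every index where the
   universal point has a nonzero coordinate, so neither side of the claim changes.\<close>
 have p: "pair B D (vmap B j v) x = q v" if v: "v : V S" for v
 proof -
  obtain w where w: "w : vec False B S" "q v = q w" "\<forall>b\<in>B. q (vunit B S b) \<noteq> q (vzero B S) \<longrightarrow> v b = w b"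
   using red[OF v] by blast
  have jv: "vmap B j v : V D" "vmap B j w : V D" using j S DA v vec_False_subset[OF w(1)] by simp_all
  have "pair B D (vmap B j v) x = pair B D (vmap B j w) x"
   by (rule pair_cong[OF cD jv x]) (use w(3) q0 in \<open>auto simp: x_def\<close>)
  then show ?thesis using fp[OF w(1)] w(2) by simp
 qed
 have xp: "x : points D"
 proof (rule Char_unitsI[OF DA x])
  show "pair B D (mul D (vunit B D b) (vunit B D c)) x = x b \<otimes>\<^sub>D x c" if "b : B" "c : B" for b c
   using that p[OF mul_closed[OF S u u], of b c]
   by (simp add: mul_natural[OF S DA j u u] vmap_vunit[OF jr cS cD] qm u) (simp add: x_def)
  show "pair B D (unt D) x = \<one>\<^sub>D" using p[OF one_closed[OF S]] by (simp add: one_natural[OF S DA j] q1)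
 qed
 \<comment> \<open>The universal property: a point whose form is constant on the fibres of
   \<open>q\<close> induces a homomorphism on the quotient.\<close>
 have fac: "\<exists>g\<in>alg_hom R D T. compose (carrier S) g j = f \<and> vmap B g x = y \<and>
    (\<forall>v\<in>V S. g (q v) = pair B T (vmap B f v) y)"
  if T: "T : Algs R" and f: "f : alg_hom R S T" and y: "y : points T"
   and fib: "\<And>v w. [|v : V S; w : V S; q v = q w|] ==> pair B T (vmap B f v) y = pair B T (vmap B f w) y"
  for T f y
 proof -
  note cT = cring_of[OF T]
  interpret T: algebra R T using T by (simp add: Algs_iff)
  note yv = Char_vec[OF y]
  note fr = alg_homD(2)[OF f]
  define h where "h v = pair B T (vmap B f v) y" for v
  have fv: "vmap B f v : V T" if "v : V S" for v using f S T that by simp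
  have fone: "vmap B f (unt S) = unt T" by (rule one_natural[OF S T f])
  have hs: "h (vscale B S s v) = f s \<otimes>\<^sub>T h v" if "s : carrier S" "v : V S" for s v
   using that by (simp add: h_def vmap_vscale[OF fr] pair_vscale[OF cT _ fv yv] alg_homD(3)[OF f])
  have hr: "h : ring_hom (ring_of S) T"
  proof (rule ring_hom_memI)
   show "h v : carrier T" if "v : carrier (ring_of S)" for v
    unfolding h_def by (rule pair_closed[OF cT fv yv]) (use that in simp)
  qed (auto simp: h_def mul_natural[OF S T f] Char_mul[OF T y fv fv] fone Char_one[OF T y]
    vmap_vadd[OF fr] pair_vadd[OF cT fv fv yv])
  have hR: "h (r \<odot>\<^sub>(ring_of S) v) = r \<odot>\<^sub>T h v" if "r : carrier R" "v : carrier (ring_of S)" for r v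
   using that hs[OF sR[OF that(1)], of v] ring_hom_closed[OF hr that(2)]
   by (simp add: smult_eq_struct_map[OF T.algebra_axioms] alg_hom_struct_map[OF f that(1) S.algebra_axioms])
  obtain g where g: "g : alg_hom R D T" "\<And>v. v : carrier (ring_of S) ==> g (q v) = h v"
  proof (rule alg_hom_factor[OF O D(2,3,4) hr])
   show "h (r \<odot>\<^sub>(ring_of S) v) = r \<odot>\<^sub>T h v" if "r : carrier R" "v : carrier (ring_of S)" for r v
    by (rule hR[OF that])
   show "h v = h w" if "v : carrier (ring_of S)" "w : carrier (ring_of S)" "q v = q w" for v w
    unfolding h_def by (rule fib) (use that in simp_all)
  qed (assumption+, rule that)
  have "compose (carrier S) g j = f"
  proof (rule extensionalityI[of _ "carrier S"])
   show "compose (carrier S) g j s = f s" if "s : carrier S" for s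
    using that g(2)[of "vscale B S s (unt S)"] sone hs[OF that one_closed[OF S]] alg_homD(3)[OF f that]
    by (simp add: compose_def j_def) (simp add: h_def fone Char_one[OF T y])
  qed (use alg_homD(1)[OF f] in auto)
  moreover have "vmap B g x = y" by (rule vec_eqI[OF vmap_alg_hom[OF g(1) DA T x] yv])
    (use g(2) u in \<open>auto simp: x_def h_def vmap_vunit[OF fr cS cT] pair_vunit_left[OF cT yv]\<close>)
  ultimately show ?thesis using g by (auto simp: h_def)
 qed
 show thesis
 proof (rule that[OF DA j xp p])
  show "carrier D = q ` V S" using D(2) by simp
 qed (assumption | rule fac)+
qed

end

text \<open>Enough quotients of \<^term>\<open>V S\<close> satisfy the hypotheses of the previous lemma: for \<^term>\<open>\<not> k\<close>
 the ring itself, for \<^term>\<open>k\<close> the quotients by the annihilators of finite sets of coordinates.\<close>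

lemma (in vec_algebra) mul_finite_coordinates:
 assumes k: k and S: "S : Algs R" and b0: "b0 : B"
 obtains K where "finite K" "K \<subseteq> B" "\<And>u v w. [|u : V S; v : V S; w : V S;
  \<forall>c\<in>K. v c = w c|] ==> mul S u v b0 = mul S u w b0"
proof -
 have kT: "vec k = vec True" using k by simp
 note cS = cring_of[OF S]
 obtain D jD gen X where D: "D : Algs R" "jD : alg_hom R S D" "gen : vec True B D"
  and E: "\<And>T f v. [|T : Algs R; f : alg_hom R S T; v : vec True B T|] ==>
   \<exists>E jE eps g. E : Algs R \<and> jE : alg_hom R T E \<and> eps : carrier E \<and> g : alg_hom R D E \<and>
    compose (carrier S) g jD = compose (carrier S) jE f \<and>
    vmap B g gen = vscale B E eps (vmap B jE v) \<and>
    inj_on (\<lambda>t. eps \<otimes>\<^sub>E jE t) (carrier T) \<and>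
    (\<forall>d\<in>carrier D. \<forall>t\<in>carrier T. g d = eps \<otimes>\<^sub>E jE t \<longrightarrow> t = pair B T v (vmap B f (X d)))"
  by (rule generic_nilpotent_vector[OF R inf S]) blast
 have genk: "gen : V D" using D(3) k by simp
 note cD = cring_of[OF D(1)]
 \<comment> \<open>The coordinate \<open>b0\<close> of the product with the generic vector is a
   natural linear form in the other factor, hence the pairing with a finitely supported
   vector.\<close>
 have "natlin k R B D (\<lambda>U f w. pair B U w (vmap B f (vunit B D b0)))" by (rule natlin_pair[OF D(1)]) (simp add: cD)
 from natlin_mul[OF D(1) this genk]
 have lin: "natlin k R B D (\<lambda>U f w. pair B U (mul U w (vmap B f gen)) (vmap B f (vunit B D b0)))" .
 obtain y where y: "y : V' D"
  "\<And>U f w. [|U : Algs R; f : alg_hom R D U; w : V U|] ==>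
   pair B U (mul U w (vmap B f gen)) (vmap B f (vunit B D b0)) = pair B U w (vmap B f y)"
  by (rule natlin_rep[OF R inf D(1) lin]) blast
 have yF: "y : vec False B D" using y(1) k by simp
 \<comment> \<open>The support of the representing vector. It is found over the generic vector and
   therefore serves all factors \<open>u\<close> at once.\<close>
 define K where "K = {b\<in>B. y b \<noteq> \<zero>\<^sub>D}"
 have K: "finite K" "K \<subseteq> B" using vec_finite[OF yF] by (auto simp: K_def)
 have "mul S u v b0 = mul S u w b0"
  if u: "u : V S" and v: "v : V S" and w: "w : V S" and eq: "\<forall>c\<in>K. v c = w c" for u v w
 proof -
  obtain E jE eps g where E: "E : Algs R" "jE : alg_hom R S E" "eps : carrier E" "g : alg_hom R D E"
    "vmap B g gen = vscale B E eps (vmap B jE u)" "inj_on (\<lambda>t. eps \<otimes>\<^sub>E jE t) (carrier S)"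
   using E[OF S id_alg_hom[OF S], of u] u unfolding kT by blast
  note cE = cring_of[OF E(1)]
  interpret E: cring E by (rule cE)
  have j: "vmap B jE v' : V E" if "v' : V S" for v' using E S that by simp
  \<comment> \<open>Specializing \<open>gen\<close> to \<open>eps\<close> times \<open>u\<close>
    turns the generic form into \<open>eps\<close> times the coordinate of the product; since
    multiplication by \<open>eps\<close> is injective on the image of \<open>S\<close>, the
    coordinate can be read off.\<close>
  have val: "eps \<otimes>\<^sub>E jE (mul S u v' b0) = pair B E (vmap B jE v') (vmap B g y)" if v': "v' : V S" for v'
  proof -
   have m: "mul E (vmap B jE u) (vmap B jE v') : V E" by (rule mul_closed[OF E(1) j[OF u] j[OF v']])
   have "pair B E (vmap B jE v') (vmap B g y)
    = pair B E (mul E (vmap B jE v') (vscale B E eps (vmap B jE u))) (vunit B E b0)"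
    using y(2)[OF E(1,4) j[OF v']] by (simp add: E(5) vmap_vunit[OF alg_homD(2)[OF E(4)] cD cE])
   also have "\<dots> = vscale B E eps (mul E (vmap B jE u) (vmap B jE v')) b0"
    using mul_comm[OF E(1) j[OF v'] vscale_closed[OF cE E(3) j[OF u]]] mul_vscale[OF E(1,3) j[OF u] j[OF v']]
     pair_vunit[OF cE vscale_closed[OF cE E(3) m] b0] by simp
   also have "\<dots> = eps \<otimes>\<^sub>E jE (mul S u v' b0)" using b0 by (simp flip: mul_natural[OF S E(1,2) u v'])
   finally show ?thesis by simp
  qed
  have "pair B E (vmap B jE v) (vmap B g y) = pair B E (vmap B jE w) (vmap B g y)"
  proof (rule pair_cong[OF cE j[OF v] j[OF w] vmap_alg_hom[OF E(4) D(1) E(1) y(1)]])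
   fix b assume "b : B" "vmap B g y b \<noteq> \<zero>\<^sub>E"
   then have "b : K" using ring_hom_0[OF alg_homD(2)[OF E(4)] cD cE] by (auto simp: K_def)
   then show "vmap B jE v b = vmap B jE w b" using eq \<open>b : B\<close> by simp
  qed
  then show ?thesis using val[OF v] val[OF w] inj_onD[OF E(6)] vec_closed[OF mul_closed[OF S u v] b0]
    vec_closed[OF mul_closed[OF S u w] b0] by auto
 qed
 then show thesis using that K by blast
qed

context vec_algebra
begin

lemma quotient_exists:
 assumes S: "S : Algs R" and F: "F \<subseteq> B" "k ==> finite F"
 shows "\<exists>D j x q. D : Algs R \<and> j : alg_hom R S D \<and> x : points D \<and>
  (\<forall>v\<in>V S. pair B D (vmap B j v) x = q v) \<and> carrier D = q ` V S \<and>
  (\<forall>v\<in>V S. \<forall>w\<in>V S. \<forall>b\<in>F. q v = q w \<longrightarrow> v b = w b) \<and>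
  (\<forall>T\<in>Algs R. \<forall>f\<in>alg_hom R S T. \<forall>y\<in>points T. (\<forall>b\<in>B - F. y b = \<zero>\<^sub>T) \<longrightarrow>
   (\<exists>g\<in>alg_hom R D T. compose (carrier S) g j = f \<and> vmap B g x = y \<and>
    (\<forall>v\<in>V S. g (q v) = pair B T (vmap B f v) y)))"
proof -
 note cS = cring_of[OF S]
 interpret S: cring S by (rule cS)
 obtain e :: "('u => 'u) => 'u" where e: "inj_on e (vec False B S)" using inj_vec_False[OF inf] .
 \<comment> \<open>For \<open>k\<close> this is congruence modulo the largest ideal contained in the
   module of vectors vanishing on \<open>F\<close>. Testing after multiplication with every
   \<open>u\<close> is what makes it compatible with products.\<close>
 define rel where "rel v w \<longleftrightarrow> (if k then \<forall>b\<in>F. \<forall>u\<in>V S. mul S u v b = mul S u w b else v = w)" for v w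
 \<comment> \<open>A class is coded by an element of \<open>'u\<close> through a finitely supported
   representative. Equivalent vectors have the same candidates, so \<open>SOME\<close> picks the
   same one for both.\<close>
 define q where "q v = e (SOME w. w : vec False B S \<and> rel w v)" for v
 \<comment> \<open>For \<open>k\<close>, finitely many coordinates decide the relation:
   \<open>F\<close> is finite, and each of its coordinates needs only the finite set found in
   \<open>mul_finite_coordinates\<close>. Truncation to this set will give the finitely supported
   representatives.\<close>
 have red: "\<exists>K. (k \<longrightarrow> finite K) \<and> K \<subseteq> B \<and> (\<forall>v\<in>V S. \<forall>w\<in>V S. (\<forall>c\<in>K. v c = w c) \<longrightarrow> rel v w)"
 proof (cases k)
  case True
  have "\<forall>b\<in>F. \<exists>K. finite K \<and> K \<subseteq> B \<and> (\<forall>u v w. u : V S \<longrightarrow> v : V S \<longrightarrow> w : V S \<longrightarrow>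
    (\<forall>c\<in>K. v c = w c) \<longrightarrow> mul S u v b = mul S u w b)"
  proof
   fix b assume "b : F"
   then have "b : B" using F by blast
   from mul_finite_coordinates[OF True S this]
   show "\<exists>K. finite K \<and> K \<subseteq> B \<and> (\<forall>u v w. u : V S \<longrightarrow> v : V S \<longrightarrow> w : V S \<longrightarrow>
    (\<forall>c\<in>K. v c = w c) \<longrightarrow> mul S u v b = mul S u w b)" by metis
  qed
  then obtain K where "\<forall>b\<in>F. finite (K b) \<and> K b \<subseteq> B \<and> (\<forall>u v w. u : V S \<longrightarrow> v : V S \<longrightarrow> w : V S \<longrightarrow>
    (\<forall>c\<in>K b. v c = w c) \<longrightarrow> mul S u v b = mul S u w b)" by metis
  then have K: "finite (K b)" "K b \<subseteq> B" "[|u : V S; v : V S; w : V S; \<forall>c\<in>K b. v c = w c|]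
    ==> mul S u v b = mul S u w b" if "b : F" for b u v w using that by blast+
  have "rel v w" if "v : V S" "w : V S" "\<forall>c\<in>\<Union> (K ` F). v c = w c" for v w
   unfolding rel_def if_P[OF True] using K(3)[OF _ _ that(1,2)] that(3) by blast
  then show ?thesis using True F(2) K(1,2) by (intro exI[of _ "\<Union> (K ` F)"]) blast
 next
  case False
  have "v = w" if "v : V S" "w : V S" "\<forall>c\<in>B. v c = w c" for v w
   by (rule vec_eqI[OF that(1,2)]) (use that(3) in blast)
  then show ?thesis using False by (auto simp: rel_def)
 qed
 then obtain K where K': "(k \<longrightarrow> finite K) \<and> K \<subseteq> B \<and>
   (\<forall>v\<in>V S. \<forall>w\<in>V S. (\<forall>c\<in>K. v c = w c) \<longrightarrow> rel v w)" ..
 then have K: "k ==> finite K" "K \<subseteq> B"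
  "[|v : V S; w : V S; \<forall>c\<in>K. v c = w c|] ==> rel v w" for v w by blast+
 define cut where "cut v = (\<lambda>b\<in>B. if b : K then v b else \<zero>\<^sub>S)" for v
 have cut: "cut v : vec False B S" if v: "v : V S" for v
 proof (cases k)
  case True
  then show ?thesis by (intro vecI_subset[of _ _ _ K]) (use K v in "auto simp: cut_def vec_closed")
 next
  case False
  then show ?thesis by (intro vecI_subset[of _ _ _ "{b\<in>B. v b \<noteq> \<zero>\<^sub>S}"])
    (use v in "auto simp: cut_def vec_closed vec_finite")
 qed
 have rel_cut: "rel (cut v) v" if "v : V S" for v
  by (rule K(3)[OF vec_False_subset[OF cut[OF that]] that]) (use K(2) in "auto simp: cut_def")
 have rel_eq: "rel v w ==> rel v' w' ==> rel v v' \<longleftrightarrow> rel w w'" for v w v' w' by (auto simp: rel_def)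
 have some: "(SOME w. w : vec False B S \<and> rel w v) : vec False B S"
  "rel (SOME w. w : vec False B S \<and> rel w v) v" if "v : V S" for v
  using someI[of "\<lambda>w. w : vec False B S \<and> rel w v" "cut v"] cut rel_cut that by blast+
 have q: "q v = q w \<longleftrightarrow> rel v w" if "v : V S" "w : V S" for v w
 proof
  assume "q v = q w"
  then have "(SOME z. z : vec False B S \<and> rel z v) = (SOME z. z : vec False B S \<and> rel z w)"
   unfolding q_def using inj_onD[OF e] some(1) that by blast
  then show "rel v w" using some(2)[OF that(1)] some(2)[OF that(2)] by (auto simp: rel_def)
 next
  assume "rel v w"
  then have "rel z v \<longleftrightarrow> rel z w" for z by (auto simp: rel_def)
  then show "q v = q w" by (simp add: q_def)
 qed
 have rel_add: "rel (vadd B S x y) (vadd B S x' y')"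
  if "x : V S" "x' : V S" "y : V S" "y' : V S" "rel x x'" "rel y y'" for x x' y y'
 proof -
  have "mul S u (vadd B S v w) = vadd B S (mul S u v) (mul S u w)"
   if "u : V S" "v : V S" "w : V S" for u v w
   using that S mul_comm[OF S that(1) vadd_closed[OF cS that(2,3)]] mul_vadd[OF S that(2,3,1)] mul_comm by simp
  then show ?thesis using that F by (auto simp: rel_def subset_iff)
 qed
 have rel_scale: "rel (vscale B S s x) (vscale B S s x')"
  if "s : carrier S" "x : V S" "x' : V S" "rel x x'" for s x x'
 proof -
  have "mul S u (vscale B S s v) = vscale B S s (mul S u v)"
   if "u : V S" "v : V S" for u v
   using that S \<open>s : carrier S\<close> mul_comm[OF S that(1) vscale_closed[OF cS \<open>s : carrier S\<close> that(2)]]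
    mul_vscale[OF S \<open>s : carrier S\<close> that(2,1)] mul_comm by simp
  then show ?thesis using that F by (auto simp: rel_def subset_iff)
 qed
 \<comment> \<open>Associativity moves the factor \<open>x\<close> to the test vector
   \<open>u\<close>.\<close>
 have rel_mul1: "rel (mul S x y) (mul S x y')"
  if "x : V S" "y : V S" "y' : V S" "rel y y'" for x y y'
 proof -
  have "mul S u (mul S x y) b = mul S u (mul S x y') b"
   if "\<forall>b\<in>F. \<forall>u\<in>V S. mul S u y b = mul S u y' b" "b : F" "u : V S" for b u
   using that(1,2) mul_closed[OF S that(3) \<open>x : V S\<close>]
   by (simp flip: mul_assoc[OF S that(3) \<open>x : V S\<close> \<open>y : V S\<close>]
     mul_assoc[OF S that(3) \<open>x : V S\<close> \<open>y' : V S\<close>])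
  then show ?thesis using that(4) unfolding rel_def by (cases k) auto
 qed
 have rel_mul: "rel (mul S x y) (mul S x' y')"
  if "x : V S" "x' : V S" "y : V S" "y' : V S" "rel x x'" "rel y y'" for x x' y y'
 proof -
  have "rel (mul S x y) (mul S x y')" by (rule rel_mul1) (use that in auto)
  moreover have "rel (mul S x y') (mul S x' y')" using rel_mul1[of y' x x'] that S mul_comm by simp
  ultimately show ?thesis by (auto simp: rel_def)
 qed
 \<comment> \<open>Testing with the unit recovers the coordinates in \<open>F\<close>
   themselves.\<close>
 have rel_F: "v b = w b" if "v : V S" "w : V S" "rel v w" "b : F" for v w b
 proof (cases k)
  case True
  then have "mul S (unt S) v b = mul S (unt S) w b" using that(3,4) one_closed[OF S] unfolding rel_def by auto
  then show ?thesis by (simp add: one_mul[OF S that(1)] one_mul[OF S that(2)])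
 qed (use that in "simp add: rel_def")
 have u: "vunit B S b : V S" for b by (simp add: cS)
 have K0: "q (vunit B S b) = q (vzero B S)" if "b : B - K" for b unfolding q[OF u vzero_closed[OF cS]]
  by (rule K(3)[OF u vzero_closed[OF cS]]) (use that K(2) in "auto simp: vunit_apply subset_iff")
 have fin': "finite {b\<in>B. q (vunit B S b) \<noteq> q (vzero B S)}" if k
  using that K0 K(1) by (auto intro: finite_subset[of _ K])
 have red': "\<exists>w\<in>vec False B S. q v = q w \<and> (\<forall>b\<in>B. q (vunit B S b) \<noteq> q (vzero B S) \<longrightarrow> v b = w b)"
  if v: "v : V S" for v
 proof (intro bexI[OF _ cut[OF v]] conjI ballI impI)
  show "q v = q (cut v)" using q[OF v vec_False_subset[OF cut[OF v]]] rel_cut[OF v] by (auto simp: rel_def)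
  show "v b = cut v b" if "b : B" "q (vunit B S b) \<noteq> q (vzero B S)" for b using that K0 by (auto simp: cut_def)
 qed
 have add': "q (vadd B S x y) = q (vadd B S x' y')" and mul': "q (mul S x y) = q (mul S x' y')"
  if "x : V S" "x' : V S" "y : V S" "y' : V S" "q x = q x'" "q y = q y'" for x x' y y'
  using that rel_add rel_mul by (simp_all add: q cS mul_closed[OF S])
 have scale': "q (vscale B S s x) = q (vscale B S s x')"
  if "s : carrier S" "x : V S" "x' : V S" "q x = q x'" for s x x' using that rel_scale by (simp add: q cS)
 show ?thesis
 proof (rule quotient_point[OF S, of q])
 fix D j x assume D: "D : Algs R" "j : alg_hom R S D" "x : points D"
  "\<And>v. v : V S ==> pair B D (vmap B j v) x = q v" "carrier D = q ` V S"
  and g: "\<And>T f y. [|T : Algs R; f : alg_hom R S T; y : points T;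
    \<And>v w. [|v : V S; w : V S; q v = q w|] ==> pair B T (vmap B f v) y = pair B T (vmap B f w) y|]
   ==> \<exists>g\<in>alg_hom R D T. compose (carrier S) g j = f \<and> vmap B g x = y \<and>
    (\<forall>v\<in>V S. g (q v) = pair B T (vmap B f v) y)"
 have "v b = w b" if "v : V S" "w : V S" "q v = q w" "b : F" for v w b using rel_F that by (simp add: q)
 \<comment> \<open>A point supported in \<open>F\<close> reads only those coordinates of its
   argument that lie in \<open>F\<close>, and these are determined by the class; hence it factors
   through the quotient.\<close>
 moreover have "\<exists>g\<in>alg_hom R D T. compose (carrier S) g j = f \<and> vmap B g x = y \<and>
   (\<forall>v\<in>V S. g (q v) = pair B T (vmap B f v) y)"
  if T: "T : Algs R" and f: "f : alg_hom R S T" and y: "y : points T" "\<forall>b\<in>B - F. y b = \<zero>\<^sub>T" for T f y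
 proof (rule g[OF T f y(1)])
  fix v w assume vw: "v : V S" "w : V S" "q v = q w"
  show "pair B T (vmap B f v) y = pair B T (vmap B f w) y"
  proof (rule pair_cong[OF cring_of[OF T] vmap_alg_hom[OF f S T vw(1)] vmap_alg_hom[OF f S T vw(2)] Char_vec[OF y(1)]])
   fix b assume b: "b : B" "y b \<noteq> \<zero>\<^sub>T"
   then have "b : F" using y(2) by blast
   then show "vmap B f v b = vmap B f w b" using rel_F[of v w b] vw b(1) by (simp add: q)
  qed
 qed
 ultimately show ?thesis by (intro exI[of _ D] exI[of _ j] exI[of _ x] exI[of _ q] conjI ballI impI) (use D in auto)
 qed (assumption | rule add' mul' scale' fin' red')+
qed

text \<open>The quotient attached to the set containing only \<open>b\<close> remembers the
  coordinate \<open>b\<close>, and pairing with its universal point computes the quotient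
  map.\<close>

lemma points_separate:
 assumes S: "S : Algs R" and v: "v : V S" "w : V S"
  and eq: "\<And>T f y. [|T : Algs R; f : alg_hom R S T; y : points T|] ==>
   pair B T (vmap B f v) y = pair B T (vmap B f w) y"
 shows "v = w"
proof (rule vec_eqI[OF v])
 fix b assume b: "b : B"
 obtain D j x q where D: "D : Algs R" "j : alg_hom R S D" "x : points D"
  and q: "\<forall>v\<in>V S. pair B D (vmap B j v) x = q v"
   "\<forall>v\<in>V S. \<forall>w\<in>V S. \<forall>b'\<in>{b}. q v = q w \<longrightarrow> v b' = w b'"
  using quotient_exists[OF S, of "{b}"] b by auto
 show "v b = w b" using q v eq[OF D] by auto
qed

text \<open>On points supported in \<open>F\<close> a function is determined by its value at the
  universal point of the quotient attached to \<open>F\<close>. For \<open>k\<close> false the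
  choice of \<open>B\<close> for \<open>F\<close> serves all points. For \<open>k\<close> true every
  point has finite support, and the vectors found for the finite sets \<open>F\<close> are glued,
  since each single coordinate stabilizes.\<close>

lemma points_functions:
 assumes S: "S : Algs R" and h: "natfun R (Char_functor R k B mul unt) S h"
 obtains v where "v : V S"
  "\<And>T f y. [|T : Algs R; f : alg_hom R S T; y : points T|] ==> h T f y = pair B T (vmap B f v) y"
proof -
 define spec where "spec F v \<longleftrightarrow> v : V S \<and> (\<forall>T\<in>Algs R. \<forall>f\<in>alg_hom R S T. \<forall>y\<in>points T.
  (\<forall>b\<in>B - F. y b = \<zero>\<^sub>T) \<longrightarrow> h T f y = pair B T (vmap B f v) y)" for F v
 have sv: "v : V S" if "spec F v" for F v using that by (simp add: spec_def)
 have natD: "h T f x : carrier T"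
  "[|U : Algs R; g : alg_hom R T U|] ==> h U (compose (carrier S) g f) (vmap B g x) = g (h T f x)"
  if "T : Algs R" "f : alg_hom R S T" "x : points T" for T f x U g
  using natfunD[OF h that(1,2)] that(3) by simp_all
 have ex: "\<exists>v. spec F v" if F: "F \<subseteq> B" "k ==> finite F" for F
 proof -
  obtain D j x q where D: "D : Algs R" "j : alg_hom R S D" "x : points D"
   "carrier D = q ` V S"
   and g: "\<forall>T\<in>Algs R. \<forall>f\<in>alg_hom R S T. \<forall>y\<in>points T. (\<forall>b\<in>B - F. y b = \<zero>\<^sub>T) \<longrightarrow>
    (\<exists>g\<in>alg_hom R D T. compose (carrier S) g j = f \<and> vmap B g x = y \<and>
     (\<forall>v\<in>V S. g (q v) = pair B T (vmap B f v) y))" using quotient_exists[OF S F] by blast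
  obtain v where v: "v : V S" "h D j x = q v" using natD(1)[OF D(1-3)] D(4) by blast
  have "h T f y = pair B T (vmap B f v) y"
   if "T : Algs R" "f : alg_hom R S T" "y : points T" "\<forall>b\<in>B - F. y b = \<zero>\<^sub>T" for T f y
  proof -
   have "\<exists>g\<in>alg_hom R D T. compose (carrier S) g j = f \<and> vmap B g x = y \<and>
     (\<forall>v\<in>V S. g (q v) = pair B T (vmap B f v) y)" using g that by blast
   then obtain g where "g : alg_hom R D T" "compose (carrier S) g j = f" "vmap B g x = y"
     "g (q v) = pair B T (vmap B f v) y" using v(1) by blast
   then show ?thesis using natD(2)[OF D(1-3) that(1)] v(2) by metis
  qed
  then show ?thesis using v(1) unfolding spec_def by blast
 qed
 show thesis
 proof (cases k)
  case False
  then obtain v where "spec B v" using ex[of B] by auto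
  then show thesis using that unfolding spec_def by blast
 next
  case True
  \<comment> \<open>The set \<open>K\<close> is the support of the universal point that detects the
    coordinate \<open>b\<close>. Two vectors representing the function on points supported there
    have the same pairing with this universal point, hence the same coordinate at
    \<open>b\<close>.\<close>
  have "\<exists>K. finite K \<and> K \<subseteq> B \<and> (\<forall>v w. spec K v \<longrightarrow> spec K w \<longrightarrow> v b = w b)" if b: "b : B" for b
  proof -
   obtain D j x q where D: "D : Algs R" "j : alg_hom R S D" "x : points D"
    and q: "\<forall>v\<in>V S. pair B D (vmap B j v) x = q v"
     "\<forall>v\<in>V S. \<forall>w\<in>V S. \<forall>b'\<in>{b}. q v = q w \<longrightarrow> v b' = w b'"
    using quotient_exists[OF S, of "{b}"] b by auto
   have x: "x : vec False B D" using Char_vec[OF D(3)] True by simp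
   let ?K = "{c\<in>B. x c \<noteq> \<zero>\<^sub>D}"
   have "v b = w b" if vw: "spec ?K v" "spec ?K w" for v w
   proof -
    have "h D j x = pair B D (vmap B j v) x" "h D j x = pair B D (vmap B j w) x"
     and "v : V S" "w : V S" using vw D unfolding spec_def by auto
    then show ?thesis using q by simp
   qed
   then show ?thesis using vec_finite[OF x] by (intro exI[of _ ?K]) blast
  qed
  then obtain K where K: "\<And>b. b : B ==> finite (K b) \<and> K b \<subseteq> B \<and> (\<forall>v w. spec (K b) v \<longrightarrow> spec (K b) w \<longrightarrow> v b = w b)"
   by metis
  define lim where "lim = (\<lambda>b\<in>B. (SOME v. spec (K b) v) b)"
  have Vb: "spec (K b) (SOME v. spec (K b) v)" if "b : B" for b
   using ex[of "K b"] K[OF that] someI_ex[of "spec (K b)"] by blast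
  have "lim : vec True B S" by (rule vecI) (auto simp: lim_def intro!: vec_closed[OF sv[OF Vb]])
  then have lim: "lim : V S" using True by simp
  have "h T f y = pair B T (vmap B f lim) y"
   if T: "T : Algs R" and f: "f : alg_hom R S T" and y: "y : points T" for T f y
  proof -
   have yv: "y : vec False B T" using Char_vec[OF y] True by simp
   \<comment> \<open>Large enough to contain the support of \<open>y\<close> and, for each index in
     it, the set on which the coordinate of \<open>lim\<close> was determined.\<close>
   define F where "F = {b\<in>B. y b \<noteq> \<zero>\<^sub>T} \<union> (\<Union>b\<in>{b\<in>B. y b \<noteq> \<zero>\<^sub>T}. K b)"
   have F: "finite F" "F \<subseteq> B" using vec_finite[OF yv] K by (auto simp: F_def)
   obtain v where v: "spec F v" using ex[of F] F by blast
   have vv: "v : V S" using v by (simp add: spec_def)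
   have "spec (K b) v" if "b : B" "y b \<noteq> \<zero>\<^sub>T" for b using v that unfolding spec_def F_def by blast
   then have vV: "v b = lim b" if "b : B" "y b \<noteq> \<zero>\<^sub>T" for b
    using that K[OF that(1)] Vb[OF that(1)] by (simp add: lim_def)
   have "h T f y = pair B T (vmap B f v) y" using v T f y unfolding spec_def F_def by blast
   also have "\<dots> = pair B T (vmap B f lim) y"
    by (rule pair_cong[OF cring_of[OF T] vmap_alg_hom[OF f S T vv] vmap_alg_hom[OF f S T lim] yv])
     (use vV in simp)
   finally show ?thesis .
  qed
  then show thesis using that lim by blast
 qed
qed

end

section \<open>Functions on a commutative monoid scheme and its dual monoid\<close>

text \<open>The map \<open>pt\<close> identifies \<open>G\<close> with the scheme of points only as
  a functor of sets. The monoid law of \<open>G\<close> acts on functions through translations;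
  \<open>mul\<close> is the pointwise product of functions and does not see it.\<close>

locale dualizable = vec_algebra R k B mul unt
 for R :: "('u, 'm) ring_scheme" and k :: bool and B :: "'u set"
  and mul :: "'u alg => ('u => 'u) => ('u => 'u) => 'u => 'u" and unt :: "'u alg => 'u => 'u" +
 fixes G :: "('u, 'v monoid, 'v) alg_functor" and pt :: "'u alg => 'v => 'u => 'u"
 assumes G: "comm_monoid_functor R G"
  and pt_bij: "T : Algs R ==> bij_betw (pt T) (vals G T) (points T)"
  and pt_natural: "[|T : Algs R; U : Algs R; f : alg_hom R T U; g : vals G T|]
   ==> pt U (Ar G T U f g) = vmap B f (pt T g)"
begin

abbreviation "pts T \<equiv> vals G T"

lemma G_monoid: "T : Algs R ==> comm_monoid (Ob G T)" using G by (simp add: comm_monoid_functor_def)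

lemma
 assumes T: "T : Algs R"
 shows G_mult: "[|g : pts T; h : pts T|] ==> g \<otimes>\<^sub>(Ob G T) h : pts T"
  and G_one: "\<one>\<^sub>(Ob G T) : pts T"
  and G_l_one: "g : pts T ==> \<one>\<^sub>(Ob G T) \<otimes>\<^sub>(Ob G T) g = g"
  and G_comm: "[|g : pts T; h : pts T|] ==> g \<otimes>\<^sub>(Ob G T) h = h \<otimes>\<^sub>(Ob G T) g"
  and G_assoc: "[|g : pts T; h : pts T; l : pts T|]
   ==> (g \<otimes>\<^sub>(Ob G T) h) \<otimes>\<^sub>(Ob G T) l = g \<otimes>\<^sub>(Ob G T) (h \<otimes>\<^sub>(Ob G T) l)"
proof -
 interpret comm_monoid "Ob G T" by (rule G_monoid[OF T])
 show "[|g : pts T; h : pts T|] ==> g \<otimes>\<^sub>(Ob G T) h : pts T" "\<one>\<^sub>(Ob G T) : pts T"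
  "g : pts T ==> \<one>\<^sub>(Ob G T) \<otimes>\<^sub>(Ob G T) g = g"
  "[|g : pts T; h : pts T|] ==> g \<otimes>\<^sub>(Ob G T) h = h \<otimes>\<^sub>(Ob G T) g"
  "[|g : pts T; h : pts T; l : pts T|] ==> (g \<otimes>\<^sub>(Ob G T) h) \<otimes>\<^sub>(Ob G T) l = g \<otimes>\<^sub>(Ob G T) (h \<otimes>\<^sub>(Ob G T) l)"
  by (auto simp: m_ac)
qed

lemma
 assumes "T : Algs R" "U : Algs R" "f : alg_hom R T U"
 shows Ar_closed: "g : pts T ==> Ar G T U f g : pts U"
  and Ar_mult: "[|g : pts T; h : pts T|] ==> Ar G T U f (g \<otimes>\<^sub>(Ob G T) h) = Ar G T U f g \<otimes>\<^sub>(Ob G U) Ar G T U f h"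
  and Ar_one: "Ar G T U f \<one>\<^sub>(Ob G T) = \<one>\<^sub>(Ob G U)"
 using G assms by (auto simp: comm_monoid_functor_def set_functor_def monoid_homs_def hom_def)

lemma Ar_id: "[|T : Algs R; g : pts T|] ==> Ar G T T (idm T) g = g"
 using G by (auto simp: comm_monoid_functor_def set_functor_def)

lemma Ar_comp:
 "[|S : Algs R; T : Algs R; U : Algs R; f : alg_hom R S T; f' : alg_hom R T U; g : pts S|]
  ==> Ar G S U (compose (carrier S) f' f) g = Ar G T U f' (Ar G S T f g)"
 using G unfolding comm_monoid_functor_def set_functor_def by blast

lemma pt_points: "[|T : Algs R; g : pts T|] ==> pt T g : points T" using pt_bij bij_betwE by fast

lemma pt_vec: "[|T : Algs R; g : pts T|] ==> pt T g : V' T" using pt_points Char_vec by fast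

lemma pt_surj: assumes "T : Algs R" "y : points T" obtains g where "g : pts T" "pt T g = y"
proof -
 have "y : pt T ` pts T" using pt_bij[OF assms(1)] assms(2) by (simp add: bij_betw_def)
 then show thesis using that by auto
qed

lemma pt_inj: "[|T : Algs R; g : pts T; h : pts T; pt T g = pt T h|] ==> g = h"
 using pt_bij by (auto simp: bij_betw_def inj_on_def)

section \<open>Translations, averages and convolution of distributions\<close>

lemma separate:
 assumes S: "S : Algs R" and v: "v : V S" "w : V S"
  and eq: "\<And>T f g. [|T : Algs R; f : alg_hom R S T; g : pts T|] ==>
   pair B T (vmap B f v) (pt T g) = pair B T (vmap B f w) (pt T g)"
 shows "v = w"
proof (rule points_separate[OF S v])
 fix T f y assume "T : Algs R" "f : alg_hom R S T" "y : points T"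
 then show "pair B T (vmap B f v) y = pair B T (vmap B f w) y" using eq pt_surj by metis
qed

text \<open>The vector of a natural function \<open>h\<close> on \<open>G\<close>; it exists by
  \<open>points_functions\<close> and is unique by \<open>separate\<close>.\<close>

definition fn :: "'u alg => ('u alg => ('u => 'u) => 'v => 'u) => 'u => 'u" where
 "fn S h = (SOME v. v : V S \<and>
   (\<forall>T\<in>Algs R. \<forall>f\<in>alg_hom R S T. \<forall>g\<in>pts T. pair B T (vmap B f v) (pt T g) = h T f g))"

lemma fn:
 assumes S: "S : Algs R" and h: "natfun R G S h"
 shows "fn S h : V S"
  "[|T : Algs R; f : alg_hom R S T; g : pts T|] ==> pair B T (vmap B f (fn S h)) (pt T g) = h T f g"
proof -
 define h' where "h' T f y = h T f (inv_into (pts T) (pt T) y)" for T f y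
 have inv: "inv_into (pts T) (pt T) (pt T g) = g" if "T : Algs R" "g : pts T" for T g
  using pt_bij[OF that(1)] that(2) by (simp add: bij_betw_def)
 have "natfun R (Char_functor R k B mul unt) S h'" unfolding natfun_def
 proof (intro ballI conjI)
  fix T f y assume T: "T : Algs R" and f: "f : alg_hom R S T"
   and "y : vals (Char_functor R k B mul unt) T"
  then have "y : points T" by simp
  then obtain g where g: "g : pts T" "pt T g = y" using pt_surj[OF T] by metis
  show "h' T f y : carrier T" using natfunD(1)[OF h T f g(1)] inv[OF T g(1)] g(2) by (simp add: h'_def)
  fix U \<phi> assume U: "U : Algs R" and \<phi>: "\<phi> : alg_hom R T U"
  have "vmap B \<phi> y = pt U (Ar G T U \<phi> g)" using pt_natural[OF T U \<phi> g(1)] g(2) by simp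
  then show "h' U (compose (carrier S) \<phi> f) (Ar (Char_functor R k B mul unt) T U \<phi> y) = \<phi> (h' T f y)"
   using natfunD(2)[OF h T f g(1) U \<phi>] inv[OF T g(1)] inv[OF U Ar_closed[OF T U \<phi> g(1)]] g(2) by (simp add: h'_def)
 qed
 then obtain v where v: "v : V S"
  "\<And>T f y. [|T : Algs R; f : alg_hom R S T; y : points T|] ==> h' T f y = pair B T (vmap B f v) y"
  by (rule points_functions[OF S]) blast
 have *: "\<forall>T\<in>Algs R. \<forall>f\<in>alg_hom R S T. \<forall>g\<in>pts T. pair B T (vmap B f v) (pt T g) = h T f g"
  by (intro ballI) (simp add: v(2)[OF _ _ pt_points, symmetric] h'_def inv)
 define P where "P v \<longleftrightarrow> v : V S \<and> (\<forall>T\<in>Algs R. \<forall>f\<in>alg_hom R S T. \<forall>g\<in>pts T.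
   pair B T (vmap B f v) (pt T g) = h T f g)" for v
 have "P v" using v(1) * by (simp add: P_def)
 then have "P (fn S h)" unfolding fn_def P_def[symmetric] by (rule someI[of P])
 then have "fn S h : V S \<and> (\<forall>T\<in>Algs R. \<forall>f\<in>alg_hom R S T. \<forall>g\<in>pts T.
   pair B T (vmap B f (fn S h)) (pt T g) = h T f g)" unfolding P_def .
 then show "fn S h : V S"
  "[|T : Algs R; f : alg_hom R S T; g : pts T|] ==> pair B T (vmap B f (fn S h)) (pt T g) = h T f g" by blast+
qed

text \<open>\<^term>\<open>L T g v\<close> is the function \<^term>\<open>v\<close> on \<^term>\<open>G\<close> translated by \<^term>\<open>g\<close>, and \<^term>\<open>M T y v\<close> its
 average over the translations by the distribution \<^term>\<open>y\<close>.\<close>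

definition L where
 "L T g v = fn T (\<lambda>U f h. pair B U (vmap B f v) (pt U (Ar G T U f g \<otimes>\<^sub>(Ob G U) h)))"

definition M where
 "M T y v = fn T (\<lambda>U f g. pair B U (L U g (vmap B f v)) (vmap B f y))"

lemma
 assumes T: "T : Algs R" and g: "g : pts T" and v: "v : V T"
 shows L_closed: "L T g v : V T"
  and L_pair: "[|U : Algs R; f : alg_hom R T U; h : pts U|] ==>
   pair B U (vmap B f (L T g v)) (pt U h) = pair B U (vmap B f v) (pt U (Ar G T U f g \<otimes>\<^sub>(Ob G U) h))"
proof -
 have "natfun R G T (\<lambda>U f h. pair B U (vmap B f v) (pt U (Ar G T U f g \<otimes>\<^sub>(Ob G U) h)))"
  unfolding natfun_def
 proof (intro ballI conjI)
  fix U f h assume U: "U : Algs R" and f: "f : alg_hom R T U" and h: "h : pts U"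
  have m: "Ar G T U f g \<otimes>\<^sub>(Ob G U) h : pts U" by (rule G_mult[OF U Ar_closed[OF T U f g] h])
  have fv: "vmap B f v : V U" using f T U v by simp
  show "pair B U (vmap B f v) (pt U (Ar G T U f g \<otimes>\<^sub>(Ob G U) h)) : carrier U"
   by (rule pair_closed[OF cring_of[OF U] fv pt_vec[OF U m]])
  fix W \<phi> assume W: "W : Algs R" and \<phi>: "\<phi> : alg_hom R U W"
  show "pair B W (vmap B (compose (carrier T) \<phi> f) v)
    (pt W (Ar G T W (compose (carrier T) \<phi> f) g \<otimes>\<^sub>(Ob G W) Ar G U W \<phi> h)) =
   \<phi> (pair B U (vmap B f v) (pt U (Ar G T U f g \<otimes>\<^sub>(Ob G U) h)))"
   using pair_alg_hom[OF \<phi> U W fv pt_vec[OF U m]] pt_natural[OF U W \<phi> m]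
   by (simp add: vmap_compose[OF v] Ar_comp[OF T U W f \<phi> g] Ar_mult[OF U W \<phi> Ar_closed[OF T U f g] h])
 qed
 note fn = fn[OF T this]
 show "L T g v : V T" unfolding L_def by (rule fn)
 show "pair B U (vmap B f (L T g v)) (pt U h) = pair B U (vmap B f v) (pt U (Ar G T U f g \<otimes>\<^sub>(Ob G U) h))"
  if "U : Algs R" "f : alg_hom R T U" "h : pts U" unfolding L_def using fn(2)[OF that] .
qed

lemma L_pair_id:
 assumes T: "T : Algs R" and g: "g : pts T" and v: "v : V T" and h: "h : pts T"
 shows "pair B T (L T g v) (pt T h) = pair B T v (pt T (g \<otimes>\<^sub>(Ob G T) h))"
 using L_pair[OF T g v T id_alg_hom[OF T] h] Ar_id[OF T g] v L_closed[OF T g v] by simp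

lemma L_natural:
 assumes T: "T : Algs R" and g: "g : pts T" and v: "v : V T" and U: "U : Algs R" and f: "f : alg_hom R T U"
 shows "vmap B f (L T g v) = L U (Ar G T U f g) (vmap B f v)"
proof -
 note fg = Ar_closed[OF T U f g] and fv = vmap_alg_hom[OF f T U v]
 show ?thesis
 proof (rule separate[OF U vmap_alg_hom[OF f T U L_closed[OF T g v]] L_closed[OF U fg fv]])
  fix W \<phi> h assume W: "W : Algs R" and \<phi>: "\<phi> : alg_hom R U W" and h: "h : pts W"
  have c: "compose (carrier T) \<phi> f : alg_hom R T W" using f \<phi> T by simp
  show "pair B W (vmap B \<phi> (vmap B f (L T g v))) (pt W h)
   = pair B W (vmap B \<phi> (L U (Ar G T U f g) (vmap B f v))) (pt W h)"
   using L_pair[OF T g v W c h] L_pair[OF U fg fv W \<phi> h]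
   by (simp add: vmap_compose[OF v] vmap_compose[OF L_closed[OF T g v]] Ar_comp[OF T U W f \<phi> g])
 qed
qed

lemma L_vadd:
 assumes T: "T : Algs R" and g: "g : pts T" and v: "v : V T" and w: "w : V T"
 shows "L T g (vadd B T v w) = vadd B T (L T g v) (L T g w)"
proof -
 note cT = cring_of[OF T]
 note L = L_closed[OF T g v] L_closed[OF T g w]
 show ?thesis
 proof (rule separate[OF T L_closed[OF T g vadd_closed[OF cT v w]] vadd_closed[OF cT L]])
  fix U f h assume U: "U : Algs R" and f: "f : alg_hom R T U" and h: "h : pts U"
  note cU = cring_of[OF U]
  have m: "Ar G T U f g \<otimes>\<^sub>(Ob G U) h : pts U" by (rule G_mult[OF U Ar_closed[OF T U f g] h])
  show "pair B U (vmap B f (L T g (vadd B T v w))) (pt U h)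
   = pair B U (vmap B f (vadd B T (L T g v) (L T g w))) (pt U h)"
   by (simp add: L_pair[OF T g vadd_closed[OF cT v w] U f h] vmap_vadd[OF alg_homD(2)[OF f] v w]
     vmap_vadd[OF alg_homD(2)[OF f] L] L_pair[OF T g v U f h] L_pair[OF T g w U f h]
     pair_vadd[OF cU vmap_alg_hom[OF f T U v] vmap_alg_hom[OF f T U w] pt_vec[OF U m]]
     pair_vadd[OF cU vmap_alg_hom[OF f T U L(1)] vmap_alg_hom[OF f T U L(2)] pt_vec[OF U h]])
 qed
qed

lemma L_vscale:
 assumes T: "T : Algs R" and g: "g : pts T" and t: "t : carrier T" and v: "v : V T"
 shows "L T g (vscale B T t v) = vscale B T t (L T g v)"
proof -
 note cT = cring_of[OF T]
 note L = L_closed[OF T g v]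
 show ?thesis
 proof (rule separate[OF T L_closed[OF T g vscale_closed[OF cT t v]] vscale_closed[OF cT t L]])
  fix U f h assume U: "U : Algs R" and f: "f : alg_hom R T U" and h: "h : pts U"
  note cU = cring_of[OF U]
  have m: "Ar G T U f g \<otimes>\<^sub>(Ob G U) h : pts U" by (rule G_mult[OF U Ar_closed[OF T U f g] h])
  show "pair B U (vmap B f (L T g (vscale B T t v))) (pt U h)
   = pair B U (vmap B f (vscale B T t (L T g v))) (pt U h)"
   by (simp add: L_pair[OF T g vscale_closed[OF cT t v] U f h] vmap_vscale[OF alg_homD(2)[OF f] t v]
     vmap_vscale[OF alg_homD(2)[OF f] t L] L_pair[OF T g v U f h]
     pair_vscale[OF cU alg_homD(3)[OF f t] vmap_alg_hom[OF f T U v] pt_vec[OF U m]]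
     pair_vscale[OF cU alg_homD(3)[OF f t] vmap_alg_hom[OF f T U L] pt_vec[OF U h]])
 qed
qed

lemma
 assumes T: "T : Algs R" and y: "y : V' T" and v: "v : V T"
 shows M_closed: "M T y v : V T"
  and M_pair: "[|U : Algs R; f : alg_hom R T U; g : pts U|] ==>
   pair B U (vmap B f (M T y v)) (pt U g) = pair B U (L U g (vmap B f v)) (vmap B f y)"
proof -
 have "natfun R G T (\<lambda>U f g. pair B U (L U g (vmap B f v)) (vmap B f y))" unfolding natfun_def
 proof (intro ballI conjI)
  fix U f g assume U: "U : Algs R" and f: "f : alg_hom R T U" and g: "g : pts U"
  note fv = vmap_alg_hom[OF f T U v] and fy = vmap_alg_hom[OF f T U y]
  note L = L_closed[OF U g fv]
  show "pair B U (L U g (vmap B f v)) (vmap B f y) : carrier U" by (rule pair_closed[OF cring_of[OF U] L fy])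
  fix W \<phi> assume W: "W : Algs R" and \<phi>: "\<phi> : alg_hom R U W"
  show "pair B W (L W (Ar G U W \<phi> g) (vmap B (compose (carrier T) \<phi> f) v)) (vmap B (compose (carrier T) \<phi> f) y)
   = \<phi> (pair B U (L U g (vmap B f v)) (vmap B f y))" using pair_alg_hom[OF \<phi> U W L fy]
   by (simp add: vmap_compose[OF v] vmap_compose[OF y] L_natural[OF U g fv W \<phi>])
 qed
 note fn = fn[OF T this]
 show "M T y v : V T" unfolding M_def by (rule fn)
 show "pair B U (vmap B f (M T y v)) (pt U g) = pair B U (L U g (vmap B f v)) (vmap B f y)"
  if "U : Algs R" "f : alg_hom R T U" "g : pts U" unfolding M_def using fn(2)[OF that] .
qed

lemma M_natural:
 assumes T: "T : Algs R" and y: "y : V' T" and v: "v : V T"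
  and U: "U : Algs R" and f: "f : alg_hom R T U"
 shows "vmap B f (M T y v) = M U (vmap B f y) (vmap B f v)"
proof -
 note fy = vmap_alg_hom[OF f T U y] and fv = vmap_alg_hom[OF f T U v]
 show ?thesis
 proof (rule separate[OF U vmap_alg_hom[OF f T U M_closed[OF T y v]] M_closed[OF U fy fv]])
  fix W \<phi> h assume W: "W : Algs R" and \<phi>: "\<phi> : alg_hom R U W" and h: "h : pts W"
  have c: "compose (carrier T) \<phi> f : alg_hom R T W" using f \<phi> T by simp
  show "pair B W (vmap B \<phi> (vmap B f (M T y v))) (pt W h)
   = pair B W (vmap B \<phi> (M U (vmap B f y) (vmap B f v))) (pt W h)"
   using M_pair[OF T y v W c h] M_pair[OF U fy fv W \<phi> h]
   by (simp add: vmap_compose[OF v] vmap_compose[OF y] vmap_compose[OF M_closed[OF T y v]])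
 qed
qed

lemma M_vadd:
 assumes T: "T : Algs R" and y: "y : V' T" and v: "v : V T" and w: "w : V T"
 shows "M T y (vadd B T v w) = vadd B T (M T y v) (M T y w)"
proof -
 note cT = cring_of[OF T]
 note m = M_closed[OF T y v] M_closed[OF T y w]
 show ?thesis
 proof (rule separate[OF T M_closed[OF T y vadd_closed[OF cT v w]] vadd_closed[OF cT m]])
  fix U f h assume U: "U : Algs R" and f: "f : alg_hom R T U" and h: "h : pts U"
  note cU = cring_of[OF U]
  note fv = vmap_alg_hom[OF f T U v] and fw = vmap_alg_hom[OF f T U w] and fy = vmap_alg_hom[OF f T U y]
  show "pair B U (vmap B f (M T y (vadd B T v w))) (pt U h)
   = pair B U (vmap B f (vadd B T (M T y v) (M T y w))) (pt U h)"
   by (simp add: M_pair[OF T y vadd_closed[OF cT v w] U f h] vmap_vadd[OF alg_homD(2)[OF f] v w]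
     vmap_vadd[OF alg_homD(2)[OF f] m] M_pair[OF T y v U f h] M_pair[OF T y w U f h]
     L_vadd[OF U h fv fw] pair_vadd[OF cU L_closed[OF U h fv] L_closed[OF U h fw] fy]
     pair_vadd[OF cU vmap_alg_hom[OF f T U m(1)] vmap_alg_hom[OF f T U m(2)] pt_vec[OF U h]])
 qed
qed

lemma M_vscale:
 assumes T: "T : Algs R" and y: "y : V' T" and t: "t : carrier T" and v: "v : V T"
 shows "M T y (vscale B T t v) = vscale B T t (M T y v)"
proof -
 note cT = cring_of[OF T]
 note m = M_closed[OF T y v]
 show ?thesis
 proof (rule separate[OF T M_closed[OF T y vscale_closed[OF cT t v]] vscale_closed[OF cT t m]])
  fix U f h assume U: "U : Algs R" and f: "f : alg_hom R T U" and h: "h : pts U"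
  note cU = cring_of[OF U]
  note fv = vmap_alg_hom[OF f T U v] and fy = vmap_alg_hom[OF f T U y] and ft = alg_homD(3)[OF f t]
  show "pair B U (vmap B f (M T y (vscale B T t v))) (pt U h)
   = pair B U (vmap B f (vscale B T t (M T y v))) (pt U h)"
   by (simp add: M_pair[OF T y vscale_closed[OF cT t v] U f h] vmap_vscale[OF alg_homD(2)[OF f] t v]
     vmap_vscale[OF alg_homD(2)[OF f] t m] M_pair[OF T y v U f h]
     L_vscale[OF U h ft fv] pair_vscale[OF cU ft L_closed[OF U h fv] fy]
     pair_vscale[OF cU ft vmap_alg_hom[OF f T U m] pt_vec[OF U h]])
 qed
qed

lemma M_vadd_left:
 assumes T: "T : Algs R" and y: "y : V' T" and z: "z : V' T" and v: "v : V T"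
 shows "M T (vadd B T y z) v = vadd B T (M T y v) (M T z v)"
proof -
 note cT = cring_of[OF T]
 note m = M_closed[OF T y v] M_closed[OF T z v]
 show ?thesis
 proof (rule separate[OF T M_closed[OF T vadd_closed[OF cT y z] v] vadd_closed[OF cT m]])
  fix U f h assume U: "U : Algs R" and f: "f : alg_hom R T U" and h: "h : pts U"
  note cU = cring_of[OF U]
  note fv = vmap_alg_hom[OF f T U v] and fz = vmap_alg_hom[OF f T U z] and fy = vmap_alg_hom[OF f T U y]
  show "pair B U (vmap B f (M T (vadd B T y z) v)) (pt U h)
   = pair B U (vmap B f (vadd B T (M T y v) (M T z v))) (pt U h)"
   by (simp add: M_pair[OF T vadd_closed[OF cT y z] v U f h] vmap_vadd[OF alg_homD(2)[OF f] y z]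
     vmap_vadd[OF alg_homD(2)[OF f] m] M_pair[OF T y v U f h] M_pair[OF T z v U f h]
     pair_vadd_right[OF cU L_closed[OF U h fv] fy fz]
     pair_vadd[OF cU vmap_alg_hom[OF f T U m(1)] vmap_alg_hom[OF f T U m(2)] pt_vec[OF U h]])
 qed
qed

lemma M_vscale_left:
 assumes T: "T : Algs R" and y: "y : V' T" and t: "t : carrier T" and v: "v : V T"
 shows "M T (vscale B T t y) v = vscale B T t (M T y v)"
proof -
 note cT = cring_of[OF T]
 note m = M_closed[OF T y v]
 show ?thesis
 proof (rule separate[OF T M_closed[OF T vscale_closed[OF cT t y] v] vscale_closed[OF cT t m]])
  fix U f h assume U: "U : Algs R" and f: "f : alg_hom R T U" and h: "h : pts U"
  note cU = cring_of[OF U]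
  note fv = vmap_alg_hom[OF f T U v] and fy = vmap_alg_hom[OF f T U y] and ft = alg_homD(3)[OF f t]
  show "pair B U (vmap B f (M T (vscale B T t y) v)) (pt U h)
   = pair B U (vmap B f (vscale B T t (M T y v))) (pt U h)"
   by (simp add: M_pair[OF T vscale_closed[OF cT t y] v U f h] vmap_vscale[OF alg_homD(2)[OF f] t y]
     vmap_vscale[OF alg_homD(2)[OF f] t m] M_pair[OF T y v U f h]
     pair_vscale_right[OF cU ft L_closed[OF U h fv] fy]
     pair_vscale[OF cU ft vmap_alg_hom[OF f T U m] pt_vec[OF U h]])
 qed
qed

text \<open>A point is a point mass, and averaging over a point mass is translation by that point;
  commutativity of \<open>G\<close> exchanges the two factors of the product.\<close>

lemma M_pt:
 assumes T: "T : Algs R" and g: "g : pts T" and v: "v : V T"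
 shows "M T (pt T g) v = L T g v"
proof (rule separate[OF T M_closed[OF T pt_vec[OF T g] v] L_closed[OF T g v]])
 fix U f h assume U: "U : Algs R" and f: "f : alg_hom R T U" and h: "h : pts U"
 note fg = Ar_closed[OF T U f g]
 show "pair B U (vmap B f (M T (pt T g) v)) (pt U h) = pair B U (vmap B f (L T g v)) (pt U h)"
  using M_pair[OF T pt_vec[OF T g] v U f h] L_pair[OF T g v U f h]
   L_pair_id[OF U h vmap_alg_hom[OF f T U v] fg] by (simp add: pt_natural[OF T U f g, symmetric] G_comm[OF U h fg])
qed

lemma L_L:
 assumes T: "T : Algs R" and g: "g : pts T" "h : pts T" and v: "v : V T"
 shows "L T h (L T g v) = L T (g \<otimes>\<^sub>(Ob G T) h) v"
proof (rule separate[OF T L_closed[OF T g(2) L_closed[OF T g(1) v]] L_closed[OF T G_mult[OF T g] v]])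
 fix U f l assume U: "U : Algs R" and f: "f : alg_hom R T U" and l: "l : pts U"
 note fg = Ar_closed[OF T U f g(1)] and fh = Ar_closed[OF T U f g(2)]
 show "pair B U (vmap B f (L T h (L T g v))) (pt U l) = pair B U (vmap B f (L T (g \<otimes>\<^sub>(Ob G T) h) v)) (pt U l)"
  by (simp add: L_pair[OF T g(2) L_closed[OF T g(1) v] U f l] L_pair[OF T g(1) v U f G_mult[OF U fh l]]
    L_pair[OF T G_mult[OF T g] v U f l] Ar_mult[OF T U f g] G_assoc[OF U fg fh l])
qed

lemma L_one:
 assumes T: "T : Algs R" and v: "v : V T" shows "L T \<one>\<^sub>(Ob G T) v = v"
proof (rule separate[OF T L_closed[OF T G_one[OF T] v] v])
 fix U f l assume U: "U : Algs R" and f: "f : alg_hom R T U" and l: "l : pts U"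
 show "pair B U (vmap B f (L T \<one>\<^sub>(Ob G T) v)) (pt U l) = pair B U (vmap B f v) (pt U l)"
  by (simp add: L_pair[OF T G_one[OF T] v U f l] Ar_one[OF T U f] G_l_one[OF U l])
qed

text \<open>Translations compose through the product of \<open>G\<close>, so translating before or
  after averaging shifts the point of evaluation in the same way. This is the input for
  associativity of convolution.\<close>

lemma M_L:
 assumes T: "T : Algs R" and z: "z : V' T" and g: "g : pts T" and v: "v : V T"
 shows "M T z (L T g v) = L T g (M T z v)"
proof (rule separate[OF T M_closed[OF T z L_closed[OF T g v]] L_closed[OF T g M_closed[OF T z v]]])
 fix U f h assume U: "U : Algs R" and f: "f : alg_hom R T U" and h: "h : pts U"
 note fg = Ar_closed[OF T U f g] and fv = vmap_alg_hom[OF f T U v]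
 show "pair B U (vmap B f (M T z (L T g v))) (pt U h) = pair B U (vmap B f (L T g (M T z v))) (pt U h)"
  by (simp add: M_pair[OF T z L_closed[OF T g v] U f h] L_natural[OF T g v U f] L_L[OF U fg h fv]
    L_pair[OF T g M_closed[OF T z v] U f h] M_pair[OF T z v U f G_mult[OF U fg h]])
qed

text \<open>A natural form on distributions is the pairing with a vector, that is with a function on
  \<open>G\<close>, and points separate functions. Identities that are linear in a distribution may
  thus be checked on point masses, although these need not span.\<close>

lemma natlin_points_eqI:
 assumes S: "S : Algs R" and l: "natlin (\<not> k) R B S l" "natlin (\<not> k) R B S l'"
  and eq: "\<And>T f g. [|T : Algs R; f : alg_hom R S T; g : pts T|] ==> l T f (pt T g) = l' T f (pt T g)"
  and T: "T : Algs R" "f : alg_hom R S T" "y : V' T"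
 shows "l T f y = l' T f y"
proof -
 obtain v where v: "v : V S"
  "\<And>T f y. [|T : Algs R; f : alg_hom R S T; y : V' T|] ==> l T f y = pair B T y (vmap B f v)"
  using natlin_rep[OF R inf S l(1)] by (metis (full_types))
 obtain w where w: "w : V S"
  "\<And>T f y. [|T : Algs R; f : alg_hom R S T; y : V' T|] ==> l' T f y = pair B T y (vmap B f w)"
  using natlin_rep[OF R inf S l(2)] by (metis (full_types))
 have "v = w"
 proof (rule separate[OF S v(1) w(1)])
  fix T f g assume *: "T : Algs R" "f : alg_hom R S T" "g : pts T"
  note pt = pt_vec[OF *(1,3)]
  show "pair B T (vmap B f v) (pt T g) = pair B T (vmap B f w) (pt T g)" using eq[OF *] v(2)[OF *(1,2) pt] w(2)[OF *(1,2) pt]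
    pair_commute[OF cring_of[OF *(1)] pt vmap_alg_hom[OF *(2) S *(1) v(1)]]
    pair_commute[OF cring_of[OF *(1)] pt vmap_alg_hom[OF *(2) S *(1) w(1)]] by simp
 qed
 then show ?thesis using v(2)[OF T] w(2)[OF T] by simp
qed

text \<open>Convolution: pairing \<open>v\<close> with the product integrates \<open>v\<close> over
  products of two points, the first distributed by \<open>x\<close> and the second by
  \<open>y\<close>. This iterated integral is a natural linear form in \<open>v\<close>, hence
  represented by a vector.\<close>

definition mul' where
 "mul' T x y = (SOME z. z : V' T \<and> (\<forall>U\<in>Algs R. \<forall>f\<in>alg_hom R T U. \<forall>v\<in>V U.
   pair B U v (vmap B f z) = pair B U (M U (vmap B f y) v) (vmap B f x)))"

lemma
 assumes T: "T : Algs R" and x: "x : V' T" and y: "y : V' T"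
 shows mul'_closed: "mul' T x y : V' T"
  and mul'_pair: "[|U : Algs R; f : alg_hom R T U; v : V U|] ==>
   pair B U v (vmap B f (mul' T x y)) = pair B U (M U (vmap B f y) v) (vmap B f x)"
proof -
 have "natlin k R B T (\<lambda>U f v. pair B U (M U (vmap B f y) v) (vmap B f x))"
 proof (rule natlinI)
  fix U f v assume U: "U : Algs R" and f: "f : alg_hom R T U" and v: "v : V U"
  note cU = cring_of[OF U]
  note fx = vmap_alg_hom[OF f T U x] and fy = vmap_alg_hom[OF f T U y]
  note m = M_closed[OF U fy v]
  show "pair B U (M U (vmap B f y) v) (vmap B f x) : carrier U" by (rule pair_closed[OF cU m fx])
  show "pair B U (M U (vmap B f y) (vadd B U v w)) (vmap B f x) =
   pair B U (M U (vmap B f y) v) (vmap B f x) \<oplus>\<^sub>U pair B U (M U (vmap B f y) w) (vmap B f x)"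
   if w: "w : V U" for w by (simp add: M_vadd[OF U fy v w] pair_vadd[OF cU m M_closed[OF U fy w] fx])
  show "pair B U (M U (vmap B f y) (vscale B U t v)) (vmap B f x) = t \<otimes>\<^sub>U pair B U (M U (vmap B f y) v) (vmap B f x)"
   if "t : carrier U" for t by (simp add: M_vscale[OF U fy that v] pair_vscale[OF cU that m fx])
  show "pair B W (M W (vmap B (compose (carrier T) \<phi> f) y) (vmap B \<phi> v)) (vmap B (compose (carrier T) \<phi> f) x) =
   \<phi> (pair B U (M U (vmap B f y) v) (vmap B f x))" if W: "W : Algs R" and \<phi>: "\<phi> : alg_hom R U W" for W \<phi>
   using pair_alg_hom[OF \<phi> U W m fx] by (simp add: vmap_compose[OF x] vmap_compose[OF y] M_natural[OF U fy v W \<phi>])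
 qed
 then obtain z where z: "z : V' T" "\<And>U f v. [|U : Algs R; f : alg_hom R T U; v : V U|] ==>
   pair B U (M U (vmap B f y) v) (vmap B f x) = pair B U v (vmap B f z)" by (rule natlin_rep[OF R inf T]) blast
 define P where "P z \<longleftrightarrow> z : V' T \<and> (\<forall>U\<in>Algs R. \<forall>f\<in>alg_hom R T U. \<forall>v\<in>V U.
   pair B U v (vmap B f z) = pair B U (M U (vmap B f y) v) (vmap B f x))" for z
 have "P z" using z by (simp add: P_def)
 then have "P (mul' T x y)" unfolding mul'_def P_def[symmetric] by (rule someI[of P])
 then have "mul' T x y : V' T \<and> (\<forall>U\<in>Algs R. \<forall>f\<in>alg_hom R T U. \<forall>v\<in>V U.
   pair B U v (vmap B f (mul' T x y)) = pair B U (M U (vmap B f y) v) (vmap B f x))" unfolding P_def .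
 then show "mul' T x y : V' T" "[|U : Algs R; f : alg_hom R T U; v : V U|] ==>
   pair B U v (vmap B f (mul' T x y)) = pair B U (M U (vmap B f y) v) (vmap B f x)" by blast+
qed

lemma mul'_pair_id:
 assumes T: "T : Algs R" and x: "x : V' T" and y: "y : V' T" and v: "v : V T"
 shows "pair B T v (mul' T x y) = pair B T (M T y v) x"
 using mul'_pair[OF T x y T id_alg_hom[OF T] v] mul'_closed[OF T x y] x y by simp

text \<open>Exchange of the order of integration. With \<open>v\<close> and \<open>x\<close> fixed,
  both iterated pairings are natural linear forms in \<open>y\<close>, and for a point mass
  \<open>y\<close> both are the pairing of \<open>x\<close> with a translate of
  \<open>v\<close>.\<close>

lemma mul'_commute:
 assumes T: "T : Algs R" and x: "x : V' T" and y: "y : V' T"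
 shows "mul' T x y = mul' T y x"
proof (rule pair_eqI[OF cring_of[OF T] mul'_closed[OF T x y] mul'_closed[OF T y x]])
 fix v assume v: "v : V T"
 have l: "natlin (\<not> k) R B T (\<lambda>U f z. pair B U (M U z (vmap B f v)) (vmap B f x))"
 proof (rule natlinI)
  fix U f z assume U: "U : Algs R" and f: "f : alg_hom R T U" and z: "z : V' U"
  note cU = cring_of[OF U]
  note fx = vmap_alg_hom[OF f T U x] and fv = vmap_alg_hom[OF f T U v]
  note m = M_closed[OF U z fv]
  show "pair B U (M U z (vmap B f v)) (vmap B f x) : carrier U" by (rule pair_closed[OF cU m fx])
  show "pair B U (M U (vadd B U z w) (vmap B f v)) (vmap B f x) =
   pair B U (M U z (vmap B f v)) (vmap B f x) \<oplus>\<^sub>U pair B U (M U w (vmap B f v)) (vmap B f x)"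
   if w: "w : V' U" for w by (simp add: M_vadd_left[OF U z w fv] pair_vadd[OF cU m M_closed[OF U w fv] fx])
  show "pair B U (M U (vscale B U t z) (vmap B f v)) (vmap B f x) = t \<otimes>\<^sub>U pair B U (M U z (vmap B f v)) (vmap B f x)"
   if "t : carrier U" for t by (simp add: M_vscale_left[OF U z that fv] pair_vscale[OF cU that m fx])
  show "pair B W (M W (vmap B \<phi> z) (vmap B (compose (carrier T) \<phi> f) v)) (vmap B (compose (carrier T) \<phi> f) x) =
   \<phi> (pair B U (M U z (vmap B f v)) (vmap B f x))" if W: "W : Algs R" and \<phi>: "\<phi> : alg_hom R U W" for W \<phi>
   using pair_alg_hom[OF \<phi> U W m fx] by (simp add: vmap_compose[OF x] vmap_compose[OF v] M_natural[OF U z fv W \<phi>])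
 qed
 have Mx: "M T x v : vec (\<not> \<not> k) B T" using M_closed[OF T x v] by simp
 note l' = natlin_pair[OF T Mx]
 have "pair B T (M T y (vmap B (idm T) v)) (vmap B (idm T) x)
  = pair B T y (vmap B (idm T) (M T x v))"
 proof (rule natlin_points_eqI[OF T l l' _ T id_alg_hom[OF T] y])
  fix U f g assume U: "U : Algs R" and f: "f : alg_hom R T U" and g: "g : pts U"
  note fM = vmap_alg_hom[OF f T U M_closed[OF T x v]]
  show "pair B U (M U (pt U g) (vmap B f v)) (vmap B f x) = pair B U (pt U g) (vmap B f (M T x v))"
   using M_pair[OF T x v U f g] pair_commute[OF cring_of[OF U] pt_vec[OF U g] fM]
   by (simp add: M_pt[OF U g vmap_alg_hom[OF f T U v]])
 qed
 then have "pair B T (M T y v) x = pair B T y (M T x v)" using v x M_closed[OF T x v] by simp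
 then show "pair B T v (mul' T x y) = pair B T v (mul' T y x)" using pair_commute[OF cring_of[OF T] y M_closed[OF T x v]]
  by (simp add: mul'_pair_id[OF T x y v] mul'_pair_id[OF T y x v])
qed

lemma mul'_natural:
 assumes T: "T : Algs R" and U: "U : Algs R" and f: "f : alg_hom R T U"
  and x: "x : V' T" and y: "y : V' T"
 shows "vmap B f (mul' T x y) = mul' U (vmap B f x) (vmap B f y)"
proof -
 note fx = vmap_alg_hom[OF f T U x] and fy = vmap_alg_hom[OF f T U y]
 show ?thesis
  by (rule pair_eqI[OF cring_of[OF U] vmap_alg_hom[OF f T U mul'_closed[OF T x y]] mul'_closed[OF U fx fy]])
   (simp add: mul'_pair[OF T x y U f] mul'_pair_id[OF U fx fy])
qed

text \<open>At a point \<open>g\<close> both sides become the iterated pairing of the translate of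
  \<open>v\<close> by \<open>g\<close>, because averaging commutes with translation. Associativity
  of convolution is read off from this.\<close>

lemma M_mul':
 assumes T: "T : Algs R" and y: "y : V' T" and z: "z : V' T" and v: "v : V T"
 shows "M T (mul' T y z) v = M T y (M T z v)"
proof (rule separate[OF T M_closed[OF T mul'_closed[OF T y z] v] M_closed[OF T y M_closed[OF T z v]]])
 fix U f g assume U: "U : Algs R" and f: "f : alg_hom R T U" and g: "g : pts U"
 note fv = vmap_alg_hom[OF f T U v] and fz = vmap_alg_hom[OF f T U z] and fy = vmap_alg_hom[OF f T U y]
 show "pair B U (vmap B f (M T (mul' T y z) v)) (pt U g) = pair B U (vmap B f (M T y (M T z v))) (pt U g)"
  by (simp add: M_pair[OF T mul'_closed[OF T y z] v U f g] M_pair[OF T y M_closed[OF T z v] U f g]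
    mul'_natural[OF T U f y z] mul'_pair_id[OF U fy fz L_closed[OF U g fv]]
    M_natural[OF T z v U f] M_L[OF U fz g fv])
qed

lemma pt_mult:
 assumes T: "T : Algs R" and g: "g : pts T" "h : pts T"
 shows "pt T (g \<otimes>\<^sub>(Ob G T) h) = mul' T (pt T g) (pt T h)"
proof (rule pair_eqI[OF cring_of[OF T] pt_vec[OF T G_mult[OF T g]] mul'_closed[OF T pt_vec[OF T g(1)] pt_vec[OF T g(2)]]])
 fix v assume v: "v : V T"
 show "pair B T v (pt T (g \<otimes>\<^sub>(Ob G T) h)) = pair B T v (mul' T (pt T g) (pt T h))"
  by (simp add: mul'_pair_id[OF T pt_vec[OF T g(1)] pt_vec[OF T g(2)] v] M_pt[OF T g(2) v]
    L_pair_id[OF T g(2) v g(1)] G_comm[OF T g(2,1)])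
qed

definition unt' where "unt' T = pt T \<one>\<^sub>(Ob G T)"

text \<open>The algebra laws are checked after pairing with an arbitrary function, where convolution
  becomes the action of the operators \<open>M\<close> and the unit, the point mass at the identity,
  becomes the trivial translation.\<close>

sublocale dual: vec_algebra R "\<not> k" B mul' unt'
proof (rule vec_algebra.intro)
 show "cring R" by (rule R)
 show "infinite (UNIV :: 'u set)" by (rule inf)
 fix T assume T: "T : Algs R"
 note cT = cring_of[OF T]
 show one: "unt' T : V' T" unfolding unt'_def by (rule pt_vec[OF T G_one[OF T]])
 fix x y assume x: "x : V' T"
 show "mul' T (unt' T) x = x"
 proof (rule pair_eqI[OF cT mul'_closed[OF T one x] x])
  fix v assume v: "v : V T"
  show "pair B T v (mul' T (unt' T) x) = pair B T v x" unfolding mul'_commute[OF T one x] mul'_pair_id[OF T x one v]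
   by (simp add: unt'_def M_pt[OF T G_one[OF T] v] L_one[OF T v])
 qed
 assume y: "y : V' T"
 show "mul' T x y : V' T" by (rule mul'_closed[OF T x y])
 show "mul' T x y = mul' T y x" by (rule mul'_commute[OF T x y])
 show "mul' T (vscale B T t x) y = vscale B T t (mul' T x y)" if t: "t : carrier T" for t
 proof (rule pair_eqI[OF cT mul'_closed[OF T vscale_closed[OF cT t x] y] vscale_closed[OF cT t mul'_closed[OF T x y]]])
  fix v assume v: "v : V T"
  show "pair B T v (mul' T (vscale B T t x) y) = pair B T v (vscale B T t (mul' T x y))"
   by (simp add: mul'_pair_id[OF T vscale_closed[OF cT t x] y v] pair_vscale_right[OF cT t v mul'_closed[OF T x y]]
     mul'_pair_id[OF T x y v] pair_vscale_right[OF cT t M_closed[OF T y v] x])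
 qed
 fix z assume z: "z : V' T"
 show "mul' T (mul' T x y) z = mul' T x (mul' T y z)"
 proof (rule pair_eqI[OF cT mul'_closed[OF T mul'_closed[OF T x y] z] mul'_closed[OF T x mul'_closed[OF T y z]]])
  fix v assume v: "v : V T"
  show "pair B T v (mul' T (mul' T x y) z) = pair B T v (mul' T x (mul' T y z))"
   by (simp add: mul'_pair_id[OF T mul'_closed[OF T x y] z v] mul'_pair_id[OF T x y M_closed[OF T z v]]
     mul'_pair_id[OF T x mul'_closed[OF T y z] v] M_mul'[OF T y z v])
 qed
 show "mul' T (vadd B T x y) z = vadd B T (mul' T x z) (mul' T y z)"
 proof (rule pair_eqI[OF cT mul'_closed[OF T vadd_closed[OF cT x y] z] vadd_closed[OF cT mul'_closed[OF T x z] mul'_closed[OF T y z]]])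
  fix v assume v: "v : V T"
  show "pair B T v (mul' T (vadd B T x y) z) = pair B T v (vadd B T (mul' T x z) (mul' T y z))"
   by (simp add: mul'_pair_id[OF T vadd_closed[OF cT x y] z v] pair_vadd_right[OF cT v mul'_closed[OF T x z] mul'_closed[OF T y z]]
     mul'_pair_id[OF T x z v] mul'_pair_id[OF T y z v] pair_vadd_right[OF cT M_closed[OF T z v] x y])
 qed
next
 fix T U f x y assume "T : Algs R" "U : Algs R" "f : alg_hom R T U" "x : V' T" "y : V' T"
 then show "vmap B f (mul' T x y) = mul' U (vmap B f x) (vmap B f y)" by (rule mul'_natural)
next
 fix T U f assume TU: "T : Algs R" "U : Algs R" "f : alg_hom R T U"
 then show "vmap B f (unt' T) = unt' U" using pt_natural[OF TU G_one[OF TU(1)]] by (simp add: unt'_def Ar_one[OF TU])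
qed

text \<open>A function that is multiplicative on \<^term>\<open>G\<close> is an eigenvector of all translations, so of all
 operators \<^term>\<open>M T y\<close>.\<close>

lemma dual_points_iff:
 assumes S: "S : Algs R" and v: "v : V S"
 shows "v : dual.points S \<longleftrightarrow> (\<forall>T\<in>Algs R. \<forall>f\<in>alg_hom R S T.
  (\<forall>g\<in>pts T. \<forall>h\<in>pts T. pair B T (vmap B f v) (pt T (g \<otimes>\<^sub>(Ob G T) h)) =
    pair B T (vmap B f v) (pt T g) \<otimes>\<^sub>T pair B T (vmap B f v) (pt T h)) \<and>
  pair B T (vmap B f v) (pt T \<one>\<^sub>(Ob G T)) = \<one>\<^sub>T)" (is "?l \<longleftrightarrow> ?r")
proof
 assume l: ?l
 show ?r
 proof (intro ballI conjI)
  fix T f assume T: "T : Algs R" and f: "f : alg_hom R S T"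
  note com = pair_commute[OF cring_of[OF T] _ vmap_alg_hom[OF f S T v], symmetric]
  note c = CharD[OF l T f]
  show "pair B T (vmap B f v) (pt T \<one>\<^sub>(Ob G T)) = \<one>\<^sub>T"
   using c(2) com[OF pt_vec[OF T G_one[OF T]]] by (simp add: unt'_def)
  fix g h assume gh: "g : pts T" "h : pts T"
  note pt = pt_vec[OF T gh(1)] pt_vec[OF T gh(2)]
  show "pair B T (vmap B f v) (pt T (g \<otimes>\<^sub>(Ob G T) h)) =
    pair B T (vmap B f v) (pt T g) \<otimes>\<^sub>T pair B T (vmap B f v) (pt T h)"
   using c(1)[OF pt] com[OF pt(1)] com[OF pt(2)] com[OF pt_vec[OF T G_mult[OF T gh]]] by (simp add: pt_mult[OF T gh])
 qed
next
 assume r: ?r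
 show ?l
 proof (rule CharI)
  show "v : vec (\<not> \<not> k) B S" using v by simp
  fix T f assume T: "T : Algs R" and f: "f : alg_hom R S T"
  note cT = cring_of[OF T]
  define w where "w = vmap B f v"
  have w: "w : V T" unfolding w_def by (rule vmap_alg_hom[OF f S T v])
  have wr: "pair B U (vmap B \<phi> w) (pt U (g \<otimes>\<^sub>(Ob G U) h)) =
    pair B U (vmap B \<phi> w) (pt U g) \<otimes>\<^sub>U pair B U (vmap B \<phi> w) (pt U h)"
   if "U : Algs R" "\<phi> : alg_hom R T U" "g : pts U" "h : pts U" for U \<phi> g h
   using r that alg_hom_comp[OF f that(2) S] by (simp add: w_def flip: vmap_compose[OF v])
  note com = pair_commute[OF cT _ w, symmetric]
  show "pair B T (unt' T) (vmap B f v) = \<one>\<^sub>T"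
  proof -
   have "pair B T w (pt T \<one>\<^sub>(Ob G T)) = \<one>\<^sub>T" using r T f unfolding w_def by blast
   then show ?thesis using com[OF pt_vec[OF T G_one[OF T]]] by (simp add: unt'_def w_def)
  qed
  have Lw: "L U g (vmap B \<phi> w) = vscale B U (pair B U (vmap B \<phi> w) (pt U g)) (vmap B \<phi> w)"
   if U: "U : Algs R" and \<phi>: "\<phi> : alg_hom R T U" and g: "g : pts U" for U \<phi> g
  proof -
   note \<phi>w = vmap_alg_hom[OF \<phi> T U w]
   have c: "pair B U (vmap B \<phi> w) (pt U g) : carrier U"
    by (rule pair_closed[OF cring_of[OF U] \<phi>w pt_vec[OF U g]])
   show ?thesis
   proof (rule separate[OF U L_closed[OF U g \<phi>w] vscale_closed[OF cring_of[OF U] c \<phi>w]])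
    fix W \<psi> h assume W: "W : Algs R" and \<psi>: "\<psi> : alg_hom R U W" and h: "h : pts W"
    have \<psi>\<phi>: "compose (carrier T) \<psi> \<phi> : alg_hom R T W" using \<phi> \<psi> T by simp
    show "pair B W (vmap B \<psi> (L U g (vmap B \<phi> w))) (pt W h) =
     pair B W (vmap B \<psi> (vscale B U (pair B U (vmap B \<phi> w) (pt U g)) (vmap B \<phi> w))) (pt W h)"
     using wr[OF W \<psi>\<phi> Ar_closed[OF U W \<psi> g] h]
     by (simp add: L_pair[OF U g \<phi>w W \<psi> h] vmap_vscale[OF alg_homD(2)[OF \<psi>] c \<phi>w]
       pair_vscale[OF cring_of[OF W] alg_homD(3)[OF \<psi> c] vmap_alg_hom[OF \<psi> U W \<phi>w] pt_vec[OF W h]]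
       vmap_compose[OF w] pt_natural[OF U W \<psi> g] pair_alg_hom[OF \<psi> U W \<phi>w pt_vec[OF U g]])
   qed
  qed
  fix x y assume x: "x : V' T" and y: "y : V' T"
  interpret T: cring T by (rule cT)
  have c: "pair B T w y : carrier T" by (rule pair_closed[OF cT w y])
  \<comment> \<open>The eigenvalue passes from translations to averages: at a point \<open>g\<close>
    the average of \<open>w\<close> over \<open>y\<close> is the pairing of \<open>y\<close> with a
    multiple of \<open>w\<close>.\<close>
  have "M T y w = vscale B T (pair B T w y) w"
  proof (rule separate[OF T M_closed[OF T y w] vscale_closed[OF cT c w]])
   fix U \<phi> g assume U: "U : Algs R" and \<phi>: "\<phi> : alg_hom R T U" and g: "g : pts U"
   interpret U: cring U by (rule cring_of[OF U])
   note \<phi>w = vmap_alg_hom[OF \<phi> T U w] and \<phi>y = vmap_alg_hom[OF \<phi> T U y]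
   note cc = pair_closed[OF U.is_cring \<phi>w pt_vec[OF U g]] pair_closed[OF U.is_cring \<phi>w \<phi>y]
   show "pair B U (vmap B \<phi> (M T y w)) (pt U g) = pair B U (vmap B \<phi> (vscale B T (pair B T w y) w)) (pt U g)"
    by (simp add: M_pair[OF T y w U \<phi> g] Lw[OF U \<phi> g] pair_vscale[OF U.is_cring cc(1) \<phi>w \<phi>y]
      vmap_vscale[OF alg_homD(2)[OF \<phi>] c w] pair_vscale[OF U.is_cring cc(2) \<phi>w pt_vec[OF U g]]
      U.m_comm[OF cc] flip: pair_alg_hom[OF \<phi> T U w y])
  qed
  then have "pair B T w (mul' T x y) = pair B T w y \<otimes>\<^sub>T pair B T w x"
   by (simp add: mul'_pair_id[OF T x y w] pair_vscale[OF cT c w x])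
  also have "\<dots> = pair B T w x \<otimes>\<^sub>T pair B T w y" by (rule T.m_comm[OF c pair_closed[OF cT w x]])
  finally show "pair B T (mul' T x y) (vmap B f v) = pair B T x (vmap B f v) \<otimes>\<^sub>T pair B T y (vmap B f v)"
   by (simp only: com[OF x] com[OF y] com[OF mul'_closed[OF T x y]] flip: w_def)
 qed
qed

end

section \<open>Restriction of scalars, and algebras under a fixed algebra\<close>

lemma restrict_scalars_simps [simp]:
 "carrier (restrict_scalars A \<phi> T) = carrier T" "monoid.mult (restrict_scalars A \<phi> T) = monoid.mult T"
 "monoid.one (restrict_scalars A \<phi> T) = monoid.one T" "ring.zero (restrict_scalars A \<phi> T) = ring.zero T"
 "ring.add (restrict_scalars A \<phi> T) = ring.add T"
 "a : carrier A ==> a \<odot>\<^sub>(restrict_scalars A \<phi> T) x = \<phi> a \<odot>\<^sub>T x"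
 by (simp_all add: restrict_scalars_def)

lemma as_base_alg_simps [simp]:
 "carrier (over R S T) = carrier T" "monoid.mult (over R S T) = monoid.mult T"
 "monoid.one (over R S T) = monoid.one T" "ring.zero (over R S T) = ring.zero T"
 "ring.add (over R S T) = ring.add T"
 "r : carrier R ==> r \<odot>\<^sub>(over R S T) x = (r \<odot>\<^sub>S \<one>\<^sub>S) \<odot>\<^sub>T x"
 by (simp_all add: as_base_alg_def)

lemma restrict_scalars_algebra:
 assumes A: "cring A" and \<phi>: "\<phi> : ring_hom A S" and T: "algebra S T"
 shows "algebra A (restrict_scalars A \<phi> T)"
proof -
 interpret T: algebra S T by fact
 note h = ring_hom_closed[OF \<phi>] ring_hom_add[OF \<phi>] ring_hom_mult[OF \<phi>] ring_hom_one[OF \<phi>]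
 have ring: "cring (restrict_scalars A \<phi> T)"
 proof (intro cringI abelian_groupI comm_monoidI)
  fix x assume "x : carrier (restrict_scalars A \<phi> T)"
  then have "\<ominus>\<^sub>T x : carrier (restrict_scalars A \<phi> T) \<and>
    \<ominus>\<^sub>T x \<oplus>\<^sub>(restrict_scalars A \<phi> T) x = \<zero>\<^sub>(restrict_scalars A \<phi> T)"
   by (simp add: T.M.l_neg)
  then show "\<exists>y\<in>carrier (restrict_scalars A \<phi> T). y \<oplus>\<^sub>(restrict_scalars A \<phi> T) x = \<zero>\<^sub>(restrict_scalars A \<phi> T)" by blast
 qed (auto simp: T.M.a_ac T.m_ac T.l_distr T.r_distr)
 show ?thesis
  using A cring.cring_simprules(1,5)[OF A] cring.cring_simprules(6)[OF A]
  by (intro algebraI) (auto simp: ring h T.smult_l_distr T.smult_r_distr T.smult_assoc1 T.smult_assoc2)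
qed

lemma base_hom:
 assumes "algebra R S" shows "(\<lambda>r. r \<odot>\<^sub>S \<one>\<^sub>S) : ring_hom R S"
proof -
 interpret algebra R S by fact
 show ?thesis by (rule ring_hom_memI) (auto simp: smult_l_distr smult_assoc1 smult_assoc2)
qed

lemma as_base_Algs [simp]: "[|S : Algs R; T : Algs S|] ==> over R S T : Algs R"
 unfolding as_base_alg_def Algs_iff by (blast intro: restrict_scalars_algebra base_hom algebra.R_cring)

lemma restrict_Algs:
 "[|f : alg_hom R S S'; S : Algs R; T : Algs S'|] ==> restrict_scalars S f T : Algs S"
 using restrict_scalars_algebra[OF cring_of alg_homD(2)] by (simp add: Algs_iff)

text \<open>Both scalar multiplications are cut down to the carrier of \<open>R\<close>, so the two
  records coincide and functors can be evaluated at either without a comparison map.\<close>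

lemma as_base_restrict:
 assumes "f : alg_hom R S S'" "S : Algs R"
 shows "over R S (restrict_scalars S f T) = over R S' T"
proof -
 interpret S: algebra R S using assms by (simp add: Algs_iff)
 have "(\<lambda>a\<in>carrier R. (\<lambda>b\<in>carrier S. (\<odot>\<^sub>T) (f b)) (a \<odot>\<^sub>S \<one>\<^sub>S)) = (\<lambda>a\<in>carrier R. (\<odot>\<^sub>T) (a \<odot>\<^sub>S' \<one>\<^sub>S'))"
  using alg_homD(4,7)[OF assms(1)] by (auto simp: fun_eq_iff)
 then show ?thesis by (simp add: as_base_alg_def restrict_scalars_def)
qed

lemma restrict_restrict:
 assumes "f : alg_hom R S S'"
 shows "restrict_scalars S f (restrict_scalars S' g T) = restrict_scalars S (compose (carrier S) g f) T"
 using alg_homD(3)[OF assms] by (auto simp: restrict_scalars_def compose_def fun_eq_iff restrict_def)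

lemma as_base_alg_hom:
 "[|S : Algs R; f : alg_hom S T U|] ==> f : alg_hom R (over R S T) (over R S U)"
 using ring_hom_closed[OF base_hom[of R S]] by (intro alg_homI) (auto simp: alg_homD Algs_iff)

lemma restrict_alg_hom:
 "[|h : alg_hom R S S'; f : alg_hom S' T U|] ==> f : alg_hom S (restrict_scalars S h T) (restrict_scalars S h U)"
 by (intro alg_homI) (auto simp: alg_homD)

lemma struct_map_base:
 assumes "S : Algs R" "T : Algs S" shows "struct_map S T : alg_hom R S (over R S T)"
proof -
 interpret S: algebra R S using assms by (simp add: Algs_iff)
 interpret T: algebra S T using assms by (simp add: Algs_iff)
 note h = alg_homD[OF struct_map_alg_hom[OF T.algebra_axioms], simplified]
 show ?thesis
 proof (rule alg_homI)
  fix r s assume "r : carrier R" "s : carrier S"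
  then show "struct_map S T (r \<odot>\<^sub>S s) = r \<odot>\<^sub>(over R S T) struct_map S T s"
   using S.smult_assoc2[of r "\<one>\<^sub>S" s] by (simp add: struct_map_def flip: T.smult_assoc1)
 qed (simp_all add: h)
qed

lemma struct_map_restrict:
 assumes "f : alg_hom R S S'"
 shows "struct_map S (restrict_scalars S f T) = compose (carrier S) (struct_map S' T) f"
 using alg_homD(3)[OF assms] by (auto simp: struct_map_def compose_def fun_eq_iff)

text \<open>The object of \<open>Algs S\<close> that corresponds to an \<open>R\<close>-algebra
  \<open>T\<close> with a homomorphism \<open>f\<close> from \<open>S\<close>. Replacing the scalars
  of \<open>T\<close> by its own multiplication before restricting them makes \<open>f\<close> the
  structure map.\<close>

definition slice_alg :: "'u alg => 'u alg => ('u => 'u) => 'u alg" where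
 "slice_alg S T f = restrict_scalars S f (self_alg T)"

lemma slice_alg_simps [simp]:
 "carrier (slice_alg S T f) = carrier T" "monoid.mult (slice_alg S T f) = monoid.mult T"
 "monoid.one (slice_alg S T f) = monoid.one T" "ring.zero (slice_alg S T f) = ring.zero T"
 "ring.add (slice_alg S T f) = ring.add T"
 "s : carrier S ==> s \<odot>\<^sub>(slice_alg S T f) x = f s \<otimes>\<^sub>T x" by (simp_all add: slice_alg_def)

lemma slice_Algs:
 "[|f : alg_hom R S T; S : Algs R; T : Algs R|] ==> slice_alg S T f : Algs S"
 unfolding slice_alg_def using restrict_Algs[of f R S T "self_alg T"] self_Algs[OF cring_of] by blast

lemma struct_map_slice:
 assumes "f : alg_hom R S T" "T : Algs R"
 shows "struct_map S (slice_alg S T f) = f"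
proof (rule extensionalityI[of _ "carrier S"])
 interpret algebra R T using assms by (simp add: Algs_iff)
 show "struct_map S (slice_alg S T f) s = f s" if "s : carrier S" for s
  using that alg_homD(3)[OF assms(1)] by (simp add: struct_map_def)
qed (use alg_homD(1)[OF assms(1)] in "auto simp: struct_map_def")

text \<open>Passing to \<open>Algs S\<close> and back replaces the scalar multiplication of the
  record, so the result need not equal \<open>T\<close>. The identity on the carrier is the
  comparison map along which values of functors are transported.\<close>

lemma slice_id:
 assumes f: "f : alg_hom R S T" and S: "S : Algs R" and T: "T : Algs R"
 shows "(idm T) : alg_hom R T (over R S (slice_alg S T f))"
proof -
 interpret T: algebra R T using T by (simp add: Algs_iff)
 interpret S: algebra R S using S by (simp add: Algs_iff)
 have "f (r \<odot>\<^sub>S \<one>\<^sub>S) \<otimes>\<^sub>T t = r \<odot>\<^sub>T t" if "r : carrier R" "t : carrier T" for r t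
  using that alg_homD(4,7)[OF f] by (simp add: T.smult_assoc2)
 then show ?thesis by (intro alg_homI) (auto intro: S.smult_closed)
qed

lemma slice_alg_hom:
 assumes "f : alg_hom R S T" "g : alg_hom R T U"
 shows "g : alg_hom S (slice_alg S T f) (slice_alg S U (compose (carrier S) g f))"
 by (rule alg_homI) (auto simp: alg_homD[OF assms(2)] alg_homD(3)[OF assms(1)] compose_def)

lemma slice_struct_map:
 assumes "S : Algs R" "T : Algs S"
 shows "(idm T) : alg_hom S T (slice_alg S (over R S T) (struct_map S T))"
  "(idm T) : alg_hom S (slice_alg S (over R S T) (struct_map S T)) T"
proof -
 interpret T: algebra S T using assms by (simp add: Algs_iff)
 show "(idm T) : alg_hom S T (slice_alg S (over R S T) (struct_map S T))"
  "(idm T) : alg_hom S (slice_alg S (over R S T) (struct_map S T)) T"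
  by (rule alg_homI; auto simp flip: smult_eq_struct_map[OF T.algebra_axioms])+
qed

text \<open>Translates a transformation indexed by \<open>Algs S\<close> into the encoding of
  \<open>natfun\<close>; the argument is transported along the comparison map of
  \<open>slice_id\<close>.\<close>

definition slice_fun where
 "slice_fun R S F et T f x =
   et (slice_alg S T f) (Ar F T (over R S (slice_alg S T f)) (idm T) x)"

text \<open>The comparison maps are natural in the algebra, which gives the first claim. The second
  is naturality of \<open>et\<close> along the identity from \<open>T\<close> to its copy in the
  slice, so that nothing is lost in translation.\<close>

lemma
 assumes S: "S : Algs R" and F: "set_functor R F"
  and val: "\<And>T x. [|T : Algs S; x : vals F (over R S T)|] ==> et T x : carrier T"
  and nat: "\<And>T U f x. [|T : Algs S; U : Algs S; f : alg_hom S T U; x : vals F (over R S T)|]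
   ==> et U (Ar F (over R S T) (over R S U) f x) = f (et T x)"
 shows slice_fun_natfun: "natfun R F S (slice_fun R S F et)"
  and slice_fun_struct_map: "[|T : Algs S; x : vals F (over R S T)|]
   ==> slice_fun R S F et (over R S T) (struct_map S T) x = et T x"
proof -
 have Fc: "Ar F T U f x : vals F U"
  if "T : Algs R" "U : Algs R" "f : alg_hom R T U" "x : vals F T" for T U f x
  using F that unfolding set_functor_def by blast
 have Fcomp: "Ar F T W (compose (carrier T) g f) x = Ar F U W g (Ar F T U f x)"
  if "T : Algs R" "U : Algs R" "W : Algs R" "f : alg_hom R T U" "g : alg_hom R U W" "x : vals F T"
  for T U W f g x using F that unfolding set_functor_def by blast
 show "natfun R F S (slice_fun R S F et)" unfolding natfun_def
 proof (intro ballI conjI)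
  fix T f x assume T: "T : Algs R" and f: "f : alg_hom R S T" and x: "x : vals F T"
  let ?T = "slice_alg S T f"
  have T': "?T : Algs S" "over R S ?T : Algs R" using slice_Algs[OF f S T] S by simp_all
  note idT = slice_id[OF f S T]
  note ix = Fc[OF T T'(2) idT x]
  show "slice_fun R S F et T f x : carrier T" using val[OF T'(1) ix] by (simp add: slice_fun_def)
  fix U g assume U: "U : Algs R" and g: "g : alg_hom R T U"
  have gf: "compose (carrier S) g f : alg_hom R S U" using f g S by simp
  let ?U = "slice_alg S U (compose (carrier S) g f)"
  have U': "?U : Algs S" "over R S ?U : Algs R" using slice_Algs[OF gf S U] S by simp_all
  note idU = slice_id[OF gf S U]
  note g' = slice_alg_hom[OF f g]
  have "Ar F U (over R S ?U) (idm U) (Ar F T U g x)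
    = Ar F T (over R S ?U) (compose (carrier T) (idm U) g) x" by (rule Fcomp[OF T U U'(2) g idU x, symmetric])
  also have "compose (carrier T) (idm U) g = compose (carrier T) g (idm T)" using g by simp
  also have "Ar F T (over R S ?U) \<dots> x
    = Ar F (over R S ?T) (over R S ?U) g (Ar F T (over R S ?T) (idm T) x)"
   by (rule Fcomp[OF T T'(2) U'(2) idT as_base_alg_hom[OF S g'] x])
  finally have e: "Ar F U (over R S ?U) (idm U) (Ar F T U g x) =
   Ar F (over R S ?T) (over R S ?U) g (Ar F T (over R S ?T) (idm T) x)" .
  show "slice_fun R S F et U (compose (carrier S) g f) (Ar F T U g x) = g (slice_fun R S F et T f x)"
   unfolding slice_fun_def e by (rule nat[OF T'(1) U'(1) g' ix])
 qed
 fix T x assume T: "T : Algs S" and x: "x : vals F (over R S T)"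
 let ?T = "slice_alg S (over R S T) (struct_map S T)"
 have T': "?T : Algs S" by (rule slice_Algs[OF struct_map_base[OF S T] S as_base_Algs[OF S T]])
 show "slice_fun R S F et (over R S T) (struct_map S T) x = et T x"
  using nat[OF T T' slice_struct_map(1)[OF S T] x] val[OF T x] by (simp add: slice_fun_def)
qed

lemma vec_base [simp]:
 "vec k B (over R S T) = vec k B T" "vec k B (restrict_scalars A f T) = vec k B T"
 "vec k B (slice_alg S T f) = vec k B T" by (simp_all add: vec_def)

lemma pair_base [simp]:
 "pair B (over R S T) v w = pair B T v w" "pair B (restrict_scalars A f T) v w = pair B T v w"
 "pair B (slice_alg S T f) v w = pair B T v w" by (simp_all add: pair_def finsum_def finprod_def)

section \<open>The dual monoid as a functor of commutative monoids\<close>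

lemma monoid_transD:
 assumes "et : vals (dual_monoid R G) S"
 shows "et : extensional (Algs S)"
  "T : Algs S ==> et T : vals G (over R S T) \<rightarrow>\<^sub>E carrier T"
  "[|T : Algs S; x : vals G (over R S T)|] ==> et T x : carrier T"
  "[|T : Algs S; U : Algs S; f : alg_hom S T U; x : vals G (over R S T)|]
   ==> et U (Ar G (over R S T) (over R S U) f x) = f (et T x)"
  "[|T : Algs S; x : vals G (over R S T); y : vals G (over R S T)|]
   ==> et T (x \<otimes>\<^sub>(Ob G (over R S T)) y) = et T x \<otimes>\<^sub>T et T y"
  "T : Algs S ==> et T \<one>\<^sub>(Ob G (over R S T)) = \<one>\<^sub>T" using assms
 by (auto simp: dual_monoid_def monoid_trans_def nat_trans_def restrict_functor_def struct_ring_def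
   monoid_homs_def hom_def Let_def PiE_mem)

lemma monoid_transI:
 assumes "et : extensional (Algs S)"
  "\<And>T. T : Algs S ==> et T : vals G (over R S T) \<rightarrow>\<^sub>E carrier T"
  "\<And>T U f x. [|T : Algs S; U : Algs S; f : alg_hom S T U; x : vals G (over R S T)|]
   ==> et U (Ar G (over R S T) (over R S U) f x) = f (et T x)"
  "\<And>T x y. [|T : Algs S; x : vals G (over R S T); y : vals G (over R S T)|]
   ==> et T (x \<otimes>\<^sub>(Ob G (over R S T)) y) = et T x \<otimes>\<^sub>T et T y"
  "\<And>T. T : Algs S ==> et T \<one>\<^sub>(Ob G (over R S T)) = \<one>\<^sub>T"
 shows "et : vals (dual_monoid R G) S" using assms
 by (auto simp: dual_monoid_def monoid_trans_def nat_trans_def restrict_functor_def struct_ring_def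
   monoid_homs_def hom_def Let_def PiE_mem)

lemma dual_monoid_simps:
 "monoid.mult (Ob (dual_monoid R G) S) =
   (\<lambda>et th. \<lambda>T\<in>Algs S. \<lambda>x\<in>vals G (over R S T). et T x \<otimes>\<^sub>T th T x)"
 "monoid.one (Ob (dual_monoid R G) S) = (\<lambda>T\<in>Algs S. \<lambda>x\<in>vals G (over R S T). \<one>\<^sub>T)"
 "Ar (dual_monoid R G) = base_change_trans" by (simp_all add: dual_monoid_def restrict_functor_def Let_def)

lemma dual_monoid_comm_monoid_functor:
 assumes G: "comm_monoid_functor R G"
 shows "comm_monoid_functor R (dual_monoid R G)"
proof -
 let ?D = "dual_monoid R G"
 have Gm: "comm_monoid (Ob G T)" if "T : Algs R" for T using G that by (simp add: comm_monoid_functor_def)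
 have Ac: "Ar G T U f x : vals G U" and A1: "Ar G T U f \<one>\<^sub>(Ob G T) = \<one>\<^sub>(Ob G U)"
  and Am: "y : vals G T ==> Ar G T U f (x \<otimes>\<^sub>(Ob G T) y) = Ar G T U f x \<otimes>\<^sub>(Ob G U) Ar G T U f y"
  if "T : Algs R" "U : Algs R" "f : alg_hom R T U" "x : vals G T" for T U f x y
  using G that by (auto simp: comm_monoid_functor_def set_functor_def monoid_homs_def hom_def)
 have eqI: "et = th" if "et : vals ?D S" "th : extensional (Algs S)"
   "\<And>T. T : Algs S ==> th T : extensional (vals G (over R S T))"
   "\<And>T x. [|T : Algs S; x : vals G (over R S T)|] ==> et T x = th T x" for S et th
 proof (rule extensionalityI[OF monoid_transD(1)[OF that(1)] that(2)])
  fix T assume T: "T : Algs S"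
  show "et T = th T" using monoid_transD(2)[OF that(1) T] that(3,4)[OF T]
   by (intro extensionalityI[of _ "vals G (over R S T)"]) (auto simp: PiE_def)
 qed
 have comm: "comm_monoid (Ob ?D S)" if S: "S : Algs R" for S
 proof -
  have TR: "over R S T : Algs R" if "T : Algs S" for T using S that by simp
  have mult: "et \<otimes>\<^sub>(Ob ?D S) th : vals ?D S" if "et : vals ?D S" "th : vals ?D S" for et th
  proof (rule monoid_transI)
   fix T assume T: "T : Algs S"
   interpret T: cring T by (rule cring_of[OF T])
   interpret Gm: comm_monoid "Ob G (over R S T)" by (rule Gm[OF TR[OF T]])
   note m = monoid_transD(3)[OF that(1) T] monoid_transD(3)[OF that(2) T]
   show "(et \<otimes>\<^sub>(Ob ?D S) th) T : vals G (over R S T) \<rightarrow>\<^sub>E carrier T"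
    using T m by (auto simp: dual_monoid_simps)
   show "(et \<otimes>\<^sub>(Ob ?D S) th) T \<one>\<^sub>(Ob G (over R S T)) = \<one>\<^sub>T"
    using T monoid_transD(6)[OF that(1) T] monoid_transD(6)[OF that(2) T] by (simp add: dual_monoid_simps)
   fix x y assume xy: "x : vals G (over R S T)" "y : vals G (over R S T)"
   show "(et \<otimes>\<^sub>(Ob ?D S) th) T (x \<otimes>\<^sub>(Ob G (over R S T)) y) = (et \<otimes>\<^sub>(Ob ?D S) th) T x \<otimes>\<^sub>T (et \<otimes>\<^sub>(Ob ?D S) th) T y"
    using T xy m[OF xy(1)] m[OF xy(2)] monoid_transD(5)[OF that(1) T xy] monoid_transD(5)[OF that(2) T xy]
    by (simp add: dual_monoid_simps T.m_ac)
  next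
   fix T U f x assume T: "T : Algs S" and U: "U : Algs S" and f: "f : alg_hom S T U"
    and x: "x : vals G (over R S T)"
   show "(et \<otimes>\<^sub>(Ob ?D S) th) U (Ar G (over R S T) (over R S U) f x) = f ((et \<otimes>\<^sub>(Ob ?D S) th) T x)"
    using T U x monoid_transD(4)[OF that(1) T U f x] monoid_transD(4)[OF that(2) T U f x]
     monoid_transD(3)[OF that(1) T x] monoid_transD(3)[OF that(2) T x]
     Ac[OF TR[OF T] TR[OF U] as_base_alg_hom[OF S f] x] by (simp add: dual_monoid_simps alg_homD(6)[OF f])
  qed (simp add: dual_monoid_simps)
  have one: "\<one>\<^sub>(Ob ?D S) : vals ?D S"
  proof (rule monoid_transI)
   fix T assume T: "T : Algs S"
   interpret T: cring T by (rule cring_of[OF T])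
   interpret Gm: comm_monoid "Ob G (over R S T)" by (rule Gm[OF TR[OF T]])
   show "\<one>\<^sub>(Ob ?D S) T : vals G (over R S T) \<rightarrow>\<^sub>E carrier T"
    "\<one>\<^sub>(Ob ?D S) T \<one>\<^sub>(Ob G (over R S T)) = \<one>\<^sub>T" using T by (auto simp: dual_monoid_simps)
   show "\<one>\<^sub>(Ob ?D S) T (x \<otimes>\<^sub>(Ob G (over R S T)) y) = \<one>\<^sub>(Ob ?D S) T x \<otimes>\<^sub>T \<one>\<^sub>(Ob ?D S) T y"
    if "x : vals G (over R S T)" "y : vals G (over R S T)" for x y using T that by (simp add: dual_monoid_simps)
  next
   fix T U f x assume T: "T : Algs S" and U: "U : Algs S" and f: "f : alg_hom S T U"
    and x: "x : vals G (over R S T)"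
   show "\<one>\<^sub>(Ob ?D S) U (Ar G (over R S T) (over R S U) f x) = f (\<one>\<^sub>(Ob ?D S) T x)"
    using T U x Ac[OF TR[OF T] TR[OF U] as_base_alg_hom[OF S f] x] by (simp add: dual_monoid_simps alg_homD(4)[OF f])
  qed (simp add: dual_monoid_simps)
  have mc: "[|s : carrier T; t : carrier T|] ==> s \<otimes>\<^sub>T t = t \<otimes>\<^sub>T s"
   "[|s : carrier T; t : carrier T; u : carrier T|] ==> s \<otimes>\<^sub>T t \<otimes>\<^sub>T u = s \<otimes>\<^sub>T (t \<otimes>\<^sub>T u)"
   "s : carrier T ==> \<one>\<^sub>T \<otimes>\<^sub>T s = s" if "T : Algs S" for T s t u
  proof -
   interpret cring T by (rule cring_of[OF that])
   show "[|s : carrier T; t : carrier T|] ==> s \<otimes>\<^sub>T t = t \<otimes>\<^sub>T s"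
    "[|s : carrier T; t : carrier T; u : carrier T|] ==> s \<otimes>\<^sub>T t \<otimes>\<^sub>T u = s \<otimes>\<^sub>T (t \<otimes>\<^sub>T u)"
    "s : carrier T ==> \<one>\<^sub>T \<otimes>\<^sub>T s = s" by (auto simp: m_ac)
  qed
  show ?thesis
  proof (rule comm_monoidI)
   fix et th \<zeta> assume c: "et : vals ?D S" "th : vals ?D S"
   show "et \<otimes>\<^sub>(Ob ?D S) th : vals ?D S" by (rule mult[OF c])
   show "et \<otimes>\<^sub>(Ob ?D S) th = th \<otimes>\<^sub>(Ob ?D S) et"
    using monoid_transD(3)[OF c(1)] monoid_transD(3)[OF c(2)]
    by (intro eqI[OF mult[OF c]]) (auto simp: dual_monoid_simps intro: mc(1))
   assume z: "\<zeta> : vals ?D S"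
   show "et \<otimes>\<^sub>(Ob ?D S) th \<otimes>\<^sub>(Ob ?D S) \<zeta> = et \<otimes>\<^sub>(Ob ?D S) (th \<otimes>\<^sub>(Ob ?D S) \<zeta>)"
    using monoid_transD(3)[OF c(1)] monoid_transD(3)[OF c(2)] monoid_transD(3)[OF z]
    by (intro eqI[OF mult[OF mult[OF c] z]]) (auto simp: dual_monoid_simps intro: mc(2))
  next
   fix et assume c: "et : vals ?D S"
   show "\<one>\<^sub>(Ob ?D S) \<otimes>\<^sub>(Ob ?D S) et = et" using monoid_transD(3)[OF c] monoid_transD(2)[OF c]
    by (intro eqI[OF mult[OF one c] monoid_transD(1)[OF c]]) (auto simp: dual_monoid_simps PiE_def intro: mc(3))
  qed (rule one)
 qed
 have bc: "base_change_trans S S' f et : vals ?D S'"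
  if S: "S : Algs R" "S' : Algs R" and f: "f : alg_hom R S S'" and c: "et : vals ?D S" for S S' f et
 proof (rule monoid_transI)
  note ar = as_base_restrict[OF f S(1)] and r = restrict_Algs[OF f S(1)]
  fix T assume T: "T : Algs S'"
  note d = monoid_transD(2-6)[OF c r[OF T], unfolded ar restrict_scalars_simps]
  show "base_change_trans S S' f et T : vals G (over R S' T) \<rightarrow>\<^sub>E carrier T"
   "base_change_trans S S' f et T \<one>\<^sub>(Ob G (over R S' T)) = \<one>\<^sub>T"
   using T d(1,5) by (simp_all add: base_change_trans_def)
  show "base_change_trans S S' f et T (x \<otimes>\<^sub>(Ob G (over R S' T)) y) =
    base_change_trans S S' f et T x \<otimes>\<^sub>T base_change_trans S S' f et T y"
   if "x : vals G (over R S' T)" "y : vals G (over R S' T)" for x y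
   using T d(4)[OF that] by (simp add: base_change_trans_def)
  fix U h x assume U: "U : Algs S'" and h: "h : alg_hom S' T U" and x: "x : vals G (over R S' T)"
  show "base_change_trans S S' f et U (Ar G (over R S' T) (over R S' U) h x) =
    h (base_change_trans S S' f et T x)"
   using T U d(3)[OF r[OF U] restrict_alg_hom[OF f h] x] by (simp add: base_change_trans_def ar)
 qed (simp add: base_change_trans_def)
 have set: "set_functor R ?D" unfolding set_functor_def dual_monoid_simps
 proof (intro conjI ballI)
  show "base_change_trans S T f : vals ?D S \<rightarrow> vals ?D T"
   if "S : Algs R" "T : Algs R" "f : alg_hom R S T" for S T f using bc[OF that] by blast
 next
  fix S et assume S: "S : Algs R" and c: "et : vals ?D S"
  let ?id = "\<lambda>s\<in>carrier S. s"
  have id: "?id : alg_hom R S S" using S by simp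
  show "base_change_trans S S ?id et = et"
  proof (rule eqI[OF bc[OF S S id c] monoid_transD(1)[OF c]])
   fix T assume T: "T : Algs S"
   show "et T : extensional (vals G (over R S T))" using monoid_transD(2)[OF c T] by (auto simp: PiE_def)
   fix x assume x: "x : vals G (over R S T)"
   \<comment> \<open>The records \<open>?T\<close> and \<open>T\<close> may differ at scalars
     outside the carrier of \<open>S\<close>, so the identity law rests on naturality of
     \<open>et\<close> along the identity map between them.\<close>
   let ?T = "restrict_scalars S ?id T"
   have idT: "(idm T) : alg_hom S T ?T"
   proof -
    interpret algebra S T using T by (simp add: Algs_iff)
    show ?thesis by (intro alg_homI) auto
   qed
   have "Ar G (over R S T) (over R S T) (idm T) x = x"
    using G x as_base_Algs[OF S T] unfolding comm_monoid_functor_def set_functor_def by (metis as_base_alg_simps(1))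
   then show "base_change_trans S S ?id et T x = et T x"
    using monoid_transD(4)[OF c T restrict_Algs[OF id S T] idT x] monoid_transD(3)[OF c T x] T
    by (simp add: base_change_trans_def as_base_restrict[OF id S])
  qed
 next
  fix S T U f g et assume "S : Algs R" "T : Algs R" "U : Algs R"
   and f: "f : alg_hom R S T" and g: "g : alg_hom R T U" and c: "et : vals ?D S"
  then show "base_change_trans S U (compose (carrier S) g f) et = base_change_trans T U g (base_change_trans S T f et)"
   by (auto simp: base_change_trans_def fun_eq_iff restrict_restrict[OF f] restrict_Algs[OF g])
 qed
 show ?thesis
  unfolding comm_monoid_functor_def
 proof (intro conjI ballI set comm)
  fix S T f assume S: "S : Algs R" "T : Algs R" and f: "f : alg_hom R S T"
  show "Ar ?D S T f : monoid_homs (Ob ?D S) (Ob ?D T)" unfolding monoid_homs_def hom_def using bc[OF S f]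
   by (auto simp: dual_monoid_simps base_change_trans_def restrict_Algs[OF f S(1)] as_base_restrict[OF f S(1)] fun_eq_iff)
 qed
qed

section \<open>Characters of \<open>G\<close> as points of the convolution algebra\<close>

context dualizable
begin

lemma G_set_functor: "set_functor R G" using G by (simp add: comm_monoid_functor_def)

abbreviation "dpts S \<equiv> vals (dual_monoid R G) S"

lemma separate_Algs:
 assumes S: "S : Algs R" and v: "v : V S" "w : V S"
  and eq: "\<And>T g. [|T : Algs S; g : pts (over R S T)|] ==>
   pair B T (vmap B (struct_map S T) v) (pt (over R S T) g) =
   pair B T (vmap B (struct_map S T) w) (pt (over R S T) g)"
 shows "v = w"
proof (rule separate[OF S v])
 fix T f g assume T: "T : Algs R" and f: "f : alg_hom R S T" and g: "g : pts T"
 let ?T = "slice_alg S T f"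
 have T': "?T : Algs S" "over R S ?T : Algs R" using slice_Algs[OF f S T] S by simp_all
 note id = slice_id[OF f S T]
 have "pt (over R S ?T) (Ar G T (over R S ?T) (idm T) g) = pt T g"
  using pt_natural[OF T T'(2) id g] vmap_id[OF pt_vec[OF T g]] by simp
 then show "pair B T (vmap B f v) (pt T g) = pair B T (vmap B f w) (pt T g)"
  using eq[OF T'(1) Ar_closed[OF T T'(2) id g]] by (simp add: struct_map_slice[OF f T])
qed

text \<open>The function on \<open>G\<close> given by a character, as a vector of kind
  \<open>k\<close>. It plays for the dual monoid and the convolution algebra the role that
  \<open>pt\<close> plays for \<open>G\<close>.\<close>

definition dpt where "dpt S et = fn S (slice_fun R S G et)"

lemma
 assumes S: "S : Algs R" and et: "et : dpts S"
 shows dpt_vec: "dpt S et : V S"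
  and dpt_slice: "[|T : Algs R; f : alg_hom R S T; g : pts T|] ==>
   pair B T (vmap B f (dpt S et)) (pt T g) = slice_fun R S G et T f g"
  and dpt_pair: "[|T : Algs S; g : pts (over R S T)|] ==>
   pair B T (vmap B (struct_map S T) (dpt S et)) (pt (over R S T) g) = et T g"
proof -
 note d = monoid_transD[OF et]
 have nf: "natfun R G S (slice_fun R S G et)" by (rule slice_fun_natfun[OF S G_set_functor d(3,4)])
 note fn = fn[OF S nf]
 show "dpt S et : V S" unfolding dpt_def by (rule fn(1))
 show 1: "pair B T (vmap B f (dpt S et)) (pt T g) = slice_fun R S G et T f g"
  if "T : Algs R" "f : alg_hom R S T" "g : pts T" for T f g unfolding dpt_def by (rule fn(2)[OF that])
 show "pair B T (vmap B (struct_map S T) (dpt S et)) (pt (over R S T) g) = et T g"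
  if T: "T : Algs S" and g: "g : pts (over R S T)"
 proof -
  have "slice_fun R S G et (over R S T) (struct_map S T) g = et T g"
   by (rule slice_fun_struct_map[OF S G_set_functor d(3,4) T g])
  then show ?thesis using 1[OF as_base_Algs[OF S T] struct_map_base[OF S T] g] by simp
 qed
qed

lemma dpt_points:
 assumes S: "S : Algs R" and et: "et : dpts S"
 shows "dpt S et : dual.points S" unfolding dual_points_iff[OF S dpt_vec[OF S et]]
proof (intro ballI conjI)
 fix T f assume T: "T : Algs R" and f: "f : alg_hom R S T"
 let ?T = "slice_alg S T f"
 have T': "?T : Algs S" "over R S ?T : Algs R" using slice_Algs[OF f S T] S by simp_all
 note id = slice_id[OF f S T]
 note Ar = Ar_closed[OF T T'(2) id]
 show "pair B T (vmap B f (dpt S et)) (pt T \<one>\<^sub>(Ob G T)) = \<one>\<^sub>T" using monoid_transD(6)[OF et T'(1)]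
  by (simp add: dpt_slice[OF S et T f G_one[OF T]] slice_fun_def Ar_one[OF T T'(2) id])
 fix g h assume gh: "g : pts T" "h : pts T"
 show "pair B T (vmap B f (dpt S et)) (pt T (g \<otimes>\<^sub>(Ob G T) h)) =
   pair B T (vmap B f (dpt S et)) (pt T g) \<otimes>\<^sub>T pair B T (vmap B f (dpt S et)) (pt T h)"
  using monoid_transD(5)[OF et T'(1) Ar[OF gh(1)] Ar[OF gh(2)]]
  by (simp add: dpt_slice[OF S et T f] gh G_mult[OF T gh] slice_fun_def Ar_mult[OF T T'(2) id gh])
qed

lemma dual_element:
 assumes S: "S : Algs R" and v: "v : V S"
  and mult: "\<And>T g h. [|T : Algs S; g : pts (over R S T); h : pts (over R S T)|] ==>
   pair B T (vmap B (struct_map S T) v) (pt (over R S T) (g \<otimes>\<^sub>(Ob G (over R S T)) h)) =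
   pair B T (vmap B (struct_map S T) v) (pt (over R S T) g) \<otimes>\<^sub>T
   pair B T (vmap B (struct_map S T) v) (pt (over R S T) h)"
  and one: "\<And>T. T : Algs S ==>
   pair B T (vmap B (struct_map S T) v) (pt (over R S T) \<one>\<^sub>(Ob G (over R S T))) = \<one>\<^sub>T"
 obtains et where "et : dpts S" "dpt S et = v"
proof -
 let ?b = "over R S"
 define et where "et = (\<lambda>T\<in>Algs S. \<lambda>g\<in>pts (?b T). pair B T (vmap B (struct_map S T) v) (pt (?b T) g))"
 have b: "?b T : Algs R" "struct_map S T : alg_hom R S (?b T)" if "T : Algs S" for T
  using S that by (simp_all add: struct_map_base)
 have vT: "vmap B (struct_map S T) v : V T" if "T : Algs S" for T
  using vmap_alg_hom[OF b(2)[OF that] S b(1)[OF that] v] by simp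
 have ptT: "pt (?b T) g : V' T" if "T : Algs S" "g : pts (?b T)" for T g
  using pt_vec[OF b(1)[OF that(1)] that(2)] by simp
 have et: "et : dpts S"
 proof (rule monoid_transI)
  show "et : extensional (Algs S)" by (simp add: et_def)
  fix T assume T: "T : Algs S"
  show "et T : pts (?b T) \<rightarrow>\<^sub>E carrier T"
   using T by (auto simp: et_def intro!: pair_closed[OF cring_of[OF T] vT[OF T] ptT])
  show "et T \<one>\<^sub>(Ob G (?b T)) = \<one>\<^sub>T" using T one[OF T] G_one[OF b(1)[OF T]] by (simp add: et_def)
  show "et T (g \<otimes>\<^sub>(Ob G (?b T)) h) = et T g \<otimes>\<^sub>T et T h" if "g : pts (?b T)" "h : pts (?b T)" for g h
   using T that mult[OF T that] G_mult[OF b(1)[OF T] that] by (simp add: et_def)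
  fix U f g assume U: "U : Algs S" and f: "f : alg_hom S T U" and g: "g : pts (?b T)"
  note f' = as_base_alg_hom[OF S f]
  have "compose (carrier S) f (struct_map S T) = struct_map S U" using alg_hom_struct_map[OF f] T
   by (intro extensionalityI[of _ "carrier S"]) (auto simp: compose_def Algs_iff struct_map_def[of S U])
  then have "vmap B f (vmap B (struct_map S T) v) = vmap B (struct_map S U) v" by (simp flip: vmap_compose[OF v])
  then show "et U (Ar G (?b T) (?b U) f g) = f (et T g)"
   using T U g Ar_closed[OF b(1)[OF T] b(1)[OF U] f' g] pt_natural[OF b(1)[OF T] b(1)[OF U] f' g]
    pair_alg_hom[OF f T U vT[OF T] ptT[OF T g]] by (simp add: et_def)
 qed
 moreover have "dpt S et = v"
 proof (rule separate_Algs[OF S dpt_vec[OF S et] v])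
  fix T g assume "T : Algs S" "g : pts (?b T)"
  then show "pair B T (vmap B (struct_map S T) (dpt S et)) (pt (?b T) g) = pair B T (vmap B (struct_map S T) v) (pt (?b T) g)"
   by (simp add: dpt_pair[OF S et]) (simp add: et_def)
 qed
 ultimately show thesis using that by blast
qed

lemma dual_eqI:
 assumes S: "S : Algs R" and et: "et : dpts S" "th : dpts S"
  and eq: "\<And>T g. [|T : Algs S; g : pts (over R S T)|] ==> et T g = th T g"
 shows "et = th"
proof (rule extensionalityI[OF monoid_transD(1)[OF et(1)] monoid_transD(1)[OF et(2)]])
 fix T assume T: "T : Algs S"
 show "et T = th T" using monoid_transD(2)[OF et(1) T] monoid_transD(2)[OF et(2) T] eq[OF T] by (auto intro: PiE_ext)
qed

lemma dpt_bij:
 assumes S: "S : Algs R" shows "bij_betw (dpt S) (dpts S) (dual.points S)" unfolding bij_betw_def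
proof
 show "inj_on (dpt S) (dpts S)" by (intro inj_onI dual_eqI[OF S]) (auto simp flip: dpt_pair[OF S])
 show "dpt S ` dpts S = dual.points S"
 proof
  show "dpt S ` dpts S \<subseteq> dual.points S" using dpt_points[OF S] by blast
  show "dual.points S \<subseteq> dpt S ` dpts S"
  proof
   fix v assume v: "v : dual.points S"
   then have vv: "v : V S" using Char_vec by fastforce
   note m = v[unfolded dual_points_iff[OF S vv], rule_format]
   have b: "over R S T : Algs R" "struct_map S T : alg_hom R S (over R S T)"
    if "T : Algs S" for T using S that by (simp_all add: struct_map_base)
   show "v : dpt S ` dpts S" by (rule dual_element[OF S vv]) (use m[OF b] in auto)
  qed
 qed
qed

lemma dpt_natural:
 assumes S: "S : Algs R" and S': "S' : Algs R" and f: "f : alg_hom R S S'" and et: "et : dpts S"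
 shows "dpt S' (base_change_trans S S' f et) = vmap B f (dpt S et)"
proof -
 have D: "comm_monoid_functor R (dual_monoid R G)" by (rule dual_monoid_comm_monoid_functor[OF G])
 have bc: "base_change_trans S S' f et : dpts S'"
  using D S S' f et unfolding comm_monoid_functor_def set_functor_def by (auto simp: dual_monoid_simps)
 show ?thesis
 proof (rule separate_Algs[OF S' dpt_vec[OF S' bc] vmap_alg_hom[OF f S S' dpt_vec[OF S et]]])
  fix T g assume T: "T : Algs S'" and g: "g : pts (over R S' T)"
  have r: "restrict_scalars S f T : Algs S" by (rule restrict_Algs[OF f S T])
  show "pair B T (vmap B (struct_map S' T) (dpt S' (base_change_trans S S' f et))) (pt (over R S' T) g) =
   pair B T (vmap B (struct_map S' T) (vmap B f (dpt S et))) (pt (over R S' T) g)" using dpt_pair[OF S et r] g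
   by (simp add: dpt_pair[OF S' bc T g] as_base_restrict[OF f S] struct_map_restrict[OF f]
     vmap_compose[OF dpt_vec[OF S et]]) (simp add: base_change_trans_def T)
 qed
qed

text \<open>This makes the theory self-dual: the locale applies again with the opposite flag and the
  convolution algebra, so that results on functions, points and separation for \<open>G\<close>
  become results for its characters.\<close>

lemma dual_dualizable: "dualizable R (\<not> k) B mul' unt' (dual_monoid R G) dpt"
proof (intro dualizable.intro dualizable_axioms.intro dual.vec_algebra_axioms)
 show "comm_monoid_functor R (dual_monoid R G)" by (rule dual_monoid_comm_monoid_functor[OF G])
 show "bij_betw (dpt T) (dpts T) (dual.points T)" if "T : Algs R" for T by (rule dpt_bij[OF that])
 show "dpt U (Ar (dual_monoid R G) T U f et) = vmap B f (dpt T et)"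
  if "T : Algs R" "U : Algs R" "f : alg_hom R T U" "et : dpts T" for T U f et
  using dpt_natural[OF that] by (simp add: dual_monoid_simps)
qed

interpretation dd: dualizable R "\<not> k" B mul' unt' "dual_monoid R G" dpt by (rule dual_dualizable)

lemma dpt_pair_id:
 assumes S: "S : Algs R" and et: "et : dpts S" and g: "g : pts S"
 shows "pair B S (dpt S et) (pt S g) = slice_fun R S G et S (idm S) g"
 using dpt_slice[OF S et S id_alg_hom[OF S] g] dpt_vec[OF S et] by simp

text \<open>Characters are multiplied pointwise, and \<open>mul\<close> is the pointwise product of
  functions because points are multiplicative forms.\<close>

lemma dpt_mult:
 assumes S: "S : Algs R" and et: "et : dpts S" "th : dpts S"
 shows "dpt S (et \<otimes>\<^sub>(Ob (dual_monoid R G) S) th) = mul S (dpt S et) (dpt S th)"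
proof -
 note c = dpt_vec[OF S et(1)] dpt_vec[OF S et(2)]
 note etth = dd.G_mult[OF S et]
 show ?thesis
 proof (rule separate_Algs[OF S dpt_vec[OF S etth] mul_closed[OF S c]])
  fix T g assume T: "T : Algs S" and g: "g : pts (over R S T)"
  note b = as_base_Algs[OF S T] struct_map_base[OF S T]
  show "pair B T (vmap B (struct_map S T) (dpt S (et \<otimes>\<^sub>(Ob (dual_monoid R G) S) th))) (pt (over R S T) g) =
   pair B T (vmap B (struct_map S T) (mul S (dpt S et) (dpt S th))) (pt (over R S T) g)"
   using Char_mul[OF b(1) pt_points[OF b(1) g] vmap_alg_hom[OF b(2) S b(1) c(1)] vmap_alg_hom[OF b(2) S b(1) c(2)]]
    T g by (simp add: dpt_pair[OF S etth T g] dpt_pair[OF S et(1) T g] dpt_pair[OF S et(2) T g]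
     mul_natural[OF S b(1) b(2) c]) (simp add: dual_monoid_simps)
 qed
qed

lemma dpt_one:
 assumes S: "S : Algs R" shows "dpt S \<one>\<^sub>(Ob (dual_monoid R G) S) = unt S"
proof -
 show ?thesis
proof (rule separate_Algs[OF S dpt_vec[OF S dd.G_one[OF S]] one_closed[OF S]])
 fix T g assume T: "T : Algs S" and g: "g : pts (over R S T)"
 note b = as_base_Algs[OF S T] struct_map_base[OF S T]
 show "pair B T (vmap B (struct_map S T) (dpt S \<one>\<^sub>(Ob (dual_monoid R G) S))) (pt (over R S T) g) =
  pair B T (vmap B (struct_map S T) (unt S)) (pt (over R S T) g)" using Char_one[OF b(1) pt_points[OF b(1) g]] T g
  by (simp add: dpt_pair[OF S dd.G_one[OF S] T g] one_natural[OF S b]) (simp add: dual_monoid_simps)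
qed
qed

text \<open>The points of \<^term>\<open>G\<close> are the elements multiplicative on the dual monoid: reflexivity.\<close>

lemma points_bidual:
 assumes S: "S : Algs R" and x: "x : V' S"
  and mult: "\<And>T f et th. [|T : Algs R; f : alg_hom R S T; et : dpts T; th : dpts T|] ==>
   pair B T (dpt T (et \<otimes>\<^sub>(Ob (dual_monoid R G) T) th)) (vmap B f x) =
   pair B T (dpt T et) (vmap B f x) \<otimes>\<^sub>T pair B T (dpt T th) (vmap B f x)"
  and one: "\<And>T f. [|T : Algs R; f : alg_hom R S T|] ==>
   pair B T (dpt T \<one>\<^sub>(Ob (dual_monoid R G) T)) (vmap B f x) = \<one>\<^sub>T"
 shows "x : points S"
proof (rule CharI[OF x])
 fix T f assume T: "T : Algs R" and f: "f : alg_hom R S T"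
 show "pair B T (unt T) (vmap B f x) = \<one>\<^sub>T" using one[OF T f] by (simp add: dpt_one[OF T])
next
 fix T f v w assume T: "T : Algs R" and f: "f : alg_hom R S T" and v: "v : V T" and w: "w : V T"
 interpret T: cring T by (rule cring_of[OF T])
 define y where "y = vmap B f x"
 have y: "y : V' T" unfolding y_def by (rule vmap_alg_hom[OF f S T x])
 have fy: "vmap B \<phi> y = vmap B (compose (carrier S) \<phi> f) x" for \<phi> by (simp add: y_def vmap_compose[OF x])
 note lin = natlin_pair[where k = k, OF T y]
 have p: "pair B T v y : carrier T" if "v : V T" for v by (rule pair_closed[OF T.is_cring that y])
 have dk: "natlin (\<not> \<not> k) = natlin k" "vec (\<not> \<not> k) = vec k" by simp_all
 \<comment> \<open>The case of one factor being a character. By \<open>mult\<close> the claim holds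
   if the other factor is a character as well, and both sides are natural linear forms in that
   factor, hence determined by their values at characters.\<close>
 have 1: "pair B T (mul T (dpt T et) w) y = pair B T (dpt T et) y \<otimes>\<^sub>T pair B T w y"
  if et: "et : dpts T" and T: "T : Algs R" and f: "f : alg_hom R S T" and y: "y = vmap B f x" and w: "w : V T" for et T f y w
 proof -
  note c = dpt_vec[OF T et]
  have yv: "y : V' T" unfolding y by (rule vmap_alg_hom[OF f S T x])
  have pc: "pair B T (dpt T et) y : carrier T" by (rule pair_closed[OF cring_of[OF T] c yv])
  note lin = natlin_pair[where k = k, OF T yv]
  have "pair B T (mul T w (vmap B (idm T) (dpt T et))) (vmap B (idm T) y)
   = (idm T) (pair B T (dpt T et) y) \<otimes>\<^sub>T pair B T w (vmap B (idm T) y)"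
  proof (rule dd.natlin_points_eqI[OF T natlin_mul[OF T lin c, folded dk] natlin_mult[OF lin pc, folded dk] _ T id_alg_hom[OF T] w[folded dk]])
   fix U \<phi> th assume U: "U : Algs R" and \<phi>: "\<phi> : alg_hom R T U" and th: "th : dpts U"
   let ?et = "Ar (dual_monoid R G) T U \<phi> et"
   have et': "?et : dpts U" "dpt U ?et = vmap B \<phi> (dpt T et)"
    using dd.Ar_closed[OF T U \<phi> et] dd.pt_natural[OF T U \<phi> et] by simp_all
   have f\<phi>: "compose (carrier S) \<phi> f : alg_hom R S U" using f \<phi> S by simp
   have y\<phi>: "vmap B \<phi> y = vmap B (compose (carrier S) \<phi> f) x" by (simp add: y vmap_compose[OF x])
   show "pair B U (mul U (dpt U th) (vmap B \<phi> (dpt T et))) (vmap B \<phi> y) =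
     \<phi> (pair B T (dpt T et) y) \<otimes>\<^sub>U pair B U (dpt U th) (vmap B \<phi> y)"
    using mult[OF U f\<phi> et'(1) th] pair_alg_hom[OF \<phi> T U c yv]
    by (simp add: dpt_mult[OF U et'(1) th] et'(2) y\<phi> mul_comm[OF U dpt_vec[OF U th] dpt_vec[OF U et'(1), unfolded et'(2)]])
  qed
  then show ?thesis using c yv pc by (simp add: mul_comm[OF T w c])
 qed
 \<comment> \<open>The same argument once more, now varying the first factor for an arbitrary second
   factor \<open>w\<close>.\<close>
 have "pair B T (mul T v (vmap B (idm T) w)) (vmap B (idm T) y)
   = (idm T) (pair B T w y) \<otimes>\<^sub>T pair B T v (vmap B (idm T) y)"
 proof (rule dd.natlin_points_eqI[OF T natlin_mul[OF T lin w, folded dk] natlin_mult[OF lin p[OF w], folded dk] _ T id_alg_hom[OF T] v[folded dk]])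
  fix U \<phi> th assume U: "U : Algs R" and \<phi>: "\<phi> : alg_hom R T U" and th: "th : dpts U"
  interpret U: cring U by (rule cring_of[OF U])
  have f\<phi>: "compose (carrier S) \<phi> f : alg_hom R S U" using f \<phi> S by simp
  note w\<phi> = vmap_alg_hom[OF \<phi> T U w]
  show "pair B U (mul U (dpt U th) (vmap B \<phi> w)) (vmap B \<phi> y) = \<phi> (pair B T w y) \<otimes>\<^sub>U pair B U (dpt U th) (vmap B \<phi> y)"
   using 1[OF th U f\<phi> fy w\<phi>] pair_alg_hom[OF \<phi> T U w y]
    U.m_comm[OF pair_closed[OF U.is_cring dpt_vec[OF U th] vmap_alg_hom[OF \<phi> T U y]]
     pair_closed[OF U.is_cring w\<phi> vmap_alg_hom[OF \<phi> T U y]]] by simp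
 qed
 then show "pair B T (mul T v w) (vmap B f x) = pair B T v (vmap B f x) \<otimes>\<^sub>T pair B T w (vmap B f x)"
  using p[OF v] p[OF w] w y by (simp add: T.m_comm flip: y_def)
qed

end

section \<open>Reflexivity\<close>

text \<open>The pairing of a character with a point, free of coordinates: \<open>et\<close> is
  evaluated on \<open>S\<close> regarded as an algebra over itself. The categorical arguments are
  phrased through this pairing.\<close>

definition ev where
 "ev R G S et g = slice_fun R S G et S (idm S) g"

text \<open>The index set, the algebra of vectors and the identification of points are hidden; only
  the kind remains, affine for \<open>k\<close> false and formal for \<open>k\<close> true.\<close>

definition reflexive_monoid where
 "reflexive_monoid k R G \<longleftrightarrow> (\<exists>B mul unt pt. dualizable R k B mul unt G pt)"

text \<open>Natural homomorphisms from \<open>G\<close> over \<open>S\<close> to the multiplicative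
  monoid, in the encoding of \<open>natfun\<close>. New characters and new points are produced by
  exhibiting such a formula.\<close>

definition nathom where
 "nathom R G S z \<longleftrightarrow> natfun R G S z \<and> (\<forall>T\<in>Algs R. \<forall>f\<in>alg_hom R S T.
   (\<forall>g\<in>vals G T. \<forall>h\<in>vals G T. z T f (g \<otimes>\<^sub>(Ob G T) h) = z T f g \<otimes>\<^sub>T z T f h) \<and>
   z T f \<one>\<^sub>(Ob G T) = \<one>\<^sub>T)"

lemma nathomI:
 assumes "\<And>T f g. [|T : Algs R; f : alg_hom R S T; g : vals G T|] ==> z T f g : carrier T"
  "\<And>T f U \<phi> g. [|T : Algs R; f : alg_hom R S T; U : Algs R; \<phi> : alg_hom R T U; g : vals G T|]
   ==> z U (compose (carrier S) \<phi> f) (Ar G T U \<phi> g) = \<phi> (z T f g)"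
  "\<And>T f g h. [|T : Algs R; f : alg_hom R S T; g : vals G T; h : vals G T|]
   ==> z T f (g \<otimes>\<^sub>(Ob G T) h) = z T f g \<otimes>\<^sub>T z T f h"
  "\<And>T f. [|T : Algs R; f : alg_hom R S T|] ==> z T f \<one>\<^sub>(Ob G T) = \<one>\<^sub>T"
 shows "nathom R G S z" using assms unfolding nathom_def natfun_def by blast

context dualizable
begin

interpretation dd: dualizable R "\<not> k" B mul' unt' "dual_monoid R G" dpt by (rule dual_dualizable)

lemma ev_pair:
 assumes "S : Algs R" "et : dpts S" "g : pts S"
 shows "ev R G S et g = pair B S (dpt S et) (pt S g)" using dpt_pair_id[OF assms] by (simp add: ev_def)

lemma ev_closed:
 assumes "S : Algs R" "et : dpts S" "g : pts S" shows "ev R G S et g : carrier S" unfolding ev_pair[OF assms]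
 by (rule pair_closed[OF cring_of[OF assms(1)] dpt_vec[OF assms(1,2)] pt_vec[OF assms(1,3)]])

lemma dpts_Ar:
 assumes "S : Algs R" "T : Algs R" "f : alg_hom R S T" "et : dpts S"
 shows "Ar (dual_monoid R G) S T f et : dpts T" "dpt T (Ar (dual_monoid R G) S T f et) = vmap B f (dpt S et)"
proof -
 show "Ar (dual_monoid R G) S T f et : dpts T" "dpt T (Ar (dual_monoid R G) S T f et) = vmap B f (dpt S et)"
  using dd.Ar_closed[OF assms] dd.pt_natural[OF assms] by simp_all
qed

lemma ev_natural:
 assumes S: "S : Algs R" and T: "T : Algs R" and f: "f : alg_hom R S T" and et: "et : dpts S" and g: "g : pts S"
 shows "ev R G T (Ar (dual_monoid R G) S T f et) (Ar G S T f g) = f (ev R G S et g)"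
 unfolding ev_pair[OF S et g] ev_pair[OF T dpts_Ar(1)[OF S T f et] Ar_closed[OF S T f g]]
  dpts_Ar(2)[OF S T f et] pt_natural[OF S T f g] by (rule pair_alg_hom[OF f S T dpt_vec[OF S et] pt_vec[OF S g]])

lemma dpts_monoid:
 assumes "S : Algs R"
 shows "[|et : dpts S; th : dpts S|] ==> et \<otimes>\<^sub>(Ob (dual_monoid R G) S) th : dpts S" "\<one>\<^sub>(Ob (dual_monoid R G) S) : dpts S"
proof -
 show "[|et : dpts S; th : dpts S|] ==> et \<otimes>\<^sub>(Ob (dual_monoid R G) S) th : dpts S" "\<one>\<^sub>(Ob (dual_monoid R G) S) : dpts S"
  using dd.G_mult[OF assms] dd.G_one[OF assms] by blast+
qed

lemma ev_mult_left:
 assumes S: "S : Algs R" and et: "et : dpts S" "th : dpts S" and g: "g : pts S"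
 shows "ev R G S (et \<otimes>\<^sub>(Ob (dual_monoid R G) S) th) g = ev R G S et g \<otimes>\<^sub>S ev R G S th g"
 by (simp add: ev_pair S et g dpts_monoid dpt_mult Char_mul[OF S pt_points[OF S g] dpt_vec[OF S et(1)] dpt_vec[OF S et(2)]])

lemma ev_one_left:
 assumes S: "S : Algs R" and g: "g : pts S"
 shows "ev R G S \<one>\<^sub>(Ob (dual_monoid R G) S) g = \<one>\<^sub>S"
 by (simp add: ev_pair S g dpts_monoid dpt_one Char_one[OF S pt_points[OF S g]])

lemma
 assumes S: "S : Algs R" and et: "et : dpts S"
 shows ev_mult_right: "[|g : pts S; h : pts S|] ==> ev R G S et (g \<otimes>\<^sub>(Ob G S) h) = ev R G S et g \<otimes>\<^sub>S ev R G S et h"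
  and ev_one_right: "ev R G S et \<one>\<^sub>(Ob G S) = \<one>\<^sub>S"
proof -
 note i = dpt_points[OF S et, unfolded dual_points_iff[OF S dpt_vec[OF S et]], rule_format, OF S id_alg_hom[OF S]]
 show "ev R G S et \<one>\<^sub>(Ob G S) = \<one>\<^sub>S"
  using i dpt_vec[OF S et] by (simp add: ev_pair[OF S et] G_one[OF S])
 show "ev R G S et (g \<otimes>\<^sub>(Ob G S) h) = ev R G S et g \<otimes>\<^sub>S ev R G S et h" if "g : pts S" "h : pts S"
  using i dpt_vec[OF S et] that by (simp add: ev_pair[OF S et] G_mult[OF S])
qed

lemma ev_separates_points:
 assumes S: "S : Algs R" and g: "g : pts S" "h : pts S"
  and eq: "\<And>T f et. [|T : Algs R; f : alg_hom R S T; et : dpts T|] ==>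
   ev R G T et (Ar G S T f g) = ev R G T et (Ar G S T f h)"
 shows "g = h"
proof -
 have "pt S g = pt S h"
 proof (rule dd.separate[OF S pt_vec[OF S g(1)] pt_vec[OF S g(2)]])
  fix T f et assume T: "T : Algs R" and f: "f : alg_hom R S T" and et: "et : dpts T"
  have *: "pair B T (vmap B f (pt S g)) (dpt T et) = ev R G T et (Ar G S T f g)" if g: "g : pts S" for g
   using pair_commute[OF cring_of[OF T] vmap_alg_hom[OF f S T pt_vec[OF S g]] dpt_vec[OF T et]]
   by (simp add: ev_pair[OF T et Ar_closed[OF S T f g]] pt_natural[OF S T f g])
  show "pair B T (vmap B f (pt S g)) (dpt T et) = pair B T (vmap B f (pt S h)) (dpt T et)"
   using eq[OF T f et] by (simp add: * g)
 qed
 then show ?thesis using pt_inj[OF S g] by simp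
qed

lemma ev_separates_dual_points:
 assumes S: "S : Algs R" and et: "et : dpts S" "th : dpts S"
  and eq: "\<And>T f g. [|T : Algs R; f : alg_hom R S T; g : pts T|] ==>
   ev R G T (Ar (dual_monoid R G) S T f et) g = ev R G T (Ar (dual_monoid R G) S T f th) g"
 shows "et = th"
proof -
 have "dpt S et = dpt S th"
 proof (rule separate[OF S dpt_vec[OF S et(1)] dpt_vec[OF S et(2)]])
  fix T f g assume T: "T : Algs R" and f: "f : alg_hom R S T" and g: "g : pts T"
  show "pair B T (vmap B f (dpt S et)) (pt T g) = pair B T (vmap B f (dpt S th)) (pt T g)"
   using eq[OF T f g] by (simp add: ev_pair[OF T _ g] dpts_Ar[OF S T f] et)
 qed
 then show ?thesis using dd.pt_inj[OF S et] by simp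
qed

lemma nathom_points:
 assumes S: "S : Algs R" and z: "nathom R G S z"
 shows "\<exists>et\<in>dpts S. \<forall>T\<in>Algs R. \<forall>f\<in>alg_hom R S T. \<forall>g\<in>pts T. ev R G T (Ar (dual_monoid R G) S T f et) g = z T f g"
proof -
 have n: "natfun R G S z" using z by (simp add: nathom_def)
 note v = fn[OF S n]
 have "fn S z : dual.points S" unfolding dual_points_iff[OF S v(1)] using z by (auto simp: nathom_def v(2) G_mult G_one)
 then obtain et where et: "et : dpts S" "dpt S et = fn S z" using dd.pt_surj[OF S] by metis
 have "ev R G T (Ar (dual_monoid R G) S T f et) g = z T f g"
  if T: "T : Algs R" and f: "f : alg_hom R S T" and g: "g : pts T" for T f g
  using v(2)[OF that] by (simp add: ev_pair[OF T _ g] dpts_Ar[OF S T f] et)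
 then show ?thesis using et(1) by blast
qed

text \<open>A natural homomorphism on the dual monoid is in particular a function there, hence given
  by a vector of kind \<open>\<not> k\<close>. Being multiplicative on characters, this vector is a
  point of \<open>G\<close> by \<open>points_bidual\<close>.\<close>

lemma nathom_dual_points:
 assumes S: "S : Algs R" and z: "nathom R (dual_monoid R G) S z"
 shows "\<exists>g\<in>pts S. \<forall>T\<in>Algs R. \<forall>f\<in>alg_hom R S T. \<forall>et\<in>dpts T. ev R G T et (Ar G S T f g) = z T f et"
proof -
 have n: "natfun R (dual_monoid R G) S z" using z by (simp add: nathom_def)
 note x = dd.fn[OF S n]
 have com: "pair B T (dpt T et) (vmap B f (dd.fn S z)) = z T f et"
  if T: "T : Algs R" and f: "f : alg_hom R S T" and et: "et : dpts T" for T f et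
  using x(2)[OF that] pair_commute[OF cring_of[OF T] vmap_alg_hom[OF f S T x(1)] dpt_vec[OF T et]] by simp
 have "dd.fn S z : points S" by (rule points_bidual[OF S x(1)]) (use z in "auto simp: com dpts_monoid nathom_def")
 then obtain g where g: "g : pts S" "pt S g = dd.fn S z" using pt_surj[OF S] by metis
 have "ev R G T et (Ar G S T f g) = z T f et"
  if T: "T : Algs R" and f: "f : alg_hom R S T" and et: "et : dpts T" for T f et
  using com[OF that] by (simp add: ev_pair[OF T et Ar_closed[OF S T f g(1)]] pt_natural[OF S T f g(1)] g(2))
 then show ?thesis using g(1) by blast
qed

text \<open>Together these facts say that \<open>ev\<close> is a perfect pairing: bimultiplicative,
  natural, separating on both sides, and representing every natural homomorphism on either side.
  Full faithfulness and essential surjectivity of duality rest on them.\<close>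

lemmas ev_facts = ev_closed ev_natural ev_mult_left ev_one_left ev_mult_right ev_one_right
 ev_separates_points ev_separates_dual_points nathom_points nathom_dual_points

text \<open>Relabels the values of \<open>G\<close> by injections into another type. Dualizing
  changes the type of values, whereas all objects of one category must share it.\<close>

lemma transport:
 assumes \<sigma>: "\<And>T. T : Algs R ==> inj_on (\<sigma> T) (pts T)"
 defines "s \<equiv> \<lambda>T. inv_into (pts T) (\<sigma> T)"
 defines "G' \<equiv> \<lparr>Ob = \<lambda>T. \<lparr>carrier = \<sigma> T ` pts T, mult = (\<lambda>a b. \<sigma> T (s T a \<otimes>\<^sub>(Ob G T) s T b)), one = \<sigma> T \<one>\<^sub>(Ob G T)\<rparr>,
   Ar = \<lambda>T U f a. \<sigma> U (Ar G T U f (s T a))\<rparr>"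
 shows "dualizable R k B mul unt G' (\<lambda>T a. pt T (s T a))"
  and "\<And>T g. [|T : Algs R; g : pts T|] ==> s T (\<sigma> T g) = g"
proof -
 have G's: "vals G' T = \<sigma> T ` pts T" "monoid.mult (Ob G' T) = (\<lambda>a b. \<sigma> T (s T a \<otimes>\<^sub>(Ob G T) s T b))"
  "monoid.one (Ob G' T) = \<sigma> T \<one>\<^sub>(Ob G T)" "Ar G' T U f a = \<sigma> U (Ar G T U f (s T a))" for T U f a
  by (simp_all add: G'_def)
 have s: "s T (\<sigma> T g) = g" if "T : Algs R" "g : pts T" for T g
  using inv_into_f_f[OF \<sigma>[OF that(1)] that(2)] by (simp add: s_def)
 then show "\<And>T g. [|T : Algs R; g : pts T|] ==> s T (\<sigma> T g) = g" .
 have "comm_monoid (Ob G' T)" if T: "T : Algs R" for T by (rule comm_monoidI)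
   (auto simp: G's s[OF T] G_mult[OF T] G_one[OF T] G_l_one[OF T] G_assoc[OF T] intro!: arg_cong[of _ _ "\<sigma> T"] G_comm[OF T])
 then have "comm_monoid_functor R G'" unfolding comm_monoid_functor_def set_functor_def monoid_homs_def hom_def
  by (auto simp: G's s Ar_closed G_mult G_one Ar_mult Ar_one Ar_id Ar_comp)
 moreover have "bij_betw (\<lambda>a. pt T (s T a)) (vals G' T) (points T)" if T: "T : Algs R" for T
 proof -
  have "bij_betw (s T) (\<sigma> T ` pts T) (pts T)" unfolding s_def
   by (rule bij_betw_inv_into) (use \<sigma>[OF T] in "simp add: bij_betw_def")
  from bij_betw_trans[OF this pt_bij[OF T]] show ?thesis by (simp add: G's comp_def)
 qed
 moreover have "pt U (s U (Ar G' T U f a)) = vmap B f (pt T (s T a))"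
  if "T : Algs R" "U : Algs R" "f : alg_hom R T U" "a : vals G' T" for T U f a
  using that by (auto simp: G's s Ar_closed pt_natural)
 ultimately show "dualizable R k B mul unt G' (\<lambda>T a. pt T (s T a))"
  by (intro dualizable.intro dualizable_axioms.intro vec_algebra_axioms)
qed

end

section \<open>The anti-equivalence for schemes of points\<close>

text \<open>A quasi-inverse is assembled by choice: an object \<open>G P\<close> with an isomorphism
  from \<open>P\<close> to \<open>F (G P)\<close>, and on morphisms the conjugates by these
  isomorphisms, lifted through the bijections on morphisms. Taking duals again would not do, because
  the dual of an object of the second category has values of yet another type.\<close>

lemma anti_equivalenceI:
 assumes C: "is_category C" and D: "is_category D" and F: "contravariant_functor C D F Fm"
  and ff: "\<And>X Y. [|X : Obj C; Y : Obj C|] ==> bij_betw (Fm X Y) (Mor C X Y) (Mor D (F Y) (F X))"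
  and surj: "\<And>P. P : Obj D ==> \<exists>X\<in>Obj C. \<exists>f. isomorphism D P (F X) f"
 shows "anti_equivalence C D F Fm"
proof -
 note idC = C[unfolded is_category_def, THEN conjunct1, rule_format]
  and cmpC = C[unfolded is_category_def, THEN conjunct2, THEN conjunct1, rule_format]
  and unitC = C[unfolded is_category_def, THEN conjunct2, THEN conjunct2, THEN conjunct1, rule_format]
  and assC = C[unfolded is_category_def, THEN conjunct2, THEN conjunct2, THEN conjunct2, rule_format]
 note idD = D[unfolded is_category_def, THEN conjunct1, rule_format]
  and cmpD = D[unfolded is_category_def, THEN conjunct2, THEN conjunct1, rule_format]
  and unitD = D[unfolded is_category_def, THEN conjunct2, THEN conjunct2, THEN conjunct1, rule_format]
  and assD = D[unfolded is_category_def, THEN conjunct2, THEN conjunct2, THEN conjunct2, rule_format]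
 note FO = F[unfolded contravariant_functor_def, THEN conjunct1, rule_format]
  and FM = F[unfolded contravariant_functor_def, THEN conjunct2, THEN conjunct1, rule_format]
  and FI = F[unfolded contravariant_functor_def, THEN conjunct2, THEN conjunct2, THEN conjunct1, rule_format]
  and FC = F[unfolded contravariant_functor_def, THEN conjunct2, THEN conjunct2, THEN conjunct2, rule_format]
 have inj: "f = g" if "X : Obj C" "Y : Obj C" "f : Mor C X Y" "g : Mor C X Y" "Fm X Y f = Fm X Y g" for X Y f g
  using ff[OF that(1,2)] that(3-5) by (auto simp: bij_betw_def inj_on_def)
 define lift where "lift X Y = inv_into (Mor C X Y) (Fm X Y)" for X Y
 have lift: "lift X Y f : Mor C X Y" "Fm X Y (lift X Y f) = f"
  if "X : Obj C" "Y : Obj C" "f : Mor D (F Y) (F X)" for X Y f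
  using ff[OF that(1,2)] that(3) by (auto simp: bij_betw_def lift_def inv_into_into f_inv_into_f)
 have "\<forall>P\<in>Obj D. \<exists>X e d. X : Obj C \<and> e : Mor D P (F X) \<and> d : Mor D (F X) P \<and>
   Cmp D P (F X) P d e = Idt D P \<and> Cmp D (F X) P (F X) e d = Idt D (F X)" using surj unfolding isomorphism_def by metis
 then obtain G e d where "\<forall>P\<in>Obj D. G P : Obj C \<and> e P : Mor D P (F (G P)) \<and> d P : Mor D (F (G P)) P \<and>
   Cmp D P (F (G P)) P (d P) (e P) = Idt D P \<and> Cmp D (F (G P)) P (F (G P)) (e P) (d P) = Idt D (F (G P))" by metis
 then have GO: "G P : Obj C" and e: "e P : Mor D P (F (G P))" and d: "d P : Mor D (F (G P)) P"
  and de: "Cmp D P (F (G P)) P (d P) (e P) = Idt D P" and ed: "Cmp D (F (G P)) P (F (G P)) (e P) (d P) = Idt D (F (G P))"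
  if "P : Obj D" for P using that by blast+
 note FG = FO[OF GO]
 define Gm where "Gm P Q g = lift (G Q) (G P) (Cmp D (F (G P)) P (F (G Q)) (Cmp D P Q (F (G Q)) (e Q) g) (d P))" for P Q g
 have gd: "Cmp D (F (G P)) P (F (G Q)) (Cmp D P Q (F (G Q)) (e Q) g) (d P) : Mor D (F (G P)) (F (G Q))"
  and ge: "Cmp D P Q (F (G Q)) (e Q) g : Mor D P (F (G Q))"
  if P: "P : Obj D" and Q: "Q : Obj D" and g: "g : Mor D P Q" for P Q g
 proof -
  show 1: "Cmp D P Q (F (G Q)) (e Q) g : Mor D P (F (G Q))" by (rule cmpD[OF P Q FG[OF Q] g e[OF Q]])
  show "Cmp D (F (G P)) P (F (G Q)) (Cmp D P Q (F (G Q)) (e Q) g) (d P) : Mor D (F (G P)) (F (G Q))"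
   by (rule cmpD[OF FG[OF P] P FG[OF Q] d[OF P] 1])
 qed
 have Gm: "Gm P Q g : Mor C (G Q) (G P)"
  "Fm (G Q) (G P) (Gm P Q g) = Cmp D (F (G P)) P (F (G Q)) (Cmp D P Q (F (G Q)) (e Q) g) (d P)"
  if P: "P : Obj D" and Q: "Q : Obj D" and g: "g : Mor D P Q" for P Q g
  using lift[OF GO[OF Q] GO[OF P] gd[OF that]] unfolding Gm_def by blast+
 \<comment> \<open>Naturality of \<open>e\<close>, from which compatibility of \<open>Gm\<close>
   with composition and the natural isomorphism on \<open>D\<close> follow.\<close>
 have Gme: "Cmp D P (F (G P)) (F (G Q)) (Fm (G Q) (G P) (Gm P Q g)) (e P) = Cmp D P Q (F (G Q)) (e Q) g"
  if P: "P : Obj D" and Q: "Q : Obj D" and g: "g : Mor D P Q" for P Q g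
  unfolding Gm(2)[OF that] assD[OF P FG[OF P] P FG[OF Q] e[OF P] d[OF P] ge[OF that]] de[OF P]
  using unitD[OF P FG[OF Q] ge[OF that]] by blast
 have G: "contravariant_functor D C G Gm" unfolding contravariant_functor_def
 proof (intro conjI ballI)
  show "G P : Obj C" if "P : Obj D" for P by (rule GO[OF that])
  show "Gm P Q g : Mor C (G Q) (G P)" if "P : Obj D" "Q : Obj D" "g : Mor D P Q" for P Q g by (rule Gm(1)[OF that])
  show "Gm P P (Idt D P) = Idt C (G P)" if P: "P : Obj D" for P
  proof (rule inj[OF GO[OF P] GO[OF P] Gm(1)[OF P P idD[OF P]] idC[OF GO[OF P]]])
   show "Fm (G P) (G P) (Gm P P (Idt D P)) = Fm (G P) (G P) (Idt C (G P))"
    using unitD[OF P FG[OF P] e[OF P]] unfolding Gm(2)[OF P P idD[OF P]] FI[OF GO[OF P]] by (simp add: ed[OF P])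
  qed
  fix P Q W g h assume P: "P : Obj D" and Q: "Q : Obj D" and W: "W : Obj D"
   and g: "g : Mor D P Q" and h: "h : Mor D Q W"
  note hg = cmpD[OF P Q W g h]
  note GG = Gm(1)[OF Q W h] Gm(1)[OF P Q g]
  show "Gm P W (Cmp D P Q W h g) = Cmp C (G W) (G Q) (G P) (Gm P Q g) (Gm Q W h)"
  proof (rule inj[OF GO[OF W] GO[OF P] Gm(1)[OF P W hg] cmpC[OF GO[OF W] GO[OF Q] GO[OF P] GG]])
   have "Fm (G W) (G P) (Cmp C (G W) (G Q) (G P) (Gm P Q g) (Gm Q W h))
    = Cmp D (F (G P)) (F (G Q)) (F (G W)) (Fm (G W) (G Q) (Gm Q W h)) (Fm (G Q) (G P) (Gm P Q g))"
    by (rule FC[OF GO[OF W] GO[OF Q] GO[OF P] GG])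
   also have "\<dots> = Cmp D (F (G P)) P (F (G W))
     (Cmp D P (F (G Q)) (F (G W)) (Fm (G W) (G Q) (Gm Q W h)) (Cmp D P Q (F (G Q)) (e Q) g)) (d P)" unfolding Gm(2)[OF P Q g]
    by (rule assD[OF FG[OF P] P FG[OF Q] FG[OF W] d[OF P] ge[OF P Q g] FM[OF GO[OF W] GO[OF Q] GG(1)], symmetric])
   also have "Cmp D P (F (G Q)) (F (G W)) (Fm (G W) (G Q) (Gm Q W h)) (Cmp D P Q (F (G Q)) (e Q) g)
    = Cmp D P Q (F (G W)) (Cmp D Q (F (G Q)) (F (G W)) (Fm (G W) (G Q) (Gm Q W h)) (e Q)) g"
    by (rule assD[OF P Q FG[OF Q] FG[OF W] g e[OF Q] FM[OF GO[OF W] GO[OF Q] GG(1)], symmetric])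
   also have "\<dots> = Cmp D P W (F (G W)) (e W) (Cmp D P Q W h g)"
    unfolding Gme[OF Q W h] by (rule assD[OF P Q W FG[OF W] g h e[OF W]])
   finally show "Fm (G W) (G P) (Gm P W (Cmp D P Q W h g)) =
     Fm (G W) (G P) (Cmp C (G W) (G Q) (G P) (Gm P Q g) (Gm Q W h))" unfolding Gm(2)[OF P W hg] by simp
  qed
 qed
 have isoD: "iso_to_identity D (\<lambda>X. F (G X)) (\<lambda>X Y g. Fm (G Y) (G X) (Gm X Y g))"
  unfolding iso_to_identity_def isomorphism_def
 proof (intro exI[of _ e] conjI ballI)
  fix P assume P: "P : Obj D"
  show "e P : Mor D P (F (G P))" by (rule e[OF P])
  show "\<exists>h\<in>Mor D (F (G P)) P. Cmp D P (F (G P)) P h (e P) = Idt D P \<and>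
    Cmp D (F (G P)) P (F (G P)) (e P) h = Idt D (F (G P))" using d[OF P] de[OF P] ed[OF P] by blast
 qed (rule Gme[symmetric])
 have isoC: "iso_to_identity C (\<lambda>X. G (F X)) (\<lambda>X Y f. Gm (F Y) (F X) (Fm X Y f))"
 proof -
  \<comment> \<open>The natural isomorphism on \<open>C\<close> lifts the inverse \<open>d\<close>
    at \<open>F X\<close>, not \<open>e\<close>, since \<open>Fm\<close> reverses arrows.\<close>
  define a where "a X = lift X (G (F X)) (d (F X))" for X
  define b where "b X = lift (G (F X)) X (e (F X))" for X
  have a: "a X : Mor C X (G (F X))" "Fm X (G (F X)) (a X) = d (F X)"
   and b: "b X : Mor C (G (F X)) X" "Fm (G (F X)) X (b X) = e (F X)" if X: "X : Obj C" for X
   using lift[OF X GO[OF FO[OF X]] d[OF FO[OF X]]] lift[OF GO[OF FO[OF X]] X e[OF FO[OF X]]] unfolding a_def b_def by blast+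
  have "isomorphism C X (G (F X)) (a X)" if X: "X : Obj C" for X unfolding isomorphism_def
  proof (intro conjI bexI[OF _ b(1)[OF X]] a(1)[OF X])
   note FX = FO[OF X] and GFX = GO[OF FO[OF X]]
   show "Cmp C X (G (F X)) X (b X) (a X) = Idt C X" by (rule inj[OF X X cmpC[OF X GFX X a(1)[OF X] b(1)[OF X]] idC[OF X]])
     (simp add: FC[OF X GFX X a(1)[OF X] b(1)[OF X]] a(2)[OF X] b(2)[OF X] de[OF FX] FI[OF X])
   show "Cmp C (G (F X)) X (G (F X)) (a X) (b X) = Idt C (G (F X))"
    by (rule inj[OF GFX GFX cmpC[OF GFX X GFX b(1)[OF X] a(1)[OF X]] idC[OF GFX]])
     (simp add: FC[OF GFX X GFX b(1)[OF X] a(1)[OF X]] a(2)[OF X] b(2)[OF X] ed[OF FX] FI[OF GFX])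
  qed
  moreover have "Cmp C X Y (G (F Y)) (a Y) f = Cmp C X (G (F X)) (G (F Y)) (Gm (F Y) (F X) (Fm X Y f)) (a X)"
   if X: "X : Obj C" and Y: "Y : Obj C" and f: "f : Mor C X Y" for X Y f
  proof -
   note FX = FO[OF X] and GFX = GO[OF FO[OF X]] and FY = FO[OF Y] and GFY = GO[OF FO[OF Y]]
   note Ff = FM[OF X Y f]
   note g = Gm[OF FY FX Ff]
   show ?thesis
   proof (rule inj[OF X GFY cmpC[OF X Y GFY f a(1)[OF Y]] cmpC[OF X GFX GFY a(1)[OF X] g(1)]])
    have "Fm X (G (F Y)) (Cmp C X (G (F X)) (G (F Y)) (Gm (F Y) (F X) (Fm X Y f)) (a X))
     = Cmp D (F (G (F Y))) (F (G (F X))) (F X) (d (F X)) (Fm (G (F X)) (G (F Y)) (Gm (F Y) (F X) (Fm X Y f)))"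
     by (simp add: FC[OF X GFX GFY a(1)[OF X] g(1)] a(2)[OF X])
    also have "\<dots> = Cmp D (F (G (F Y))) (F Y) (F X)
      (Cmp D (F Y) (F (G (F X))) (F X) (d (F X)) (Cmp D (F Y) (F X) (F (G (F X))) (e (F X)) (Fm X Y f))) (d (F Y))"
     unfolding g(2) by (rule assD[OF FG[OF FY] FY FG[OF FX] FX d[OF FY] ge[OF FY FX Ff] d[OF FX], symmetric])
    also have "Cmp D (F Y) (F (G (F X))) (F X) (d (F X)) (Cmp D (F Y) (F X) (F (G (F X))) (e (F X)) (Fm X Y f)) = Fm X Y f"
     unfolding assD[OF FY FX FG[OF FX] FX Ff e[OF FX] d[OF FX], symmetric] de[OF FX] using unitD[OF FY FX Ff] by blast
    finally show "Fm X (G (F Y)) (Cmp C X Y (G (F Y)) (a Y) f) =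
      Fm X (G (F Y)) (Cmp C X (G (F X)) (G (F Y)) (Gm (F Y) (F X) (Fm X Y f)) (a X))"
     by (simp add: FC[OF X Y GFY f a(1)[OF Y]] a(2)[OF Y])
   qed
  qed
  ultimately show ?thesis unfolding iso_to_identity_def by blast
 qed
 show ?thesis
  unfolding anti_equivalence_def using C D F G isoC isoD by blast
qed

section \<open>Morphisms of functors of monoids and the categories they form\<close>

lemma monoid_trans_iff:
 "et : monoid_trans R F G \<longleftrightarrow> et : extensional (Algs R) \<and> (\<forall>T\<in>Algs R. et T : vals F T \<rightarrow>\<^sub>E vals G T) \<and>
   (\<forall>T\<in>Algs R. \<forall>U\<in>Algs R. \<forall>f\<in>alg_hom R T U. \<forall>x\<in>vals F T. et U (Ar F T U f x) = Ar G T U f (et T x)) \<and>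
   (\<forall>T\<in>Algs R. (\<forall>x\<in>vals F T. \<forall>y\<in>vals F T. et T (x \<otimes>\<^sub>(Ob F T) y) = et T x \<otimes>\<^sub>(Ob G T) et T y) \<and>
    et T \<one>\<^sub>(Ob F T) = \<one>\<^sub>(Ob G T))"
 by (auto simp: monoid_trans_def nat_trans_def monoid_homs_def hom_def PiE_def Pi_def)

lemma mtD:
 assumes "et : monoid_trans R F G" "T : Algs R"
 shows "x : vals F T ==> et T x : vals G T"
  "[|U : Algs R; f : alg_hom R T U; x : vals F T|] ==> et U (Ar F T U f x) = Ar G T U f (et T x)"
  "[|x : vals F T; y : vals F T|] ==> et T (x \<otimes>\<^sub>(Ob F T) y) = et T x \<otimes>\<^sub>(Ob G T) et T y"
  "et T \<one>\<^sub>(Ob F T) = \<one>\<^sub>(Ob G T)" using assms unfolding monoid_trans_iff by blast+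

lemma mt_eqI:
 assumes "et : monoid_trans R F G" "th : monoid_trans R F G"
  "\<And>T x. [|T : Algs R; x : vals F T|] ==> et T x = th T x"
 shows "et = th"
proof (rule extensionalityI[of _ "Algs R"])
 fix T assume T: "T : Algs R"
 show "et T = th T" by (rule PiE_ext[of _ "vals F T" "\<lambda>_. vals G T"])
   (use assms T in "auto simp: monoid_trans_iff")
qed (use assms in "auto simp: monoid_trans_iff")

lemma comm_monoid_functorD:
 assumes "comm_monoid_functor R G" "T : Algs R"
 shows "comm_monoid (Ob G T)"
  "[|g : vals G T; h : vals G T|] ==> g \<otimes>\<^sub>(Ob G T) h : vals G T"
  "\<one>\<^sub>(Ob G T) : vals G T"
  "[|U : Algs R; f : alg_hom R T U; g : vals G T|] ==> Ar G T U f g : vals G U"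
  "[|U : Algs R; f : alg_hom R T U; g : vals G T; h : vals G T|] ==>
   Ar G T U f (g \<otimes>\<^sub>(Ob G T) h) = Ar G T U f g \<otimes>\<^sub>(Ob G U) Ar G T U f h"
  "[|U : Algs R; f : alg_hom R T U|] ==> Ar G T U f \<one>\<^sub>(Ob G T) = \<one>\<^sub>(Ob G U)"
  "g : vals G T ==> Ar G T T (idm T) g = g"
  "[|U : Algs R; W : Algs R; f : alg_hom R T U; f' : alg_hom R U W; g : vals G T|]
   ==> Ar G T W (compose (carrier T) f' f) g = Ar G U W f' (Ar G T U f g)"
proof -
 show 1: "comm_monoid (Ob G T)" using assms by (simp add: comm_monoid_functor_def)
 then interpret comm_monoid "Ob G T" .
 show "[|g : vals G T; h : vals G T|] ==> g \<otimes>\<^sub>(Ob G T) h : vals G T"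
  "\<one>\<^sub>(Ob G T) : vals G T" by auto
qed (use assms in "auto simp: comm_monoid_functor_def set_functor_def monoid_homs_def hom_def")

lemma mt_restrictI:
 assumes G: "comm_monoid_functor R F"
  and "\<And>T x. [|T : Algs R; x : vals F T|] ==> et T x : vals G T"
  "\<And>T U f x. [|T : Algs R; U : Algs R; f : alg_hom R T U; x : vals F T|]
   ==> et U (Ar F T U f x) = Ar G T U f (et T x)"
  "\<And>T x y. [|T : Algs R; x : vals F T; y : vals F T|]
   ==> et T (x \<otimes>\<^sub>(Ob F T) y) = et T x \<otimes>\<^sub>(Ob G T) et T y"
  "\<And>T. T : Algs R ==> et T \<one>\<^sub>(Ob F T) = \<one>\<^sub>(Ob G T)"
 shows "(\<lambda>T\<in>Algs R. \<lambda>x\<in>vals F T. et T x) : monoid_trans R F G"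
proof -
 note d = comm_monoid_functorD[OF G]
 show ?thesis
  using assms(2-5) d(2,3,4) unfolding monoid_trans_iff by auto
qed

lemma monoid_functor_cat_simps [simp]:
 "Obj (monoid_functor_cat R Os) = Os" "Mor (monoid_functor_cat R Os) = monoid_trans R"
 "Idt (monoid_functor_cat R Os) = (\<lambda>F. \<lambda>T\<in>Algs R. \<lambda>x\<in>vals F T. x)"
 "Cmp (monoid_functor_cat R Os) = (\<lambda>F G H th et. \<lambda>T\<in>Algs R. compose (vals F T) (th T) (et T))"
 by (simp_all add: monoid_functor_cat_def)

lemma mt_id: "comm_monoid_functor R F ==> (\<lambda>T\<in>Algs R. \<lambda>x\<in>vals F T. x) : monoid_trans R F F"
 by (rule mt_restrictI) auto

lemma mt_compose:
 assumes F: "comm_monoid_functor R F" and et: "et : monoid_trans R F G" and th: "th : monoid_trans R G H"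
 shows "(\<lambda>T\<in>Algs R. compose (vals F T) (th T) (et T)) : monoid_trans R F H" unfolding compose_def
 by (rule mt_restrictI[OF F]) (auto simp: mtD[OF et] mtD[OF th])

lemma monoid_functor_category:
 assumes "\<And>F. F : Os ==> comm_monoid_functor R F"
 shows "is_category (monoid_functor_cat R Os)" unfolding is_category_def monoid_functor_cat_simps
proof (intro conjI ballI)
 show "(\<lambda>T\<in>Algs R. \<lambda>x\<in>vals F T. x) : monoid_trans R F F" if "F : Os" for F
  by (rule mt_id) (rule assms[OF that])
 show "(\<lambda>T\<in>Algs R. compose (vals F T) (th T) (et T)) : monoid_trans R F H"
  if "F : Os" "G : Os" "H : Os" "et : monoid_trans R F G" "th : monoid_trans R G H" for F G H et th
  by (rule mt_compose[OF assms[OF that(1)] that(4,5)])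
next
 fix F G et assume FG: "F : Os" "G : Os" and et: "et : monoid_trans R F G"
 show "(\<lambda>T\<in>Algs R. compose (vals F T) (et T) ((\<lambda>T\<in>Algs R. \<lambda>x\<in>vals F T. x) T)) = et"
  by (rule mt_eqI[OF mt_compose[OF assms[OF FG(1)] mt_id[OF assms[OF FG(1)]] et] et]) (auto simp: compose_def)
 show "(\<lambda>T\<in>Algs R. compose (vals F T) ((\<lambda>T\<in>Algs R. \<lambda>x\<in>vals G T. x) T) (et T)) = et"
  by (rule mt_eqI[OF mt_compose[OF assms[OF FG(1)] et mt_id[OF assms[OF FG(2)]]] et]) (auto simp: compose_def mtD[OF et])
next
 fix E F G H \<zeta> et th assume O: "E : Os" "F : Os" "G : Os" "H : Os"
  and m: "\<zeta> : monoid_trans R E F" "et : monoid_trans R F G" "th : monoid_trans R G H"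
 show "(\<lambda>T\<in>Algs R. compose (vals E T) ((\<lambda>T\<in>Algs R. compose (vals F T) (th T) (et T)) T) (\<zeta> T)) =
  (\<lambda>T\<in>Algs R. compose (vals E T) (th T) ((\<lambda>T\<in>Algs R. compose (vals E T) (et T) (\<zeta> T)) T))"
  by (auto simp: fun_eq_iff compose_def mtD[OF m(1)])
qed

lemma mt_isomorphism:
 assumes F: "comm_monoid_functor R F" and G: "comm_monoid_functor R G" and et: "et : monoid_trans R F G"
  and bij: "\<And>T. T : Algs R ==> bij_betw (et T) (vals F T) (vals G T)"
 shows "isomorphism (monoid_functor_cat R Os) F G et"
proof -
 define s where "s T = inv_into (vals F T) (et T)" for T
 have s: "s T y : vals F T" "et T (s T y) = y" if "T : Algs R" "y : vals G T" for T y
  using bij[OF that(1)] that(2) unfolding s_def bij_betw_def by (auto simp: inv_into_into f_inv_into_f)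
 have s': "s T (et T x) = x" if "T : Algs R" "x : vals F T" for T x
  using bij[OF that(1)] that(2) by (simp add: s_def bij_betw_def)
 have inj: "x = y" if "T : Algs R" "x : vals F T" "y : vals F T" "et T x = et T y" for T x y
  using bij[OF that(1)] that(2-4) by (auto simp: bij_betw_def inj_on_def)
 note FD = comm_monoid_functorD[OF F] and GD = comm_monoid_functorD[OF G]
 have inv: "(\<lambda>T\<in>Algs R. \<lambda>y\<in>vals G T. s T y) : monoid_trans R G F"
 proof (rule mt_restrictI[OF G])
  fix T assume T: "T : Algs R"
  interpret F: comm_monoid "Ob F T" by (rule FD(1)[OF T])
  interpret G: comm_monoid "Ob G T" by (rule GD(1)[OF T])
  show "s T x : vals F T" if "x : vals G T" for x using s T that by blast
  show "s T \<one>\<^sub>(Ob G T) = \<one>\<^sub>(Ob F T)" using s'[OF T F.one_closed] mtD(4)[OF et T] by simp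
  show "s T (x \<otimes>\<^sub>(Ob G T) y) = s T x \<otimes>\<^sub>(Ob F T) s T y" if "x : vals G T" "y : vals G T" for x y
  proof (rule inj[OF T])
   note sx = s[OF T that(1)] and sy = s[OF T that(2)] and sxy = s[OF T G.m_closed[OF that]]
   show "s T (x \<otimes>\<^sub>(Ob G T) y) : vals F T" by (rule sxy)
   show "s T x \<otimes>\<^sub>(Ob F T) s T y : vals F T" by (rule F.m_closed[OF sx(1) sy(1)])
   show "et T (s T (x \<otimes>\<^sub>(Ob G T) y)) = et T (s T x \<otimes>\<^sub>(Ob F T) s T y)"
    by (simp only: mtD(3)[OF et T sx(1) sy(1)] sx(2) sy(2) sxy(2))
  qed
 next
  fix T U f x assume T: "T : Algs R" and U: "U : Algs R" and f: "f : alg_hom R T U" and x: "x : vals G T"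
  show "s U (Ar G T U f x) = Ar F T U f (s T x)"
   by (rule inj[OF U]) (use s[OF T x] s[OF U GD(4)[OF T U f x]] FD(4)[OF T U f] mtD(2)[OF et T U f] in auto)
 qed
 show ?thesis
  unfolding isomorphism_def monoid_functor_cat_simps
  by (intro conjI bexI[OF _ inv] et) (auto simp: fun_eq_iff compose_def s s' mtD(1)[OF et])
qed

lemma reflexive_monoid_functor: "reflexive_monoid k R G ==> comm_monoid_functor R G"
 unfolding reflexive_monoid_def by (metis dualizable.G)

lemma reflexive_monoid_dual: "reflexive_monoid k R G ==> reflexive_monoid (\<not> k) R (dual_monoid R G)"
 unfolding reflexive_monoid_def by (metis dualizable.dual_dualizable)

lemma reflexive_monoidD: "reflexive_monoid k R G ==> \<exists>B mul unt pt. dualizable R k B mul unt G pt"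
 by (simp add: reflexive_monoid_def)

section \<open>Transposes of morphisms and full faithfulness of duality\<close>

lemma dual_monoid_map_closed:
 assumes G: "comm_monoid_functor R G" and \<psi>: "\<psi> : monoid_trans R G H"
  and S: "S : Algs R" and et: "et : vals (dual_monoid R H) S"
 shows "dual_monoid_map R G H \<psi> S et : vals (dual_monoid R G) S"
proof (rule monoid_transI)
 fix T assume T: "T : Algs S"
 note b = as_base_Algs[OF S T]
 note d = monoid_transD[OF et]
 note m = mtD[OF \<psi> b] and g = comm_monoid_functorD[OF G b]
 show "dual_monoid_map R G H \<psi> S et T : vals G (over R S T) \<rightarrow>\<^sub>E carrier T"
  using S T et d(3)[OF T m(1)] by (auto simp: dual_monoid_map_def compose_def)
 show "dual_monoid_map R G H \<psi> S et T \<one>\<^sub>(Ob G (over R S T)) = \<one>\<^sub>T"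
  using S T et d(6)[OF T] g(3) m(4) by (simp add: dual_monoid_map_def compose_def)
 show "dual_monoid_map R G H \<psi> S et T (x \<otimes>\<^sub>(Ob G (over R S T)) y) =
   dual_monoid_map R G H \<psi> S et T x \<otimes>\<^sub>T dual_monoid_map R G H \<psi> S et T y"
  if "x : vals G (over R S T)" "y : vals G (over R S T)" for x y
  using S T et d(5)[OF T m(1)[OF that(1)] m(1)[OF that(2)]] g(2)[OF that] m(3)[OF that] that
  by (simp add: dual_monoid_map_def compose_def)
 fix U f x assume U: "U : Algs S" and f: "f : alg_hom S T U" and x: "x : vals G (over R S T)"
 note f' = as_base_alg_hom[OF S f]
 show "dual_monoid_map R G H \<psi> S et U (Ar G (over R S T) (over R S U) f x) =
   f (dual_monoid_map R G H \<psi> S et T x)"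
  using S T U et d(4)[OF T U f m(1)[OF x]] g(4)[OF as_base_Algs[OF S U] f' x] m(2)[OF as_base_Algs[OF S U] f' x] x
  by (simp add: dual_monoid_map_def compose_def)
qed (use S et in "simp add: dual_monoid_map_def")

text \<open>Adjointness of a morphism and its transpose for the pairing. Combined with separation it
  yields functoriality and injectivity without unfolding the transpose again.\<close>

lemma dual_monoid_map_ev:
 assumes G: "comm_monoid_functor R G" and \<psi>: "\<psi> : monoid_trans R G H"
  and S: "S : Algs R" and et: "et : vals (dual_monoid R H) S" and g: "g : vals G S"
 shows "ev R G S (dual_monoid_map R G H \<psi> S et) g = ev R H S et (\<psi> S g)"
proof -
 let ?S = "slice_alg S S (idm S)"
 note id = id_alg_hom[OF S]
 have S': "?S : Algs S" "over R S ?S : Algs R" using slice_Algs[OF id S S] S by simp_all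
 note i = slice_id[OF id S S]
 show ?thesis
  using S et S' comm_monoid_functorD(4)[OF G S S'(2) i g] mtD(2)[OF \<psi> S S'(2) i g]
  by (simp add: ev_def slice_fun_def dual_monoid_map_def compose_def)
qed

lemma dual_monoid_map_mt:
 assumes G: "comm_monoid_functor R G" and H: "comm_monoid_functor R H" and \<psi>: "\<psi> : monoid_trans R G H"
 shows "dual_monoid_map R G H \<psi> : monoid_trans R (dual_monoid R H) (dual_monoid R G)"
proof -
 let ?m = "\<lambda>S et. \<lambda>T\<in>Algs S. compose (vals G (over R S T)) (et T) (\<psi> (over R S T))"
 have m: "dual_monoid_map R G H \<psi> S et = ?m S et" if "S : Algs R" "et : vals (dual_monoid R H) S" for S et
  using that by (simp add: dual_monoid_map_def)
 have "(\<lambda>S\<in>Algs R. \<lambda>et\<in>vals (dual_monoid R H) S. ?m S et) : monoid_trans R (dual_monoid R H) (dual_monoid R G)"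
 proof (rule mt_restrictI[OF dual_monoid_comm_monoid_functor[OF H]])
  show "?m S et : vals (dual_monoid R G) S" if "S : Algs R" "et : vals (dual_monoid R H) S" for S et
   using dual_monoid_map_closed[OF G \<psi> that] m[OF that] by simp
 next
  fix S S' f et assume S: "S : Algs R" and S': "S' : Algs R" and f: "f : alg_hom R S S'"
   and et: "et : vals (dual_monoid R H) S"
  show "?m S' (Ar (dual_monoid R H) S S' f et) = Ar (dual_monoid R G) S S' f (?m S et)"
   by (auto simp: dual_monoid_simps base_change_trans_def fun_eq_iff restrict_Algs[OF f S] as_base_restrict[OF f S] compose_def)
 next
  fix S et th assume S: "S : Algs R"
  show "?m S (et \<otimes>\<^sub>(Ob (dual_monoid R H) S) th) = ?m S et \<otimes>\<^sub>(Ob (dual_monoid R G) S) ?m S th"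
   by (auto simp: dual_monoid_simps fun_eq_iff compose_def mtD(1)[OF \<psi>] S)
 next
  fix S assume S: "S : Algs R"
  show "?m S \<one>\<^sub>(Ob (dual_monoid R H) S) = \<one>\<^sub>(Ob (dual_monoid R G) S)"
   by (auto simp: dual_monoid_simps fun_eq_iff compose_def mtD(1)[OF \<psi>] S)
 qed
 then show ?thesis by (simp add: dual_monoid_map_def)
qed

text \<open>Characters are told apart by their values at points after base change, and naturality
  absorbs the base change; it is therefore enough to compare values of \<open>ev\<close> over one
  algebra at a time.\<close>

lemma dual_ev_determines:
 assumes X: "reflexive_monoid k R X" and F: "comm_monoid_functor R F"
  and \<phi>: "\<phi> : monoid_trans R F (dual_monoid R X)" "\<phi>' : monoid_trans R F (dual_monoid R X)"
  and eq: "\<And>S x g. [|S : Algs R; x : vals F S; g : vals X S|] ==>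
   ev R X S (\<phi> S x) g = ev R X S (\<phi>' S x) g"
 shows "\<phi> = \<phi>'"
proof (rule mt_eqI[OF \<phi>])
 obtain B mul unt pt where d: "dualizable R k B mul unt X pt" using reflexive_monoidD[OF X] by blast
 fix S x assume S: "S : Algs R" and x: "x : vals F S"
 show "\<phi> S x = \<phi>' S x"
 proof (rule dualizable.ev_facts(8)[OF d S mtD(1)[OF \<phi>(1) S x] mtD(1)[OF \<phi>(2) S x]])
  fix T f g assume T: "T : Algs R" and f: "f : alg_hom R S T" and g: "g : vals X T"
  show "ev R X T (Ar (dual_monoid R X) S T f (\<phi> S x)) g = ev R X T (Ar (dual_monoid R X) S T f (\<phi>' S x)) g"
   using eq[OF T comm_monoid_functorD(4)[OF F S T f x] g] mtD(2)[OF \<phi>(1) S T f x] mtD(2)[OF \<phi>(2) S T f x] by simp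
 qed
qed

lemma ev_determines:
 assumes X: "reflexive_monoid k R X" and F: "comm_monoid_functor R F"
  and \<phi>: "\<phi> : monoid_trans R F X" "\<phi>' : monoid_trans R F X"
  and eq: "\<And>S x et. [|S : Algs R; x : vals F S; et : vals (dual_monoid R X) S|] ==>
   ev R X S et (\<phi> S x) = ev R X S et (\<phi>' S x)"
 shows "\<phi> = \<phi>'"
proof (rule mt_eqI[OF \<phi>])
 obtain B mul unt pt where d: "dualizable R k B mul unt X pt" using reflexive_monoidD[OF X] by blast
 fix S x assume S: "S : Algs R" and x: "x : vals F S"
 show "\<phi> S x = \<phi>' S x"
 proof (rule dualizable.ev_facts(7)[OF d S mtD(1)[OF \<phi>(1) S x] mtD(1)[OF \<phi>(2) S x]])
  fix T f et assume T: "T : Algs R" and f: "f : alg_hom R S T" and et: "et : vals (dual_monoid R X) T"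
  show "ev R X T et (Ar X S T f (\<phi> S x)) = ev R X T et (Ar X S T f (\<phi>' S x))"
   using eq[OF T comm_monoid_functorD(4)[OF F S T f x] et] mtD(2)[OF \<phi>(1) S T f x] mtD(2)[OF \<phi>(2) S T f x] by simp
 qed
qed

lemma dual_monoid_map_id:
 assumes X: "reflexive_monoid k R X"
 shows "dual_monoid_map R X X (\<lambda>T\<in>Algs R. \<lambda>x\<in>vals X T. x) =
  (\<lambda>T\<in>Algs R. \<lambda>x\<in>vals (dual_monoid R X) T. x)"
proof -
 note cX = reflexive_monoid_functor[OF X]
 note dX = dual_monoid_comm_monoid_functor[OF cX]
 show ?thesis
  by (rule dual_ev_determines[OF X dX dual_monoid_map_mt[OF cX cX mt_id[OF cX]] mt_id[OF dX]])
   (simp add: dual_monoid_map_ev[OF cX mt_id[OF cX]])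
qed

lemma dual_monoid_map_compose:
 assumes X: "reflexive_monoid k R X" and Y: "comm_monoid_functor R Y" and Z: "comm_monoid_functor R Z"
  and f: "f : monoid_trans R X Y" and g: "g : monoid_trans R Y Z"
 shows "dual_monoid_map R X Z (\<lambda>T\<in>Algs R. compose (vals X T) (g T) (f T)) =
  (\<lambda>T\<in>Algs R. compose (vals (dual_monoid R Z) T) (dual_monoid_map R X Y f T) (dual_monoid_map R Y Z g T))"
proof -
 note cX = reflexive_monoid_functor[OF X]
 note d = dual_monoid_comm_monoid_functor
 note gf = mt_compose[OF cX f g]
 show ?thesis
 proof (rule dual_ev_determines[OF X d[OF Z] dual_monoid_map_mt[OF cX Z gf]
    mt_compose[OF d[OF Z] dual_monoid_map_mt[OF Y Z g] dual_monoid_map_mt[OF cX Y f]]])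
  fix S et x assume S: "S : Algs R" and et: "et : vals (dual_monoid R Z) S" and x: "x : vals X S"
  note et' = dual_monoid_map_closed[OF Y g S et]
  show "ev R X S (dual_monoid_map R X Z (\<lambda>T\<in>Algs R. compose (vals X T) (g T) (f T)) S et) x =
   ev R X S ((\<lambda>T\<in>Algs R. compose (vals (dual_monoid R Z) T) (dual_monoid_map R X Y f T) (dual_monoid_map R Y Z g T)) S et) x"
   unfolding dual_monoid_map_ev[OF cX gf S et x]
   using S et x by (simp add: compose_def dual_monoid_map_ev[OF cX f S et' x] dual_monoid_map_ev[OF Y g S et mtD(1)[OF f S x]])
 qed
qed

lemma dual_monoid_map_inj:
 assumes X: "reflexive_monoid k R X" and Y: "reflexive_monoid k R Y"
 shows "inj_on (dual_monoid_map R X Y) (monoid_trans R X Y)"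
proof (rule inj_onI)
 fix \<psi> \<psi>' assume \<psi>: "\<psi> : monoid_trans R X Y" "\<psi>' : monoid_trans R X Y"
  and eq: "dual_monoid_map R X Y \<psi> = dual_monoid_map R X Y \<psi>'"
 note cX = reflexive_monoid_functor[OF X]
 show "\<psi> = \<psi>'" by (rule ev_determines[OF Y cX \<psi>])
   (simp add: eq flip: dual_monoid_map_ev[OF cX \<psi>(1)] dual_monoid_map_ev[OF cX \<psi>(2)])
qed

text \<open>For a point \<open>g\<close> of \<open>X\<close>, the value of \<open>\<phi> et\<close>
  at \<open>g\<close> is a natural homomorphism in the character \<open>et\<close> of
  \<open>Y\<close>, hence evaluation at a unique point of \<open>Y\<close>, which is taken as the
  image of \<open>g\<close>. The laws of the resulting morphism are checked by evaluating characters
  of \<open>Y\<close>.\<close>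

lemma dual_monoid_map_surj:
 assumes X: "reflexive_monoid k R X" and Y: "reflexive_monoid k R Y"
  and \<phi>: "\<phi> : monoid_trans R (dual_monoid R Y) (dual_monoid R X)"
 shows "\<exists>\<psi>\<in>monoid_trans R X Y. dual_monoid_map R X Y \<psi> = \<phi>"
proof -
 note cX = reflexive_monoid_functor[OF X] and cY = reflexive_monoid_functor[OF Y]
 obtain B mul unt pt where d: "dualizable R k B mul unt X pt" using reflexive_monoidD[OF X] by blast
 obtain B' mul' unt' pt' where d': "dualizable R k B' mul' unt' Y pt'" using reflexive_monoidD[OF Y] by blast
 note eX = dualizable.ev_facts[OF d] and eY = dualizable.ev_facts[OF d']
 note XD = comm_monoid_functorD[OF cX] and YD = comm_monoid_functorD[OF cY]
 note dX = comm_monoid_functorD[OF dual_monoid_comm_monoid_functor[OF cX]]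
  and dY = comm_monoid_functorD[OF dual_monoid_comm_monoid_functor[OF cY]]
 note m = mtD[OF \<phi>]
 have "\<exists>h\<in>vals Y S. \<forall>T\<in>Algs R. \<forall>f\<in>alg_hom R S T. \<forall>et\<in>vals (dual_monoid R Y) T.
   ev R Y T et (Ar Y S T f h) = ev R X T (\<phi> T et) (Ar X S T f g)"
  if S: "S : Algs R" and g: "g : vals X S" for S g
 proof (rule eY(10)[OF S], rule nathomI)
  fix T f assume T: "T : Algs R" and f: "f : alg_hom R S T"
  note fg = XD(4)[OF S T f g]
  show "ev R X T (\<phi> T \<one>\<^sub>(Ob (dual_monoid R Y) T)) (Ar X S T f g) = \<one>\<^sub>T"
   using m(4)[OF T] eX(4)[OF T fg] by simp
  fix et assume et: "et : vals (dual_monoid R Y) T"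
  show "ev R X T (\<phi> T et) (Ar X S T f g) : carrier T" by (rule eX(1)[OF T m(1)[OF T et] fg])
  show "ev R X U (\<phi> U (Ar (dual_monoid R Y) T U h et)) (Ar X S U (compose (carrier S) h f) g) =
    h (ev R X T (\<phi> T et) (Ar X S T f g))" if U: "U : Algs R" and h: "h : alg_hom R T U" for U h
   using eX(2)[OF T U h m(1)[OF T et] fg] m(2)[OF T U h et] XD(8)[OF S T U f h g] by simp
  show "ev R X T (\<phi> T (et \<otimes>\<^sub>(Ob (dual_monoid R Y) T) th)) (Ar X S T f g) =
   ev R X T (\<phi> T et) (Ar X S T f g) \<otimes>\<^sub>T ev R X T (\<phi> T th) (Ar X S T f g)"
   if th: "th : vals (dual_monoid R Y) T" for th
   using m(3)[OF T et th] eX(3)[OF T m(1)[OF T et] m(1)[OF T th] fg] by simp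
 qed
 then obtain \<psi> where \<psi>: "\<psi> S g : vals Y S"
  "[|T : Algs R; f : alg_hom R S T; et : vals (dual_monoid R Y) T|] ==>
   ev R Y T et (Ar Y S T f (\<psi> S g)) = ev R X T (\<phi> T et) (Ar X S T f g)"
  if "S : Algs R" "g : vals X S" for S g T f et by metis
 have \<psi>id: "ev R Y S et (\<psi> S g) = ev R X S (\<phi> S et) g"
  if "S : Algs R" "g : vals X S" "et : vals (dual_monoid R Y) S" for S g et
  using \<psi>(2)[OF that(1,2,1) id_alg_hom[OF that(1)] that(3)] YD(7)[OF that(1) \<psi>(1)[OF that(1,2)]] XD(7)[OF that(1,2)] by simp
 have mt: "(\<lambda>S\<in>Algs R. \<lambda>g\<in>vals X S. \<psi> S g) : monoid_trans R X Y"
 proof (rule mt_restrictI[OF cX])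
  fix S assume S: "S : Algs R"
  show "\<psi> S x : vals Y S" if "x : vals X S" for x by (rule \<psi>(1)[OF S that])
  show "\<psi> S (x \<otimes>\<^sub>(Ob X S) y) = \<psi> S x \<otimes>\<^sub>(Ob Y S) \<psi> S y" if xy: "x : vals X S" "y : vals X S" for x y
  proof (rule eY(7)[OF S \<psi>(1)[OF S XD(2)[OF S xy]] YD(2)[OF S \<psi>(1)[OF S xy(1)] \<psi>(1)[OF S xy(2)]]])
   fix T f et assume T: "T : Algs R" and f: "f : alg_hom R S T" and et: "et : vals (dual_monoid R Y) T"
   note p = \<psi>(1)[OF S xy(1)] \<psi>(1)[OF S xy(2)]
   show "ev R Y T et (Ar Y S T f (\<psi> S (x \<otimes>\<^sub>(Ob X S) y))) = ev R Y T et (Ar Y S T f (\<psi> S x \<otimes>\<^sub>(Ob Y S) \<psi> S y))"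
    by (simp add: \<psi>(2)[OF S XD(2)[OF S xy] T f et] YD(5)[OF S T f p] XD(5)[OF S T f xy]
      eY(5)[OF T et YD(4)[OF S T f p(1)] YD(4)[OF S T f p(2)]] \<psi>(2)[OF S _ T f et] xy
      eX(5)[OF T m(1)[OF T et] XD(4)[OF S T f xy(1)] XD(4)[OF S T f xy(2)]])
  qed
  show "\<psi> S \<one>\<^sub>(Ob X S) = \<one>\<^sub>(Ob Y S)"
  proof (rule eY(7)[OF S \<psi>(1)[OF S XD(3)[OF S]] YD(3)[OF S]])
   fix T f et assume T: "T : Algs R" and f: "f : alg_hom R S T" and et: "et : vals (dual_monoid R Y) T"
   show "ev R Y T et (Ar Y S T f (\<psi> S \<one>\<^sub>(Ob X S))) = ev R Y T et (Ar Y S T f \<one>\<^sub>(Ob Y S))"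
    by (simp add: \<psi>(2)[OF S XD(3)[OF S] T f et] XD(6)[OF S T f] YD(6)[OF S T f] eX(6)[OF T m(1)[OF T et]] eY(6)[OF T et])
  qed
 next
  fix S U h x assume S: "S : Algs R" and U: "U : Algs R" and h: "h : alg_hom R S U" and x: "x : vals X S"
  note hx = XD(4)[OF S U h x]
  show "\<psi> U (Ar X S U h x) = Ar Y S U h (\<psi> S x)"
  proof (rule eY(7)[OF U \<psi>(1)[OF U hx] YD(4)[OF S U h \<psi>(1)[OF S x]]])
   fix T f et assume T: "T : Algs R" and f: "f : alg_hom R U T" and et: "et : vals (dual_monoid R Y) T"
   have fh: "compose (carrier S) f h : alg_hom R S T" using f h S by simp
   show "ev R Y T et (Ar Y U T f (\<psi> U (Ar X S U h x))) = ev R Y T et (Ar Y U T f (Ar Y S U h (\<psi> S x)))"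
    using \<psi>(2)[OF S x T fh et]
    by (simp add: \<psi>(2)[OF U hx T f et] XD(8)[OF S U T h f x] YD(8)[OF S U T h f \<psi>(1)[OF S x]])
  qed
 qed
 moreover have "dual_monoid_map R X Y (\<lambda>S\<in>Algs R. \<lambda>g\<in>vals X S. \<psi> S g) = \<phi>"
  by (rule dual_ev_determines[OF X dual_monoid_comm_monoid_functor[OF cY] dual_monoid_map_mt[OF cX cY mt] \<phi>])
   (simp add: dual_monoid_map_ev[OF cX mt] \<psi>id)
 ultimately show ?thesis by blast
qed

text \<open>A point is a vector, that is a map from \<open>'u\<close> to \<open>'u\<close>, so the
  injection \<open>\<iota>\<close> codes the values of any such functor inside \<open>'v\<close>,
  however large their own type is.\<close>

lemma reflexive_transport:
 fixes \<iota> :: "('u => 'u) => 'v" and P :: "('u, 'w monoid, 'w) alg_functor"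
 assumes P: "reflexive_monoid k R P" and \<iota>: "inj \<iota>"
 obtains Q :: "('u, 'v monoid, 'v) alg_functor" and \<tau> where "reflexive_monoid k R Q"
  "\<And>T. T : Algs R ==> bij_betw (\<tau> T) (vals Q T) (vals P T)"
  "\<And>T a b. [|T : Algs R; a : vals Q T; b : vals Q T|] ==> \<tau> T (a \<otimes>\<^sub>(Ob Q T) b) = \<tau> T a \<otimes>\<^sub>(Ob P T) \<tau> T b"
  "\<And>T. T : Algs R ==> \<tau> T \<one>\<^sub>(Ob Q T) = \<one>\<^sub>(Ob P T)"
  "\<And>T U f a. [|T : Algs R; U : Algs R; f : alg_hom R T U; a : vals Q T|] ==>
   \<tau> U (Ar Q T U f a) = Ar P T U f (\<tau> T a)"
proof -
 obtain B mul unt pt where "dualizable R k B mul unt P pt" using P unfolding reflexive_monoid_def by blast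
 then interpret dualizable R k B mul unt P pt .
 define \<sigma> where "\<sigma> T g = \<iota> (pt T g)" for T g
 have \<sigma>: "inj_on (\<sigma> T) (pts T)" if "T : Algs R" for T
  using pt_inj[OF that] injD[OF \<iota>] by (auto simp: inj_on_def \<sigma>_def)
 define s where "s T = inv_into (pts T) (\<sigma> T)" for T
 define Q where "Q = \<lparr>Ob = \<lambda>T. \<lparr>carrier = \<sigma> T ` pts T, mult = (\<lambda>a b. \<sigma> T (s T a \<otimes>\<^sub>(Ob P T) s T b)), one = \<sigma> T \<one>\<^sub>(Ob P T)\<rparr>,
   Ar = \<lambda>T U f a. \<sigma> U (Ar P T U f (s T a))\<rparr>"
 have t: "dualizable R k B mul unt Q (\<lambda>T a. pt T (s T a))"
  unfolding Q_def s_def by (rule transport(1)) (rule \<sigma>)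
 have s: "s T (\<sigma> T g) = g" if "T : Algs R" "g : pts T" for T g
  using inv_into_f_f[OF \<sigma>[OF that(1)] that(2)] by (simp add: s_def)
 show thesis
 proof (rule that[of Q s])
  show "reflexive_monoid k R Q" using t unfolding reflexive_monoid_def by blast
  fix T assume T: "T : Algs R"
  show "bij_betw (s T) (vals Q T) (pts T)"
   using bij_betw_inv_into[of "\<sigma> T" "pts T" "\<sigma> T ` pts T"] \<sigma>[OF T] by (simp add: Q_def s_def bij_betw_def)
  show "s T \<one>\<^sub>(Ob Q T) = \<one>\<^sub>(Ob P T)" using s[OF T G_one[OF T]] by (simp add: Q_def)
  show "s T (a \<otimes>\<^sub>(Ob Q T) b) = s T a \<otimes>\<^sub>(Ob P T) s T b" if "a : vals Q T" "b : vals Q T" for a b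
   using that s[OF T] G_mult[OF T] by (auto simp: Q_def)
  show "s U (Ar Q T U f a) = Ar P T U f (s T a)"
   if "U : Algs R" "f : alg_hom R T U" "a : vals Q T" for U f a
   using that s[OF T] s[OF that(1)] Ar_closed[OF T that(1,2)] by (auto simp: Q_def)
 qed
qed

text \<open>Here \<open>Q\<close> is a copy of the dual of \<open>P\<close> with values in
  \<open>'v\<close>. An element of \<open>P\<close> acts on \<open>Q\<close> by evaluation, and
  since the pairing of \<open>P\<close> with its dual is perfect, this identifies \<open>P\<close>
  with the dual of \<open>Q\<close>.\<close>

lemma dual_essentially_surjective:
 fixes \<iota> :: "('u => 'u) => 'v" and P :: "('u, ('u alg => 'v => 'u) monoid, 'u alg => 'v => 'u) alg_functor"
 assumes P: "reflexive_monoid k R P" and \<iota>: "inj \<iota>"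
 shows "\<exists>Q :: ('u, 'v monoid, 'v) alg_functor. reflexive_monoid (\<not> k) R Q \<and>
  (\<exists>\<zeta>. isomorphism (monoid_functor_cat R Os) P (dual_monoid R Q) \<zeta>)"
proof -
 let ?dP = "dual_monoid R P"
 obtain Q :: "('u, 'v monoid, 'v) alg_functor" and \<tau> where Q: "reflexive_monoid (\<not> k) R Q"
  and \<tau>_bij: "\<And>T. T : Algs R ==> bij_betw (\<tau> T) (vals Q T) (vals ?dP T)"
  and \<tau>_mult: "\<And>T a b. [|T : Algs R; a : vals Q T; b : vals Q T|] ==> \<tau> T (a \<otimes>\<^sub>(Ob Q T) b) = \<tau> T a \<otimes>\<^sub>(Ob ?dP T) \<tau> T b"
  and \<tau>_one: "\<And>T. T : Algs R ==> \<tau> T \<one>\<^sub>(Ob Q T) = \<one>\<^sub>(Ob ?dP T)"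
  and \<tau>_nat: "\<And>T U f a. [|T : Algs R; U : Algs R; f : alg_hom R T U; a : vals Q T|] ==>
   \<tau> U (Ar Q T U f a) = Ar ?dP T U f (\<tau> T a)"
  by (rule reflexive_transport[OF reflexive_monoid_dual[OF P] \<iota>]) (rule that)
 note cP = reflexive_monoid_functor[OF P] and cQ = reflexive_monoid_functor[OF Q]
 note cdQ = dual_monoid_comm_monoid_functor[OF cQ]
 obtain B mul unt pt where d: "dualizable R k B mul unt P pt" using reflexive_monoidD[OF P] by blast
 obtain B' mul' unt' pt' where d': "dualizable R (\<not> k) B' mul' unt' Q pt'" using reflexive_monoidD[OF Q] by blast
 note eP = dualizable.ev_facts[OF d] and eQ = dualizable.ev_facts[OF d']
 note PD = comm_monoid_functorD[OF cP] and QD = comm_monoid_functorD[OF cQ]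
 note dQ = comm_monoid_functorD[OF cdQ] and dP = comm_monoid_functorD[OF dual_monoid_comm_monoid_functor[OF cP]]
 have \<tau>: "\<tau> T a : vals ?dP T" if "T : Algs R" "a : vals Q T" for T a
  using bij_betwE[OF \<tau>_bij[OF that(1)]] that(2) by blast
 have \<tau>_inj: "a = b" if "T : Algs R" "a : vals Q T" "b : vals Q T" "\<tau> T a = \<tau> T b" for T a b
  using \<tau>_bij[OF that(1)] that(2-4) by (auto simp: bij_betw_def inj_on_def)
 define t where "t T = inv_into (vals Q T) (\<tau> T)" for T
 have t: "t T th : vals Q T" "\<tau> T (t T th) = th" if "T : Algs R" "th : vals ?dP T" for T th
  using \<tau>_bij[OF that(1)] that(2) unfolding t_def bij_betw_def by (auto simp: inv_into_into f_inv_into_f)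
 have t\<tau>: "t T (\<tau> T a) = a" if "T : Algs R" "a : vals Q T" for T a
  using \<tau>_bij[OF that(1)] that(2) by (simp add: t_def bij_betw_def)
 have "\<exists>et\<in>vals (dual_monoid R Q) S. \<forall>T\<in>Algs R. \<forall>f\<in>alg_hom R S T. \<forall>a\<in>vals Q T.
   ev R Q T (Ar (dual_monoid R Q) S T f et) a = ev R P T (\<tau> T a) (Ar P S T f h)"
  if S: "S : Algs R" and h: "h : vals P S" for S h
 proof (rule eQ(9)[OF S], rule nathomI)
  fix T f assume T: "T : Algs R" and f: "f : alg_hom R S T"
  note fh = PD(4)[OF S T f h]
  show "ev R P T (\<tau> T \<one>\<^sub>(Ob Q T)) (Ar P S T f h) = \<one>\<^sub>T" by (simp add: \<tau>_one[OF T] eP(4)[OF T fh])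
  fix a assume a: "a : vals Q T"
  show "ev R P T (\<tau> T a) (Ar P S T f h) : carrier T" by (rule eP(1)[OF T \<tau>[OF T a] fh])
  show "ev R P U (\<tau> U (Ar Q T U g a)) (Ar P S U (compose (carrier S) g f) h) = g (ev R P T (\<tau> T a) (Ar P S T f h))"
   if U: "U : Algs R" and g: "g : alg_hom R T U" for U g
   using eP(2)[OF T U g \<tau>[OF T a] fh] by (simp add: \<tau>_nat[OF T U g a] PD(8)[OF S T U f g h])
  show "ev R P T (\<tau> T (a \<otimes>\<^sub>(Ob Q T) b)) (Ar P S T f h) =
    ev R P T (\<tau> T a) (Ar P S T f h) \<otimes>\<^sub>T ev R P T (\<tau> T b) (Ar P S T f h)" if b: "b : vals Q T" for b
   using eP(3)[OF T \<tau>[OF T a] \<tau>[OF T b] fh] by (simp add: \<tau>_mult[OF T a b])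
 qed
 then obtain \<zeta> where \<zeta>: "\<zeta> S h : vals (dual_monoid R Q) S"
  "[|T : Algs R; f : alg_hom R S T; a : vals Q T|] ==>
   ev R Q T (Ar (dual_monoid R Q) S T f (\<zeta> S h)) a = ev R P T (\<tau> T a) (Ar P S T f h)"
  if "S : Algs R" "h : vals P S" for S h T f a by metis
 have mt: "(\<lambda>S\<in>Algs R. \<lambda>h\<in>vals P S. \<zeta> S h) : monoid_trans R P (dual_monoid R Q)"
 proof (rule mt_restrictI[OF cP])
  fix S assume S: "S : Algs R"
  show "\<zeta> S x : vals (dual_monoid R Q) S" if "x : vals P S" for x by (rule \<zeta>(1)[OF S that])
  show "\<zeta> S (x \<otimes>\<^sub>(Ob P S) y) = \<zeta> S x \<otimes>\<^sub>(Ob (dual_monoid R Q) S) \<zeta> S y"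
   if xy: "x : vals P S" "y : vals P S" for x y
  proof (rule eQ(8)[OF S \<zeta>(1)[OF S PD(2)[OF S xy]] dQ(2)[OF S \<zeta>(1)[OF S xy(1)] \<zeta>(1)[OF S xy(2)]]])
   fix T f a assume T: "T : Algs R" and f: "f : alg_hom R S T" and a: "a : vals Q T"
   note p = \<zeta>(1)[OF S xy(1)] \<zeta>(1)[OF S xy(2)]
   show "ev R Q T (Ar (dual_monoid R Q) S T f (\<zeta> S (x \<otimes>\<^sub>(Ob P S) y))) a =
     ev R Q T (Ar (dual_monoid R Q) S T f (\<zeta> S x \<otimes>\<^sub>(Ob (dual_monoid R Q) S) \<zeta> S y)) a"
    by (simp add: \<zeta>(2)[OF S PD(2)[OF S xy] T f a] dQ(5)[OF S T f p] PD(5)[OF S T f xy]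
      eQ(3)[OF T dQ(4)[OF S T f p(1)] dQ(4)[OF S T f p(2)] a] \<zeta>(2)[OF S _ T f a] xy
      eP(5)[OF T \<tau>[OF T a] PD(4)[OF S T f xy(1)] PD(4)[OF S T f xy(2)]])
  qed
  show "\<zeta> S \<one>\<^sub>(Ob P S) = \<one>\<^sub>(Ob (dual_monoid R Q) S)"
  proof (rule eQ(8)[OF S \<zeta>(1)[OF S PD(3)[OF S]] dQ(3)[OF S]])
   fix T f a assume T: "T : Algs R" and f: "f : alg_hom R S T" and a: "a : vals Q T"
   show "ev R Q T (Ar (dual_monoid R Q) S T f (\<zeta> S \<one>\<^sub>(Ob P S))) a =
     ev R Q T (Ar (dual_monoid R Q) S T f \<one>\<^sub>(Ob (dual_monoid R Q) S)) a"
    by (simp add: \<zeta>(2)[OF S PD(3)[OF S] T f a] PD(6)[OF S T f] dQ(6)[OF S T f] eP(6)[OF T \<tau>[OF T a]] eQ(4)[OF T a])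
  qed
 next
  fix S U h x assume S: "S : Algs R" and U: "U : Algs R" and h: "h : alg_hom R S U" and x: "x : vals P S"
  note hx = PD(4)[OF S U h x]
  show "\<zeta> U (Ar P S U h x) = Ar (dual_monoid R Q) S U h (\<zeta> S x)"
  proof (rule eQ(8)[OF U \<zeta>(1)[OF U hx] dQ(4)[OF S U h \<zeta>(1)[OF S x]]])
   fix T f a assume T: "T : Algs R" and f: "f : alg_hom R U T" and a: "a : vals Q T"
   have fh: "compose (carrier S) f h : alg_hom R S T" using f h S by simp
   show "ev R Q T (Ar (dual_monoid R Q) U T f (\<zeta> U (Ar P S U h x))) a =
     ev R Q T (Ar (dual_monoid R Q) U T f (Ar (dual_monoid R Q) S U h (\<zeta> S x))) a" using \<zeta>(2)[OF S x T fh a]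
    by (simp add: \<zeta>(2)[OF U hx T f a] PD(8)[OF S U T h f x] dQ(8)[OF S U T h f \<zeta>(1)[OF S x]])
  qed
 qed
 have inj: "h = h'" if S: "S : Algs R" and h: "h : vals P S" "h' : vals P S" "\<zeta> S h = \<zeta> S h'" for S h h'
 proof (rule eP(7)[OF S h(1,2)])
  fix T f et assume T: "T : Algs R" and f: "f : alg_hom R S T" and et: "et : vals ?dP T"
  show "ev R P T et (Ar P S T f h) = ev R P T et (Ar P S T f h')"
   using \<zeta>(2)[OF S h(1) T f t(1)[OF T et]] \<zeta>(2)[OF S h(2) T f t(1)[OF T et]] by (simp add: t(2)[OF T et] h(3))
 qed
 \<comment> \<open>A character of \<open>Q\<close>, pulled back along \<open>t\<close>, is a natural
   homomorphism on the dual of \<open>P\<close>, hence evaluation at an element of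
   \<open>P\<close>.\<close>
 have surj: "\<exists>h\<in>vals P S. \<zeta> S h = et" if S: "S : Algs R" and et: "et : vals (dual_monoid R Q) S" for S et
 proof -
  have "\<exists>h\<in>vals P S. \<forall>T\<in>Algs R. \<forall>f\<in>alg_hom R S T. \<forall>th\<in>vals ?dP T.
   ev R P T th (Ar P S T f h) = ev R Q T (Ar (dual_monoid R Q) S T f et) (t T th)"
  proof (rule eP(10)[OF S], rule nathomI)
   fix T f assume T: "T : Algs R" and f: "f : alg_hom R S T"
   note fet = dQ(4)[OF S T f et]
   have t1: "t T \<one>\<^sub>(Ob ?dP T) = \<one>\<^sub>(Ob Q T)" using t\<tau>[OF T QD(3)[OF T]] by (simp add: \<tau>_one[OF T])
   show "ev R Q T (Ar (dual_monoid R Q) S T f et) (t T \<one>\<^sub>(Ob ?dP T)) = \<one>\<^sub>T"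
    by (simp add: t1 eQ(6)[OF T fet])
   fix th assume th: "th : vals ?dP T"
   note tth = t[OF T th]
   show "ev R Q T (Ar (dual_monoid R Q) S T f et) (t T th) : carrier T" by (rule eQ(1)[OF T fet tth(1)])
   show "ev R Q U (Ar (dual_monoid R Q) S U (compose (carrier S) g f) et) (t U (Ar ?dP T U g th)) =
     g (ev R Q T (Ar (dual_monoid R Q) S T f et) (t T th))"
    if U: "U : Algs R" and g: "g : alg_hom R T U" for U g
   proof -
    have "t U (Ar ?dP T U g th) = Ar Q T U g (t T th)"
     using \<tau>_nat[OF T U g tth(1)] t\<tau>[OF U QD(4)[OF T U g tth(1)]] by (simp add: tth(2))
    then show ?thesis using eQ(2)[OF T U g fet tth(1)] by (simp add: dQ(8)[OF S T U f g et])
   qed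
   show "ev R Q T (Ar (dual_monoid R Q) S T f et) (t T (th \<otimes>\<^sub>(Ob ?dP T) th')) =
     ev R Q T (Ar (dual_monoid R Q) S T f et) (t T th) \<otimes>\<^sub>T ev R Q T (Ar (dual_monoid R Q) S T f et) (t T th')"
    if th': "th' : vals ?dP T" for th'
   proof -
    note tth' = t[OF T th']
    have "t T (th \<otimes>\<^sub>(Ob ?dP T) th') = t T th \<otimes>\<^sub>(Ob Q T) t T th'"
     using \<tau>_mult[OF T tth(1) tth'(1)] t\<tau>[OF T QD(2)[OF T tth(1) tth'(1)]] by (simp add: tth(2) tth'(2))
    then show ?thesis using eQ(5)[OF T fet tth(1) tth'(1)] by simp
   qed
  qed
  then obtain h where h: "h : vals P S" "\<And>T f th. [|T : Algs R; f : alg_hom R S T; th : vals ?dP T|] ==>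
   ev R P T th (Ar P S T f h) = ev R Q T (Ar (dual_monoid R Q) S T f et) (t T th)" by blast
  have "\<zeta> S h = et"
  proof (rule eQ(8)[OF S \<zeta>(1)[OF S h(1)] et])
   fix T f a assume T: "T : Algs R" and f: "f : alg_hom R S T" and a: "a : vals Q T"
   show "ev R Q T (Ar (dual_monoid R Q) S T f (\<zeta> S h)) a = ev R Q T (Ar (dual_monoid R Q) S T f et) a"
    by (simp add: \<zeta>(2)[OF S h(1) T f a] h(2)[OF T f \<tau>[OF T a]] t\<tau>[OF T a])
  qed
  then show ?thesis using h(1) by blast
 qed
 have "isomorphism (monoid_functor_cat R Os) P (dual_monoid R Q) (\<lambda>S\<in>Algs R. \<lambda>h\<in>vals P S. \<zeta> S h)"
 proof (rule mt_isomorphism[OF cP cdQ mt])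
  fix S assume S: "S : Algs R"
  have "inj_on (\<zeta> S) (vals P S)" using inj[OF S] by (auto simp: inj_on_def)
  moreover have "\<zeta> S ` vals P S = vals (dual_monoid R Q) S" using \<zeta>(1)[OF S] surj[OF S] by blast
  ultimately show "bij_betw ((\<lambda>S\<in>Algs R. \<lambda>h\<in>vals P S. \<zeta> S h) S) (vals P S) (vals (dual_monoid R Q) S)"
   using S by (simp add: bij_betw_def cong: image_cong_simp inj_on_cong)
 qed
 then show ?thesis using Q by blast
qed

theorem reflexive_duality:
 fixes R :: "('u, 'm) ring_scheme" and \<iota> :: "('u => 'u) => 'v"
 assumes \<iota>: "inj \<iota>"
 shows "anti_equivalence
  (monoid_functor_cat R {G :: ('u, 'v monoid, 'v) alg_functor. reflexive_monoid k R G})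
  (monoid_functor_cat R {G. reflexive_monoid (\<not> k) R G}) (dual_monoid R) (dual_monoid_map R)"
proof (rule anti_equivalenceI)
 show "is_category (monoid_functor_cat R {G :: ('u, 'v monoid, 'v) alg_functor. reflexive_monoid k R G})"
  "is_category (monoid_functor_cat R {G :: ('u, ('u alg => 'v => 'u) monoid, 'u alg => 'v => 'u) alg_functor. reflexive_monoid (\<not> k) R G})"
  by (auto intro!: monoid_functor_category reflexive_monoid_functor)
 show "contravariant_functor
  (monoid_functor_cat R {G :: ('u, 'v monoid, 'v) alg_functor. reflexive_monoid k R G})
  (monoid_functor_cat R {G. reflexive_monoid (\<not> k) R G}) (dual_monoid R) (dual_monoid_map R)"
  unfolding contravariant_functor_def monoid_functor_cat_simps mem_Collect_eq
 proof (intro conjI ballI)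
  show "reflexive_monoid (\<not> k) R (dual_monoid R G)" if "G : {G. reflexive_monoid k R G}"
   for G :: "('u, 'v monoid, 'v) alg_functor" using that reflexive_monoid_dual by blast
 next
  fix G H :: "('u, 'v monoid, 'v) alg_functor" and f
  assume "G : {G. reflexive_monoid k R G}" "H : {G. reflexive_monoid k R G}" "f : monoid_trans R G H"
  then show "dual_monoid_map R G H f : monoid_trans R (dual_monoid R H) (dual_monoid R G)"
   by (simp add: dual_monoid_map_mt reflexive_monoid_functor)
 next
  fix G :: "('u, 'v monoid, 'v) alg_functor" assume "G : {G. reflexive_monoid k R G}"
  then show "dual_monoid_map R G G (\<lambda>T\<in>Algs R. \<lambda>x\<in>vals G T. x) =
    (\<lambda>T\<in>Algs R. \<lambda>x\<in>vals (dual_monoid R G) T. x)" by (intro dual_monoid_map_id) simp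
 next
  fix X Y Z :: "('u, 'v monoid, 'v) alg_functor" and f g
  assume "X : {G. reflexive_monoid k R G}" "Y : {G. reflexive_monoid k R G}" "Z : {G. reflexive_monoid k R G}"
   and "f : monoid_trans R X Y" "g : monoid_trans R Y Z"
  then show "dual_monoid_map R X Z (\<lambda>T\<in>Algs R. compose (vals X T) (g T) (f T)) =
    (\<lambda>T\<in>Algs R. compose (vals (dual_monoid R Z) T) (dual_monoid_map R X Y f T) (dual_monoid_map R Y Z g T))"
   by (intro dual_monoid_map_compose) (auto intro: reflexive_monoid_functor)
 qed
next
 fix X Y :: "('u, 'v monoid, 'v) alg_functor"
 assume "X : Obj (monoid_functor_cat R {G. reflexive_monoid k R G})"
  "Y : Obj (monoid_functor_cat R {G. reflexive_monoid k R G})"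
 then have X: "reflexive_monoid k R X" and Y: "reflexive_monoid k R Y" by simp_all
 note c = reflexive_monoid_functor[OF X] reflexive_monoid_functor[OF Y]
 show "bij_betw (dual_monoid_map R X Y) (Mor (monoid_functor_cat R {G. reflexive_monoid k R G}) X Y)
   (Mor (monoid_functor_cat R {G. reflexive_monoid (\<not> k) R G}) (dual_monoid R Y) (dual_monoid R X))"
  unfolding bij_betw_def monoid_functor_cat_simps
  using dual_monoid_map_inj[OF X Y] dual_monoid_map_surj[OF X Y] dual_monoid_map_mt[OF c] by blast
next
 fix P :: "('u, ('u alg => 'v => 'u) monoid, 'u alg => 'v => 'u) alg_functor"
 assume "P : Obj (monoid_functor_cat R {G. reflexive_monoid (\<not> k) R G})"
 then have "reflexive_monoid (\<not> k) R P" by simp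
 from dual_essentially_surjective[OF this \<iota>]
 show "\<exists>X\<in>Obj (monoid_functor_cat R {G :: ('u, 'v monoid, 'v) alg_functor. reflexive_monoid k R G}).
   \<exists>f. isomorphism (monoid_functor_cat R {G. reflexive_monoid (\<not> k) R G}) P (dual_monoid R X) f" by simp
qed

section \<open>Tensor products and free modules\<close>

definition addmap :: "('a, 'x) ring_scheme => ('b, 'y) ring_scheme => ('a => 'b) => bool" where
 "addmap A A' h \<longleftrightarrow> (\<forall>x\<in>carrier A. h x : carrier A') \<and>
   (\<forall>x\<in>carrier A. \<forall>y\<in>carrier A. h (x \<oplus>\<^sub>A y) = h x \<oplus>\<^sub>A' h y)"

lemma addmapD:
 assumes "addmap A A' h"
 shows "x : carrier A ==> h x : carrier A'"
  "[|x : carrier A; y : carrier A|] ==> h (x \<oplus>\<^sub>A y) = h x \<oplus>\<^sub>A' h y"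
 using assms unfolding addmap_def by blast+

lemma addmap_zero_minus:
 assumes "addmap A A' h" "abelian_group A" "abelian_group A'"
 shows "h \<zero>\<^sub>A = \<zero>\<^sub>A'" "x : carrier A ==> h (\<ominus>\<^sub>A x) = \<ominus>\<^sub>A' h x"
proof -
 interpret A: abelian_group A by fact
 interpret A': abelian_group A' by fact
 have "group_hom (add_monoid A) (add_monoid A') h"
  using addmapD[OF assms(1)] by (intro group_hom.intro group_hom_axioms.intro homI A.a_group A'.a_group) auto
 then interpret h: group_hom "add_monoid A" "add_monoid A'" h .
 show "h \<zero>\<^sub>A = \<zero>\<^sub>A'" using h.hom_one by simp
 show "x : carrier A ==> h (\<ominus>\<^sub>A x) = \<ominus>\<^sub>A' h x" using h.hom_inv by (simp add: a_inv_def)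
qed

definition tens where
 "tens R M S m s = tensor_class R M S (frag_of (m, s))"

locale tensor_prod = M: module R M + S: algebra R S
 for R :: "('a, 'm) ring_scheme" and M :: "('a, 'b, 'x) module_scheme" and S :: "('a, 'c, 'y) module_scheme"
begin

abbreviation "P \<equiv> tensor R M S"
abbreviation "cl \<equiv> tensor_class R M S"
abbreviation "N \<equiv> tensor_rel R M S"
abbreviation "tn \<equiv> tens R M S"
definition frags :: "(('b \<times> 'c) \<Rightarrow>\<^sub>0 int) set" where
 "frags = {z. Poly_Mapping.keys z \<subseteq> carrier M \<times> carrier S}"

lemma carrier_pre: "carrier (tensor_pre M S) = frags" by (auto simp: tensor_pre_def frags_def)

lemma frags_closed:
 "[|x : frags; y : frags|] ==> x + y : frags" "[|x : frags; y : frags|] ==> x - y : frags"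
 "x : frags ==> - x : frags" "0 : frags" "[|m : carrier M; s : carrier S|] ==> frag_of (m, s) : frags"
 using keys_add[of x y] keys_diff[of x y] by (auto simp: keys_minus frags_def)

lemma N_subgroup: "subgroup N (tensor_pre M S)" unfolding tensor_rel_def
 by (rule group.generate_is_subgroup) (auto simp: tensor_pre_def carrier_pre[unfolded tensor_pre_def]
  simp del: carrier_free_Abelian_group_iff intro!: frags_closed)

lemma N_facts: "N \<subseteq> frags" "0 : N" "[|x : N; y : N|] ==> x + y : N" "x : N ==> - x : N"
proof -
 interpret subgroup N "tensor_pre M S" by (rule N_subgroup)
 show sub: "N \<subseteq> frags" using subset by (simp add: carrier_pre)
 show "0 : N" "[|x : N; y : N|] ==> x + y : N" using one_closed m_closed by (simp_all add: tensor_pre_def)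
 show "x : N ==> - x : N" using m_inv_closed[of x] sub by (auto simp: tensor_pre_def frags_def subset_iff)
qed

lemma cl_eq: "cl z = {n + z |n. n : N}" by (auto simp: tensor_class_def r_coset_def tensor_pre_def)

lemma cl_eq_iff: "cl x = cl y \<longleftrightarrow> x - y : N"
proof
 assume "cl x = cl y"
 moreover have "x : cl x" using N_facts(2) by (force simp: cl_eq)
 ultimately show "x - y : N" by (auto simp: cl_eq)
next
 assume xy: "x - y : N"
 have yx: "y - x : N" using N_facts(4)[OF xy] by simp
 have "n + x = (n + (x - y)) + y" "n + y = (n + (y - x)) + x" for n by simp_all
 then show "cl x = cl y" unfolding cl_eq using N_facts(3) xy yx by blast
qed

lemma cl_self: "z : cl z" using N_facts(2) by (force simp: cl_eq)

lemma cl_mem: "x : cl z ==> cl x = cl z" by (auto simp: cl_eq_iff) (auto simp: cl_eq)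

lemma P_carrier: "carrier P = cl ` frags" by (auto simp: tensor_def FactGroup_def RCOSETS_def tensor_class_def carrier_pre)

lemma P_add: "cl x \<oplus>\<^sub>P cl y = cl (x + y)"
proof -
 have "cl x \<oplus>\<^sub>P cl y = {a + b |a b. a : cl x \<and> b : cl y}"
  by (auto simp: tensor_def FactGroup_def set_mult_def tensor_pre_def)
 also have "\<dots> = cl (x + y)"
 proof (intro equalityI subsetI)
  fix c assume "c : {a + b |a b. a : cl x \<and> b : cl y}"
  then obtain n m where "n : N" "m : N" "c = (n + m) + (x + y)" by (auto simp: cl_eq algebra_simps)
  then show "c : cl (x + y)" unfolding cl_eq using N_facts(3) by blast
 next
  fix c assume "c : cl (x + y)"
  then obtain n where n: "n : N" "c = (n + x) + y" by (auto simp: cl_eq algebra_simps)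
  have "n + x : cl x" "y : cl y" using n cl_self by (auto simp: cl_eq)
  then show "c : {a + b |a b. a : cl x \<and> b : cl y}" using n by blast
 qed
 finally show ?thesis .
qed

lemma P_zero: "\<zero>\<^sub>P = cl 0" by (auto simp: tensor_def FactGroup_def cl_eq)

lemma P_abelian_group: "abelian_group P"
proof (rule abelian_groupI)
 fix x assume "x : carrier P"
 then obtain z where "z : frags" "x = cl z" by (auto simp: P_carrier)
 then have "cl (- z) : carrier P \<and> cl (- z) \<oplus>\<^sub>P x = \<zero>\<^sub>P" using frags_closed(3) by (auto simp: P_carrier P_add P_zero)
 then show "\<exists>y\<in>carrier P. y \<oplus>\<^sub>P x = \<zero>\<^sub>P" by blast
qed (use frags_closed in "auto simp: P_carrier P_add P_zero add_ac")

sublocale P: abelian_group P by (rule P_abelian_group)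

lemma P_minus: assumes "x : frags" "y : frags" shows "cl (x - y) = cl x \<ominus>\<^sub>P cl y"
proof -
 have c: "cl x : carrier P" "cl y : carrier P" "cl (x - y) : carrier P"
  using assms frags_closed(2) by (auto simp: P_carrier)
 have "cl (x - y) \<oplus>\<^sub>P cl y = cl x" by (simp add: P_add)
 then show ?thesis using c by (metis P.minus_eq P.r_neg1 P.a_comm P.a_inv_closed)
qed

lemma tn_closed [simp]: "[|m : carrier M; s : carrier S|] ==> tn m s : carrier P"
 using frags_closed(5) by (auto simp: tens_def P_carrier)

lemma rel_eq: assumes "z - a - b : N" shows "cl z = cl a \<oplus>\<^sub>P cl b"
 using assms by (simp add: P_add cl_eq_iff algebra_simps)

lemma tn_add_left:
 assumes "m : carrier M" "n : carrier M" "s : carrier S"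
 shows "tn (m \<oplus>\<^sub>M n) s = tn m s \<oplus>\<^sub>P tn n s"
 unfolding tens_def tensor_rel_def by (rule rel_eq) (use assms in "auto simp: tensor_rel_def intro!: generate.incl")

lemma tn_add_right:
 assumes "m : carrier M" "s : carrier S" "t : carrier S"
 shows "tn m (s \<oplus>\<^sub>S t) = tn m s \<oplus>\<^sub>P tn m t"
 unfolding tens_def tensor_rel_def by (rule rel_eq) (use assms in "auto simp: tensor_rel_def intro!: generate.incl")

lemma tn_balanced:
 assumes "r : carrier R" "m : carrier M" "s : carrier S"
 shows "tn (r \<odot>\<^sub>M m) s = tn m (r \<odot>\<^sub>S s)"
 unfolding tens_def cl_eq_iff tensor_rel_def by (rule generate.incl) (use assms in auto)

lemma P_induct [consumes 1, case_names zero diff tens]: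
 assumes "X : carrier P" "Q \<zero>\<^sub>P"
  "\<And>X Y. [|X : carrier P; Y : carrier P; Q X; Q Y|] ==> Q (X \<ominus>\<^sub>P Y)"
  "\<And>m s. [|m : carrier M; s : carrier S|] ==> Q (tn m s)"
 shows "Q X"
proof -
 obtain z where z: "Poly_Mapping.keys z \<subseteq> carrier M \<times> carrier S" "X = cl z"
  using assms(1) by (auto simp: P_carrier frags_def)
 from z(1) have "Q (cl z)"
 proof (rule free_Abelian_group_induct, goal_cases)
  case (2 x y)
  have "cl x : carrier P" "cl y : carrier P" using 2(1,2) by (auto simp: P_carrier frags_def)
  then have "Q (cl x \<ominus>\<^sub>P cl y)" using 2 by (intro assms(3))
  then show ?case using P_minus[of x y] 2(1,2) by (simp add: frags_def)
 next
  case (3 a)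
  then show ?case using assms(4) by (cases a) (auto simp: tens_def)
 qed (use assms(2) in "simp add: P_zero")
 then show ?thesis using z by simp
qed

lemma addmap_eqI:
 assumes h: "addmap P A h" and h': "addmap P A h'" and A: "abelian_group A"
  and eq: "\<And>m s. [|m : carrier M; s : carrier S|] ==> h (tn m s) = h' (tn m s)" and X: "X : carrier P"
 shows "h X = h' X" using X
proof (induction rule: P_induct)
 case zero
 then show ?case using addmap_zero_minus[OF h P_abelian_group A] addmap_zero_minus[OF h' P_abelian_group A] by simp
next
 case (diff X Y)
 then show ?case
  using addmapD[OF h] addmapD[OF h'] addmap_zero_minus[OF h P_abelian_group A] addmap_zero_minus[OF h' P_abelian_group A]
  by (simp add: P.minus_eq)
qed (rule eq)

definition balanced :: "('d, 'z) ring_scheme => ('b => 'c => 'd) => bool" where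
 "balanced A g \<longleftrightarrow> (\<forall>m\<in>carrier M. \<forall>s\<in>carrier S. g m s : carrier A) \<and>
  (\<forall>m\<in>carrier M. \<forall>n\<in>carrier M. \<forall>s\<in>carrier S. g (m \<oplus>\<^sub>M n) s = g m s \<oplus>\<^sub>A g n s) \<and>
  (\<forall>m\<in>carrier M. \<forall>s\<in>carrier S. \<forall>t\<in>carrier S. g m (s \<oplus>\<^sub>S t) = g m s \<oplus>\<^sub>A g m t) \<and>
  (\<forall>r\<in>carrier R. \<forall>m\<in>carrier M. \<forall>s\<in>carrier S. g (r \<odot>\<^sub>M m) s = g m (r \<odot>\<^sub>S s))"

lemma balancedI:
 assumes "\<And>m s. [|m : carrier M; s : carrier S|] ==> g m s : carrier A"
  "\<And>m n s. [|m : carrier M; n : carrier M; s : carrier S|] ==> g (m \<oplus>\<^sub>M n) s = g m s \<oplus>\<^sub>A g n s"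
  "\<And>m s t. [|m : carrier M; s : carrier S; t : carrier S|] ==> g m (s \<oplus>\<^sub>S t) = g m s \<oplus>\<^sub>A g m t"
  "\<And>r m s. [|r : carrier R; m : carrier M; s : carrier S|] ==> g (r \<odot>\<^sub>M m) s = g m (r \<odot>\<^sub>S s)"
 shows "balanced A g" unfolding balanced_def by (intro conjI ballI) (rule assms; assumption)+

text \<open>The balanced map extends to the free abelian group on pairs, and the three families of
  relations lie in the kernel of the extension.\<close>

lemma universal:
 assumes A: "abelian_group A" and g: "balanced A g"
 shows "\<exists>h. addmap P A h \<and> (\<forall>m\<in>carrier M. \<forall>s\<in>carrier S. h (tn m s) = g m s)"
proof -
 interpret A: abelian_group A by fact
 note g = g[unfolded balanced_def]
 have "case_prod g ` (carrier M \<times> carrier S) \<subseteq> carrier (add_monoid A)" using g by auto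
 from comm_group.free_Abelian_group_universal[OF A.a_comm_group this]
 obtain h where h: "h : hom (tensor_pre M S) (add_monoid A)"
  "\<And>x. x : carrier M \<times> carrier S ==> h (frag_of x) = case_prod g x" unfolding tensor_pre_def by blast
 have gr: "group (tensor_pre M S)" by (simp add: tensor_pre_def)
 interpret h: group_hom "tensor_pre M S" "add_monoid A" h
  using h(1) gr A.a_group by (simp add: group_hom_def group_hom_axioms_def)
 have hc: "h x : carrier A" if "x : frags" for x using h.hom_closed[of x] that by (simp add: carrier_pre)
 have ha: "h (x + y) = h x \<oplus>\<^sub>A h y" if "x : frags" "y : frags" for x y
 proof -
  have "h (x \<otimes>\<^sub>(tensor_pre M S) y) = h x \<oplus>\<^sub>A h y" using h.hom_mult[of x y] that by (simp add: carrier_pre)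
  then show ?thesis by (simp add: tensor_pre_def)
 qed
 have h0: "h 0 = \<zero>\<^sub>A" using h.hom_one by (simp add: tensor_pre_def)
 have hd: "h (x - y) = h x \<ominus>\<^sub>A h y" if "x : frags" "y : frags" for x y
 proof -
  have "h (x - y) \<oplus>\<^sub>A h y = h x" using ha[OF frags_closed(2)[OF that] that(2)] by simp
  then show ?thesis using hc[OF that(1)] hc[OF that(2)] hc[OF frags_closed(2)[OF that]]
   by (metis A.minus_eq A.r_neg1 A.a_comm A.a_inv_closed)
 qed
 have fr: "h (frag_of (m, s)) = g m s" "frag_of (m, s) : frags" if "m : carrier M" "s : carrier S" for m s
  using h(2)[of "(m, s)"] that frags_closed(5) by auto
 have cancel: "a \<oplus>\<^sub>A b \<ominus>\<^sub>A a \<ominus>\<^sub>A b = \<zero>\<^sub>A" if "a : carrier A" "b : carrier A" for a b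
 proof -
  have "a \<oplus>\<^sub>A b \<ominus>\<^sub>A a = b"
   using that A.a_comm[of "a \<oplus>\<^sub>A b" "\<ominus>\<^sub>A a"] by (simp add: A.minus_eq A.r_neg1)
  then show ?thesis using that by (simp add: A.minus_eq A.r_neg)
 qed
 have kern: "subgroup (kernel (tensor_pre M S) (add_monoid A) h) (tensor_pre M S)" by (rule h.subgroup_kernel)
 have k: "h n = \<zero>\<^sub>A" if "n : N" for n
 proof -
  have "N \<subseteq> kernel (tensor_pre M S) (add_monoid A) h" unfolding tensor_rel_def
  proof (rule group.generate_subgroup_incl[OF gr _ kern], intro subsetI, elim UnE)
   fix z assume "z : {frag_of (x \<oplus>\<^sub>M y, s) - frag_of (x, s) - frag_of (y, s) |x y s. x : carrier M \<and> y : carrier M \<and> s : carrier S}"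
   then obtain x y s where z: "z = frag_of (x \<oplus>\<^sub>M y, s) - frag_of (x, s) - frag_of (y, s)"
    "x : carrier M" "y : carrier M" "s : carrier S" by blast
   have m: "x \<oplus>\<^sub>M y : carrier M" using z by simp
   have "z : frags" unfolding z(1) by (intro frags_closed z m)
   moreover have "h z = \<zero>\<^sub>A" using z(2-4) m g by (simp add: z(1) hd frags_closed fr cancel)
   ultimately show "z : kernel (tensor_pre M S) (add_monoid A) h" by (simp add: kernel_def carrier_pre)
  next
   fix z assume "z : {frag_of (x, s \<oplus>\<^sub>S t) - frag_of (x, s) - frag_of (x, t) |x s t. x : carrier M \<and> s : carrier S \<and> t : carrier S}"
   then obtain x s t where z: "z = frag_of (x, s \<oplus>\<^sub>S t) - frag_of (x, s) - frag_of (x, t)"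
    "x : carrier M" "s : carrier S" "t : carrier S" by blast
   have m: "s \<oplus>\<^sub>S t : carrier S" using z by simp
   have "z : frags" unfolding z(1) by (intro frags_closed z m)
   moreover have "h z = \<zero>\<^sub>A" using z(2-4) m g by (simp add: z(1) hd frags_closed fr cancel)
   ultimately show "z : kernel (tensor_pre M S) (add_monoid A) h" by (simp add: kernel_def carrier_pre)
  next
   fix z assume "z : {frag_of (r \<odot>\<^sub>M x, s) - frag_of (x, r \<odot>\<^sub>S s) |r x s. r : carrier R \<and> x : carrier M \<and> s : carrier S}"
   then obtain r x s where z: "z = frag_of (r \<odot>\<^sub>M x, s) - frag_of (x, r \<odot>\<^sub>S s)"
    "r : carrier R" "x : carrier M" "s : carrier S" by blast
   have m: "r \<odot>\<^sub>M x : carrier M" "r \<odot>\<^sub>S s : carrier S" using z by simp_all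
   have "z : frags" unfolding z(1) by (intro frags_closed z m)
   moreover have "h z = \<zero>\<^sub>A" using z(2-4) m g by (simp add: z(1) hd frags_closed fr A.minus_eq A.r_neg)
   ultimately show "z : kernel (tensor_pre M S) (add_monoid A) h" by (simp add: kernel_def carrier_pre)
  qed
  then show ?thesis using that by (auto simp: kernel_def)
 qed
 \<comment> \<open>The extension is constant on cosets, so any representative may be chosen.\<close>
 define h' where "h' X = h (SOME x. x : X)" for X
 have h': "h' (cl z) = h z" if "z : frags" for z
 proof -
  obtain n where n: "n : N" "(SOME x. x : cl z) = n + z"
   using someI[of "\<lambda>x. x : cl z" z] cl_self by (auto simp: cl_eq)
  then show ?thesis using ha[of n z] N_facts(1) that k[OF n(1)] hc[OF that] by (auto simp: h'_def)
 qed
 have "addmap P A h'" unfolding addmap_def P_carrier using frags_closed(1) by (auto simp: h' P_add hc ha)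
 moreover have "h' (tn m s) = g m s" if "m : carrier M" "s : carrier S" for m s
  unfolding tens_def using h'[OF fr(2)[OF that]] fr(1)[OF that] by simp
 ultimately show ?thesis by blast
qed

text \<open>A map on representatives that satisfies the relations of the tensor product is constant on
 each coset, so the unions in the definition of the operations are evaluated on any element.\<close>

lemma lift_unique:
 assumes h: "addmap P A h" and A: "abelian_group A"
  and zero: "\<phi> 0 = \<zero>\<^sub>A" and diff: "\<And>x y. [|x : frags; y : frags; \<phi> x = h (cl x); \<phi> y = h (cl y)|] ==> \<phi> (x - y) = \<phi> x \<ominus>\<^sub>A \<phi> y"
  and of: "\<And>m s. [|m : carrier M; s : carrier S|] ==> \<phi> (frag_of (m, s)) = h (tn m s)"
  and z: "z : frags"
 shows "\<phi> z = h (cl z)"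
proof -
 note h0 = addmap_zero_minus[OF h P_abelian_group A]
 interpret A: abelian_group A by fact
 from z have "Poly_Mapping.keys z \<subseteq> carrier M \<times> carrier S" by (simp add: frags_def)
 then show ?thesis
 proof (rule free_Abelian_group_induct, goal_cases)
  case (2 x y)
  have c: "x : frags" "y : frags" "cl x : carrier P" "cl y : carrier P" using 2(1,2) by (auto simp: P_carrier frags_def)
  then show ?case using diff[OF c(1,2) 2(3,4)] 2(3,4) P_minus[OF c(1,2)] h0 addmapD[OF h]
   by (simp add: P.minus_eq A.minus_eq)
 next
  case (3 a)
  then show ?case using of by (cases a) (auto simp: tens_def)
 qed (use zero h0 in "simp add: P_zero")
qed

lemma UN_lift:
 assumes "X : carrier P" "\<And>z. z : frags ==> \<phi> z = h (cl z)"
 shows "(\<Union>x\<in>X. \<phi> x) = h X"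
proof -
 obtain z where z: "z : frags" "X = cl z" using assms(1) by (auto simp: P_carrier)
 have "x : frags" if "x : cl z" for x using that N_facts(1) frags_closed(1) z(1) unfolding cl_eq by blast
 then have "\<phi> x = h X" if "x : X" for x using that assms(2)[of x] cl_mem[of x z] z by simp
 then show ?thesis using cl_self[of z] z by auto
qed

end

lemma addmapI:
 assumes "\<And>x. x : carrier A ==> h x : carrier A'"
  "\<And>x y. [|x : carrier A; y : carrier A|] ==> h (x \<oplus>\<^sub>A y) = h x \<oplus>\<^sub>A' h y"
 shows "addmap A A' h" using assms unfolding addmap_def by blast

lemma keys_frag_extend_subset:
 "(\<And>i. i : Poly_Mapping.keys c ==> Poly_Mapping.keys (f i) \<subseteq> K) ==> Poly_Mapping.keys (frag_extend f c) \<subseteq> K"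
 using keys_frag_extend[of f c] by blast

context tensor_prod
begin

text \<open>The universal property supplies an additive map with the right values on elementary
  tensors; \<open>lift_unique\<close> and \<open>UN_lift\<close> identify it with the union by which
  scalar multiplication is defined.\<close>

lemma P_smult:
 assumes s: "s : carrier S"
 shows "addmap P P ((\<odot>\<^sub>P) s)" "[|m : carrier M; t : carrier S|] ==> s \<odot>\<^sub>P tn m t = tn m (s \<otimes>\<^sub>S t)"
proof -
 have "balanced P (\<lambda>m t. tn m (s \<otimes>\<^sub>S t))"
  by (rule balancedI) (use s in "auto simp: tn_add_left tn_add_right tn_balanced S.r_distr S.smult_assoc2 S.m_lcomm
    S.m_comm[of s]")
 from universal[OF P_abelian_group this] obtain h where
  h: "addmap P P h" "\<And>m t. [|m : carrier M; t : carrier S|] ==> h (tn m t) = tn m (s \<otimes>\<^sub>S t)" by blast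
 let ?\<phi> = "\<lambda>x. frag_extend (\<lambda>(m, t). frag_of (m, s \<otimes>\<^sub>S t)) x"
 have fr: "?\<phi> z : frags" if "z : frags" for z unfolding frags_def mem_Collect_eq
  by (rule keys_frag_extend_subset) (use that s in "auto simp: frags_def split: prod.splits")
 have "cl (?\<phi> z) = h (cl z)" if "z : frags" for z by (rule lift_unique[OF h(1) P_abelian_group _ _ _ that])
   (use h(2) in \<open>simp_all add: P_zero frag_extend_diff P_minus fr tens_def\<close>)
 then have eq: "s \<odot>\<^sub>P X = h X" if "X : carrier P" for X
  using UN_lift[OF that, of "\<lambda>z. cl (?\<phi> z)" h] by (simp add: tensor_def)
 show "addmap P P ((\<odot>\<^sub>P) s)" by (rule addmapI) (use eq addmapD[OF h(1)] in auto)
 show "[|m : carrier M; t : carrier S|] ==> s \<odot>\<^sub>P tn m t = tn m (s \<otimes>\<^sub>S t)" using eq h(2) by simp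
qed

lemma smult_closed [simp]: "[|s : carrier S; X : carrier P|] ==> s \<odot>\<^sub>P X : carrier P"
 using addmapD(1)[OF P_smult(1)] by blast

lemma addmap_id: "addmap P P (\<lambda>X. X)" by (rule addmapI) auto

lemma addmap_add:
 assumes "addmap P A h" "addmap P A h'" "abelian_group A" shows "addmap P A (\<lambda>X. h X \<oplus>\<^sub>A h' X)"
proof -
 interpret A: abelian_group A by fact
 show ?thesis by (rule addmapI) (auto simp: addmapD[OF assms(1)] addmapD[OF assms(2)] A.a_ac)
qed

lemma addmap_comp: "[|addmap A A' h; addmap A' A'' h'|] ==> addmap A A'' (\<lambda>X. h' (h X))"
 by (rule addmapI) (auto simp: addmapD)

lemma P_module: "module S P"
proof -
 have sc: "(s \<oplus>\<^sub>S t) \<odot>\<^sub>P X = s \<odot>\<^sub>P X \<oplus>\<^sub>P t \<odot>\<^sub>P X" "(s \<otimes>\<^sub>S t) \<odot>\<^sub>P X = s \<odot>\<^sub>P (t \<odot>\<^sub>P X)" "\<one>\<^sub>S \<odot>\<^sub>P X = X"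
  if "s : carrier S" "t : carrier S" and X: "X : carrier P" for s t X
 proof -
  show "(s \<oplus>\<^sub>S t) \<odot>\<^sub>P X = s \<odot>\<^sub>P X \<oplus>\<^sub>P t \<odot>\<^sub>P X"
   by (rule addmap_eqI[OF P_smult(1) addmap_add[OF P_smult(1) P_smult(1) P_abelian_group] P_abelian_group _ X])
    (use that in "auto simp: P_smult(2) S.l_distr tn_add_right")
  show "(s \<otimes>\<^sub>S t) \<odot>\<^sub>P X = s \<odot>\<^sub>P (t \<odot>\<^sub>P X)"
   by (rule addmap_eqI[OF P_smult(1) addmap_comp[OF P_smult(1) P_smult(1)] P_abelian_group _ X])
    (use that in "auto simp: P_smult(2) S.m_assoc")
  show "\<one>\<^sub>S \<odot>\<^sub>P X = X"
   by (rule addmap_eqI[OF P_smult(1) addmap_id P_abelian_group _ X]) (use that in "auto simp: P_smult(2)")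
 qed
 show ?thesis
  by (rule moduleI) (auto simp: algebra.M_cring[OF S.algebra_axioms] P_abelian_group sc(1,2)
   sc(3)[of "\<one>\<^sub>S" "\<one>\<^sub>S"] addmapD(2)[OF P_smult(1)])
qed

end

lemma tensor_map:
 assumes "tensor_prod R M S" "tensor_prod R M' S'"
  and g: "\<And>m. m : carrier M ==> g m : carrier M'" "\<And>m n. [|m : carrier M; n : carrier M|] ==> g (m \<oplus>\<^sub>M n) = g m \<oplus>\<^sub>M' g n"
   "\<And>r m. [|r : carrier R; m : carrier M|] ==> g (r \<odot>\<^sub>M m) = r \<odot>\<^sub>M' g m"
  and f: "\<And>m. m : carrier S ==> f m : carrier S'" "\<And>m n. [|m : carrier S; n : carrier S|] ==> f (m \<oplus>\<^sub>S n) = f m \<oplus>\<^sub>S' f n"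
   "\<And>r m. [|r : carrier R; m : carrier S|] ==> f (r \<odot>\<^sub>S m) = r \<odot>\<^sub>S' f m"
 shows "addmap (tensor R M S) (tensor R M' S') (tensor_map R M S M' S' g f)"
  "[|m : carrier M; s : carrier S|] ==> tensor_map R M S M' S' g f (tens R M S m s) = tens R M' S' (g m) (f s)"
proof -
 interpret T: tensor_prod R M S by fact
 interpret T': tensor_prod R M' S' by fact
 have "T.balanced T'.P (\<lambda>m s. T'.tn (g m) (f s))"
  by (rule T.balancedI) (auto simp: g f T'.tn_add_left T'.tn_add_right T'.tn_balanced)
 from T.universal[OF T'.P_abelian_group this] obtain h where
  h: "addmap T.P T'.P h" "\<And>m t. [|m : carrier M; t : carrier S|] ==> h (T.tn m t) = T'.tn (g m) (f t)" by blast
 let ?\<phi> = "\<lambda>x. frag_extend (\<lambda>(m, t). frag_of (g m, f t)) x"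
 have fr: "?\<phi> z : T'.frags" if "z : T.frags" for z unfolding T'.frags_def mem_Collect_eq
  by (rule keys_frag_extend_subset) (use that g(1) f(1) in "auto simp: T.frags_def split: prod.splits")
 have "T'.cl (?\<phi> z) = h (T.cl z)" if "z : T.frags" for z
  by (rule T.lift_unique[OF h(1) T'.P_abelian_group _ _ _ that])
   (use h(2) in \<open>simp_all add: T'.P_zero frag_extend_diff T'.P_minus fr tens_def\<close>)
 then have eq: "tensor_map R M S M' S' g f X = h X" if "X : carrier T.P" for X
  using T.UN_lift[OF that, of "\<lambda>z. T'.cl (?\<phi> z)" h] by (simp add: tensor_map_def)
 show "addmap (tensor R M S) (tensor R M' S') (tensor_map R M S M' S' g f)"
  by (rule addmapI) (use eq addmapD[OF h(1)] in auto)
 show "[|m : carrier M; s : carrier S|] ==> tensor_map R M S M' S' g f (T.tn m s) = T'.tn (g m) (f s)" using eq h(2) by simp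
qed

locale tensor_alg = A: algebra R A + tensor_prod R A S
 for R :: "('a, 'm) ring_scheme" and A :: "('a, 'b, 'x) module_scheme" and S :: "('a, 'c, 'y) module_scheme"
begin

text \<open>The universal property is used twice: first in the left factor with an elementary tensor
  on the right, then in the right factor for an arbitrary element on the left.\<close>

lemma P_mult:
 shows "X : carrier P ==> addmap P P (\<lambda>Y. X \<otimes>\<^sub>P Y)" "Y : carrier P ==> addmap P P (\<lambda>X. X \<otimes>\<^sub>P Y)"
  "[|m : carrier A; n : carrier A; s : carrier S; t : carrier S|] ==> tn m s \<otimes>\<^sub>P tn n t = tn (m \<otimes>\<^sub>A n) (s \<otimes>\<^sub>S t)"
proof -
 have "\<exists>h. addmap P P h \<and> (\<forall>m\<in>carrier A. \<forall>s\<in>carrier S. h (tn m s) = tn (m \<otimes>\<^sub>A n) (s \<otimes>\<^sub>S t))"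
  if "n : carrier A" "t : carrier S" for n t by (rule universal[OF P_abelian_group], rule balancedI)
   (use that in "auto simp: tn_add_left tn_add_right tn_balanced A.l_distr S.l_distr A.smult_assoc2 S.smult_assoc2")
 then obtain h where h: "\<And>n t. [|n : carrier A; t : carrier S|] ==> addmap P P (h n t)"
  "\<And>n t m s. [|n : carrier A; t : carrier S; m : carrier A; s : carrier S|] ==> h n t (tn m s) = tn (m \<otimes>\<^sub>A n) (s \<otimes>\<^sub>S t)"
  by metis
 have hb: "balanced P (\<lambda>n t. h n t X)" if X: "X : carrier P" for X
 proof (rule balancedI)
  show "h n t X : carrier P" if "n : carrier A" "t : carrier S" for n t using h(1)[OF that] X by (rule addmapD(1))
  show "h (n \<oplus>\<^sub>A n') t X = h n t X \<oplus>\<^sub>P h n' t X" if "n : carrier A" "n' : carrier A" "t : carrier S" for n n' t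
   by (rule addmap_eqI[OF h(1) addmap_add[OF h(1) h(1) P_abelian_group] P_abelian_group _ X])
    (use that in "auto simp: h(2) A.r_distr tn_add_left")
  show "h n (t \<oplus>\<^sub>S t') X = h n t X \<oplus>\<^sub>P h n t' X" if "n : carrier A" "t : carrier S" "t' : carrier S" for n t t'
   by (rule addmap_eqI[OF h(1) addmap_add[OF h(1) h(1) P_abelian_group] P_abelian_group _ X])
    (use that in "auto simp: h(2) S.r_distr tn_add_right")
  show "h (r \<odot>\<^sub>A n) t X = h n (r \<odot>\<^sub>S t) X" if "r : carrier R" "n : carrier A" "t : carrier S" for r n t
   by (rule addmap_eqI[OF h(1) h(1) P_abelian_group _ X])
    (use that in \<open>auto simp: h(2) A.m_comm[of _ "r \<odot>\<^sub>A n"] A.m_comm[of _ n] S.m_comm[of _ "r \<odot>\<^sub>S t"] S.m_comm[of _ t]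
     A.smult_assoc2 S.smult_assoc2 tn_balanced\<close>)
 qed
 have "\<exists>\<mu>. addmap P P \<mu> \<and> (\<forall>n\<in>carrier A. \<forall>t\<in>carrier S. \<mu> (tn n t) = h n t X)" if "X : carrier P" for X
  by (rule universal[OF P_abelian_group hb[OF that]])
 then obtain \<mu> where \<mu>: "\<And>X. X : carrier P ==> addmap P P (\<mu> X)"
  "\<And>X n t. [|X : carrier P; n : carrier A; t : carrier S|] ==> \<mu> X (tn n t) = h n t X" by metis
 have \<mu>2: "addmap P P (\<lambda>X. \<mu> X Y)" if Y: "Y : carrier P" for Y
 proof (rule addmapI)
  show "\<mu> X Y : carrier P" if "X : carrier P" for X using addmapD(1)[OF \<mu>(1)[OF that] Y] .
  show "\<mu> (X \<oplus>\<^sub>P X') Y = \<mu> X Y \<oplus>\<^sub>P \<mu> X' Y" if "X : carrier P" "X' : carrier P" for X X'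
   by (rule addmap_eqI[OF \<mu>(1) addmap_add[OF \<mu>(1) \<mu>(1) P_abelian_group] P_abelian_group _ Y])
    (use that in \<open>auto simp: \<mu>(2) addmapD(2)[OF h(1)]\<close>)
 qed
 let ?\<psi> = "\<lambda>m s y. frag_extend (\<lambda>(n, t). frag_of (m \<otimes>\<^sub>A n, s \<otimes>\<^sub>S t)) y"
 let ?\<phi> = "\<lambda>x y. frag_extend (\<lambda>(m, s). ?\<psi> m s y) x"
 have fr1: "?\<psi> m s z : frags" if "m : carrier A" "s : carrier S" "z : frags" for m s z
  unfolding frags_def mem_Collect_eq
  by (rule keys_frag_extend_subset) (use that in "auto simp: frags_def split: prod.splits")
 have fr: "?\<phi> x y : frags" if "x : frags" "y : frags" for x y unfolding frags_def mem_Collect_eq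
 proof (rule keys_frag_extend_subset)
  fix i assume "i : Poly_Mapping.keys x"
  then have "i : carrier A \<times> carrier S" using that(1) by (auto simp: frags_def)
  then obtain m s where i: "i = (m, s)" "m : carrier A" "s : carrier S" by blast
  show "Poly_Mapping.keys (case i of (m, s) => ?\<psi> m s y) \<subseteq> carrier A \<times> carrier S"
   using fr1[OF i(2,3) that(2)] by (simp add: i(1) frags_def)
 qed
 have c1: "cl (?\<psi> m s z) = \<mu> (tn m s) (cl z)" if "m : carrier A" "s : carrier S" "z : frags" for m s z
  by (rule lift_unique[OF \<mu>(1) P_abelian_group _ _ _ that(3)])
   (use that h(2) \<mu>(2) in \<open>simp_all add: P_zero frag_extend_diff P_minus fr1 tens_def[symmetric]\<close>)
 have clc: "cl z : carrier P" if "z : frags" for z using that by (simp add: P_carrier)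
 have c2: "cl (?\<phi> x y) = \<mu> (cl x) (cl y)" if "x : frags" "y : frags" for x y
  by (rule lift_unique[OF \<mu>2[OF clc[OF that(2)]] P_abelian_group _ _ _ that(1)])
   (use that in \<open>simp_all add: P_zero frag_extend_diff P_minus fr c1\<close>)
 have eq: "X \<otimes>\<^sub>P Y = \<mu> X Y" if X: "X : carrier P" and Y: "Y : carrier P" for X Y
 proof -
  have "(\<Union>y\<in>Y. cl (?\<phi> x y)) = \<mu> (cl x) Y" if x: "x : frags" for x
   by (rule UN_lift[OF Y, of "\<lambda>y. cl (?\<phi> x y)" "\<mu> (cl x)"]) (use c2[OF x] in simp)
  then have "(\<Union>x\<in>X. \<Union>y\<in>Y. cl (?\<phi> x y)) = \<mu> X Y"
   by (rule UN_lift[OF X, of "\<lambda>x. \<Union>y\<in>Y. cl (?\<phi> x y)" "\<lambda>X. \<mu> X Y"])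
  then show ?thesis by (simp add: tensor_def)
 qed
 show "X : carrier P ==> addmap P P (\<lambda>Y. X \<otimes>\<^sub>P Y)"
  by (rule addmapI) (use eq addmapD[OF \<mu>(1)] in auto)
 show "Y : carrier P ==> addmap P P (\<lambda>X. X \<otimes>\<^sub>P Y)"
  by (rule addmapI) (use eq addmapD[OF \<mu>2] in auto)
 show "[|m : carrier A; n : carrier A; s : carrier S; t : carrier S|] ==> tn m s \<otimes>\<^sub>P tn n t = tn (m \<otimes>\<^sub>A n) (s \<otimes>\<^sub>S t)"
  using eq \<mu>(2) h(2) by simp
qed

lemma P_one: "\<one>\<^sub>P = tn \<one>\<^sub>A \<one>\<^sub>S" by (simp add: tensor_def tens_def)

lemma P_m_closed [simp]: "[|X : carrier P; Y : carrier P|] ==> X \<otimes>\<^sub>P Y : carrier P"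
 using addmapD(1)[OF P_mult(1)] by blast

text \<open>The laws compare maps that are additive in each argument, so they are verified on
  elementary tensors, one argument after the other.\<close>

lemma P_algebra: "algebra S P"
proof -
 interpret PS: module S P by (rule P_module)
 note ag = P_abelian_group
 have comm: "X \<otimes>\<^sub>P Y = Y \<otimes>\<^sub>P X" if X: "X : carrier P" and Y: "Y : carrier P" for X Y
 proof (rule addmap_eqI[OF P_mult(2)[OF Y] P_mult(1)[OF Y] ag _ X])
  fix m s assume ms: "m : carrier A" "s : carrier S"
  show "tn m s \<otimes>\<^sub>P Y = Y \<otimes>\<^sub>P tn m s"
   by (rule addmap_eqI[OF P_mult(1) P_mult(2) ag _ Y]) (use ms in "auto simp: P_mult(3) A.m_comm S.m_comm")
 qed
 have one: "\<one>\<^sub>P \<otimes>\<^sub>P X = X" if X: "X : carrier P" for X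
  by (rule addmap_eqI[OF P_mult(1) addmap_id ag _ X]) (auto simp: P_one P_mult(3))
 have sm: "s \<odot>\<^sub>P X \<otimes>\<^sub>P Y = s \<odot>\<^sub>P (X \<otimes>\<^sub>P Y)" if s: "s : carrier S" and X: "X : carrier P" and Y: "Y : carrier P" for s X Y
 proof (rule addmap_eqI[OF addmap_comp[OF P_smult(1)[OF s] P_mult(2)[OF Y]] addmap_comp[OF P_mult(2)[OF Y] P_smult(1)[OF s]] ag _ X])
  fix m t assume mt: "m : carrier A" "t : carrier S"
  show "s \<odot>\<^sub>P tn m t \<otimes>\<^sub>P Y = s \<odot>\<^sub>P (tn m t \<otimes>\<^sub>P Y)"
   by (rule addmap_eqI[OF P_mult(1) addmap_comp[OF P_mult(1) P_smult(1)[OF s]] ag _ Y])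
    (use mt s in "auto simp: P_mult(3) P_smult(2) S.m_assoc")
 qed
 have assoc: "X \<otimes>\<^sub>P Y \<otimes>\<^sub>P Z = X \<otimes>\<^sub>P (Y \<otimes>\<^sub>P Z)" if X: "X : carrier P" and Y: "Y : carrier P" and Z: "Z : carrier P" for X Y Z
 proof (rule addmap_eqI[OF addmap_comp[OF P_mult(2)[OF Y] P_mult(2)[OF Z]] P_mult(2) ag _ X])
  show "Y \<otimes>\<^sub>P Z : carrier P" using Y Z by simp
  fix m s assume ms: "m : carrier A" "s : carrier S"
  show "tn m s \<otimes>\<^sub>P Y \<otimes>\<^sub>P Z = tn m s \<otimes>\<^sub>P (Y \<otimes>\<^sub>P Z)"
  proof (rule addmap_eqI[OF addmap_comp[OF P_mult(1) P_mult(2)[OF Z]] addmap_comp[OF P_mult(2)[OF Z] P_mult(1)] ag _ Y])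
   fix n t assume nt: "n : carrier A" "t : carrier S"
   show "tn m s \<otimes>\<^sub>P tn n t \<otimes>\<^sub>P Z = tn m s \<otimes>\<^sub>P (tn n t \<otimes>\<^sub>P Z)"
    by (rule addmap_eqI[OF P_mult(1) addmap_comp[OF P_mult(1) P_mult(1)] ag _ Z])
     (use ms nt in "auto simp: P_mult(3) A.m_assoc S.m_assoc")
  qed (use ms in auto)
 qed
 have "cring P"
 proof (intro cringI comm_monoidI ag)
  show "\<one>\<^sub>P : carrier P" by (simp add: P_one)
  show "(X \<oplus>\<^sub>P Y) \<otimes>\<^sub>P Z = X \<otimes>\<^sub>P Z \<oplus>\<^sub>P Y \<otimes>\<^sub>P Z" if "X : carrier P" "Y : carrier P" "Z : carrier P" for X Y Z
   using that addmapD(2)[OF P_mult(2)] by simp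
 qed (simp, (rule assoc one comm; assumption)+)
 then show ?thesis
  by (intro algebraI) (auto simp: algebra.M_cring[OF S.algebra_axioms] sm PS.smult_l_distr PS.smult_r_distr PS.smult_assoc1)
qed

end

lemma addmap_finsum:
 assumes h: "addmap A A' h" and A: "abelian_group A" and A': "abelian_group A'"
  and f: "f : K \<rightarrow> carrier A" and K: "finite K"
 shows "h (finsum A f K) = finsum A' (\<lambda>k. h (f k)) K"
proof -
 interpret A: abelian_group A by fact
 interpret A': abelian_group A' by fact
 show ?thesis
  using K f
 proof (induction K)
  case empty
  show ?case using addmap_zero_minus(1)[OF h A A'] by simp
 next
  case (insert k K)
  have "h (finsum A f (insert k K)) = h (f k) \<oplus>\<^sub>A' h (finsum A f K)"
   using insert addmapD(2)[OF h] by (simp add: A.finsum_insert)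
  also have "\<dots> = finsum A' (\<lambda>k. h (f k)) (insert k K)"
   using insert addmapD(1)[OF h] by (subst A'.finsum_insert) auto
  finally show ?case .
 qed
qed

text \<open>A linear isomorphism onto finitely supported vectors. The index set is arbitrary: over
  the zero ring all basis vectors coincide, so it cannot always be realized as a subset of the
  module.\<close>

definition frame ::
 "('a, 'm) ring_scheme => ('a, 'b, 'x) module_scheme => 'c set => ('b => 'c => 'a) => bool" where
 "frame R C B co \<longleftrightarrow> bij_betw co (carrier C) (vec False B R) \<and>
   (\<forall>m\<in>carrier C. \<forall>n\<in>carrier C. co (m \<oplus>\<^sub>C n) = vadd B R (co m) (co n)) \<and>
   (\<forall>r\<in>carrier R. \<forall>m\<in>carrier C. co (r \<odot>\<^sub>C m) = vscale B R r (co m))"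

locale framed = C: module R C
 for R :: "('a, 'm) ring_scheme" and C :: "('a, 'b, 'x) module_scheme" +
 fixes B :: "'c set" and co :: "'b => 'c => 'a"
 assumes frame: "frame R C B co"
begin

lemma cR: "cring R" by (rule module.axioms(1)[OF C.module_axioms])

definition \<beta> where "\<beta> b = inv_into (carrier C) co (vunit B R b)"

lemma co_bij: "bij_betw co (carrier C) (vec False B R)"
 and co_add: "[|m : carrier C; n : carrier C|] ==> co (m \<oplus>\<^sub>C n) = vadd B R (co m) (co n)"
 and co_smult: "[|r : carrier R; m : carrier C|] ==> co (r \<odot>\<^sub>C m) = vscale B R r (co m)"
 using frame unfolding frame_def by blast+

lemma co_vec: "m : carrier C ==> co m : vec False B R" using co_bij by (auto simp: bij_betw_def)

lemma \<beta>: "\<beta> b : carrier C" "co (\<beta> b) = vunit B R b"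
proof -
 have "vunit B R b : co ` carrier C" using co_bij vunit_closed[OF cR] by (auto simp: bij_betw_def)
 then show "\<beta> b : carrier C" "co (\<beta> b) = vunit B R b" by (auto simp: \<beta>_def inv_into_into f_inv_into_f)
qed

lemma coordinate_addmap: "b : B ==> addmap C R (\<lambda>m. co m b)"
 by (rule addmapI) (auto simp: vec_closed[OF co_vec] co_add)

lemma co_combination:
 assumes c: "c : vec False B R"
 shows "co (finsum C (\<lambda>b. c b \<odot>\<^sub>C \<beta> b) {b\<in>B. c b \<noteq> \<zero>\<^sub>R}) = c"
proof (rule vec_eqI[OF co_vec c])
 let ?K = "{b\<in>B. c b \<noteq> \<zero>\<^sub>R}"
 have K: "finite ?K" using c by (simp add: vec_def)
 have t: "(\<lambda>b. c b \<odot>\<^sub>C \<beta> b) : ?K \<rightarrow> carrier C" using c \<beta>(1) by (auto simp: vec_closed)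
 then show "finsum C (\<lambda>b. c b \<odot>\<^sub>C \<beta> b) ?K : carrier C" by (rule C.finsum_closed)
 fix b assume b: "b : B"
 have "co (finsum C (\<lambda>b. c b \<odot>\<^sub>C \<beta> b) ?K) b = finsum R (\<lambda>b'. co (c b' \<odot>\<^sub>C \<beta> b') b) ?K"
  by (rule addmap_finsum[OF coordinate_addmap[OF b] C.abelian_group_axioms C.R.abelian_group_axioms t K])
 also have "\<dots> = finsum R (\<lambda>b'. c b' \<otimes>\<^sub>R vunit B R b b') ?K"
  by (rule C.R.finsum_cong') (use c b \<beta> in "auto simp: co_smult vec_closed vunit_apply")
 also have "\<dots> = pair B R c (vunit B R b)"
  by (rule pair_eq_finsum[OF cR c vunit_closed[OF cR, where k = True] K, symmetric])
   (use c b in "auto simp: vunit_apply")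
 also have "\<dots> = c b" by (rule pair_vunit[OF cR c b])
 finally show "co (finsum C (\<lambda>b. c b \<odot>\<^sub>C \<beta> b) ?K) b = c b" .
qed

lemma combination: "m : carrier C ==> finsum C (\<lambda>b. co m b \<odot>\<^sub>C \<beta> b) {b\<in>B. co m b \<noteq> \<zero>\<^sub>R} = m"
proof -
 assume m: "m : carrier C"
 have "finsum C (\<lambda>b. co m b \<odot>\<^sub>C \<beta> b) {b\<in>B. co m b \<noteq> \<zero>\<^sub>R} : carrier C"
  by (rule C.finsum_closed) (use \<beta>(1) in "auto simp: vec_closed[OF co_vec[OF m]]")
 then show ?thesis using co_combination[OF co_vec[OF m]] co_bij m by (auto simp: bij_betw_def inj_on_def)
qed

lemma free: "free_mod R C"
proof (cases "\<one>\<^sub>R = \<zero>\<^sub>R")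
 \<comment> \<open>Over the zero ring \<open>\<beta>\<close> need not be injective, but then the
   module is zero and the empty basis serves.\<close>
 case True
 have "m = \<zero>\<^sub>C" if "m : carrier C" for m using C.smult_one[OF that] C.smult_l_null[OF that] True by simp
 then show ?thesis unfolding free_mod_def using C.module_axioms by (intro conjI exI[of _ "{}"]) auto
next
 case False
 have inj: "inj_on \<beta> B"
 proof (rule inj_onI)
  fix b c assume "b : B" "c : B" "\<beta> b = \<beta> c"
  then have "vunit B R b b = vunit B R c b" by (metis \<beta>(2))
  then show "b = c" using \<open>b : B\<close> False by (auto simp: vunit_apply split: if_splits)
 qed
 have red: "(\<lambda>b\<in>B. c (\<beta> b)) : vec False B R"
  "finsum C (\<lambda>b. c b \<odot>\<^sub>C b) {b : \<beta> ` B. c b \<noteq> \<zero>\<^sub>R}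
   = finsum C (\<lambda>b. (\<lambda>b\<in>B. c (\<beta> b)) b \<odot>\<^sub>C \<beta> b) {b\<in>B. (\<lambda>b\<in>B. c (\<beta> b)) b \<noteq> \<zero>\<^sub>R}"
  if c: "c : \<beta> ` B \<rightarrow>\<^sub>E carrier R" "finite {b : \<beta> ` B. c b \<noteq> \<zero>\<^sub>R}" for c
 proof -
  have cc: "c (\<beta> b) : carrier R" if "b : B" for b using c(1) that by (auto simp: PiE_mem)
  have eq: "{b : \<beta> ` B. c b \<noteq> \<zero>\<^sub>R} = \<beta> ` {b\<in>B. (\<lambda>b\<in>B. c (\<beta> b)) b \<noteq> \<zero>\<^sub>R}" by auto
  have inj': "inj_on \<beta> {b\<in>B. (\<lambda>b\<in>B. c (\<beta> b)) b \<noteq> \<zero>\<^sub>R}" by (rule inj_on_subset[OF inj]) auto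
  have "finite {b\<in>B. (\<lambda>b\<in>B. c (\<beta> b)) b \<noteq> \<zero>\<^sub>R}"
   using c(2) finite_imageD[OF _ inj'] unfolding eq by blast
  then show "(\<lambda>b\<in>B. c (\<beta> b)) : vec False B R" using c(1) by (intro vecI) auto
  have "finsum C (\<lambda>b. c b \<odot>\<^sub>C b) (\<beta> ` {b\<in>B. (\<lambda>b\<in>B. c (\<beta> b)) b \<noteq> \<zero>\<^sub>R})
   = finsum C (\<lambda>b. c (\<beta> b) \<odot>\<^sub>C \<beta> b) {b\<in>B. (\<lambda>b\<in>B. c (\<beta> b)) b \<noteq> \<zero>\<^sub>R}"
   by (rule C.finsum_reindex[OF _ inj']) (use cc \<beta>(1) in auto)
  also have "\<dots> = finsum C (\<lambda>b. (\<lambda>b\<in>B. c (\<beta> b)) b \<odot>\<^sub>C \<beta> b) {b\<in>B. (\<lambda>b\<in>B. c (\<beta> b)) b \<noteq> \<zero>\<^sub>R}"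
   by (rule C.finsum_cong') (use cc \<beta>(1) in auto)
  finally show "finsum C (\<lambda>b. c b \<odot>\<^sub>C b) {b : \<beta> ` B. c b \<noteq> \<zero>\<^sub>R}
   = finsum C (\<lambda>b. (\<lambda>b\<in>B. c (\<beta> b)) b \<odot>\<^sub>C \<beta> b) {b\<in>B. (\<lambda>b\<in>B. c (\<beta> b)) b \<noteq> \<zero>\<^sub>R}" unfolding eq .
 qed
 have coord: "co m = (\<lambda>b\<in>B. c (\<beta> b))"
  if "c : \<beta> ` B \<rightarrow>\<^sub>E carrier R \<and> finite {b : \<beta> ` B. c b \<noteq> \<zero>\<^sub>R} \<and> m = finsum C (\<lambda>b. c b \<odot>\<^sub>C b) {b : \<beta> ` B. c b \<noteq> \<zero>\<^sub>R}"
  for c m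
 proof -
  note c = conjunct1[OF that] conjunct1[OF conjunct2[OF that]] and m = conjunct2[OF conjunct2[OF that]]
  show ?thesis using co_combination[OF red(1)[OF c]] by (simp only: m red(2)[OF c])
 qed
 have "\<exists>!c. c : \<beta> ` B \<rightarrow>\<^sub>E carrier R \<and> finite {b : \<beta> ` B. c b \<noteq> \<zero>\<^sub>R} \<and>
   m = finsum C (\<lambda>b. c b \<odot>\<^sub>C b) {b : \<beta> ` B. c b \<noteq> \<zero>\<^sub>R}" if m: "m : carrier C" for m
 proof (rule ex_ex1I)
  define c where "c = (\<lambda>b'\<in>\<beta> ` B. co m (inv_into B \<beta> b'))"
  have cb: "c (\<beta> b) = co m b" if "b : B" for b using that inj by (simp add: c_def)
  have c: "(\<lambda>b\<in>B. c (\<beta> b)) = co m"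
   by (rule extensionalityI[of _ B]) (auto simp: cb vec_extensional[OF co_vec[OF m]])
  have "{b : \<beta> ` B. c b \<noteq> \<zero>\<^sub>R} \<subseteq> \<beta> ` {b\<in>B. co m b \<noteq> \<zero>\<^sub>R}" by (auto simp: cb)
  then have "finite {b : \<beta> ` B. c b \<noteq> \<zero>\<^sub>R}"
   using vec_finite[OF co_vec[OF m]] by (blast intro: finite_subset finite_imageI)
  moreover have "c : \<beta> ` B \<rightarrow>\<^sub>E carrier R"
   by (intro PiE_I) (auto simp: cb vec_closed[OF co_vec[OF m]], simp add: c_def)
  ultimately show "\<exists>c. c : \<beta> ` B \<rightarrow>\<^sub>E carrier R \<and> finite {b : \<beta> ` B. c b \<noteq> \<zero>\<^sub>R} \<and>
   m = finsum C (\<lambda>b. c b \<odot>\<^sub>C b) {b : \<beta> ` B. c b \<noteq> \<zero>\<^sub>R}"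
   using red(2)[of c] combination[OF m] unfolding c by auto
 next
  fix c d
  assume c: "c : \<beta> ` B \<rightarrow>\<^sub>E carrier R \<and> finite {b : \<beta> ` B. c b \<noteq> \<zero>\<^sub>R} \<and> m = finsum C (\<lambda>b. c b \<odot>\<^sub>C b) {b : \<beta> ` B. c b \<noteq> \<zero>\<^sub>R}"
   and d: "d : \<beta> ` B \<rightarrow>\<^sub>E carrier R \<and> finite {b : \<beta> ` B. d b \<noteq> \<zero>\<^sub>R} \<and> m = finsum C (\<lambda>b. d b \<odot>\<^sub>C b) {b : \<beta> ` B. d b \<noteq> \<zero>\<^sub>R}"
  note cd = conjunct1[OF c] conjunct1[OF d]
  have e: "(\<lambda>b\<in>B. c (\<beta> b)) = (\<lambda>b\<in>B. d (\<beta> b))" using coord[OF c] coord[OF d] by simp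
  have "c (\<beta> b) = d (\<beta> b)" if "b : B" for b using fun_cong[OF e, of b] that by simp
  then show "c = d" by (intro extensionalityI[of c "\<beta> ` B" d]) (use cd in "auto simp: PiE_def")
 qed
 then show ?thesis unfolding free_mod_def using C.module_axioms \<beta>(1) by (intro conjI exI[of _ "\<beta> ` B"]) auto
qed

end

lemma free_mod_frame:
 assumes "free_mod R C" shows "\<exists>B\<subseteq>carrier C. \<exists>co. frame R C B co"
proof -
 interpret module R C using assms by (simp add: free_mod_def)
 note cring = module.axioms(1)[OF module_axioms]
 obtain B where B: "B \<subseteq> carrier C" and ex: "\<forall>m\<in>carrier C. \<exists>!c. c : B \<rightarrow>\<^sub>E carrier R \<and>
   finite {b : B. c b \<noteq> \<zero>\<^sub>R} \<and> m = finsum C (\<lambda>b. c b \<odot>\<^sub>C b) {b : B. c b \<noteq> \<zero>\<^sub>R}"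
  using conjunct2[OF assms[unfolded free_mod_def]] by (elim exE conjE)
 define lc where "lc c = finsum C (\<lambda>b. c b \<odot>\<^sub>C b) {b\<in>B. c b \<noteq> \<zero>\<^sub>R}" for c
 have ex: "\<exists>!c. c : vec False B R \<and> m = lc c" if "m : carrier C" for m
  using bspec[OF ex that] unfolding lc_def vec_def by (simp add: conj_assoc)
 have lcK: "lc c = finsum C (\<lambda>b. c b \<odot>\<^sub>C b) K"
  if "c : vec False B R" "finite K" "K \<subseteq> B" "{b\<in>B. c b \<noteq> \<zero>\<^sub>R} \<subseteq> K" for c K
  unfolding lc_def by (rule M.add.finprod_mono_neutral_cong_left) (use that B in "auto simp: vec_closed subset_iff")
 have lc: "lc c : carrier C" if "c : vec False B R" for c
  unfolding lc_def by (rule finsum_closed) (use that B in "auto simp: vec_closed subset_iff")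
 have add: "lc (vadd B R c d) = lc c \<oplus>\<^sub>C lc d" if c: "c : vec False B R" and d: "d : vec False B R" for c d
 proof -
  let ?K = "{b\<in>B. c b \<noteq> \<zero>\<^sub>R} \<union> {b\<in>B. d b \<noteq> \<zero>\<^sub>R}"
  have K: "finite ?K" "?K \<subseteq> B" using c d by (auto simp: vec_def)
  have cl: "(\<lambda>b. c b \<odot>\<^sub>C b) : ?K \<rightarrow> carrier C" "(\<lambda>b. d b \<odot>\<^sub>C b) : ?K \<rightarrow> carrier C"
   using c d B by (auto simp: vec_closed subset_iff)
  have "lc (vadd B R c d) = finsum C (\<lambda>b. vadd B R c d b \<odot>\<^sub>C b) ?K"
   by (rule lcK[OF vadd_closed[OF cring c d] K]) auto
  also have "\<dots> = finsum C (\<lambda>b. c b \<odot>\<^sub>C b \<oplus>\<^sub>C d b \<odot>\<^sub>C b) ?K"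
   by (rule finsum_cong') (use c d B in "auto simp: smult_l_distr vec_closed subset_iff")
  also have "\<dots> = finsum C (\<lambda>b. c b \<odot>\<^sub>C b) ?K \<oplus>\<^sub>C finsum C (\<lambda>b. d b \<odot>\<^sub>C b) ?K"
   by (rule finsum_addf[OF cl])
  also have "finsum C (\<lambda>b. c b \<odot>\<^sub>C b) ?K = lc c" by (rule lcK[OF c K, symmetric]) auto
  also have "finsum C (\<lambda>b. d b \<odot>\<^sub>C b) ?K = lc d" by (rule lcK[OF d K, symmetric]) auto
  finally show ?thesis .
 qed
 have smult: "lc (vscale B R r c) = r \<odot>\<^sub>C lc c" if r: "r : carrier R" and c: "c : vec False B R" for r c
 proof -
  let ?K = "{b\<in>B. c b \<noteq> \<zero>\<^sub>R}"
  have K: "finite ?K" "?K \<subseteq> B" using c by (auto simp: vec_def)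
  have "lc (vscale B R r c) = finsum C (\<lambda>b. vscale B R r c b \<odot>\<^sub>C b) ?K"
   by (rule lcK[OF vscale_closed[OF cring r c] K]) (use r in auto)
  also have "\<dots> = finsum C (\<lambda>b. r \<odot>\<^sub>C (c b \<odot>\<^sub>C b)) ?K"
   by (rule finsum_cong') (use r c B in "auto simp: smult_assoc1 vec_closed subset_iff")
  also have "\<dots> = r \<odot>\<^sub>C finsum C (\<lambda>b. c b \<odot>\<^sub>C b) ?K"
   by (rule finsum_smult_ldistr[symmetric, OF K(1) r]) (use c B in "auto simp: vec_closed subset_iff")
  finally show ?thesis by (simp add: lc_def)
 qed
 define co where "co m = (THE c. c : vec False B R \<and> m = lc c)" for m
 have co: "co m : vec False B R" "lc (co m) = m" if "m : carrier C" for m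
  using theI'[OF ex[OF that]] by (simp_all add: co_def)
 have colc: "co (lc c) = c" if "c : vec False B R" for c using ex[OF lc[OF that]] co[OF lc[OF that]] that by metis
 have "frame R C B co" unfolding frame_def
 proof (intro conjI ballI)
  show "bij_betw co (carrier C) (vec False B R)" by (rule bij_betw_byWitness[of _ lc]) (use co colc lc in auto)
  show "co (m \<oplus>\<^sub>C n) = vadd B R (co m) (co n)" if "m : carrier C" "n : carrier C" for m n
   using colc[OF vadd_closed[OF cring co(1)[OF that(1)] co(1)[OF that(2)]]] that by (simp add: add co)
  show "co (r \<odot>\<^sub>C m) = vscale B R r (co m)" if "r : carrier R" "m : carrier C" for r m
   using colc[OF vscale_closed[OF cring that(1) co(1)[OF that(2)]]] that by (simp add: smult co)
 qed
 then show ?thesis using B by blast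
qed

section \<open>Affine schemes as schemes of points\<close>

lemma struct_map_hom: "T : Algs R ==> struct_map R T : alg_hom R (self_alg R) T"
 by (simp add: struct_map_alg_hom Algs_iff)

lemma vmap_struct_map:
 assumes "T : Algs R" "v : vec k B R"
 shows "vmap B (struct_map R T) v : vec k B T"
 using vmap_alg_hom[OF struct_map_hom self_Algs, of T R v k B] assms Algs_base_cring[OF assms(1)] by simp

lemma compose_struct_map:
 assumes "f : alg_hom R T U" "T : Algs R"
 shows "compose (carrier R) f (struct_map R T) = struct_map R U" using alg_hom_struct_map[OF assms(1)] assms(2)
 by (auto simp: compose_def fun_eq_iff struct_map_def Algs_iff)

lemma vmap_struct_map_hom:
 assumes "f : alg_hom R T U" "T : Algs R" "v : vec k B R"
 shows "vmap B f (vmap B (struct_map R T) v) = vmap B (struct_map R U) v"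
 using vmap_compose[of v k B R f "struct_map R T"] assms compose_struct_map[OF assms(1,2)] by simp

lemma vscale_one: "[|cring T; v : vec k B T|] ==> vscale B T \<one>\<^sub>T v = v"
 by (intro extensionalityI[of _ B]) (auto simp: vec_closed cring.cring_simprules(12) dest: vec_extensional)

abbreviation fvec_mod :: "'c set => 'a alg => ('a, 'c => 'a) module" where
 "fvec_mod B T \<equiv> vec_mod (\<lambda>t. t) False B T undefined undefined"

context framed
begin

lemma tensor_prod: "T : Algs R ==> tensor_prod R C T" by (simp add: tensor_prod_def C.module_axioms Algs_iff)

text \<open>The coordinate isomorphism from \<open>C \<otimes> T\<close> to the finitely supported
  vectors over \<open>T\<close>. It exists by the universal property, and the use of
  \<open>SOME\<close> is harmless because an additive map is determined by its values on elementary
  tensors.\<close>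

definition \<rho> where
 "\<rho> T = (SOME h. addmap (tensor R C T) (fvec_mod B T) h \<and> (\<forall>c\<in>carrier C. \<forall>t\<in>carrier T.
   h (tens R C T c t) = vscale B T t (vmap B (struct_map R T) (co c))))"

lemma
 assumes T: "T : Algs R"
 shows \<rho>_addmap: "addmap (tensor R C T) (fvec_mod B T) (\<rho> T)"
  and \<rho>_tens: "[|c : carrier C; t : carrier T|] ==>
   \<rho> T (tens R C T c t) = vscale B T t (vmap B (struct_map R T) (co c))"
proof -
 note cT = cring_of[OF T]
 interpret T: cring T by (rule cT)
 interpret P: tensor_prod R C T by (rule tensor_prod[OF T])
 note ag = vec_mod_abelian_group[OF cT, of "\<lambda>t. t" False B undefined undefined]
 have v: "vmap B (struct_map R T) (co c) : vec False B T" if "c : carrier C" for c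
  by (rule vmap_struct_map[OF T co_vec[OF that]])
 note j = alg_homD[OF struct_map_hom[OF T], simplified]
 note cl = vec_closed[OF co_vec]
 have "P.balanced (fvec_mod B T) (\<lambda>c t. vscale B T t (vmap B (struct_map R T) (co c)))" by (rule P.balancedI)
   (auto simp: cT v co_add co_smult j cl T.r_distr T.l_distr T.m_ac smult_eq_struct_map[of R T] T[unfolded Algs_iff]
    intro!: extensionalityI[of _ B])
 from someI_ex[OF P.universal[OF ag this]]
 show "addmap (tensor R C T) (fvec_mod B T) (\<rho> T)"
  "[|c : carrier C; t : carrier T|] ==>
   \<rho> T (tens R C T c t) = vscale B T t (vmap B (struct_map R T) (co c))" unfolding \<rho>_def by blast+
qed

lemma \<rho>_closed: "[|T : Algs R; X : carrier (tensor R C T)|] ==> \<rho> T X : vec False B T"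
 using addmapD(1)[OF \<rho>_addmap] by auto

lemma \<rho>_add: "[|T : Algs R; X : carrier (tensor R C T); Y : carrier (tensor R C T)|]
  ==> \<rho> T (X \<oplus>\<^sub>(tensor R C T) Y) = vadd B T (\<rho> T X) (\<rho> T Y)"
 using addmapD(2)[OF \<rho>_addmap] by auto

lemma \<rho>_tens_one:
 assumes T: "T : Algs R" and c: "c : carrier C"
 shows "\<rho> T (tens R C T c \<one>\<^sub>T) = vmap B (struct_map R T) (co c)"
proof -
 note cT = cring_of[OF T]
 interpret T: cring T by (rule cT)
 show ?thesis using \<rho>_tens[OF T c, of "\<one>\<^sub>T"] vscale_one[OF cT vmap_struct_map[OF T co_vec[OF c]]] by simp
qed

lemma \<rho>_\<beta>:
 assumes T: "T : Algs R"
 shows "\<rho> T (tens R C T (\<beta> b) \<one>\<^sub>T) = vunit B T b"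
proof -
 have "vmap B (struct_map R T) (vunit B R b) = vunit B T b"
  using vmap_vunit[OF alg_homD(2)[OF struct_map_hom[OF T]] _ cring_of[OF T], of B b] cR by (simp add: cring_self_alg)
 then show ?thesis using \<rho>_tens_one[OF T \<beta>(1)] by (simp add: \<beta>(2))
qed

lemma \<rho>_smult:
 assumes T: "T : Algs R" and t: "t : carrier T" and X: "X : carrier (tensor R C T)"
 shows "\<rho> T (t \<odot>\<^sub>(tensor R C T) X) = vscale B T t (\<rho> T X)"
proof -
 note cT = cring_of[OF T]
 interpret T: cring T by (rule cT)
 interpret P: tensor_prod R C T by (rule tensor_prod[OF T])
 note ag = vec_mod_abelian_group[OF cT, of "\<lambda>t. t" False B undefined undefined]
 have sc: "addmap (fvec_mod B T) (fvec_mod B T) (vscale B T t)"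
  by (rule addmapI) (use t in \<open>auto simp: cT vec_closed T.r_distr intro!: extensionalityI[of _ B]\<close>)
 show ?thesis
 proof (rule P.addmap_eqI[OF P.addmap_comp[OF P.P_smult(1)[OF t] \<rho>_addmap[OF T]] P.addmap_comp[OF \<rho>_addmap[OF T] sc] ag _ X])
  fix c s assume cs: "c : carrier C" "s : carrier T"
  show "\<rho> T (t \<odot>\<^sub>(tensor R C T) tens R C T c s) = vscale B T t (\<rho> T (tens R C T c s))"
   using cs t vec_closed[OF vmap_struct_map[OF T co_vec[OF cs(1)]]]
   by (auto simp: P.P_smult(2) \<rho>_tens[OF T] T.m_assoc intro!: extensionalityI[of _ B])
 qed
qed

lemma \<rho>_natural:
 assumes T: "T : Algs R" and U: "U : Algs R" and f: "f : alg_hom R T U" and X: "X : carrier (tensor R C T)"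
 shows "\<rho> U (tensor_map R C T C U (\<lambda>m. m) f X) = vmap B f (\<rho> T X)"
proof -
 interpret P: tensor_prod R C T by (rule tensor_prod[OF T])
 note tm = tensor_map[OF tensor_prod[OF T] tensor_prod[OF U], of "\<lambda>m. m" f]
 note f' = alg_homD[OF f]
 have vm: "addmap (fvec_mod B T) (fvec_mod B U) (vmap B f)"
  by (rule addmapI) (auto simp: vmap_alg_hom[OF f T U] vmap_vadd[OF f'(2)])
 have tma: "addmap (tensor R C T) (tensor R C U) (tensor_map R C T C U (\<lambda>m. m) f)" by (rule tm(1)) (auto simp: f')
 have tmt: "tensor_map R C T C U (\<lambda>m. m) f (tens R C T c t) = tens R C U c (f t)"
  if "c : carrier C" "t : carrier T" for c t by (rule tm(2)) (use that in "auto simp: f'")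
 show ?thesis
 proof (rule P.addmap_eqI[OF P.addmap_comp[OF tma \<rho>_addmap[OF U]] P.addmap_comp[OF \<rho>_addmap[OF T] vm] _ _ X])
  show "abelian_group (fvec_mod B U)" by (rule vec_mod_abelian_group[OF cring_of[OF U]])
  fix c t assume ct: "c : carrier C" "t : carrier T"
  show "\<rho> U (tensor_map R C T C U (\<lambda>m. m) f (tens R C T c t)) = vmap B f (\<rho> T (tens R C T c t))"
   using ct vmap_struct_map_hom[OF f T co_vec[OF ct(1)]] vmap_vscale[OF f'(2) ct(2) vmap_struct_map[OF T co_vec[OF ct(1)]]]
   by (simp add: tmt \<rho>_tens[OF T] \<rho>_tens[OF U] f'(3))
 qed
qed

lemma combination_map:
 assumes h: "addmap C A h" and A: "abelian_group A" and m: "m : carrier C"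
 shows "finsum A (\<lambda>b. h (co m b \<odot>\<^sub>C \<beta> b)) {b\<in>B. co m b \<noteq> \<zero>\<^sub>R} = h m"
proof -
 have "h (finsum C (\<lambda>b. co m b \<odot>\<^sub>C \<beta> b) {b\<in>B. co m b \<noteq> \<zero>\<^sub>R}) =
   finsum A (\<lambda>b. h (co m b \<odot>\<^sub>C \<beta> b)) {b\<in>B. co m b \<noteq> \<zero>\<^sub>R}"
  by (rule addmap_finsum[OF h C.abelian_group_axioms A])
   (use vec_finite[OF co_vec[OF m]] \<beta>(1) in "auto simp: vec_closed[OF co_vec[OF m]]")
 then show ?thesis by (simp add: combination[OF m])
qed

lemma \<rho>_bij: assumes T: "T : Algs R" shows "bij_betw (\<rho> T) (carrier (tensor R C T)) (vec False B T)"
proof -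
 note cT = cring_of[OF T]
 interpret T: cring T by (rule cT)
 interpret P: tensor_prod R C T by (rule tensor_prod[OF T])
 note ag = vec_mod_abelian_group[OF cT, of "\<lambda>t. t" False B undefined undefined]
 let ?tn = "tens R C T"
 \<comment> \<open>The inverse: the combination of basis tensors whose right factors are the
   coordinates of \<open>v\<close>.\<close>
 define \<sigma> where "\<sigma> v = finsum P.P (\<lambda>b. ?tn (\<beta> b) (v b)) {b\<in>B. v b \<noteq> \<zero>\<^sub>T}" for v
 have tz: "?tn c \<zero>\<^sub>T = \<zero>\<^sub>P.P" if "c : carrier C" for c
 proof -
  have "addmap T P.P (?tn c)" by (rule addmapI) (use that P.tn_add_right in auto)
  from addmap_zero_minus(1)[OF this T.abelian_group_axioms P.P_abelian_group] show ?thesis .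
 qed
 have \<sigma>K: "\<sigma> v = finsum P.P (\<lambda>b. ?tn (\<beta> b) (v b)) K"
  if "v : vec False B T" "finite K" "K \<subseteq> B" "{b\<in>B. v b \<noteq> \<zero>\<^sub>T} \<subseteq> K" for v K
  unfolding \<sigma>_def
  by (rule P.P.add.finprod_mono_neutral_cong_left) (use that tz \<beta>(1) in "auto simp: vec_closed subset_iff")
 have \<sigma>c: "\<sigma> v : carrier P.P" if "v : vec False B T" for v
  unfolding \<sigma>_def by (rule P.P.finsum_closed) (use that \<beta>(1) in "auto simp: vec_closed")
 have \<sigma>a: "addmap (fvec_mod B T) P.P \<sigma>"
 proof (rule addmapI)
  show "\<sigma> v : carrier P.P" if "v : carrier (fvec_mod B T)" for v using that \<sigma>c by simp
  fix v w assume "v : carrier (fvec_mod B T)" "w : carrier (fvec_mod B T)"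
  then have v: "v : vec False B T" and w: "w : vec False B T" by simp_all
  let ?K = "{b\<in>B. v b \<noteq> \<zero>\<^sub>T} \<union> {b\<in>B. w b \<noteq> \<zero>\<^sub>T}"
  have K: "finite ?K" "?K \<subseteq> B" using v w by (auto simp: vec_def)
  have "\<sigma> (vadd B T v w) = finsum P.P (\<lambda>b. ?tn (\<beta> b) (vadd B T v w b)) ?K"
   by (rule \<sigma>K[OF vadd_closed[OF cT v w] K]) auto
  also have "\<dots> = finsum P.P (\<lambda>b. ?tn (\<beta> b) (v b) \<oplus>\<^sub>P.P ?tn (\<beta> b) (w b)) ?K"
   by (rule P.P.finsum_cong') (use v w \<beta>(1) in "auto simp: P.tn_add_right vec_closed")
  also have "\<dots> = finsum P.P (\<lambda>b. ?tn (\<beta> b) (v b)) ?K \<oplus>\<^sub>P.P finsum P.P (\<lambda>b. ?tn (\<beta> b) (w b)) ?K"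
   by (rule P.P.finsum_addf) (use v w \<beta>(1) in "auto simp: vec_closed")
  also have "finsum P.P (\<lambda>b. ?tn (\<beta> b) (v b)) ?K = \<sigma> v" by (rule \<sigma>K[OF v K, symmetric]) auto
  also have "finsum P.P (\<lambda>b. ?tn (\<beta> b) (w b)) ?K = \<sigma> w" by (rule \<sigma>K[OF w K, symmetric]) auto
  finally show "\<sigma> (v \<oplus>\<^sub>(fvec_mod B T) w) = \<sigma> v \<oplus>\<^sub>P.P \<sigma> w" by simp
 qed
 have \<sigma>\<rho>: "\<sigma> (\<rho> T X) = X" if X: "X : carrier P.P" for X
 proof (rule P.addmap_eqI[OF P.addmap_comp[OF \<rho>_addmap[OF T] \<sigma>a] P.addmap_id P.P_abelian_group _ X])
  fix c t assume c: "c : carrier C" and t: "t : carrier T"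
  let ?K = "{b\<in>B. co c b \<noteq> \<zero>\<^sub>R}"
  have K: "finite ?K" "?K \<subseteq> B" using vec_finite[OF co_vec[OF c]] by auto
  let ?v = "vscale B T t (vmap B (struct_map R T) (co c))"
  have v: "?v : vec False B T" using t vmap_struct_map[OF T co_vec[OF c]] cT by simp
  note j = alg_homD[OF struct_map_hom[OF T], simplified]
  have j0: "struct_map R T \<zero>\<^sub>R = \<zero>\<^sub>T"
   using ring_hom_0[OF alg_homD(2)[OF struct_map_hom[OF T]] cring_self_alg[OF cR] cT] by simp
  have "\<sigma> ?v = finsum P.P (\<lambda>b. ?tn (\<beta> b) (?v b)) ?K" by (rule \<sigma>K[OF v K]) (use t j0 in auto)
  also have "\<dots> = finsum P.P (\<lambda>b. ?tn (co c b \<odot>\<^sub>C \<beta> b) t) ?K" by (rule P.P.finsum_cong')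
    (use t \<beta>(1) in "auto simp: vec_closed[OF co_vec[OF c]] P.tn_balanced T.m_comm[of t] j
      smult_eq_struct_map[of R T] T[unfolded Algs_iff]")
  also have "\<dots> = ?tn c t"
   by (rule combination_map[where h = "\<lambda>c. ?tn c t", OF _ P.P_abelian_group c], rule addmapI)
    (use t in "auto simp: P.tn_add_left")
  finally show "\<sigma> (\<rho> T (?tn c t)) = ?tn c t" by (simp add: \<rho>_tens[OF T c t])
 qed
 have \<rho>\<sigma>: "\<rho> T (\<sigma> v) = v" if v: "v : vec False B T" for v
 proof (rule vec_eqI[OF \<rho>_closed[OF T \<sigma>c[OF v]] v])
  fix b assume b: "b : B"
  have ca: "addmap P.P T (\<lambda>X. \<rho> T X b)"
   by (rule addmapI) (use b in \<open>auto simp: vec_closed[OF \<rho>_closed[OF T]] \<rho>_add[OF T]\<close>)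
  have "\<rho> T (\<sigma> v) b = finsum T (\<lambda>b'. \<rho> T (?tn (\<beta> b') (v b')) b) {b\<in>B. v b \<noteq> \<zero>\<^sub>T}"
   unfolding \<sigma>_def by (rule addmap_finsum[OF ca P.P_abelian_group T.abelian_group_axioms])
    (use v \<beta>(1) in "auto simp: vec_closed vec_finite")
  also have "\<dots> = finsum T (\<lambda>b'. v b' \<otimes>\<^sub>T vunit B T b b') {b\<in>B. v b \<noteq> \<zero>\<^sub>T}"
  proof (rule T.finsum_cong')
   fix b' assume b': "b' : {b\<in>B. v b \<noteq> \<zero>\<^sub>T}"
   have vb: "v b' : carrier T" using b' v by (auto simp: vec_closed)
   have "?tn (\<beta> b') (v b') = v b' \<odot>\<^sub>P.P ?tn (\<beta> b') \<one>\<^sub>T" using P.P_smult(2)[OF vb \<beta>(1), of "\<one>\<^sub>T"] vb by simp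
   then have "\<rho> T (?tn (\<beta> b') (v b')) = vscale B T (v b') (vunit B T b')"
    using \<rho>_smult[OF T vb P.tn_closed[OF \<beta>(1), of "\<one>\<^sub>T"]] \<rho>_\<beta>[OF T] by simp
   then show "\<rho> T (?tn (\<beta> b') (v b')) b = v b' \<otimes>\<^sub>T vunit B T b b'" using b b' by (auto simp: vunit_apply)
  qed (use v in "auto simp: vec_closed vunit_def")
  also have "\<dots> = pair B T v (vunit B T b)"
   by (rule pair_eq_finsum[OF cT v vunit_closed[OF cT, where k = True] vec_finite[OF v], symmetric])
    (use v b in "auto simp: vunit_apply")
  also have "\<dots> = v b" by (rule pair_vunit[OF cT v b])
  finally show "\<rho> T (\<sigma> v) b = v b" .
 qed
 show ?thesis
  by (rule bij_betw_byWitness[of _ \<sigma>]) (use \<sigma>\<rho> \<rho>\<sigma> \<rho>_closed[OF T] \<sigma>c in auto)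
qed

end

section \<open>Isomorphisms of functors and transport of algebra structures\<close>

lemma functor_isoI:
 assumes "\<And>T. T : Algs R ==> bij_betw (h T) (vals F T) (vals G T)"
  "\<And>T U f x. [|T : Algs R; U : Algs R; f : alg_hom R T U; x : vals F T|]
   ==> h U (Ar F T U f x) = Ar G T U f (h T x)"
  and F: "\<And>T U f x. [|T : Algs R; U : Algs R; f : alg_hom R T U; x : vals F T|]
   ==> Ar F T U f x : vals F U"
 shows "functor_iso R F G"
proof -
 define et where "et = (\<lambda>T\<in>Algs R. \<lambda>x\<in>vals F T. h T x)"
 have "et : nat_trans R F G" unfolding nat_trans_def using assms(1) by (auto simp: et_def assms(2) F bij_betw_def)
 moreover have "bij_betw (et T) (vals F T) (vals G T)" if "T : Algs R" for T
  using assms(1)[OF that] that by (simp add: et_def cong: bij_betw_cong)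
 ultimately show ?thesis unfolding functor_iso_def by blast
qed

lemma functor_isoD:
 assumes "functor_iso R F G"
 shows "\<exists>h. (\<forall>T\<in>Algs R. bij_betw (h T) (vals F T) (vals G T)) \<and>
  (\<forall>T\<in>Algs R. \<forall>U\<in>Algs R. \<forall>f\<in>alg_hom R T U. \<forall>x\<in>vals F T. h U (Ar F T U f x) = Ar G T U f (h T x))"
 using assms unfolding functor_iso_def nat_trans_def by auto

lemma functor_iso_sym:
 assumes "functor_iso R F G"
  and F: "\<And>T U f x. [|T : Algs R; U : Algs R; f : alg_hom R T U; x : vals F T|]
   ==> Ar F T U f x : vals F U"
  and G: "\<And>T U f x. [|T : Algs R; U : Algs R; f : alg_hom R T U; x : vals G T|]
   ==> Ar G T U f x : vals G U"
 shows "functor_iso R G F"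
proof -
 obtain h where "(\<forall>T\<in>Algs R. bij_betw (h T) (vals F T) (vals G T)) \<and>
  (\<forall>T\<in>Algs R. \<forall>U\<in>Algs R. \<forall>f\<in>alg_hom R T U. \<forall>x\<in>vals F T. h U (Ar F T U f x) = Ar G T U f (h T x))"
  using functor_isoD[OF assms(1)] ..
 note h = conjunct1[OF this, rule_format] conjunct2[OF this, rule_format]
 show ?thesis
 proof (rule functor_isoI[where h = "\<lambda>T. inv_into (vals F T) (h T)"])
  show "bij_betw (inv_into (vals F T) (h T)) (vals G T) (vals F T)" if "T : Algs R" for T
   by (rule bij_betw_inv_into[OF h(1)[OF that]])
  fix T U f x assume T: "T : Algs R" and U: "U : Algs R" and f: "f : alg_hom R T U" and x: "x : vals G T"
  show "Ar G T U f x : vals G U" by (rule G[OF T U f x])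
  obtain y where y: "y : vals F T" "x = h T y" using h(1)[OF T] x by (auto simp: bij_betw_def)
  have "inv_into (vals F U) (h U) (h U (Ar F T U f y)) = Ar F T U f y"
   by (rule inv_into_f_f) (use h(1)[OF U] F[OF T U f y(1)] in "auto simp: bij_betw_def")
  moreover have "inv_into (vals F T) (h T) x = y" using h(1)[OF T] y by (auto simp: bij_betw_def)
  ultimately show "inv_into (vals F U) (h U) (Ar G T U f x) = Ar F T U f (inv_into (vals F T) (h T) x)"
   using h(2)[OF T U f y(1)] y(2) by simp
 qed
qed

lemma functor_iso_trans:
 assumes "functor_iso R F G" "functor_iso R G H"
  and F: "\<And>T U f x. [|T : Algs R; U : Algs R; f : alg_hom R T U; x : vals F T|]
   ==> Ar F T U f x : vals F U"
 shows "functor_iso R F H"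
proof -
 obtain h where "(\<forall>T\<in>Algs R. bij_betw (h T) (vals F T) (vals G T)) \<and>
  (\<forall>T\<in>Algs R. \<forall>U\<in>Algs R. \<forall>f\<in>alg_hom R T U. \<forall>x\<in>vals F T. h U (Ar F T U f x) = Ar G T U f (h T x))"
  using functor_isoD[OF assms(1)] ..
 note h = conjunct1[OF this, rule_format] conjunct2[OF this, rule_format]
 obtain h' where "(\<forall>T\<in>Algs R. bij_betw (h' T) (vals G T) (vals H T)) \<and>
  (\<forall>T\<in>Algs R. \<forall>U\<in>Algs R. \<forall>f\<in>alg_hom R T U. \<forall>x\<in>vals G T. h' U (Ar G T U f x) = Ar H T U f (h' T x))"
  using functor_isoD[OF assms(2)] ..
 note h' = conjunct1[OF this, rule_format] conjunct2[OF this, rule_format]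
 show ?thesis
 proof (rule functor_isoI[where h = "\<lambda>T. h' T \<circ> h T"])
  show "bij_betw (h' T \<circ> h T) (vals F T) (vals H T)" if "T : Algs R" for T
   by (rule bij_betw_trans[OF h(1)[OF that] h'(1)[OF that]])
  fix T U f x assume T: "T : Algs R" and U: "U : Algs R" and f: "f : alg_hom R T U" and x: "x : vals F T"
  have "h T x : vals G T" using h(1)[OF T] x by (auto simp: bij_betw_def)
  then show "(h' U \<circ> h U) (Ar F T U f x) = Ar H T U f ((h' T \<circ> h T) x)"
   using h(2)[OF T U f x] h'(2)[OF T U f] by simp
 qed (rule F)
qed

lemma tensor_map_mult:
 assumes "tensor_alg R A S" "tensor_alg R A' S'" and g: "g : ring_hom A A'" "\<And>r m. [|r : carrier R; m : carrier A|] ==> g (r \<odot>\<^sub>A m) = r \<odot>\<^sub>A' g m"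
  and f: "f : ring_hom S S'" "\<And>r m. [|r : carrier R; m : carrier S|] ==> f (r \<odot>\<^sub>S m) = r \<odot>\<^sub>S' f m"
 shows "[|X : carrier (tensor R A S); Y : carrier (tensor R A S)|] ==>
   tensor_map R A S A' S' g f (X \<otimes>\<^sub>(tensor R A S) Y) =
   tensor_map R A S A' S' g f X \<otimes>\<^sub>(tensor R A' S') tensor_map R A S A' S' g f Y"
  "tensor_map R A S A' S' g f \<one>\<^sub>(tensor R A S) = \<one>\<^sub>(tensor R A' S')"
proof -
 interpret T: tensor_alg R A S by fact
 interpret T': tensor_alg R A' S' by fact
 note g' = ring_hom_closed[OF g(1)] ring_hom_add[OF g(1)] ring_hom_mult[OF g(1)] ring_hom_one[OF g(1)]
 note f' = ring_hom_closed[OF f(1)] ring_hom_add[OF f(1)] ring_hom_mult[OF f(1)] ring_hom_one[OF f(1)]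
 note tm = tensor_map[OF T.tensor_prod_axioms T'.tensor_prod_axioms, of g f]
 let ?h = "tensor_map R A S A' S' g f"
 have h: "addmap T.P T'.P ?h" by (rule tm(1)) (auto simp: g' f' g(2) f(2))
 have ht: "?h (T.tn m s) = T'.tn (g m) (f s)" if "m : carrier A" "s : carrier S" for m s
  by (rule tm(2)) (use that in "auto simp: g' f' g(2) f(2)")
 show "?h \<one>\<^sub>T.P = \<one>\<^sub>T'.P" by (simp add: T.P_one T'.P_one ht g' f')
 assume X: "X : carrier T.P" and Y: "Y : carrier T.P"
 show "?h (X \<otimes>\<^sub>T.P Y) = ?h X \<otimes>\<^sub>T'.P ?h Y"
 proof (rule T.addmap_eqI[OF T.addmap_comp[OF T.P_mult(2)[OF Y] h] T.addmap_comp[OF h T'.P_mult(2)[OF addmapD(1)[OF h Y]]] T'.P_abelian_group _ X])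
  fix m s assume ms: "m : carrier A" "s : carrier S"
  show "?h (T.tn m s \<otimes>\<^sub>T.P Y) = ?h (T.tn m s) \<otimes>\<^sub>T'.P ?h Y"
   by (rule T.addmap_eqI[OF T.addmap_comp[OF T.P_mult(1) h] T.addmap_comp[OF h T'.P_mult(1)] T'.P_abelian_group _ Y])
    (use ms in "auto simp: T.P_mult(3) T'.P_mult(3) ht g' f'")
 qed
qed

lemma Char_functor_Ar:
 "[|T : Algs R; U : Algs R; f : alg_hom R T U; x : vals (Char_functor R k B mul unt) T|]
  ==> Ar (Char_functor R k B mul unt) T U f x : vals (Char_functor R k B mul unt) U" by (simp add: Char_vmap)

lemma Spec_Ar:
 "[|algebra R A; T : Algs R; U : Algs R; f : alg_hom R T U; x : vals (Spec R A) T|]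
  ==> Ar (Spec R A) T U f x : vals (Spec R A) U" by (simp add: Spec_def alg_hom_compose)

text \<open>Transport of structure along natural coordinates \<open>q\<close>. It is applied to
  \<open>A \<otimes> S\<close>, with finitely supported coordinates, and to the dual of a free
  module, with arbitrary ones.\<close>

lemma vec_algebra_transport:
 fixes Q :: "'u alg => ('u, 'w, 'y) module_scheme" and R :: "('u, 'm) ring_scheme"
 assumes R: "cring R" and inf: "infinite (UNIV :: 'u set)"
  and Q: "\<And>S. S : Algs R ==> algebra S (Q S)"
  and bij: "\<And>S. S : Algs R ==> bij_betw (q S) (carrier (Q S)) (vec k B S)"
  and add: "\<And>S x y. [|S : Algs R; x : carrier (Q S); y : carrier (Q S)|] ==> q S (x \<oplus>\<^sub>(Q S) y) = vadd B S (q S x) (q S y)"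
  and smult: "\<And>S s x. [|S : Algs R; s : carrier S; x : carrier (Q S)|] ==> q S (s \<odot>\<^sub>(Q S) x) = vscale B S s (q S x)"
  and hom: "\<And>S U f. [|S : Algs R; U : Algs R; f : alg_hom R S U|] ==> h S U f : ring_hom (Q S) (Q U)"
  and nat: "\<And>S U f x. [|S : Algs R; U : Algs R; f : alg_hom R S U; x : carrier (Q S)|] ==> q U (h S U f x) = vmap B f (q S x)"
 shows "\<exists>mul unt. vec_algebra R k B mul unt \<and> (\<forall>S\<in>Algs R. (\<forall>x\<in>carrier (Q S). \<forall>y\<in>carrier (Q S).
  mul S (q S x) (q S y) = q S (x \<otimes>\<^sub>(Q S) y)) \<and> unt S = q S \<one>\<^sub>(Q S))"
proof -
 define i where "i S = inv_into (carrier (Q S)) (q S)" for S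
 define mul where "mul S v w = q S (i S v \<otimes>\<^sub>(Q S) i S w)" for S v w
 define unt where "unt S = q S \<one>\<^sub>(Q S)" for S
 have q: "q S x : vec k B S" "i S (q S x) = x" if "S : Algs R" "x : carrier (Q S)" for S x
  using bij[OF that(1)] that(2) by (auto simp: i_def bij_betw_def)
 have ex: "\<exists>x\<in>carrier (Q S). v = q S x" if "S : Algs R" "v : vec k B S" for S v
  using bij[OF that(1)] that(2) by (auto simp: bij_betw_def)
 have m: "mul S (q S x) (q S y) = q S (x \<otimes>\<^sub>(Q S) y)" if "S : Algs R" "x : carrier (Q S)" "y : carrier (Q S)" for S x y
  using that by (simp add: mul_def q)
 have "vec_algebra R k B mul unt"
 proof (rule vec_algebra.intro[OF R inf])
  fix S assume S: "S : Algs R"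
  interpret c: cring "Q S" by (rule algebra.M_cring[OF Q[OF S]])
  interpret a: algebra S "Q S" by (rule Q[OF S])
  note q = q[OF S] and m = m[OF S] and ex = ex[OF S] and add = add[OF S, symmetric] and smult = smult[OF S, symmetric]
  show "unt S : vec k B S" by (simp add: unt_def q)
  fix v assume "v : vec k B S"
  then obtain x where x: "x : carrier (Q S)" "v = q S x" using ex by blast
  show "mul S (unt S) v = v" using x by (simp add: unt_def m)
  fix w assume "w : vec k B S"
  then obtain y where y: "y : carrier (Q S)" "w = q S y" using ex by blast
  show "mul S v w : vec k B S" "mul S v w = mul S w v" using x y by (simp_all add: m q c.m_comm)
  show "mul S (vscale B S s v) w = vscale B S s (mul S v w)" if "s : carrier S" for s
   using x y that by (simp add: smult m a.smult_assoc2)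
  fix z assume "z : vec k B S"
  then obtain u where u: "u : carrier (Q S)" "z = q S u" using ex by blast
  show "mul S (mul S v w) z = mul S v (mul S w z)" "mul S (vadd B S v w) z = vadd B S (mul S v z) (mul S w z)"
   using x y u by (simp_all add: m add c.m_assoc c.l_distr)
 next
  fix S U f assume S: "S : Algs R" and U: "U : Algs R" and f: "f : alg_hom R S U"
  interpret c: cring "Q S" by (rule algebra.M_cring[OF Q[OF S]])
  note h = hom[OF S U f] and nat = nat[OF S U f, symmetric]
  show "vmap B f (unt S) = unt U" by (simp add: unt_def nat ring_hom_one[OF h])
  fix v w assume v: "v : vec k B S" and w: "w : vec k B S"
  obtain x where "x : carrier (Q S)" "v = q S x" using ex[OF S v] ..
  moreover obtain y where "y : carrier (Q S)" "w = q S y" using ex[OF S w] ..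
  ultimately show "vmap B f (mul S v w) = mul U (vmap B f v) (vmap B f w)"
   by (simp add: m[OF S] m[OF U] nat ring_hom_mult[OF h] ring_hom_closed[OF h])
 qed
 then show ?thesis using m unfolding unt_def by blast
qed

section \<open>Spectra of free algebras\<close>

locale framed_algebra = algebra R A + framed R A B co
 for R :: "('u, 'm) ring_scheme" and A :: "'u alg" and B :: "'u set" and co :: "'u => 'u => 'u"
begin

definition ext where "ext S x = (\<lambda>a\<in>carrier A. pair B S (vmap B (struct_map R S) (co a)) x)"

lemma vmap_vunit_struct_map: assumes "S : Algs R" shows "vmap B (struct_map R S) (vunit B R b) = vunit B S b"
 using vmap_vunit[OF alg_homD(2)[OF struct_map_hom[OF assms]] _ cring_of[OF assms], of B b] cR by (simp add: cring_self_alg)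

lemma ext_\<beta>: assumes S: "S : Algs R" and x: "x : vec True B S" and b: "b : B" shows "ext S x (\<beta> b) = x b"
 using \<beta> pair_vunit_left[OF cring_of[OF S] x b] by (simp add: ext_def vmap_vunit_struct_map[OF S])

lemma ext_restrict:
 assumes S: "S : Algs R" and \<phi>: "\<phi> : alg_hom R A S"
 shows "ext S (\<lambda>b\<in>B. \<phi> (\<beta> b)) = \<phi>"
proof (rule extensionalityI[of _ "carrier A"])
 note cS = cring_of[OF S]
 interpret S: cring S by (rule cS)
 fix a assume a: "a : carrier A"
 let ?K = "{b\<in>B. co a b \<noteq> \<zero>\<^sub>R}"
 note p = alg_homD[OF \<phi>]
 note j = alg_homD[OF struct_map_hom[OF S], simplified]
 have j0: "struct_map R S \<zero>\<^sub>R = \<zero>\<^sub>S"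
  using ring_hom_0[OF alg_homD(2)[OF struct_map_hom[OF S]] cring_self_alg[OF cR] cS] by simp
 have x: "(\<lambda>b\<in>B. \<phi> (\<beta> b)) : vec True B S" by (rule vecI) (use p \<beta> in auto)
 have K: "finite ?K" "?K \<subseteq> B" using vec_finite[OF co_vec[OF a]] by auto
 have "pair B S (vmap B (struct_map R S) (co a)) (\<lambda>b\<in>B. \<phi> (\<beta> b)) =
   finsum S (\<lambda>b. vmap B (struct_map R S) (co a) b \<otimes>\<^sub>S (\<lambda>b\<in>B. \<phi> (\<beta> b)) b) ?K"
  by (rule pair_eq_finsum[OF cS vmap_struct_map[OF S co_vec[OF a]] x K]) (use p \<beta> j0 in auto)
 also have "\<dots> = finsum S (\<lambda>b. \<phi> (co a b \<odot>\<^sub>A \<beta> b)) ?K" by (rule S.finsum_cong')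
   (use p \<beta> vec_closed[OF co_vec[OF a]] in "auto simp: smult_eq_struct_map[of R S] S[unfolded Algs_iff]")
 also have "\<dots> = \<phi> a" by (rule combination_map[OF _ S.abelian_group_axioms a], rule addmapI) (use p in auto)
 finally show "ext S (\<lambda>b\<in>B. \<phi> (\<beta> b)) a = \<phi> a" using a by (simp add: ext_def)
qed (use alg_homD(1)[OF \<phi>] in \<open>auto simp: ext_def\<close>)

text \<open>A homomorphism from \<open>A\<close> to \<open>S\<close> is a linear map, given freely
  by its values on the basis; it preserves products and the unit exactly when these values form a
  multiplicative form on \<open>A \<otimes> S\<close>. Linear extension \<open>ext\<close> is the
  inverse.\<close>

lemma Spec_iso_Char:
 assumes va: "vec_algebra R False B mul unt"
  and m: "\<And>a a'. [|a : carrier A; a' : carrier A|] ==> mul (self_alg R) (co a) (co a') = co (a \<otimes>\<^sub>A a')"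
  and o: "unt (self_alg R) = co \<one>\<^sub>A"
 shows "functor_iso R (Spec R A) (Char_functor R False B mul unt)"
proof -
 interpret va: vec_algebra R False B mul unt by fact
 have sR: "self_alg R : Algs R" by (rule self_Algs[OF cR])
 have mS: "mul S (vmap B (struct_map R S) (co a)) (vmap B (struct_map R S) (co a')) = vmap B (struct_map R S) (co (a \<otimes>\<^sub>A a'))"
  if S: "S : Algs R" and "a : carrier A" "a' : carrier A" for S a a'
  using va.mul_natural[OF sR S struct_map_hom[OF S], of "co a" "co a'"] that m co_vec by simp
 have oS: "unt S = vmap B (struct_map R S) (co \<one>\<^sub>A)" if S: "S : Algs R" for S
  using va.one_natural[OF sR S struct_map_hom[OF S]] o by simp
 show ?thesis
 proof (rule functor_isoI[where h = "\<lambda>S \<phi>. \<lambda>b\<in>B. \<phi> (\<beta> b)"])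
  fix S assume S: "S : Algs R"
  note cS = cring_of[OF S]
  interpret S: cring S by (rule cS)
  have j: "struct_map R S : ring_hom R S" using alg_homD(2)[OF struct_map_hom[OF S]] by (simp add: ring_hom_def)
  note vm = vmap_struct_map[OF S co_vec]
  have res: "(\<lambda>b\<in>B. \<phi> (\<beta> b)) : va.points S" if \<phi>: "\<phi> : alg_hom R A S" for \<phi>
  proof (rule va.Char_unitsI[OF S])
   note p = alg_homD[OF \<phi>]
   show x: "(\<lambda>b\<in>B. \<phi> (\<beta> b)) : vec (\<not> False) B S" by (rule vecI) (use p \<beta> in auto)
   have e: "pair B S (vmap B (struct_map R S) (co a)) (\<lambda>b\<in>B. \<phi> (\<beta> b)) = \<phi> a" if "a : carrier A" for a
    using fun_cong[OF ext_restrict[OF S \<phi>], of a] that by (simp add: ext_def)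
   show "pair B S (unt S) (\<lambda>b\<in>B. \<phi> (\<beta> b)) = \<one>\<^sub>S" by (simp add: oS[OF S] e p(4))
   show "pair B S (mul S (vunit B S b) (vunit B S c)) (\<lambda>b\<in>B. \<phi> (\<beta> b)) = (\<lambda>b\<in>B. \<phi> (\<beta> b)) b \<otimes>\<^sub>S (\<lambda>b\<in>B. \<phi> (\<beta> b)) c"
    if "b : B" "c : B" for b c
    using mS[OF S \<beta>(1) \<beta>(1), of b c] e[of "\<beta> b \<otimes>\<^sub>A \<beta> c"] that \<beta> by (simp add: vmap_vunit_struct_map[OF S] p(6))
  qed
  have extx: "ext S x : alg_hom R A S" if x: "x : va.points S" for x
  proof (rule alg_homI)
   have xv: "x : vec (\<not> False) B S" using Char_vec[OF x] .
   show "ext S x : extensional (carrier A)" by (simp add: ext_def)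
   show "ext S x a : carrier S" if "a : carrier A" for a
    using pair_closed[OF cS vm[OF that] xv] that by (simp add: ext_def)
   show "ext S x \<one>\<^sub>A = \<one>\<^sub>S" using Char_one[OF S x] by (simp add: ext_def oS[OF S])
   show "ext S x (a \<oplus>\<^sub>A a') = ext S x a \<oplus>\<^sub>S ext S x a'" if a: "a : carrier A" "a' : carrier A" for a a'
    using a pair_vadd[OF cS vm[OF a(1)] vm[OF a(2)] xv]
    by (simp add: ext_def co_add vmap_vadd[OF j co_vec[OF a(1)] co_vec[OF a(2)]])
   show "ext S x (a \<otimes>\<^sub>A a') = ext S x a \<otimes>\<^sub>S ext S x a'" if a: "a : carrier A" "a' : carrier A" for a a'
    using a Char_mul[OF S x vm[OF a(1)] vm[OF a(2)]] by (simp add: ext_def mS[OF S])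
   show "ext S x (r \<odot>\<^sub>A a) = r \<odot>\<^sub>S ext S x a" if a: "r : carrier R" "a : carrier A" for r a
    using a pair_vscale[OF cS ring_hom_closed[OF j a(1)] vm[OF a(2)] xv] pair_closed[OF cS vm[OF a(2)] xv]
     S[unfolded Algs_iff] by (simp add: ext_def co_smult vmap_vscale[OF j a(1) co_vec[OF a(2)]] smult_eq_struct_map[of R S])
  qed
  have "(\<lambda>b\<in>B. ext S x (\<beta> b)) = x" if x: "x : va.points S" for x
   using Char_vec[OF x] vec_extensional[OF Char_vec[OF x]] by (intro extensionalityI[of _ B]) (auto simp: ext_\<beta>[OF S])
  then show "bij_betw (\<lambda>\<phi>. \<lambda>b\<in>B. \<phi> (\<beta> b)) (vals (Spec R A) S) (vals (Char_functor R False B mul unt) S)"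
   using res extx ext_restrict[OF S] by (intro bij_betw_byWitness[of _ "ext S"]) (auto simp: Spec_def)
 next
  fix T U f \<phi> assume T: "T : Algs R" and U: "U : Algs R" and f: "f : alg_hom R T U" and \<phi>: "\<phi> : vals (Spec R A) T"
  show "Ar (Spec R A) T U f \<phi> : vals (Spec R A) U"
   using f \<phi> alg_hom_compose[OF _ f algebra_axioms] by (simp add: Spec_def)
  show "(\<lambda>b\<in>B. Ar (Spec R A) T U f \<phi> (\<beta> b)) = Ar (Char_functor R False B mul unt) T U f (\<lambda>b\<in>B. \<phi> (\<beta> b))"
   using \<beta>(1) by (auto simp: Spec_def vmap_def compose_def fun_eq_iff)
 qed
qed

text \<open>The algebra of vectors over \<open>S\<close> is \<open>A \<otimes> S\<close> in
  coordinates. Over the base ring it is \<open>A\<close> itself, which ties the product of vectors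
  to that of \<open>A\<close>.\<close>

lemma vec_algebra_exists:
 assumes inf: "infinite (UNIV :: 'u set)"
 shows "\<exists>mul unt. vec_algebra R False B mul unt \<and>
  (\<forall>a\<in>carrier A. \<forall>a'\<in>carrier A. mul (self_alg R) (co a) (co a') = co (a \<otimes>\<^sub>A a')) \<and> unt (self_alg R) = co \<one>\<^sub>A"
proof -
 have ta: "tensor_alg R A T" if "T : Algs R" for T
  using tensor_prod[OF that] by (simp add: tensor_alg_def algebra_axioms)
 have tm: "tensor_map R A T A U (\<lambda>m. m) f : ring_hom (tensor R A T) (tensor R A U)"
  if T: "T : Algs R" and U: "U : Algs R" and f: "f : alg_hom R T U" for T U f
 proof (rule ring_hom_memI)
  have idr: "(\<lambda>m. m) : ring_hom A A" by (simp add: ring_hom_def)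
  have h: "addmap (tensor R A T) (tensor R A U) (tensor_map R A T A U (\<lambda>m. m) f)"
   by (rule tensor_map(1)[OF tensor_prod[OF T] tensor_prod[OF U]]) (auto simp: alg_homD[OF f])
  note hD = addmapD[OF h] and m = tensor_map_mult[OF ta[OF T] ta[OF U] idr _ alg_homD(2)[OF f]]
  show "tensor_map R A T A U (\<lambda>m. m) f X : carrier (tensor R A U)" if "X : carrier (tensor R A T)" for X
   using hD(1)[OF that] .
  show "tensor_map R A T A U (\<lambda>m. m) f (X \<oplus>\<^sub>(tensor R A T) Y) =
    tensor_map R A T A U (\<lambda>m. m) f X \<oplus>\<^sub>(tensor R A U) tensor_map R A T A U (\<lambda>m. m) f Y"
   if "X : carrier (tensor R A T)" "Y : carrier (tensor R A T)" for X Y using hD(2)[OF that] .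
 qed (rule tensor_map_mult[OF ta[OF T] ta[OF U] _ _ alg_homD(2)[OF f]]; auto simp: alg_homD[OF f] ring_hom_def)+
 obtain mul unt where va: "vec_algebra R False B mul unt"
  and m: "\<forall>S\<in>Algs R. (\<forall>x\<in>carrier (tensor R A S). \<forall>y\<in>carrier (tensor R A S).
   mul S (\<rho> S x) (\<rho> S y) = \<rho> S (x \<otimes>\<^sub>(tensor R A S) y)) \<and> unt S = \<rho> S \<one>\<^sub>(tensor R A S)"
  using vec_algebra_transport[OF cR inf tensor_alg.P_algebra[OF ta] \<rho>_bij \<rho>_add \<rho>_smult tm \<rho>_natural] by blast
 have sR: "self_alg R : Algs R" by (rule self_Algs[OF cR])
 interpret ta: tensor_alg R A "self_alg R" by (rule ta[OF sR])
 interpret R: cring R by (rule cR)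
 have one: "\<one>\<^sub>R : carrier R" "\<one>\<^sub>R \<otimes>\<^sub>R \<one>\<^sub>R = \<one>\<^sub>R" by simp_all
 have sm: "vmap B (struct_map R (self_alg R)) (co a) = co a" if "a : carrier A" for a
  using vec_closed[OF co_vec[OF that]] vec_extensional[OF co_vec[OF that]]
  by (intro extensionalityI[of _ B]) (auto simp: struct_map_def)
 have co: "\<rho> (self_alg R) (tens R A (self_alg R) a \<one>\<^sub>R) = co a" if "a : carrier A" for a
  using \<rho>_tens_one[OF sR that] by (simp add: sm[OF that])
 note m = m[rule_format, OF sR, THEN conjunct1, rule_format] m[rule_format, OF sR, THEN conjunct2]
 have "mul (self_alg R) (co a) (co a') = co (a \<otimes>\<^sub>A a')" if "a : carrier A" "a' : carrier A" for a a'
  using m(1)[OF ta.tn_closed[OF that(1)] ta.tn_closed[OF that(2)], of "\<one>\<^sub>R" "\<one>\<^sub>R"] that one by (simp add: co ta.P_mult(3))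
 moreover have "unt (self_alg R) = co \<one>\<^sub>A" using m(2) by (simp add: ta.P_one co)
 ultimately show ?thesis using va by blast
qed

end

text \<open>The vectors over the base ring form the desired free algebra; finite support, that is
  \<open>\<not> k\<close>, allows a copy of it inside \<open>'u\<close>.\<close>

lemma (in vec_algebra) free_algebra_exists:
 assumes k: "\<not> k"
 shows "\<exists>A co. framed_algebra R A B co \<and>
  (\<forall>a\<in>carrier A. \<forall>a'\<in>carrier A. mul (self_alg R) (co a) (co a') = co (a \<otimes>\<^sub>A a')) \<and> unt (self_alg R) = co \<one>\<^sub>A"
proof -
 have sR: "self_alg R : Algs R" by (rule self_Algs[OF R])
 note fs = mul_closed[OF sR] mul_comm[OF sR] mul_assoc[OF sR] one_mul[OF sR] mul_vadd[OF sR] mul_vscale[OF sR] one_closed[OF sR]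
 let ?V = "vec_mod (\<lambda>r. r) False B R (mul (self_alg R)) (unt (self_alg R))"
 have V: "algebra R ?V"
 proof (rule vec_mod_algebra[OF R R])
  show "(\<lambda>r. r) : ring_hom R R" by (simp add: ring_hom_def)
 qed (use fs k in simp_all)
 obtain e :: "('u => 'u) => 'u" where e: "inj_on e (vec False B R)" using inj_vec_False[OF inf] .
 obtain A :: "'u alg" where A: "algebra R A" "carrier A = e ` carrier ?V" "e : ring_hom ?V A"
  "\<And>r x. [|r : carrier R; x : carrier ?V|] ==> e (r \<odot>\<^sub>?V x) = r \<odot>\<^sub>A e x"
 proof (rule image_algebra[OF V, of e])
 qed (use e in "simp_all add: inj_on_eq_iff")
 define co where "co = inv_into (vec False B R) e"
 have co: "co (e v) = v" if "v : vec False B R" for v using that e by (simp add: co_def)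
 have cA: "carrier A = e ` vec False B R" using A(2) by simp
 note e' = ring_hom_add[OF A(3), simplified, symmetric] ring_hom_mult[OF A(3), simplified, symmetric]
  ring_hom_one[OF A(3), simplified, symmetric]
 have es: "r \<odot>\<^sub>A e x = e (vscale B R r x)" if "r : carrier R" "x : vec False B R" for r x using A(4)[of r x] that by simp
 have "frame R A B co" unfolding frame_def
 proof (intro conjI ballI)
  show "bij_betw co (carrier A) (vec False B R)" unfolding cA by (rule bij_betw_byWitness[of _ e]) (use co in auto)
 qed (auto simp: cA e' es co R)
 then have "framed_algebra R A B co" using A(1) by (simp add: framed_algebra_def framed_def framed_axioms_def algebra.axioms)
 moreover have "mul (self_alg R) (co a) (co a') = co (a \<otimes>\<^sub>A a')" if "a : carrier A" "a' : carrier A" for a a'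
  using that fs(1) k by (auto simp: cA e' co)
 moreover have "unt (self_alg R) = co \<one>\<^sub>A" using fs(7) k by (simp add: e' co)
 ultimately show ?thesis by blast
qed

theorem affine_free_scheme_iff:
 fixes R :: "('u, 'm) ring_scheme"
 assumes R: "cring R" and inf: "infinite (UNIV :: 'u set)"
  and F: "set_functor R F"
 shows "affine_free_scheme R F \<longleftrightarrow>
  (\<exists>B mul unt. vec_algebra R False B mul unt \<and> functor_iso R F (Char_functor R False B mul unt))"
proof -
 have FA: "Ar F T U f x : vals F U"
  if "T : Algs R" "U : Algs R" "f : alg_hom R T U" "x : vals F T" for T U f x
  using F that unfolding set_functor_def by blast
 show ?thesis
 proof
  assume "affine_free_scheme R F"
  then obtain A where A: "algebra R A" "free_mod R A" and iso: "functor_iso R F (Spec R A)"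
   unfolding affine_free_scheme_def by blast
  obtain B :: "'u set" and co where fr: "frame R A B co" using free_mod_frame[OF A(2)] by blast
  interpret framed_algebra R A B co
   using A(1) fr by (simp add: framed_algebra_def framed_def framed_axioms_def algebra.axioms)
  obtain mul unt where m: "vec_algebra R False B mul unt"
   "\<forall>a\<in>carrier A. \<forall>a'\<in>carrier A. mul (self_alg R) (co a) (co a') = co (a \<otimes>\<^sub>A a')" "unt (self_alg R) = co \<one>\<^sub>A"
   using vec_algebra_exists[OF inf] by blast
  have "functor_iso R (Spec R A) (Char_functor R False B mul unt)"
   by (rule Spec_iso_Char[OF m(1) _ m(3)]) (use m(2) in blast)
  from functor_iso_trans[OF iso this FA] m(1)
  show "\<exists>B mul unt. vec_algebra R False B mul unt \<and> functor_iso R F (Char_functor R False B mul unt)" by blast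
 next
  assume "\<exists>B mul unt. vec_algebra R False B mul unt \<and> functor_iso R F (Char_functor R False B mul unt)"
  then obtain B mul unt where va: "vec_algebra R False B mul unt" and iso: "functor_iso R F (Char_functor R False B mul unt)"
   by blast
  interpret va: vec_algebra R False B mul unt by fact
  obtain A co where fa: "framed_algebra R A B co"
   and m: "\<forall>a\<in>carrier A. \<forall>a'\<in>carrier A. mul (self_alg R) (co a) (co a') = co (a \<otimes>\<^sub>A a')" "unt (self_alg R) = co \<one>\<^sub>A"
   using va.free_algebra_exists by blast
  interpret framed_algebra R A B co by fact
  have "functor_iso R (Spec R A) (Char_functor R False B mul unt)" by (rule Spec_iso_Char[OF va _ m(2)]) (use m(1) in blast)
  then have "functor_iso R (Char_functor R False B mul unt) (Spec R A)"
   by (rule functor_iso_sym) (rule Spec_Ar[OF algebra_axioms] Char_functor_Ar; assumption)+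
  from functor_iso_trans[OF iso this FA]
  show "affine_free_scheme R F" unfolding affine_free_scheme_def using algebra_axioms free by blast
 qed
qed

section \<open>Formal schemes as schemes of points\<close>

lemma ops_base [simp]:
 "vadd B (over R S T) = vadd B T" "vscale B (over R S T) = vscale B T"
 "vunit B (over R S T) = vunit B T" "vzero B (over R S T) = vzero B T"
 by (auto simp: vadd_def vscale_def vunit_def vzero_def fun_eq_iff)

lemma one_closed_Algs: "T : Algs R ==> \<one>\<^sub>T : carrier T" by (rule cring.cring_simprules(6)[OF cring_of])

text \<open>In contrast to \<open>image_algebra\<close> the record \<open>T\<close> is given in
  advance, so closure of its operations has to be supplied; injectivity of \<open>q\<close> then
  pulls the laws back.\<close>

lemma algebra_transport:
 assumes A: "algebra R A" and inj: "inj_on q (carrier T)" and q: "q ` carrier T = carrier A"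
  and cl: "\<And>x y. [|x : carrier T; y : carrier T|] ==> x \<oplus>\<^sub>T y : carrier T"
   "\<And>x y. [|x : carrier T; y : carrier T|] ==> x \<otimes>\<^sub>T y : carrier T"
   "\<And>r x. [|r : carrier R; x : carrier T|] ==> r \<odot>\<^sub>T x : carrier T" "\<zero>\<^sub>T : carrier T" "\<one>\<^sub>T : carrier T"
  and h: "\<And>x y. [|x : carrier T; y : carrier T|] ==> q (x \<oplus>\<^sub>T y) = q x \<oplus>\<^sub>A q y"
   "\<And>x y. [|x : carrier T; y : carrier T|] ==> q (x \<otimes>\<^sub>T y) = q x \<otimes>\<^sub>A q y"
   "\<And>r x. [|r : carrier R; x : carrier T|] ==> q (r \<odot>\<^sub>T x) = r \<odot>\<^sub>A q x" "q \<zero>\<^sub>T = \<zero>\<^sub>A" "q \<one>\<^sub>T = \<one>\<^sub>A"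
 shows "algebra R T"
proof -
 interpret A: algebra R A by fact
 have qc: "q x : carrier A" if "x : carrier T" for x using q that by blast
 have eqI: "x = y" if "x : carrier T" "y : carrier T" "q x = q y" for x y using inj that by (simp add: inj_on_def)
 have ring: "cring T"
 proof (intro cringI abelian_groupI comm_monoidI)
  fix x assume x: "x : carrier T"
  have "\<ominus>\<^sub>A q x : q ` carrier T" using q qc[OF x] by simp
  then obtain y where y: "y : carrier T" "q y = \<ominus>\<^sub>A q x" by auto
  then have "y \<oplus>\<^sub>T x = \<zero>\<^sub>T" using x qc by (intro eqI) (auto simp: cl h A.M.l_neg)
  with y show "\<exists>y\<in>carrier T. y \<oplus>\<^sub>T x = \<zero>\<^sub>T" by blast
 qed (auto intro!: eqI simp: cl h qc A.M.a_ac A.m_ac A.l_distr A.r_distr)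
 show ?thesis
  by (rule algebraI)
   (auto intro!: eqI simp: ring A.R_cring cl h qc A.smult_l_distr A.smult_r_distr A.smult_assoc1 A.smult_assoc2
    cring.cring_simprules(1,5,6)[OF A.R_cring])
qed

section \<open>The dual of a free module in coordinates\<close>

locale framed_module = framed R C B co
 for R :: "('u, 'm) ring_scheme" and C :: "'u alg" and B :: "'u set" and co :: "'u => 'u => 'u"
begin

abbreviation "D \<equiv> dual_module R (quasi_coherent R C)"

abbreviation "CT S T \<equiv> tensor R C (over R S T)"

lemma D_simps:
 "\<zero>\<^sub>(Ob D S) = (\<lambda>T\<in>Algs S. \<lambda>X\<in>carrier (CT S T). \<zero>\<^sub>T)"
 "et \<oplus>\<^sub>(Ob D S) th = (\<lambda>T\<in>Algs S. \<lambda>X\<in>carrier (CT S T). et T X \<oplus>\<^sub>T th T X)"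
 "s \<odot>\<^sub>(Ob D S) et = (\<lambda>T\<in>Algs S. \<lambda>X\<in>carrier (CT S T). s \<odot>\<^sub>T et T X)"
 "Ar D = base_change_trans" by (simp_all add: dual_module_def restrict_functor_def quasi_coherent_def Let_def)

lemma D_carrier:
 "et : vals D S \<longleftrightarrow> et : extensional (Algs S) \<and>
   (\<forall>T\<in>Algs S. et T : carrier (CT S T) \<rightarrow>\<^sub>E carrier T) \<and>
   (\<forall>T\<in>Algs S. \<forall>U\<in>Algs S. \<forall>f\<in>alg_hom S T U. \<forall>X\<in>carrier (CT S T).
    et U (tensor_map R C (over R S T) C (over R S U) (\<lambda>m. m) f X) = f (et T X)) \<and>
   (\<forall>T\<in>Algs S.
    (\<forall>X\<in>carrier (CT S T). \<forall>Y\<in>carrier (CT S T).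
     et T (X \<oplus>\<^sub>(CT S T) Y) = et T X \<oplus>\<^sub>T et T Y) \<and>
    (\<forall>t\<in>carrier T. \<forall>X\<in>carrier (CT S T).
     et T (t \<odot>\<^sub>(CT S T) X) = t \<otimes>\<^sub>T et T X))"
 by (simp add: dual_module_def restrict_functor_def quasi_coherent_def Let_def linear_trans_def nat_trans_def
   struct_ring_def conj_assoc)

lemma D_D:
 assumes "et : vals D S"
 shows "et : extensional (Algs S)"
  "T : Algs S ==> et T : extensional (carrier (CT S T))"
  "[|T : Algs S; X : carrier (CT S T)|] ==> et T X : carrier T"
  "[|T : Algs S; U : Algs S; f : alg_hom S T U; X : carrier (CT S T)|]
   ==> et U (tensor_map R C (over R S T) C (over R S U) (\<lambda>m. m) f X) = f (et T X)"
  "[|T : Algs S; X : carrier (CT S T); Y : carrier (CT S T)|]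
   ==> et T (X \<oplus>\<^sub>(CT S T) Y) = et T X \<oplus>\<^sub>T et T Y"
  "[|T : Algs S; t : carrier T; X : carrier (CT S T)|]
   ==> et T (t \<odot>\<^sub>(CT S T) X) = t \<otimes>\<^sub>T et T X"
proof -
 note d = assms[unfolded D_carrier]
 show "et : extensional (Algs S)" using d by (rule conjunct1)
 show "T : Algs S ==> et T : extensional (carrier (CT S T))"
  "[|T : Algs S; X : carrier (CT S T)|] ==> et T X : carrier T" using d by (simp_all add: PiE_iff)
qed (use assms[unfolded D_carrier] in simp_all)

text \<open>The coordinates of a form are its values at the basis tensors over \<open>S\<close>
  itself, the initial algebra of \<open>Algs S\<close>.\<close>

definition crd where
 "crd S et = (\<lambda>b\<in>B. et (self_alg S) (tens R C (over R S (self_alg S)) (\<beta> b) \<one>\<^sub>S))"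

definition \<Theta> where
 "\<Theta> S u = (\<lambda>T\<in>Algs S. \<lambda>X\<in>carrier (CT S T).
   pair B T (\<rho> (over R S T) X) (vmap B (struct_map S T) u))"

lemma tens_closed: "[|T : Algs R; c : carrier C; t : carrier T|] ==> tens R C T c t : carrier (tensor R C T)"
 by (rule tensor_prod.tn_closed[OF tensor_prod])

lemma tensor_map_tens:
 assumes "T : Algs R" "U : Algs R" "f : alg_hom R T U" "c : carrier C" "t : carrier T"
 shows "tensor_map R C T C U (\<lambda>m. m) f (tens R C T c t) = tens R C U c (f t)"
 by (rule tensor_map(2)[OF tensor_prod[OF assms(1)] tensor_prod[OF assms(2)]]) (use assms in "auto simp: alg_homD[OF assms(3)]")

lemma tensor_map_closed:
 assumes "T : Algs R" "U : Algs R" "f : alg_hom R T U" "X : carrier (tensor R C T)"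
 shows "tensor_map R C T C U (\<lambda>m. m) f X : carrier (tensor R C U)"
 by (rule addmapD(1)[OF tensor_map(1)[OF tensor_prod[OF assms(1)] tensor_prod[OF assms(2)]] assms(4)])
  (auto simp: alg_homD[OF assms(3)])

lemma crd_vec:
 assumes S: "S : Algs R" and et: "et : vals D S" shows "crd S et : vec True B S"
proof -
 note sS = self_Algs[OF cring_of[OF S]]
 show ?thesis
  by (rule vecI) (use D_D(3)[OF et sS tens_closed[OF as_base_Algs[OF S sS] \<beta>(1)]] one_closed_Algs[OF S] in "auto simp: crd_def")
qed

text \<open>Naturality along the structure map fixes the form on basis tensors over
  \<open>T\<close>, additivity extends this to all \<open>c \<otimes> 1\<close> because
  \<open>co c\<close> has finite support, and \<open>T\<close>-linearity reaches all elementary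
  tensors.\<close>

lemma crd_eq:
 assumes S: "S : Algs R" and et: "et : vals D S" and T: "T : Algs S"
  and X: "X : carrier (CT S T)"
 shows "et T X = pair B T (\<rho> (over R S T) X) (vmap B (struct_map S T) (crd S et))"
proof -
 let ?T = "over R S T"
 note cT = cring_of[OF T]
 note T' = as_base_Algs[OF S T]
 note sS = self_Algs[OF cring_of[OF S]]
 note u = vmap_struct_map[OF T crd_vec[OF S et]]
 note d = D_D[OF et]
 interpret T: cring T by (rule cT)
 interpret P: tensor_prod R C ?T by (rule tensor_prod[OF T'])
 have one: "\<one>\<^sub>T : carrier ?T" by simp
 have unit: "et T (P.tn (\<beta> b) \<one>\<^sub>T) = vmap B (struct_map S T) (crd S et) b" if b: "b : B" for b
 proof -
  note f = struct_map_hom[OF T]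
  have "et T (tensor_map R C (over R S (self_alg S)) C ?T (\<lambda>m. m) (struct_map S T)
    (tens R C (over R S (self_alg S)) (\<beta> b) \<one>\<^sub>S)) = struct_map S T (crd S et b)"
   using d(4)[OF sS T f tens_closed[OF as_base_Algs[OF S sS] \<beta>(1)]] b one_closed_Algs[OF S] by (simp add: crd_def)
  then show ?thesis
   using tensor_map_tens[OF as_base_Algs[OF S sS] T' as_base_alg_hom[OF S f] \<beta>(1), of "\<one>\<^sub>S"] b
    one_closed_Algs[OF S] alg_homD(4)[OF f] by simp
 qed
 have gen: "et T (P.tn c \<one>\<^sub>T) = pair B T (vmap B (struct_map R ?T) (co c)) (vmap B (struct_map S T) (crd S et))"
  if c: "c : carrier C" for c
 proof -
  let ?K = "{b\<in>B. co c b \<noteq> \<zero>\<^sub>R}"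
  have K: "finite ?K" "?K \<subseteq> B" using vec_finite[OF co_vec[OF c]] by auto
  note j = alg_homD[OF struct_map_hom[OF T'], simplified]
  have j0: "struct_map R ?T \<zero>\<^sub>R = \<zero>\<^sub>T"
   using ring_hom_0[OF alg_homD(2)[OF struct_map_hom[OF T']] cring_self_alg[OF cR] cring_of[OF T']] by simp
  have tr: "P.tn (r \<odot>\<^sub>C m) \<one>\<^sub>T = struct_map R ?T r \<odot>\<^sub>P.P P.tn m \<one>\<^sub>T" if "r : carrier R" "m : carrier C" for r m
   using that P.tn_balanced[OF that one] P.P_smult(2)[OF _ that(2) one, of "struct_map R ?T r"] j(3)[OF that(1)]
    smult_eq_struct_map[OF T'[unfolded Algs_iff] that(1) one] by simp
  have am: "addmap C T (\<lambda>c. et T (P.tn c \<one>\<^sub>T))"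
   by (rule addmapI) (use d(3)[OF T P.tn_closed[OF _ one]] d(5)[OF T P.tn_closed[OF _ one] P.tn_closed[OF _ one]] P.tn_add_left[OF _ _ one] in auto)
  have "pair B T (vmap B (struct_map R ?T) (co c)) (vmap B (struct_map S T) (crd S et))
   = finsum T (\<lambda>b. vmap B (struct_map R ?T) (co c) b \<otimes>\<^sub>T vmap B (struct_map S T) (crd S et) b) ?K"
   by (rule pair_eq_finsum[OF cT _ u K, where k = False])
    (use vmap_struct_map[OF T' co_vec[OF c]] vec_closed[OF u] j0 in auto)
  also have "\<dots> = finsum T (\<lambda>b. et T (P.tn (co c b \<odot>\<^sub>C \<beta> b) \<one>\<^sub>T)) ?K"
  proof (rule T.finsum_cong')
   fix b assume b: "b : ?K"
   then have cb: "b : B" "co c b : carrier R" using vec_closed[OF co_vec[OF c]] by auto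
   show "vmap B (struct_map R ?T) (co c) b \<otimes>\<^sub>T vmap B (struct_map S T) (crd S et) b = et T (P.tn (co c b \<odot>\<^sub>C \<beta> b) \<one>\<^sub>T)"
    using d(6)[OF T _ P.tn_closed[OF \<beta>(1) one], of "struct_map R ?T (co c b)" b] unit[OF cb(1)] cb j(3)[OF cb(2)]
    by (simp add: tr[OF cb(2) \<beta>(1)])
  qed (use addmapD(1)[OF am] vec_closed[OF co_vec[OF c]] \<beta>(1) in auto)
  also have "\<dots> = et T (P.tn c \<one>\<^sub>T)" by (rule combination_map[OF am T.abelian_group_axioms c])
  finally show ?thesis ..
 qed
 have r1: "addmap P.P T (\<lambda>X. pair B T (\<rho> ?T X) (vmap B (struct_map S T) (crd S et)))"
 proof (rule addmapI)
  fix X assume X: "X : carrier P.P"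
  have v: "\<rho> ?T X : vec False B T" using \<rho>_closed[OF T' X] by simp
  show "pair B T (\<rho> ?T X) (vmap B (struct_map S T) (crd S et)) : carrier T" by (rule pair_closed[OF cT v u])
  fix Y assume Y: "Y : carrier P.P"
  have w: "\<rho> ?T Y : vec False B T" using \<rho>_closed[OF T' Y] by simp
  show "pair B T (\<rho> ?T (X \<oplus>\<^sub>P.P Y)) (vmap B (struct_map S T) (crd S et)) =
   pair B T (\<rho> ?T X) (vmap B (struct_map S T) (crd S et)) \<oplus>\<^sub>T pair B T (\<rho> ?T Y) (vmap B (struct_map S T) (crd S et))"
   using pair_vadd[OF cT v w] u by (simp add: \<rho>_add[OF T' X Y])
 qed
 have r2: "addmap P.P T (et T)" by (rule addmapI) (use d(3,5)[OF T] in auto)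
 show ?thesis
 proof (rule P.addmap_eqI[OF r2 r1 T.abelian_group_axioms _ X])
  fix c t assume c: "c : carrier C" and t: "t : carrier ?T"
  have tt: "t : carrier T" using t by simp
  have v: "vmap B (struct_map R ?T) (co c) : vec False B T" using vmap_struct_map[OF T' co_vec[OF c]] by simp
  have "et T (P.tn c t) = t \<otimes>\<^sub>T et T (P.tn c \<one>\<^sub>T)"
   using P.P_smult(2)[OF t c one] tt d(6)[OF T tt P.tn_closed[OF c one]] by simp
  then show "et T (P.tn c t) = pair B T (\<rho> ?T (P.tn c t)) (vmap B (struct_map S T) (crd S et))"
   using gen[OF c] pair_vscale[OF cT tt v] u by (simp add: \<rho>_tens[OF T' c t])
 qed
qed

lemma
 assumes S: "S : Algs R" and u: "u : vec True B S"
 shows \<Theta>_closed: "\<Theta> S u : vals D S" and crd_\<Theta>: "crd S (\<Theta> S u) = u"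
proof -
 show "\<Theta> S u : vals D S" unfolding D_carrier
 proof (intro conjI ballI)
  show "\<Theta> S u : extensional (Algs S)" by (simp add: \<Theta>_def)
  fix T assume T: "T : Algs S"
  let ?T = "over R S T"
  note cT = cring_of[OF T] and T' = as_base_Algs[OF S T]
  have uT: "vmap B (struct_map S T) u : vec (\<not> False) B T" using vmap_struct_map[OF T u] by simp
  have r: "\<rho> ?T X : vec False B T" if "X : carrier (tensor R C ?T)" for X using \<rho>_closed[OF T' that] by simp
  show "\<Theta> S u T : carrier (tensor R C ?T) \<rightarrow>\<^sub>E carrier T"
   using pair_closed[OF cT r uT] T by (auto simp: \<Theta>_def)
  interpret P: tensor_prod R C ?T by (rule tensor_prod[OF T'])
  fix X assume X: "X : carrier (tensor R C ?T)"
  show "\<Theta> S u T (X \<oplus>\<^sub>(tensor R C ?T) Y) = \<Theta> S u T X \<oplus>\<^sub>T \<Theta> S u T Y" if Y: "Y : carrier (tensor R C ?T)" for Y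
   using T X Y pair_vadd[OF cT r[OF X] r[OF Y] uT] by (simp add: \<Theta>_def \<rho>_add[OF T'])
  show "\<Theta> S u T (t \<odot>\<^sub>(tensor R C ?T) X) = t \<otimes>\<^sub>T \<Theta> S u T X" if t: "t : carrier T" for t
   using T X t pair_vscale[OF cT t r[OF X] uT] P.smult_closed[of t X] by (simp add: \<Theta>_def \<rho>_smult[OF T'])
 next
  fix T U f X assume T: "T : Algs S" and U: "U : Algs S" and f: "f : alg_hom S T U"
   and X: "X : carrier (CT S T)"
  note T' = as_base_Algs[OF S T] and U' = as_base_Algs[OF S U] and f' = as_base_alg_hom[OF S f]
  have r: "\<rho> (over R S T) X : vec False B T" using \<rho>_closed[OF T' X] by simp
  have uT: "vmap B (struct_map S T) u : vec (\<not> False) B T" using vmap_struct_map[OF T u] by simp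
  show "\<Theta> S u U (tensor_map R C (over R S T) C (over R S U) (\<lambda>m. m) f X) = f (\<Theta> S u T X)"
   using T U X tensor_map_closed[OF T' U' f' X] pair_alg_hom[OF f T U r uT] vmap_struct_map_hom[OF f T u]
   by (simp add: \<Theta>_def \<rho>_natural[OF T' U' f' X])
 qed
 note sS = self_Algs[OF cring_of[OF S]]
 show "crd S (\<Theta> S u) = u"
 proof (rule extensionalityI[of _ B])
  fix b assume b: "b : B"
  note s1 = as_base_Algs[OF S sS]
  interpret S: cring S by (rule cring_of[OF S])
  have i: "vmap B (struct_map S (self_alg S)) u = u" using vec_closed[OF u] vec_extensional[OF u]
   by (intro extensionalityI[of _ B]) (auto simp: struct_map_def)
  have "\<rho> (over R S (self_alg S)) (tens R C (over R S (self_alg S)) (\<beta> b) \<one>\<^sub>S) = vunit B S b"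
   using \<rho>_\<beta>[OF s1, of b] by simp
  then show "crd S (\<Theta> S u) b = u b"
   using b sS tens_closed[OF s1 \<beta>(1), of "\<one>\<^sub>S" b] pair_vunit_left[OF cring_of[OF S] u b]
   by (simp add: crd_def \<Theta>_def i)
 qed (use vec_extensional[OF u] in "auto simp: crd_def")
qed

lemma \<Theta>_crd:
 assumes S: "S : Algs R" and et: "et : vals D S" shows "\<Theta> S (crd S et) = et"
proof (rule extensionalityI[of _ "Algs S"])
 fix T assume T: "T : Algs S"
 show "\<Theta> S (crd S et) T = et T" by (rule extensionalityI[of _ "carrier (CT S T)"])
   (use T D_D(2)[OF et T] crd_eq[OF S et T] in \<open>auto simp: \<Theta>_def\<close>)
qed (use D_D(1)[OF et] in \<open>auto simp: \<Theta>_def\<close>)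

lemma crd_add:
 "[|S : Algs R; et : vals D S; th : vals D S|] ==> crd S (et \<oplus>\<^sub>(Ob D S) th) = vadd B S (crd S et) (crd S th)"
 using self_Algs[OF cring_of[of S R]] tens_closed[OF as_base_Algs[of S R "self_alg S"] \<beta>(1), of "\<one>\<^sub>S"]
  one_closed_Algs[of S R] by (auto simp: crd_def D_simps intro!: extensionalityI[of _ B])

lemma crd_smult:
 "[|S : Algs R; s : carrier S; et : vals D S|] ==> crd S (s \<odot>\<^sub>(Ob D S) et) = vscale B S s (crd S et)"
 using self_Algs[OF cring_of[of S R]] tens_closed[OF as_base_Algs[of S R "self_alg S"] \<beta>(1), of "\<one>\<^sub>S"]
  one_closed_Algs[of S R] by (auto simp: crd_def D_simps intro!: extensionalityI[of _ B])

lemma crd_zero: "S : Algs R ==> crd S \<zero>\<^sub>(Ob D S) = vzero B S"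
 using self_Algs[OF cring_of[of S R]] tens_closed[OF as_base_Algs[of S R "self_alg S"] \<beta>(1), of "\<one>\<^sub>S"]
  one_closed_Algs[of S R] by (auto simp: crd_def D_simps intro!: extensionalityI[of _ B])

lemma Ar_D_closed:
 assumes S: "S : Algs R" and S': "S' : Algs R" and f: "f : alg_hom R S S'" and et: "et : vals D S"
 shows "base_change_trans S S' f et : vals D S'"
proof -
 note r = restrict_Algs[OF f S] and b = as_base_restrict[OF f S]
 note d = D_D[OF et]
 show ?thesis
  unfolding D_carrier
 proof (intro conjI ballI)
  show "base_change_trans S S' f et : extensional (Algs S')" by (simp add: base_change_trans_def)
  fix T assume T: "T : Algs S'"
  note d' = d(2-)[OF r[OF T]]
  show "base_change_trans S S' f et T : carrier (tensor R C (over R S' T)) \<rightarrow>\<^sub>E carrier T"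
   using T d'(1,2) by (simp add: base_change_trans_def b PiE_iff)
  fix X assume X: "X : carrier (tensor R C (over R S' T))"
  show "base_change_trans S S' f et T (X \<oplus>\<^sub>(tensor R C (over R S' T)) Y) =
   base_change_trans S S' f et T X \<oplus>\<^sub>T base_change_trans S S' f et T Y"
   if "Y : carrier (tensor R C (over R S' T))" for Y
   using T X that d(5)[OF r[OF T]] by (simp add: base_change_trans_def b)
  show "base_change_trans S S' f et T (t \<odot>\<^sub>(tensor R C (over R S' T)) X) = t \<otimes>\<^sub>T base_change_trans S S' f et T X"
   if "t : carrier T" for t using T X that d(6)[OF r[OF T]] by (simp add: base_change_trans_def b)
 next
  fix T U h X assume T: "T : Algs S'" and U: "U : Algs S'" and h: "h : alg_hom S' T U"
   and X: "X : carrier (tensor R C (over R S' T))"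
  show "base_change_trans S S' f et U (tensor_map R C (over R S' T) C (over R S' U) (\<lambda>m. m) h X) =
   h (base_change_trans S S' f et T X)"
   using T U X d(4)[OF r[OF T] r[OF U] restrict_alg_hom[OF f h]] by (simp add: base_change_trans_def b)
 qed
qed

lemma crd_natural:
 assumes S: "S : Algs R" and S': "S' : Algs R" and f: "f : alg_hom R S S'" and et: "et : vals D S"
 shows "crd S' (base_change_trans S S' f et) = vmap B f (crd S et)"
proof (rule extensionalityI[of _ B])
 fix b assume b: "b : B"
 note sS = self_Algs[OF cring_of[OF S']]
 \<comment> \<open>This is \<open>S'\<close> as an algebra over \<open>S\<close> through
   \<open>f\<close>. The base change of \<open>et\<close> is evaluated there, and the structure map
   of this object is \<open>f\<close>.\<close>
 let ?T = "restrict_scalars S f (self_alg S')"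
 note s1 = as_base_Algs[OF S' sS]
 have T: "?T : Algs S" by (rule restrict_Algs[OF f S sS])
 have e: "over R S ?T = over R S' (self_alg S')" by (rule as_base_restrict[OF f S])
 have st: "struct_map S ?T = f" using struct_map_slice[OF f S'] by (simp add: slice_alg_def)
 have X: "tens R C (over R S' (self_alg S')) (\<beta> b) \<one>\<^sub>S' : carrier (tensor R C (over R S' (self_alg S')))"
  using tens_closed[OF s1 \<beta>(1), of "\<one>\<^sub>S'" b] one_closed_Algs[OF S'] by simp
 have v: "vmap B f (crd S et) : vec True B S'" using vmap_alg_hom[OF f S S' crd_vec[OF S et]] .
 have "\<rho> (over R S' (self_alg S')) (tens R C (over R S' (self_alg S')) (\<beta> b) \<one>\<^sub>S') = vunit B S' b"
  using \<rho>_\<beta>[OF s1, of b] by simp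
 then show "crd S' (base_change_trans S S' f et) b = vmap B f (crd S et) b"
  using crd_eq[OF S et T, unfolded e, OF X] b sS pair_vunit_left[OF cring_of[OF S'] v b]
  by (simp add: crd_def base_change_trans_def st[unfolded crd_def])
qed (auto simp: crd_def)

end

section \<open>Copies of tensor products inside \<open>'u\<close>, and pairings with values in
  them\<close>

lemma (in tensor_prod) inj_cosets:
 assumes g: "inj (g :: ('b \<times> 'c \<Rightarrow>\<^sub>0 int) => 'd)"
 shows "inj_on (\<lambda>X. g (SOME x. x : X)) (carrier P)"
proof (rule inj_onI)
 fix X Y assume X: "X : carrier P" and Y: "Y : carrier P" and eq: "g (SOME x. x : X) = g (SOME x. x : Y)"
 have s: "cl (SOME x. x : X) = X" if Xc: "X : carrier P" for X
 proof -
  obtain z where z: "X = cl z" using Xc unfolding P_carrier by blast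
  have "(SOME x. x : X) : X" using cl_self[of z] z by (intro someI[of "\<lambda>x. x : X"]) simp
  then show ?thesis using cl_mem[of _ z] z by simp
 qed
 have "(SOME x. x : X) = (SOME x. x : Y)" using g eq by (simp add: inj_eq)
 then have "cl (SOME x. x : X) = cl (SOME x. x : Y)" by (rule arg_cong)
 then show "X = Y" unfolding s[OF X] s[OF Y] .
qed

lemma tensor_alg_Algs: "[|S : Algs R; U : Algs R|] ==> tensor_alg R S U"
 by (simp add: tensor_alg_def tensor_prod_def Algs_iff algebra.axioms)

abbreviation (input) "inl e R S U \<equiv> \<lambda>s\<in>carrier S. e (tens R S U s \<one>\<^sub>U)"
abbreviation (input) "inr e R S U \<equiv> \<lambda>u\<in>carrier U. e (tens R S U \<one>\<^sub>S u)"

text \<open>Choosing representatives injects the cosets into the free abelian group on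
  \<open>'u \<times> 'u\<close>, which is no larger than that infinite type. The copy makes
  \<open>S \<otimes> U\<close> an object of \<open>Algs R\<close> under both factors, so that
  functors can be evaluated at it.\<close>

lemma tensor_copy:
 fixes S U :: "'u alg"
 assumes inf: "infinite (UNIV :: 'u set)" and S: "S : Algs R" and U: "U : Algs R"
 obtains T e where "T : Algs R" "inj_on e (carrier (tensor R S U))" "e : ring_hom (tensor R S U) T"
  "(inl e R S U) : alg_hom R S T"
  "(inr e R S U) : alg_hom R U T"
proof -
 interpret tensor_alg R S U by (rule tensor_alg_Algs[OF S U])
 interpret PA: algebra U P by (rule P_algebra)
 obtain p :: "'u \<times> 'u => 'u" where p: "inj p" using inj_prod_infinite[OF inf] .
 have "infinite (UNIV :: ('u \<times> 'u) set)" using inf by (metis UNIV_Times_UNIV finite_cartesian_productD1 UNIV_not_empty)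
 from eqpoll_free_Abelian_group_infinite[OF this] obtain g :: "('u \<times> 'u \<Rightarrow>\<^sub>0 int) => 'u \<times> 'u"
  where "bij_betw g (carrier (free_Abelian_group UNIV)) UNIV" unfolding eqpoll_def by blast
 moreover have "carrier (free_Abelian_group (UNIV :: ('u \<times> 'u) set)) = UNIV" by auto
 ultimately have "inj g" by (simp add: bij_betw_def)
 then have "inj (p \<circ> g)" using p by (rule inj_compose[rotated])
 from inj_cosets[OF this] obtain e :: "('u, 'u) tensor => 'u" where e: "inj_on e (carrier P)" by blast
 obtain T0 :: "'u alg" where T0: "algebra U T0" "carrier T0 = e ` carrier P" "e : ring_hom P T0"
  "\<And>r x. [|r : carrier U; x : carrier P|] ==> e (r \<odot>\<^sub>P x) = r \<odot>\<^sub>T0 e x"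
  by (rule image_algebra[OF P_algebra, of e]) (use e in "simp_all add: inj_on_eq_iff")
 have T0A: "T0 : Algs U" using T0(1) by (simp add: Algs_iff)
 let ?T = "over R U T0"
 note e' = ring_hom_closed[OF T0(3)] ring_hom_add[OF T0(3)] ring_hom_mult[OF T0(3)] ring_hom_one[OF T0(3)]
 have one: "\<one>\<^sub>U : carrier U" "\<one>\<^sub>S : carrier S" using one_closed_Algs S U by blast+
 note oneU = cring.cring_simprules(12)[OF cring_of[OF U]] and oneS = cring.cring_simprules(12)[OF cring_of[OF S]]
 have i: "(inl e R S U) : alg_hom R S ?T"
 proof (rule alg_homI)
  show "(inl e R S U) (s \<otimes>\<^sub>S t) = (inl e R S U) s \<otimes>\<^sub>?T (inl e R S U) t"
   if "s : carrier S" "t : carrier S" for s t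
   using that e'(3)[of "tn s \<one>\<^sub>U" "tn t \<one>\<^sub>U"] P_mult(3)[OF that one(1) one(1)] one oneU by simp
  show "(inl e R S U) (r \<odot>\<^sub>S s) = r \<odot>\<^sub>?T (inl e R S U) s"
   if r: "r : carrier R" and s: "s : carrier S" for r s
  proof -
   have c: "r \<odot>\<^sub>U \<one>\<^sub>U : carrier U" using ring_hom_closed[OF base_hom r] U by (auto simp: Algs_iff)
   have "tn (r \<odot>\<^sub>S s) \<one>\<^sub>U = (r \<odot>\<^sub>U \<one>\<^sub>U) \<odot>\<^sub>P tn s \<one>\<^sub>U"
    using tn_balanced[OF r s one(1)] P_smult(2)[OF c s one(1)] cring.cring_simprules(14)[OF cring_of[OF U]] c one
     cring.cring_simprules(14)[OF cring_of[OF U] c one(1)] oneU[OF c] by simp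
   then show ?thesis using T0(4)[OF c tn_closed[OF s one(1)]] r s by simp
  qed
 qed (use one tn_closed[OF _ one(1)] in "auto simp: e' tn_add_left simp flip: P_one")
 have "(inr e R S U) = struct_map U T0"
 proof (rule extensionalityI[of _ "carrier U"])
  fix u assume u: "u : carrier U"
  have "tn \<one>\<^sub>S u = u \<odot>\<^sub>P \<one>\<^sub>P" 
   using P_smult(2)[OF u one(2) one(1)] cring.cring_simprules(14)[OF cring_of[OF U] u one(1)] oneU[OF u] by (simp add: P_one)
  then show "(inr e R S U) u = struct_map U T0 u" using u T0(4)[OF u PA.one_closed] e'(4) by (simp add: struct_map_def)
 qed (simp_all add: struct_map_def)
 then have j: "(inr e R S U) : alg_hom R U ?T" using struct_map_base[OF U T0A] by simp
 have "e : ring_hom P ?T" using T0(3) by (simp add: ring_hom_def)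
 from that[OF as_base_Algs[OF U T0A] e this i j] show thesis .
qed

context tensor_prod
begin

text \<open>The pairing of two vectors whose entries lie in different factors, with values in the
  tensor product.\<close>

definition comb :: "'d set => ('d => 'b) => ('d => 'c) => ('b, 'c) tensor" where
 "comb B th w = finsum P (\<lambda>b. tn (th b) (w b)) {b\<in>B. th b \<noteq> \<zero>\<^sub>M}"

lemma comb_closed:
 "[|th : vec False B M; w : vec True B S|] ==> comb B th w : carrier P"
 unfolding comb_def by (rule P.finsum_closed) (auto simp: vec_closed)

lemma comb_map:
 assumes h: "addmap P A h" and A: "abelian_group A" and th: "th : vec False B M" and w: "w : vec True B S"
 shows "h (comb B th w) = finsum A (\<lambda>b. h (tn (th b) (w b))) {b\<in>B. th b \<noteq> \<zero>\<^sub>M}"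
 unfolding comb_def by (rule addmap_finsum[OF h P_abelian_group A]) (use th w in "auto simp: vec_closed vec_finite")

lemma comb_pair:
 assumes h: "addmap P T h" and T: "cring T"
  and ij: "\<And>s u. [|s : carrier M; u : carrier S|] ==> h (tn s u) = i s \<otimes>\<^sub>T j u"
  and th: "th : vec False B M" and w: "w : vec True B S"
  and ith: "vmap B i th : vec False B T" and jw: "vmap B j w : vec True B T" and i0: "i \<zero>\<^sub>M = \<zero>\<^sub>T"
 shows "h (comb B th w) = pair B T (vmap B i th) (vmap B j w)"
proof -
 interpret T: cring T by fact
 have "pair B T (vmap B i th) (vmap B j w) = finsum T (\<lambda>b. vmap B i th b \<otimes>\<^sub>T vmap B j w b) {b\<in>B. th b \<noteq> \<zero>\<^sub>M}"
  by (rule pair_eq_finsum[OF T ith jw vec_finite[OF th]]) (use i0 vec_closed[OF jw] in auto)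
 also have "\<dots> = finsum T (\<lambda>b. h (tn (th b) (w b))) {b\<in>B. th b \<noteq> \<zero>\<^sub>M}"
  by (rule T.finsum_cong') (use th w addmapD(1)[OF h] in "auto simp: vec_closed simp flip: ij")
 also have "\<dots> = h (comb B th w)" by (rule comb_map[OF h T.abelian_group_axioms th w, symmetric])
 finally show ?thesis ..
qed

lemma tn_zero: "s : carrier S ==> tn \<zero>\<^sub>M s = \<zero>\<^sub>P"
proof -
 assume s: "s : carrier S"
 have "addmap M P (\<lambda>m. tn m s)" by (rule addmapI) (use s tn_add_left in auto)
 from addmap_zero_minus(1)[OF this M.abelian_group_axioms P_abelian_group] show ?thesis .
qed

end

lemma comb_tensor_map:
 fixes S S' U U' :: "'u alg"
 assumes S: "S : Algs R" "S' : Algs R" "U : Algs R" "U' : Algs R"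
  and f: "f : ring_hom S S'" "\<And>r m. [|r : carrier R; m : carrier S|] ==> f (r \<odot>\<^sub>S m) = r \<odot>\<^sub>S' f m"
  and g: "g : ring_hom U U'" "\<And>r m. [|r : carrier R; m : carrier U|] ==> g (r \<odot>\<^sub>U m) = r \<odot>\<^sub>U' g m"
  and th: "th : vec False B S" and w: "w : vec True B U"
 shows "tensor_map R S U S' U' f g (tensor_prod.comb R S U B th w) =
  tensor_prod.comb R S' U' B (vmap B f th) (vmap B g w)"
proof -
 interpret P: tensor_alg R S U by (rule tensor_alg_Algs[OF S(1,3)])
 interpret P': tensor_alg R S' U' by (rule tensor_alg_Algs[OF S(2,4)])
 note cr = cring_of[OF S(1)] cring_of[OF S(2)] cring_of[OF S(3)] cring_of[OF S(4)]
 note f' = ring_hom_closed[OF f(1)] ring_hom_add[OF f(1)] ring_hom_0[OF f(1) cr(1,2)]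
 note g' = ring_hom_closed[OF g(1)] ring_hom_add[OF g(1)]
 note tm = tensor_map[OF P.tensor_prod_axioms P'.tensor_prod_axioms, of f g]
 let ?h = "tensor_map R S U S' U' f g"
 have h: "addmap P.P P'.P ?h" by (rule tm(1)) (auto simp: f' g' f(2) g(2))
 have ht: "?h (P.tn m s) = P'.tn (f m) (g s)" if "m : carrier S" "s : carrier U" for m s
  by (rule tm(2)) (use that in "auto simp: f' g' f(2) g(2)")
 have fth: "vmap B f th : vec False B S'" by (rule vmap_closed[OF f(1) cr(1,2) th])
 have gw: "vmap B g w : vec True B U'" by (rule vmap_closed[OF g(1) cr(3,4) w])
 have "?h (P.comb B th w) = finsum P'.P (\<lambda>b. ?h (P.tn (th b) (w b))) {b\<in>B. th b \<noteq> \<zero>\<^sub>S}"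
  by (rule P.comb_map[OF h P'.P_abelian_group th w])
 also have "\<dots> = finsum P'.P (\<lambda>b. P'.tn (vmap B f th b) (vmap B g w b)) {b\<in>B. th b \<noteq> \<zero>\<^sub>S}"
  by (rule P'.P.finsum_cong') (use fth gw th w in "auto simp: ht vec_closed f' g'")
 also have "\<dots> = P'.comb B (vmap B f th) (vmap B g w)" unfolding P'.comb_def
  by (rule P'.P.add.finprod_mono_neutral_cong_left[symmetric])
   (use vec_finite[OF th] vec_closed[OF fth] vec_closed[OF gw] in "auto simp: f' P'.tn_zero vec_closed g' w")
 finally show ?thesis .
qed

text \<open>The algebra map from \<open>S \<otimes> U\<close> to \<open>U\<close> induced by
  \<open>f\<close> and the identity. It turns values in \<open>S \<otimes> U\<close> into elements
  of an algebra under \<open>S\<close>.\<close>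

definition fold_tensor where
 "fold_tensor R S U f = (SOME h. addmap (tensor R S U) U h \<and>
   (\<forall>s\<in>carrier S. \<forall>u\<in>carrier U. h (tens R S U s u) = f s \<otimes>\<^sub>U u))"

lemma
 fixes S U :: "'u alg"
 assumes S: "S : Algs R" and U: "U : Algs R" and f: "f : alg_hom R S U"
 shows fold_addmap: "addmap (tensor R S U) U (fold_tensor R S U f)"
  and fold_tens: "[|s : carrier S; u : carrier U|] ==> fold_tensor R S U f (tens R S U s u) = f s \<otimes>\<^sub>U u"
  and fold_smult: "[|u : carrier U; X : carrier (tensor R S U)|] ==>
   fold_tensor R S U f (u \<odot>\<^sub>(tensor R S U) X) = u \<otimes>\<^sub>U fold_tensor R S U f X"
  and fold_mult: "[|X : carrier (tensor R S U); Y : carrier (tensor R S U)|] ==>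
   fold_tensor R S U f (X \<otimes>\<^sub>(tensor R S U) Y) = fold_tensor R S U f X \<otimes>\<^sub>U fold_tensor R S U f Y"
  and fold_one: "fold_tensor R S U f \<one>\<^sub>(tensor R S U) = \<one>\<^sub>U"
proof -
 interpret cU: cring U by (rule cring_of[OF U])
 interpret aU: algebra R U using U by (simp add: Algs_iff)
 interpret P: tensor_alg R S U by (rule tensor_alg_Algs[OF S U])
 note f' = alg_homD[OF f]
 let ?h = "fold_tensor R S U f"
 have "P.balanced U (\<lambda>s u. f s \<otimes>\<^sub>U u)"
  by (rule P.balancedI) (auto simp: f' cU.l_distr cU.r_distr smult_eq_struct_map[of R U] aU.algebra_axioms cU.m_ac)
 from someI_ex[OF P.universal[OF cU.abelian_group_axioms this]]
 show h: "addmap P.P U ?h" and ht: "[|s : carrier S; u : carrier U|] ==> ?h (P.tn s u) = f s \<otimes>\<^sub>U u" for s u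
  unfolding fold_tensor_def by blast+
 show "?h \<one>\<^sub>P.P = \<one>\<^sub>U" using ht f' by (simp add: P.P_one)
 show "?h (u \<odot>\<^sub>P.P X) = u \<otimes>\<^sub>U ?h X" if u: "u : carrier U" and X: "X : carrier P.P"
 proof (rule P.addmap_eqI[OF P.addmap_comp[OF P.P_smult(1)[OF u] h] _ cU.abelian_group_axioms _ X])
  show "addmap P.P U (\<lambda>X. u \<otimes>\<^sub>U ?h X)" by (rule addmapI) (use u addmapD[OF h] in "auto simp: cU.r_distr")
 qed (use u in "auto simp: P.P_smult(2) ht f' cU.m_ac")
 have l: "addmap P.P U (\<lambda>X. ?h X \<otimes>\<^sub>U u)" "addmap P.P U (\<lambda>X. u \<otimes>\<^sub>U ?h X)" if "u : carrier U" for u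
  by (rule addmapI; use that addmapD[OF h] in "auto simp: cU.l_distr cU.r_distr")+
 assume X: "X : carrier P.P" and Y: "Y : carrier P.P"
 show "?h (X \<otimes>\<^sub>P.P Y) = ?h X \<otimes>\<^sub>U ?h Y"
 proof (rule P.addmap_eqI[OF P.addmap_comp[OF P.P_mult(2)[OF Y] h] l(1)[OF addmapD(1)[OF h Y]] cU.abelian_group_axioms _ X])
  fix s u assume su: "s : carrier S" "u : carrier U"
  show "?h (P.tn s u \<otimes>\<^sub>P.P Y) = ?h (P.tn s u) \<otimes>\<^sub>U ?h Y"
   by (rule P.addmap_eqI[OF P.addmap_comp[OF P.P_mult(1) h] l(2) cU.abelian_group_axioms _ Y])
    (use su in "auto simp: P.P_mult(3) ht f' cU.m_ac")
 qed
qed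

lemma fold_natural:
 fixes S U U' :: "'u alg"
 assumes S: "S : Algs R" and U: "U : Algs R" and U': "U' : Algs R" and f: "f : alg_hom R S U" and g: "g : alg_hom R U U'"
  and X: "X : carrier (tensor R S U)"
 shows "fold_tensor R S U' (compose (carrier S) g f) (tensor_map R S U S U' (\<lambda>s. s) g X) = g (fold_tensor R S U f X)"
proof -
 interpret P: tensor_alg R S U by (rule tensor_alg_Algs[OF S U])
 interpret P': tensor_alg R S U' by (rule tensor_alg_Algs[OF S U'])
 note g' = alg_homD[OF g]
 note gf = alg_hom_comp[OF f g S]
 note tm = tensor_map[OF P.tensor_prod_axioms P'.tensor_prod_axioms, of "\<lambda>s. s" g]
 have h: "addmap P.P P'.P (tensor_map R S U S U' (\<lambda>s. s) g)" by (rule tm(1)) (auto simp: g')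
 have ht: "tensor_map R S U S U' (\<lambda>s. s) g (P.tn m s) = P'.tn m (g s)" if "m : carrier S" "s : carrier U" for m s
  by (rule tm(2)) (use that in "auto simp: g'")
 have ga: "addmap U U' g" by (rule addmapI) (auto simp: g')
 show ?thesis
 proof (rule P.addmap_eqI[OF P.addmap_comp[OF h fold_addmap[OF S U' gf]] P.addmap_comp[OF fold_addmap[OF S U f] ga] _ _ X])
  show "abelian_group U'" using cring_of[OF U'] by (simp add: cring_def ring_def)
  fix s u assume su: "s : carrier S" "u : carrier U"
  show "fold_tensor R S U' (compose (carrier S) g f) (tensor_map R S U S U' (\<lambda>s. s) g (P.tn s u)) = g (fold_tensor R S U f (P.tn s u))"
   using su alg_homD(3)[OF f su(1)] by (simp add: ht fold_tens[OF S U f] fold_tens[OF S U' gf] g' compose_eq)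
 qed
qed

lemma comm_algebra_functorD:
 assumes "comm_algebra_functor R Q" "S : Algs R"
 shows "algebra S (Ob Q S)"
  "[|T : Algs R; f : alg_hom R S T|] ==> Ar Q S T f : ring_hom (Ob Q S) (Ob Q T)"
 using assms unfolding comm_algebra_functor_def by blast+

lemma algebra_trans_iff:
 "\<psi> : algebra_trans R Q F \<longleftrightarrow> \<psi> : extensional (Algs R) \<and>
  (\<forall>U\<in>Algs R. \<psi> U : vals Q U \<rightarrow>\<^sub>E vals F U) \<and>
  (\<forall>U\<in>Algs R. \<forall>U'\<in>Algs R. \<forall>f\<in>alg_hom R U U'. \<forall>x\<in>vals Q U. \<psi> U' (Ar Q U U' f x) = Ar F U U' f (\<psi> U x)) \<and>
  (\<forall>U\<in>Algs R. \<psi> U : alg_hom U (Ob Q U) (Ob F U))"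
 by (simp add: algebra_trans_def nat_trans_def conj_assoc)

lemma quasi_coherent_simps [simp]:
 "Ob (quasi_coherent R S) U = tensor R S U"
 "Ar (quasi_coherent R S) U U' f = tensor_map R S U S U' (\<lambda>m. m) f" by (simp_all add: quasi_coherent_def)

section \<open>Points of a formal scheme as multiplicative forms\<close>

locale formal_algebra = framed_module R C B co
 for R :: "('u, 'm) ring_scheme" and C :: "'u alg" and B :: "'u set" and co :: "'u => 'u => 'u" +
 fixes Q :: "('u, ('u, 'u alg => ('u, 'u) tensor => 'u) module, 'u alg => ('u, 'u) tensor => 'u) alg_functor"
  and mul :: "'u alg => ('u => 'u) => ('u => 'u) => 'u => 'u" and unt :: "'u alg => 'u => 'u"
 assumes Q: "comm_algebra_functor R Q"
  and ObQ: "S : Algs R ==> Ob Q S = (Ob D S)\<lparr>mult := monoid.mult (Ob Q S), one := monoid.one (Ob Q S)\<rparr>"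
  and ArQ: "Ar Q = Ar D"
  and va: "vec_algebra R True B mul unt"
  and crd_mult: "[|S : Algs R; et : vals Q S; th : vals Q S|] ==> crd S (et \<otimes>\<^sub>(Ob Q S) th) = mul S (crd S et) (crd S th)"
  and crd_one: "S : Algs R ==> crd S \<one>\<^sub>(Ob Q S) = unt S"
begin

sublocale va: vec_algebra R True B mul unt by (rule va)

lemma Q_simps:
 assumes "S : Algs R"
 shows "vals Q S = vals D S" "et \<oplus>\<^sub>(Ob Q S) th = et \<oplus>\<^sub>(Ob D S) th" "s \<odot>\<^sub>(Ob Q S) et = s \<odot>\<^sub>(Ob D S) et"
  "Ar Q = base_change_trans" by (subst ObQ[OF assms], simp)+ (simp add: ArQ D_simps)

lemma Q_algebra: "S : Algs R ==> algebra S (Ob Q S)" by (rule comm_algebra_functorD(1)[OF Q])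

lemma crdQ:
 assumes S: "S : Algs R"
 shows "et : vals Q S ==> crd S et : vec True B S"
  "u : vec True B S ==> \<Theta> S u : vals Q S" "u : vec True B S ==> crd S (\<Theta> S u) = u"
  "et : vals Q S ==> \<Theta> S (crd S et) = et"
  "[|et : vals Q S; th : vals Q S|] ==> crd S (et \<oplus>\<^sub>(Ob Q S) th) = vadd B S (crd S et) (crd S th)"
  "[|s : carrier S; et : vals Q S|] ==> crd S (s \<odot>\<^sub>(Ob Q S) et) = vscale B S s (crd S et)"
  "[|S' : Algs R; f : alg_hom R S S'; et : vals Q S|] ==> crd S' (Ar Q S S' f et) = vmap B f (crd S et)"
  "[|S' : Algs R; f : alg_hom R S S'; et : vals Q S|] ==> Ar Q S S' f et : vals Q S'"
 using S crd_vec \<Theta>_closed crd_\<Theta> \<Theta>_crd crd_add crd_smult crd_natural Ar_D_closed by (simp_all add: Q_simps)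

lemma \<Theta>_ops:
 assumes S: "S : Algs R" and u: "u : vec True B S" and v: "v : vec True B S"
 shows "\<Theta> S (vadd B S u v) = \<Theta> S u \<oplus>\<^sub>(Ob Q S) \<Theta> S v"
  "s : carrier S ==> \<Theta> S (vscale B S s u) = s \<odot>\<^sub>(Ob Q S) \<Theta> S u"
  "\<Theta> S (mul S u v) = \<Theta> S u \<otimes>\<^sub>(Ob Q S) \<Theta> S v" "\<Theta> S (unt S) = \<one>\<^sub>(Ob Q S)"
  "[|S' : Algs R; f : alg_hom R S S'|] ==> \<Theta> S' (vmap B f u) = Ar Q S S' f (\<Theta> S u)"
proof -
 interpret A: algebra S "Ob Q S" by (rule Q_algebra[OF S])
 note c = crdQ(2)[OF S u] crdQ(2)[OF S v] and l = crdQ(3)[OF S u] crdQ(3)[OF S v]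
 show "\<Theta> S (vadd B S u v) = \<Theta> S u \<oplus>\<^sub>(Ob Q S) \<Theta> S v"
  using crdQ(4)[OF S A.M.a_closed[OF c]] crdQ(5)[OF S c] by (simp add: l)
 show "s : carrier S ==> \<Theta> S (vscale B S s u) = s \<odot>\<^sub>(Ob Q S) \<Theta> S u"
  using crdQ(4)[OF S A.smult_closed[OF _ c(1)]] crdQ(6)[OF S _ c(1)] by (simp add: l)
 show "\<Theta> S (mul S u v) = \<Theta> S u \<otimes>\<^sub>(Ob Q S) \<Theta> S v"
  using crdQ(4)[OF S A.m_closed[OF c]] crd_mult[OF S c] by (simp add: l)
 show "\<Theta> S (unt S) = \<one>\<^sub>(Ob Q S)" using crdQ(4)[OF S A.one_closed] crd_one[OF S] by simp
 show "[|S' : Algs R; f : alg_hom R S S'|] ==> \<Theta> S' (vmap B f u) = Ar Q S S' f (\<Theta> S u)"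
  using crdQ(4)[OF _ crdQ(8)[OF S _ _ c(1)]] crdQ(7)[OF S _ _ c(1)] by (simp add: l)
qed

lemma trans_D:
 assumes S: "S : Algs R" and \<psi>: "\<psi> : algebra_trans R Q (quasi_coherent R S)" and U: "U : Algs R"
 shows "\<psi> U : extensional (vals Q U)"
  "et : vals Q U ==> \<psi> U et : carrier (tensor R S U)"
  "[|U' : Algs R; f : alg_hom R U U'; et : vals Q U|] ==>
   \<psi> U' (Ar Q U U' f et) = tensor_map R S U S U' (\<lambda>s. s) f (\<psi> U et)"
  "\<psi> U : alg_hom U (Ob Q U) (tensor R S U)"
proof -
 note d = \<psi>[unfolded algebra_trans_iff]
 show a: "\<psi> U : alg_hom U (Ob Q U) (tensor R S U)" using d U by simp
 show "\<psi> U : extensional (vals Q U)" using alg_homD(1)[OF a] .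
 show "et : vals Q U ==> \<psi> U et : carrier (tensor R S U)" using alg_homD(3)[OF a] .
 show "[|U' : Algs R; f : alg_hom R U U'; et : vals Q U|] ==>
   \<psi> U' (Ar Q U U' f et) = tensor_map R S U S U' (\<lambda>s. s) f (\<psi> U et)" using d U by simp
qed

text \<open>The transformation defined by a point \<open>th\<close> over \<open>S\<close>: a form is
  sent to the pairing of its coordinates with \<open>th\<close>. The pairing lives in
  \<open>S \<otimes> U\<close>, since \<open>th\<close> has entries in \<open>S\<close> and the
  coordinates lie in \<open>U\<close>.\<close>

definition of_point where
 "of_point S th = (\<lambda>U\<in>Algs R. \<lambda>et\<in>vals Q U. tensor_prod.comb R S U B th (crd U et))"

lemma fold_tensor_id_comb:
 assumes S: "S : Algs R" and th: "th : vec False B S" and w: "w : vec True B S"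
 shows "fold_tensor R S S (idm S) (tensor_prod.comb R S S B th w) = pair B S th w"
proof -
 interpret P: tensor_alg R S S by (rule tensor_alg_Algs[OF S S])
 note cS = cring_of[OF S]
 note i = id_alg_hom[OF S]
 have "fold_tensor R S S (idm S) (P.comb B th w) = pair B S (vmap B (idm S) th) (vmap B (\<lambda>s. s) w)"
  by (rule P.comb_pair[OF fold_addmap[OF S S i] cS _ th w])
   (use th w cS fold_tens[OF S S i] in \<open>simp_all add: vmap_id[OF th] vmap_closed[OF _ cS cS w] ring_hom_def cring.cring_simprules(2)\<close>)
 moreover have "vmap B (\<lambda>s. s) w = w" using vec_extensional[OF w] by (intro extensionalityI[of _ B]) auto
 ultimately show ?thesis by (simp add: vmap_id[OF th])
qed

text \<open>Both sides are additive and send an elementary tensor to the product of the images of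
  its factors. A value in \<open>S \<otimes> U\<close> is thus known from folded values over
  algebras under \<open>S\<close>, of which the copy \<open>T\<close> is one.\<close>

lemma copy_fold:
 assumes S: "S : Algs R" and U: "U : Algs R" and T: "T : Algs R" and e: "e : ring_hom (tensor R S U) T"
  and i: "(inl e R S U) : alg_hom R S T"
  and j: "(inr e R S U) : alg_hom R U T"
  and X: "X : carrier (tensor R S U)"
 shows "fold_tensor R S T (inl e R S U)
   (tensor_map R S U S T (\<lambda>s. s) (inr e R S U) X) = e X"
  "[|s : carrier S; u : carrier U|] ==> e (tens R S U s u) =
   (inl e R S U) s \<otimes>\<^sub>T (inr e R S U) u"
proof -
 interpret cS: cring S by (rule cring_of[OF S])
 interpret cU: cring U by (rule cring_of[OF U])
 interpret cT: cring T by (rule cring_of[OF T])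
 interpret P: tensor_alg R S U by (rule tensor_alg_Algs[OF S U])
 interpret P': tensor_alg R S T by (rule tensor_alg_Algs[OF S T])
 let ?i = "inl e R S U" and ?j = "inr e R S U"
 note j' = alg_homD[OF j]
 note tm = tensor_map[OF P.tensor_prod_axioms P'.tensor_prod_axioms, of "\<lambda>s. s" ?j]
 have h: "addmap P.P P'.P (tensor_map R S U S T (\<lambda>s. s) ?j)" by (rule tm(1)) (use j'(3,5,7) in auto)
 have ht: "tensor_map R S U S T (\<lambda>s. s) ?j (P.tn m s) = P'.tn m (?j s)" if "m : carrier S" "s : carrier U" for m s
  by (rule tm(2)) (use that j'(3,5,7) in auto)
 have one: "\<one>\<^sub>S : carrier S" "\<one>\<^sub>U : carrier U" by simp_all
 have ij: "e (P.tn s u) = ?i s \<otimes>\<^sub>T ?j u" if su: "s : carrier S" "u : carrier U" for s u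
  using ring_hom_mult[OF e P.tn_closed[OF su(1) one(2)] P.tn_closed[OF one(1) su(2)]]
   P.P_mult(3)[OF su(1) one(1) one(2) su(2)] su by simp
 then show "[|s : carrier S; u : carrier U|] ==> e (P.tn s u) = ?i s \<otimes>\<^sub>T ?j u" .
 have ea: "addmap P.P T e" by (rule addmapI) (use ring_hom_closed[OF e] ring_hom_add[OF e] in auto)
 show "fold_tensor R S T ?i (tensor_map R S U S T (\<lambda>s. s) ?j X) = e X"
 proof (rule P.addmap_eqI[OF P.addmap_comp[OF h fold_addmap[OF S T i]] ea cT.abelian_group_axioms _ X])
  fix s u assume su: "s : carrier S" "u : carrier U"
  show "fold_tensor R S T ?i (tensor_map R S U S T (\<lambda>s. s) ?j (P.tn s u)) = e (P.tn s u)"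
   using fold_tens[OF S T i su(1) j'(3)[OF su(2)]] by (simp only: ht[OF su] ij[OF su])
 qed
qed

text \<open>Inside the copy both vectors have entries in one ring, so \<open>comb\<close> becomes an
  ordinary pairing.\<close>

lemma comb_copy:
 assumes S: "S : Algs R" and U: "U : Algs R" and T: "T : Algs R" and e: "e : ring_hom (tensor R S U) T"
  and i: "(inl e R S U) : alg_hom R S T"
  and j: "(inr e R S U) : alg_hom R U T"
  and th: "th : vec False B S" and w: "w : vec True B U"
 shows "e (tensor_prod.comb R S U B th w) =
  pair B T (vmap B (inr e R S U) w) (vmap B (inl e R S U) th)"
proof -
 interpret P: tensor_alg R S U by (rule tensor_alg_Algs[OF S U])
 let ?i = "inl e R S U" and ?j = "inr e R S U"
 note cT = cring_of[OF T]
 have ea: "addmap P.P T e" by (rule addmapI) (use ring_hom_closed[OF e] ring_hom_add[OF e] in auto)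
 have ith: "vmap B ?i th : vec False B T" and jw: "vmap B ?j w : vec True B T"
  using vmap_alg_hom[OF i S T th] vmap_alg_hom[OF j U T w] by simp_all
 have "e (P.comb B th w) = pair B T (vmap B ?i th) (vmap B ?j w)"
  by (rule P.comb_pair[OF ea cT copy_fold(2)[OF S U T e i j P.P.zero_closed] th w ith jw
    ring_hom_0[OF alg_homD(2)[OF i] cring_of[OF S] cT]])
 then show ?thesis using pair_commute[OF cT ith jw] by simp
qed

text \<open>Equations in \<open>S \<otimes> U\<close> are verified after the injection
  \<open>e\<close> into \<open>T\<close>. There \<open>comb\<close> is a pairing over an algebra
  under \<open>S\<close>, and multiplicativity is the defining property of the point
  \<open>th\<close>.\<close>

lemma of_point_trans:
 assumes S: "S : Algs R" and th: "th : va.points S"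
 shows "of_point S th : algebra_trans R Q (quasi_coherent R S)"
proof -
 have thv: "th : vec False B S" using Char_vec[OF th] by simp
 have hom: "of_point S th U : alg_hom U (Ob Q U) (tensor R S U)" if U: "U : Algs R" for U
 proof -
  interpret P: tensor_alg R S U by (rule tensor_alg_Algs[OF S U])
  interpret PA: algebra U P.P by (rule P.P_algebra)
  interpret A: algebra U "Ob Q U" by (rule Q_algebra[OF U])
  let ?g = "\<lambda>et. P.comb B th (crd U et)"
  have g: "of_point S th U et = ?g et" if "et : vals Q U" for et using that U by (simp add: of_point_def)
  have gc: "?g et : carrier P.P" if "et : vals Q U" for et by (rule P.comb_closed[OF thv crdQ(1)[OF U that]])
  obtain T e where T: "T : Algs R" and inj: "inj_on e (carrier P.P)" and e: "e : ring_hom P.P T"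
   and i: "(inl e R S U) : alg_hom R S T"
   and j: "(inr e R S U) : alg_hom R U T" by (rule tensor_copy[OF va.inf S U])
  let ?i = "inl e R S U" and ?j = "inr e R S U"
  note cT = cring_of[OF T]
  note cm = comb_copy[OF S U T e i j thv]
  note e' = ring_hom_closed[OF e] ring_hom_add[OF e] ring_hom_mult[OF e] ring_hom_one[OF e]
  have ith: "vmap B ?i th : vec (\<not> True) B T" using vmap_alg_hom[OF i S T thv] by simp
  have jv: "vmap B ?j w : vec True B T" if "w : vec True B U" for w using vmap_alg_hom[OF j U T that] .
  have eqI: "X = Y" if "X : carrier P.P" "Y : carrier P.P" "e X = e Y" for X Y
   using inj that by (simp add: inj_on_def)
  show ?thesis
  proof (rule alg_homI)
   show "of_point S th U : extensional (vals Q U)" using U by (simp add: of_point_def)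
   show "of_point S th U et : carrier P.P" if "et : vals Q U" for et using g gc that by simp
   have "?g \<one>\<^sub>(Ob Q U) = \<one>\<^sub>P.P"
   proof (rule eqI[OF gc[OF A.one_closed] PA.one_closed])
    show "e (?g \<one>\<^sub>(Ob Q U)) = e \<one>\<^sub>P.P"
     unfolding crd_one[OF U] cm[OF va.one_closed[OF U]] va.one_natural[OF U T j] e'(4) by (rule CharD(2)[OF th T i])
   qed
   then show "of_point S th U \<one>\<^sub>(Ob Q U) = \<one>\<^sub>P.P" by (simp add: g)
   fix et assume et: "et : vals Q U"
   note l = crdQ(1)[OF U et]
   have "?g (s \<odot>\<^sub>(Ob Q U) et) = s \<odot>\<^sub>P.P ?g et" if s: "s : carrier U" for s
   proof (rule eqI[OF gc[OF A.smult_closed[OF s et]] PA.smult_closed[OF s gc[OF et]]])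
    have one: "\<one>\<^sub>S : carrier S" by (rule one_closed_Algs[OF S])
    have "s \<odot>\<^sub>P.P ?g et = P.tn \<one>\<^sub>S s \<otimes>\<^sub>P.P ?g et"
    proof -
     have "P.tn \<one>\<^sub>S s = s \<odot>\<^sub>P.P \<one>\<^sub>P.P" using P.P_smult(2)[OF s one one_closed_Algs[OF U]]
      cring.cring_simprules(12,14)[OF cring_of[OF U]] s one_closed_Algs[OF U] by (simp add: P.P_one)
     then show ?thesis using PA.smult_assoc2[OF s PA.one_closed gc[OF et]] gc[OF et] by simp
    qed
    then have "e (s \<odot>\<^sub>P.P ?g et) = ?j s \<otimes>\<^sub>T e (?g et)"
     using e'(3)[OF P.tn_closed[OF one s] gc[OF et]] s by simp
    also have "\<dots> = e (?g (s \<odot>\<^sub>(Ob Q U) et))"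
     unfolding crdQ(6)[OF U s et] cm[OF l] cm[OF vscale_closed[OF cring_of[OF U] s l]] vmap_vscale[OF alg_homD(2)[OF j] s l]
     by (rule pair_vscale[OF cT alg_homD(3)[OF j s] jv[OF l] ith, symmetric])
    finally show "e (?g (s \<odot>\<^sub>(Ob Q U) et)) = e (s \<odot>\<^sub>P.P ?g et)" ..
   qed
   then show "of_point S th U (s \<odot>\<^sub>(Ob Q U) et) = s \<odot>\<^sub>P.P of_point S th U et" if "s : carrier U" for s
    using that et by (simp add: g)
   fix et' assume et': "et' : vals Q U"
   note l' = crdQ(1)[OF U et']
   have "?g (et \<oplus>\<^sub>(Ob Q U) et') = ?g et \<oplus>\<^sub>P.P ?g et'"
    by (rule eqI[OF gc[OF A.M.a_closed[OF et et']] P.P.a_closed[OF gc[OF et] gc[OF et']]],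
     unfold crdQ(5)[OF U et et'] e'(2)[OF gc[OF et] gc[OF et']] cm[OF l] cm[OF l'] cm[OF vadd_closed[OF cring_of[OF U] l l']]
      vmap_vadd[OF alg_homD(2)[OF j] l l'], rule pair_vadd[OF cT jv[OF l] jv[OF l'] ith])
   then show "of_point S th U (et \<oplus>\<^sub>(Ob Q U) et') = of_point S th U et \<oplus>\<^sub>P.P of_point S th U et'"
    using et et' by (simp add: g)
   have "?g (et \<otimes>\<^sub>(Ob Q U) et') = ?g et \<otimes>\<^sub>P.P ?g et'"
    by (rule eqI[OF gc[OF A.m_closed[OF et et']] PA.m_closed[OF gc[OF et] gc[OF et']]],
     unfold crd_mult[OF U et et'] e'(3)[OF gc[OF et] gc[OF et']] cm[OF l] cm[OF l'] cm[OF va.mul_closed[OF U l l']]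
      va.mul_natural[OF U T j l l'], rule CharD(1)[OF th T i jv[OF l] jv[OF l']])
   then show "of_point S th U (et \<otimes>\<^sub>(Ob Q U) et') = of_point S th U et \<otimes>\<^sub>P.P of_point S th U et'"
    using et et' by (simp add: g)
  qed
 qed
 show ?thesis
  unfolding algebra_trans_iff quasi_coherent_simps
 proof (intro conjI ballI)
  show "of_point S th : extensional (Algs R)" by (simp add: of_point_def)
  fix U assume U: "U : Algs R"
  show "of_point S th U : alg_hom U (Ob Q U) (tensor R S U)" by (rule hom[OF U])
  show "of_point S th U : vals Q U \<rightarrow>\<^sub>E carrier (tensor R S U)"
   using alg_homD(1,3)[OF hom[OF U]] by (auto simp: PiE_def)
  fix U' f et assume U': "U' : Algs R" and f: "f : alg_hom R U U'" and et: "et : vals Q U"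
  have "tensor_map R S U S U' (\<lambda>m. m) f (tensor_prod.comb R S U B th (crd U et)) =
    tensor_prod.comb R S U' B (vmap B (\<lambda>m. m) th) (vmap B f (crd U et))"
   by (rule comb_tensor_map[OF S S U U' _ _ alg_homD(2)[OF f] _ thv crdQ(1)[OF U et]])
    (auto simp: ring_hom_def alg_homD(7)[OF f])
  moreover have "vmap B (\<lambda>m. m) th = th" using vec_extensional[OF thv] by (intro extensionalityI[of _ B]) auto
  ultimately show "of_point S th U' (Ar Q U U' f et) = tensor_map R S U S U' (\<lambda>m. m) f (of_point S th U et)"
   using U U' et crdQ(8)[OF U U' f et] by (simp add: of_point_def crdQ(7)[OF U U' f et])
 qed
qed

text \<open>Folding the values of \<open>\<psi>\<close> gives a natural linear form on arbitrary
  families over algebras under \<open>S\<close>, hence the pairing with a finitely supported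
  \<open>th\<close>. This form determines \<open>\<psi>\<close>, by evaluation at the copy of
  \<open>S \<otimes> U\<close>.\<close>

lemma trans_point:
 assumes S: "S : Algs R" and \<psi>: "\<psi> : algebra_trans R Q (quasi_coherent R S)"
 shows "\<exists>th\<in>va.points S. of_point S th = \<psi>"
proof -
 let ?l = "\<lambda>U f w. fold_tensor R S U f (\<psi> U (\<Theta> U w))"
 have "natlin True R B S ?l"
 proof (rule natlinI)
  fix U f w assume U: "U : Algs R" and f: "f : alg_hom R S U" and w: "w : vec True B U"
  note d = trans_D[OF S \<psi> U] and h = alg_homD[OF trans_D(4)[OF S \<psi> U]]
  note c = crdQ(2)[OF U w]
  note F = addmapD[OF fold_addmap[OF S U f]]
  show "?l U f w : carrier U" by (rule F(1)[OF d(2)[OF c]])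
  show "?l U f (vadd B U w w') = ?l U f w \<oplus>\<^sub>U ?l U f w'" if w': "w' : vec True B U" for w'
   using F(2)[OF d(2)[OF c] d(2)[OF crdQ(2)[OF U w']]] by (simp add: \<Theta>_ops(1)[OF U w w'] h(5)[OF c crdQ(2)[OF U w']])
  show "?l U f (vscale B U t w) = t \<otimes>\<^sub>U ?l U f w" if t: "t : carrier U" for t
   using fold_smult[OF S U f t d(2)[OF c]] by (simp add: \<Theta>_ops(2)[OF U w w t] h(7)[OF t c])
  show "?l U' (compose (carrier S) g f) (vmap B g w) = g (?l U f w)" if U': "U' : Algs R" and g: "g : alg_hom R U U'" for U' g
   using fold_natural[OF S U U' f g d(2)[OF c]] by (simp add: \<Theta>_ops(5)[OF U w w U' g] d(3)[OF U' g c])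
 qed
 then have "\<exists>th. th : vec (\<not> True) B S \<and> (\<forall>U\<in>Algs R. \<forall>f\<in>alg_hom R S U. \<forall>w\<in>vec True B U. ?l U f w = pair B U w (vmap B f th))"
  by (rule natlin_rep[OF va.R va.inf S]) blast
 then obtain th where th: "th : vec (\<not> True) B S"
  and l': "\<forall>U\<in>Algs R. \<forall>f\<in>alg_hom R S U. \<forall>w\<in>vec True B U. ?l U f w = pair B U w (vmap B f th)" by blast
 note l = l'[rule_format]
 have thv: "th : vec False B S" using th by simp
 have lS: "fold_tensor R S S (idm S) (\<psi> S (\<Theta> S w)) = pair B S w th" if "w : vec True B S" for w
  using l[OF S id_alg_hom[OF S] that] by (simp add: vmap_id[OF th])
 have "th : va.points S"
 proof (rule va.Char_unitsI[OF S th])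
  note d = trans_D[OF S \<psi> S] and h = alg_homD[OF trans_D(4)[OF S \<psi> S]]
  note cS = cring_of[OF S]
  note i = id_alg_hom[OF S]
  have u: "vunit B S b : vec True B S" for b by (simp add: cS)
  note c = crdQ(2)[OF S u]
  show "pair B S (mul S (vunit B S b) (vunit B S c)) th = th b \<otimes>\<^sub>S th c" if "b : B" "c : B" for b c
   using lS[OF va.mul_closed[OF S u u], of b c] lS[OF u, of b] lS[OF u, of c] that
    fold_mult[OF S S i d(2)[OF c] d(2)[OF c], of b c]
   by (simp add: \<Theta>_ops(3)[OF S u u] h(6)[OF c c] pair_vunit_left[OF cS thv])
  show "pair B S (unt S) th = \<one>\<^sub>S"
   using lS[OF va.one_closed[OF S]] fold_one[OF S S i] by (simp add: \<Theta>_ops(4)[OF S u u] h(4))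
 qed
 moreover have "of_point S th = \<psi>"
 proof (rule extensionalityI[of _ "Algs R"])
  show "of_point S th : extensional (Algs R)" by (simp add: of_point_def)
  show "\<psi> : extensional (Algs R)" using \<psi> by (simp add: algebra_trans_iff)
  fix U assume U: "U : Algs R"
  note d = trans_D[OF S \<psi> U]
  show "of_point S th U = \<psi> U"
  proof (rule extensionalityI[of _ "vals Q U"])
   show "of_point S th U : extensional (vals Q U)" using U by (simp add: of_point_def)
   show "\<psi> U : extensional (vals Q U)" by (rule d(1))
   fix et assume et: "et : vals Q U"
   interpret P: tensor_alg R S U by (rule tensor_alg_Algs[OF S U])
   obtain T e where T: "T : Algs R" and inj: "inj_on e (carrier P.P)" and e: "e : ring_hom P.P T"
    and i: "(inl e R S U) : alg_hom R S T"
    and j: "(inr e R S U) : alg_hom R U T" by (rule tensor_copy[OF va.inf S U])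
   let ?i = "inl e R S U" and ?j = "inr e R S U"
   note lv = crdQ(1)[OF U et]
   have "e (\<psi> U et) = fold_tensor R S T ?i (tensor_map R S U S T (\<lambda>s. s) ?j (\<psi> U et))"
    by (rule copy_fold(1)[OF S U T e i j d(2)[OF et], symmetric])
   also have "tensor_map R S U S T (\<lambda>s. s) ?j (\<psi> U et) = \<psi> T (Ar Q U T ?j et)"
    by (rule d(3)[OF T j et, symmetric])
   also have "Ar Q U T ?j et = \<Theta> T (vmap B ?j (crd U et))"
    using \<Theta>_ops(5)[OF U lv lv T j] by (simp add: crdQ(4)[OF U et])
   also have "fold_tensor R S T ?i (\<psi> T (\<Theta> T (vmap B ?j (crd U et)))) = pair B T (vmap B ?j (crd U et)) (vmap B ?i th)"
    by (rule l[OF T i vmap_alg_hom[OF j U T lv]])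
   also have "\<dots> = e (P.comb B th (crd U et))" by (rule comb_copy[OF S U T e i j thv lv, symmetric])
   finally have "\<psi> U et = P.comb B th (crd U et)"
    using inj d(2)[OF et] P.comb_closed[OF thv lv] by (simp add: inj_on_def)
   then show "of_point S th U et = \<psi> U et" using U et by (simp add: of_point_def)
  qed
 qed
 ultimately show ?thesis by blast
qed

lemma Char_iso_Spec: "functor_iso R (Char_functor R True B mul unt) (Spec_functor R Q)"
proof (rule functor_isoI[where h = of_point])
 fix S assume S: "S : Algs R"
 note cS = cring_of[OF S]
 have "inj_on (of_point S) (va.points S)"
 proof (rule inj_onI)
  fix th th' assume t: "th : va.points S" "th' : va.points S" and eq: "of_point S th = of_point S th'"
  have tv: "th : vec False B S" "th' : vec False B S" using Char_vec[OF t(1)] Char_vec[OF t(2)] by simp_all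
  show "th = th'"
  proof (rule vec_eqI[OF tv])
   fix b assume b: "b : B"
   have u: "vunit B S b : vec True B S" by (simp add: cS)
   \<comment> \<open>Evaluating at a unit vector over \<open>S\<close> and folding along the
     identity recovers a coordinate of the point.\<close>
   have "fold_tensor R S S (idm S) (of_point S th S (\<Theta> S (vunit B S b))) = th b" if "th : vec False B S" for th
    using fold_tensor_id_comb[OF S that u] S crdQ(2,3)[OF S u] pair_vunit[OF cS that b] by (simp add: of_point_def)
   then show "th b = th' b" using tv eq by metis
  qed
 qed
 then show "bij_betw (of_point S) (vals (Char_functor R True B mul unt) S) (vals (Spec_functor R Q) S)"
  using of_point_trans[OF S] trans_point[OF S] by (auto simp: bij_betw_def Spec_functor_def)
next
 fix S S' f th assume S: "S : Algs R" and S': "S' : Algs R" and f: "f : alg_hom R S S'"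
  and t: "th : vals (Char_functor R True B mul unt) S"
 show "Ar (Char_functor R True B mul unt) S S' f th : vals (Char_functor R True B mul unt) S'"
  by (rule Char_functor_Ar[OF S S' f t])
 have th: "th : vec False B S" using Char_vec[of th R True B mul unt S] t by simp
 have c: "tensor_map R S U S' U f (\<lambda>u. u) (tensor_prod.comb R S U B th (crd U et)) =
   tensor_prod.comb R S' U B (vmap B f th) (crd U et)" if U: "U : Algs R" and et: "et : vals Q U" for U et
 proof -
  have "tensor_map R S U S' U f (\<lambda>u. u) (tensor_prod.comb R S U B th (crd U et)) =
   tensor_prod.comb R S' U B (vmap B f th) (vmap B (\<lambda>u. u) (crd U et))"
   by (rule comb_tensor_map[OF S S' U U alg_homD(2)[OF f] _ _ _ th crdQ(1)[OF U et]])
    (auto simp: ring_hom_def alg_homD(7)[OF f])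
  moreover have "vmap B (\<lambda>u. u) (crd U et) = crd U et"
   using vec_extensional[OF crdQ(1)[OF U et]] by (intro extensionalityI[of _ B]) auto
  ultimately show ?thesis by simp
 qed
 show "of_point S' (Ar (Char_functor R True B mul unt) S S' f th) = Ar (Spec_functor R Q) S S' f (of_point S th)"
  by (rule ext) (auto simp: of_point_def Spec_functor_def compose_def restrict_def c fun_eq_iff)
qed

end

section \<open>From algebras of vectors back to formal schemes\<close>

lemma (in framed_module) D_ops:
 assumes S: "S : Algs R" and et: "et : vals D S" and th: "th : vals D S"
 shows "et \<oplus>\<^sub>(Ob D S) th = \<Theta> S (vadd B S (crd S et) (crd S th))"
  "s : carrier S ==> s \<odot>\<^sub>(Ob D S) et = \<Theta> S (vscale B S s (crd S et))"
  "\<zero>\<^sub>(Ob D S) = \<Theta> S (vzero B S)"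
proof -
 note u = crd_vec[OF S et] and w = crd_vec[OF S th]
 have r: "\<rho> (over R S T) X : vec False B T" if "T : Algs S" "X : carrier (CT S T)" for T X
  using \<rho>_closed[OF as_base_Algs[OF S that(1)] that(2)] by simp
 have sm: "vmap B (struct_map S T) v : vec (\<not> False) B T" "struct_map S T : ring_hom S T"
  if "T : Algs S" "v : vec True B S" for T v
  using vmap_struct_map[OF that] alg_homD(2)[OF struct_map_hom[OF that(1)]] by (simp_all add: ring_hom_def)
 have "et T X \<oplus>\<^sub>T th T X = pair B T (\<rho> (over R S T) X) (vmap B (struct_map S T) (vadd B S (crd S et) (crd S th)))"
  if T: "T : Algs S" and X: "X : carrier (CT S T)" for T X
  using pair_vadd_right[OF cring_of[OF T] r[OF T X] sm(1)[OF T u] sm(1)[OF T w]]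
   vmap_vadd[OF sm(2)[OF T u] u w] by (simp add: crd_eq[OF S et T X] crd_eq[OF S th T X])
 then show "et \<oplus>\<^sub>(Ob D S) th = \<Theta> S (vadd B S (crd S et) (crd S th))"
  by (auto simp: D_simps \<Theta>_def fun_eq_iff)
 have "s \<odot>\<^sub>T et T X = pair B T (\<rho> (over R S T) X) (vmap B (struct_map S T) (vscale B S s (crd S et)))"
  if s: "s : carrier S" and T: "T : Algs S" and X: "X : carrier (CT S T)" for s T X
  using pair_vscale_right[OF cring_of[OF T] ring_hom_closed[OF sm(2)[OF T u] s] r[OF T X] sm(1)[OF T u]]
   vmap_vscale[OF sm(2)[OF T u] s u] smult_eq_struct_map[OF _ s, of T] T D_D(3)[OF et T X]
  by (simp add: crd_eq[OF S et T X] Algs_iff)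
 then show "s : carrier S ==> s \<odot>\<^sub>(Ob D S) et = \<Theta> S (vscale B S s (crd S et))"
  by (auto simp: D_simps \<Theta>_def fun_eq_iff)
 have "\<zero>\<^sub>T = pair B T (\<rho> (over R S T) X) (vmap B (struct_map S T) (vzero B S))"
  if T: "T : Algs S" and X: "X : carrier (CT S T)" for T X
 proof -
  interpret T: cring T by (rule cring_of[OF T])
  have "vmap B (struct_map S T) (vzero B S) = vzero B T" by (rule vmap_vzero[OF sm(2)[OF T u] cring_of[OF S] cring_of[OF T]])
  moreover have "{b\<in>B. \<rho> (over R S T) X b \<otimes>\<^sub>T vzero B T b \<noteq> \<zero>\<^sub>T} = {}"
   using vec_closed[OF r[OF T X]] by auto
  ultimately show ?thesis by (simp only: pair_def T.finsum_empty)
 qed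
 then show "\<zero>\<^sub>(Ob D S) = \<Theta> S (vzero B S)" by (auto simp: D_simps \<Theta>_def fun_eq_iff)
qed

text \<open>A copy inside \<open>'u\<close> of the finitely supported vectors over \<open>R\<close>,
  as a module only: the product will live on its dual.\<close>

lemma (in vec_algebra) free_module_exists: "\<exists>C co. framed_module R C B co"
proof -
 obtain e :: "('u => 'u) => 'u" where e: "inj_on e (vec False B R)" using inj_vec_False[OF inf] .
 define co where "co = inv_into (vec False B R) e"
 have co: "co (e v) = v" if "v : vec False B R" for v using that e by (simp add: co_def)
 define C :: "'u alg" where "C = \<lparr>carrier = e ` vec False B R, mult = undefined, one = undefined,
  ring.zero = e (vzero B R), add = (\<lambda>x y. e (vadd B R (co x) (co y))), smult = (\<lambda>r x. e (vscale B R r (co x)))\<rparr>"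
 have cs: "carrier C = e ` vec False B R" "\<zero>\<^sub>C = e (vzero B R)" "x \<oplus>\<^sub>C y = e (vadd B R (co x) (co y))"
  "r \<odot>\<^sub>C x = e (vscale B R r (co x))" for x y r by (simp_all add: C_def)
 interpret V: module R "vec_mod (\<lambda>r. r) False B R undefined undefined"
  by (rule vec_mod_module[OF R R]) (simp add: ring_hom_def)
 note va = V.M.a_assoc[simplified] V.M.a_comm[simplified] V.M.a_lcomm[simplified] V.M.l_zero[simplified] V.M.r_zero[simplified] V.M.a_closed[simplified]
  V.smult_l_distr[simplified] V.smult_r_distr[simplified] V.smult_assoc1[simplified] V.smult_one[simplified]
  V.smult_closed[simplified]
 have ag: "abelian_group C"
 proof (rule abelian_groupI)
  fix x assume "x : carrier C"
  then obtain v where v: "v : vec False B R" "x = e v" by (auto simp: cs)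
  have m: "\<ominus>\<^sub>(vec_mod (\<lambda>r. r) False B R undefined undefined) v : vec False B R"
   "vadd B R (\<ominus>\<^sub>(vec_mod (\<lambda>r. r) False B R undefined undefined) v) v = vzero B R"
   using V.M.a_inv_closed[of v] V.M.l_neg[of v] v(1) by simp_all
  then have "e (\<ominus>\<^sub>(vec_mod (\<lambda>r. r) False B R undefined undefined) v) : carrier C \<and>
   e (\<ominus>\<^sub>(vec_mod (\<lambda>r. r) False B R undefined undefined) v) \<oplus>\<^sub>C x = \<zero>\<^sub>C"
   using v by (simp add: cs co)
  then show "\<exists>y\<in>carrier C. y \<oplus>\<^sub>C x = \<zero>\<^sub>C" by blast
 qed (auto simp: cs co va R)
 have mod: "module R C" by (rule moduleI) (auto simp: R ag cs co va)
 have "frame R C B co" unfolding frame_def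
 proof (intro conjI ballI)
  show "bij_betw co (carrier C) (vec False B R)" unfolding cs by (rule bij_betw_byWitness[of _ e]) (use co in auto)
 qed (auto simp: cs co va)
 with mod have "framed_module R C B co" by (simp add: framed_module_def framed_def framed_axioms_def)
 then show ?thesis by blast
qed

context framed_module
begin

lemma vec_algebra_of_functor:
 assumes inf: "infinite (UNIV :: 'u set)" and Q: "comm_algebra_functor R Q"
  and ObQ: "\<And>S. S : Algs R ==> Ob Q S = (Ob D S)\<lparr>mult := monoid.mult (Ob Q S), one := monoid.one (Ob Q S)\<rparr>"
  and ArQ: "Ar Q = Ar D"
 shows "\<exists>mul unt. formal_algebra R C B co Q mul unt"
proof -
 have Qs: "vals Q S = vals D S" "et \<oplus>\<^sub>(Ob Q S) th = et \<oplus>\<^sub>(Ob D S) th" "s \<odot>\<^sub>(Ob Q S) et = s \<odot>\<^sub>(Ob D S) et"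
  "Ar Q = base_change_trans" if "S : Algs R" for S et th s by (subst ObQ[OF that], simp)+ (simp add: ArQ D_simps)
 have bij: "bij_betw (crd S) (vals Q S) (vec True B S)" if S: "S : Algs R" for S unfolding Qs(1)[OF S]
  by (rule bij_betw_byWitness[of _ "\<Theta> S"]) (use S \<Theta>_crd crd_\<Theta> crd_vec \<Theta>_closed in auto)
 have "\<exists>mul unt. vec_algebra R True B mul unt \<and> (\<forall>S\<in>Algs R. (\<forall>x\<in>vals Q S. \<forall>y\<in>vals Q S.
  mul S (crd S x) (crd S y) = crd S (x \<otimes>\<^sub>(Ob Q S) y)) \<and> unt S = crd S \<one>\<^sub>(Ob Q S))"
  by (rule vec_algebra_transport[where h = "Ar Q"];
    (rule cR inf comm_algebra_functorD(1)[OF Q] bij comm_algebra_functorD(2)[OF Q]; assumption)?)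
   (simp_all add: Qs crd_add crd_smult crd_natural)
 then obtain mul unt where va: "vec_algebra R True B mul unt"
  and m: "\<forall>S\<in>Algs R. (\<forall>x\<in>vals Q S. \<forall>y\<in>vals Q S.
  mul S (crd S x) (crd S y) = crd S (x \<otimes>\<^sub>(Ob Q S) y)) \<and> unt S = crd S \<one>\<^sub>(Ob Q S)" by blast
 have "formal_algebra R C B co Q mul unt"
  by (intro formal_algebra.intro framed_module_axioms formal_algebra_axioms.intro Q ObQ ArQ va) (use m in simp_all)
 then show ?thesis by blast
qed

text \<open>The module operations of the dual are kept, as the definition of a formal scheme
  prescribes, while product and unit are pulled back from the vectors by \<open>\<Theta>\<close>.
  Equations are checked on coordinates.\<close>

lemma functor_of_vec_algebra:
 assumes va: "vec_algebra R True B mul unt"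
 shows "\<exists>Q. formal_algebra R C B co Q mul unt"
proof -
 interpret va: vec_algebra R True B mul unt by fact
 define Q :: "('u, ('u, 'u alg => ('u, 'u) tensor => 'u) module, 'u alg => ('u, 'u) tensor => 'u) alg_functor"
  where "Q = \<lparr>Ob = \<lambda>S. (Ob D S)\<lparr>mult := (\<lambda>et th. \<Theta> S (mul S (crd S et) (crd S th))), one := \<Theta> S (unt S)\<rparr>,
   Ar = base_change_trans\<rparr>"
 have Qs: "vals Q S = vals D S" "et \<oplus>\<^sub>(Ob Q S) th = et \<oplus>\<^sub>(Ob D S) th" "s \<odot>\<^sub>(Ob Q S) et = s \<odot>\<^sub>(Ob D S) et"
  "\<zero>\<^sub>(Ob Q S) = \<zero>\<^sub>(Ob D S)" "et \<otimes>\<^sub>(Ob Q S) th = \<Theta> S (mul S (crd S et) (crd S th))" "\<one>\<^sub>(Ob Q S) = \<Theta> S (unt S)"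
  "Ar Q = base_change_trans" for S et th s by (simp_all add: Q_def)
 have eqI: "et = th" if "S : Algs R" "et : vals D S" "th : vals D S" "crd S et = crd S th" for S et th
  using arg_cong[OF that(4), of "\<Theta> S"] unfolding \<Theta>_crd[OF that(1,2)] \<Theta>_crd[OF that(1,3)] .
 have cl: "et \<oplus>\<^sub>(Ob Q S) th : vals Q S" "et \<otimes>\<^sub>(Ob Q S) th : vals Q S" "s : carrier S ==> s \<odot>\<^sub>(Ob Q S) et : vals Q S"
  "\<zero>\<^sub>(Ob Q S) : vals Q S" "\<one>\<^sub>(Ob Q S) : vals Q S"
  if S: "S : Algs R" and c: "et : vals Q S" "th : vals Q S" for S et th s
 proof -
  have c': "et : vals D S" "th : vals D S" using c by (simp_all add: Qs)
  note v = crd_vec[OF S c'(1)] crd_vec[OF S c'(2)] and cS = cring_of[OF S]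
  show "et \<oplus>\<^sub>(Ob Q S) th : vals Q S" "et \<otimes>\<^sub>(Ob Q S) th : vals Q S"
   "s : carrier S ==> s \<odot>\<^sub>(Ob Q S) et : vals Q S"
   "\<zero>\<^sub>(Ob Q S) : vals Q S" "\<one>\<^sub>(Ob Q S) : vals Q S"
   using \<Theta>_closed[OF S] va.mul_closed[OF S v] va.one_closed[OF S] v cS by (simp_all add: Qs D_ops[OF S c'])
 qed
 have zc: "\<zero>\<^sub>(Ob Q S) : vals Q S" "\<one>\<^sub>(Ob Q S) : vals Q S" if "S : Algs R" for S
  using cl(4,5)[OF that, of "\<Theta> S (unt S)" "\<Theta> S (unt S)"] \<Theta>_closed[OF that va.one_closed[OF that]]
  by (simp_all add: Qs(1))
 have alg: "algebra S (Ob Q S)" if S: "S : Algs R" for S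
 proof (rule algebra_transport[where q = "crd S"])
  note cS = cring_of[OF S]
  show "algebra S (vec_mod (\<lambda>t. t) True B S (mul S) (unt S))" by (rule vec_mod_algebra[OF cS cS])
    (simp_all add: ring_hom_def va.mul_closed[OF S] va.one_closed[OF S] va.mul_assoc[OF S]
     va.one_mul[OF S] va.mul_vadd[OF S] va.mul_vscale[OF S], rule va.mul_comm[OF S])
  show "inj_on (crd S) (vals Q S)" using eqI[OF S] by (auto simp: inj_on_def Qs(1))
  have "crd S ` vals D S = vec True B S"
  proof
   show "crd S ` vals D S \<subseteq> vec True B S" using crd_vec[OF S] by auto
   show "vec True B S \<subseteq> crd S ` vals D S"
   proof
    fix v assume v: "v : vec True B S"
    show "v : crd S ` vals D S"
     by (rule image_eqI[of _ _ "\<Theta> S v"]) (use crd_\<Theta>[OF S v] \<Theta>_closed[OF S v] in simp_all)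
   qed
  qed
  then show "crd S ` vals Q S = carrier (vec_mod (\<lambda>t. t) True B S (mul S) (unt S))" by (simp add: Qs(1))
 qed (use S cl(1-3)[OF S] zc[OF S] crd_\<Theta>[OF S] va.mul_closed[OF S] va.one_closed[OF S] crd_vec[OF S] in
   \<open>simp_all add: Qs crd_add crd_smult crd_zero\<close>)
 have Arc: "base_change_trans S U f et : vals D U"
  if "S : Algs R" "U : Algs R" "f : alg_hom R S U" "et : vals D S" for S U f et
  by (rule Ar_D_closed[OF that])
 have sf: "set_functor R Q" unfolding set_functor_def Qs(1,7)
 proof (intro conjI ballI)
  show "base_change_trans S U f : vals D S \<rightarrow> vals D U"
   if "S : Algs R" "U : Algs R" "f : alg_hom R S U" for S U f using Arc[OF that] by auto
  show "base_change_trans S S (idm S) et = et" if S: "S : Algs R" and et: "et : vals D S" for S et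
   by (rule eqI[OF S Arc[OF S S id_alg_hom[OF S] et] et])
    (simp add: crd_natural[OF S S id_alg_hom[OF S] et] vmap_id[OF crd_vec[OF S et]])
  show "base_change_trans S V (compose (carrier S) g f) et = base_change_trans U V g (base_change_trans S U f et)"
   if S: "S : Algs R" and U: "U : Algs R" and V: "V : Algs R" and f: "f : alg_hom R S U" and g: "g : alg_hom R U V"
    and et: "et : vals D S" for S U V f g et
   by (rule eqI[OF V Arc[OF S V alg_hom_comp[OF f g S] et] Arc[OF U V g Arc[OF S U f et]]])
    (simp add: crd_natural[OF S V alg_hom_comp[OF f g S] et] crd_natural[OF U V g Arc[OF S U f et]]
     crd_natural[OF S U f et] vmap_compose[OF crd_vec[OF S et]])
 qed
 have Q: "comm_algebra_functor R Q" unfolding comm_algebra_functor_def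
 proof (intro conjI ballI sf alg)
  fix S U f assume S: "S : Algs R" and U: "U : Algs R" and f: "f : alg_hom R S U"
  note f' = alg_homD(2)[OF f]
  note A = Arc[OF S U f]
  have Aq: "Ar Q S U f et : vals Q U" if "et : vals Q S" for et using A that by (simp add: Qs)
  have n: "crd U (Ar Q S U f et) = vmap B f (crd S et)" if "et : vals Q S" for et
   using that crd_natural[OF S U f] by (simp add: Qs)
  have eqQ: "et = th" if "et : vals Q U" "th : vals Q U" "crd U et = crd U th" for et th
   using eqI[OF U] that by (simp add: Qs(1))
  have lm: "crd S (et \<otimes>\<^sub>(Ob Q S) th) = mul S (crd S et) (crd S th)"
   if "S : Algs R" "et : vals Q S" "th : vals Q S" for S et th
   using crd_\<Theta>[OF that(1) va.mul_closed[OF that(1)]] crd_vec[OF that(1)] that by (simp add: Qs)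
  have la: "crd S (et \<oplus>\<^sub>(Ob Q S) th) = vadd B S (crd S et) (crd S th)"
   if "S : Algs R" "et : vals Q S" "th : vals Q S" for S et th using crd_add that by (simp add: Qs)
  have ls: "crd S (s \<odot>\<^sub>(Ob Q S) et) = vscale B S s (crd S et)"
   if "S : Algs R" "s : carrier S" "et : vals Q S" for S s et using crd_smult that by (simp add: Qs)
  have lv: "crd S et : vec True B S" if "et : vals Q S" for et using crd_vec[OF S] that by (simp add: Qs(1))
  show "Ar Q S U f : ring_hom (Ob Q S) (Ob Q U)"
  proof (rule ring_hom_memI)
   fix et assume et: "et : vals Q S"
   show "Ar Q S U f et : vals Q U" by (rule Aq[OF et])
   fix th assume th: "th : vals Q S"
   show "Ar Q S U f (et \<otimes>\<^sub>(Ob Q S) th) = Ar Q S U f et \<otimes>\<^sub>(Ob Q U) Ar Q S U f th"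
    by (rule eqQ[OF Aq[OF cl(2)[OF S et th]] cl(2)[OF U Aq[OF et] Aq[OF th]]])
     (simp only: n[OF cl(2)[OF S et th]] lm[OF S et th] lm[OF U Aq[OF et] Aq[OF th]] n[OF et] n[OF th]
      va.mul_natural[OF S U f lv[OF et] lv[OF th]])
   show "Ar Q S U f (et \<oplus>\<^sub>(Ob Q S) th) = Ar Q S U f et \<oplus>\<^sub>(Ob Q U) Ar Q S U f th"
    by (rule eqQ[OF Aq[OF cl(1)[OF S et th]] cl(1)[OF U Aq[OF et] Aq[OF th]]])
     (simp only: n[OF cl(1)[OF S et th]] la[OF S et th] la[OF U Aq[OF et] Aq[OF th]] n[OF et] n[OF th]
      vmap_vadd[OF f' lv[OF et] lv[OF th]])
  next
   show "Ar Q S U f \<one>\<^sub>(Ob Q S) = \<one>\<^sub>(Ob Q U)" by (rule eqQ[OF Aq[OF zc(2)[OF S]] zc(2)[OF U]])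
     (use n[OF zc(2)[OF S]] in \<open>simp add: Qs crd_\<Theta>[OF S va.one_closed[OF S]] crd_\<Theta>[OF U va.one_closed[OF U]] va.one_natural[OF S U f]\<close>)
  qed
  fix s et assume s: "s : carrier S" and et: "et : vals Q S"
  note fs = ring_hom_closed[OF f' s]
  show "Ar Q S U f (s \<odot>\<^sub>(Ob Q S) et) = f s \<odot>\<^sub>(Ob Q U) Ar Q S U f et"
   by (rule eqQ[OF Aq[OF cl(3)[OF S et et s]] cl(3)[OF U Aq[OF et] Aq[OF et] fs]])
    (simp only: n[OF cl(3)[OF S et et s]] ls[OF S s et] ls[OF U fs Aq[OF et]] n[OF et] vmap_vscale[OF f' s lv[OF et]])
 qed
 have "formal_algebra R C B co Q mul unt" using Q va
 proof (intro formal_algebra.intro framed_module_axioms formal_algebra_axioms.intro)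
  fix S assume S: "S : Algs R"
  show "Ob Q S = (Ob D S)\<lparr>mult := monoid.mult (Ob Q S), one := monoid.one (Ob Q S)\<rparr>" by (simp add: Q_def)
  show "crd S \<one>\<^sub>(Ob Q S) = unt S" using crd_\<Theta>[OF S va.one_closed[OF S]] by (simp add: Qs)
  show "crd S (et \<otimes>\<^sub>(Ob Q S) th) = mul S (crd S et) (crd S th)" if "et : vals Q S" "th : vals Q S" for et th
   using that crd_\<Theta>[OF S va.mul_closed[OF S]] crd_vec[OF S] by (simp add: Qs)
 qed (simp_all add: Qs D_simps)
 then show ?thesis by blast
qed

end

lemma Spec_functor_Ar:
 assumes "formal_algebra R C B co Q mul unt" "T : Algs R" "U : Algs R" "f : alg_hom R T U"
  "\<psi> : vals (Spec_functor R Q) T"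
 shows "Ar (Spec_functor R Q) T U f \<psi> : vals (Spec_functor R Q) U"
proof -
 interpret formal_algebra R C B co Q mul unt by fact
 obtain h where h: "(\<forall>T\<in>Algs R. bij_betw (h T) (vals (Char_functor R True B mul unt) T) (vals (Spec_functor R Q) T)) \<and>
  (\<forall>T\<in>Algs R. \<forall>U\<in>Algs R. \<forall>f\<in>alg_hom R T U. \<forall>x\<in>vals (Char_functor R True B mul unt) T.
   h U (Ar (Char_functor R True B mul unt) T U f x) = Ar (Spec_functor R Q) T U f (h T x))"
  using functor_isoD[OF Char_iso_Spec] ..
 note b = conjunct1[OF h, rule_format] and n = conjunct2[OF h, rule_format]
 obtain x where x: "x : vals (Char_functor R True B mul unt) T" "\<psi> = h T x"
  using b[OF assms(2)] assms(5) unfolding bij_betw_def by blast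
 have "h U (Ar (Char_functor R True B mul unt) T U f x) : vals (Spec_functor R Q) U"
  using b[OF assms(3)] Char_functor_Ar[OF assms(2-4) x(1)] unfolding bij_betw_def by blast
 then show ?thesis using n[OF assms(2-4) x(1)] x(2) by simp
qed

section \<open>Identification of the two categories with those of reflexive monoids\<close>

theorem formal_scheme_iff:
 fixes R :: "('u, 'm) ring_scheme"
 assumes R: "cring R" and inf: "infinite (UNIV :: 'u set)" and F: "set_functor R F"
 shows "formal_scheme R F \<longleftrightarrow>
  (\<exists>B mul unt. vec_algebra R True B mul unt \<and> functor_iso R F (Char_functor R True B mul unt))"
proof -
 have FA: "Ar F T U f x : vals F U"
  if "T : Algs R" "U : Algs R" "f : alg_hom R T U" "x : vals F T" for T U f x
  using F that unfolding set_functor_def by blast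
 show ?thesis
 proof
  assume "formal_scheme R F"
  then obtain C Q where C: "free_mod R C" and Q: "comm_algebra_functor R Q"
   and ObQ: "\<forall>S\<in>Algs R. Ob Q S = (Ob (dual_module R (quasi_coherent R C)) S)
    \<lparr>mult := monoid.mult (Ob Q S), one := monoid.one (Ob Q S)\<rparr>"
   and ArQ: "Ar Q = Ar (dual_module R (quasi_coherent R C))" and iso: "functor_iso R F (Spec_functor R Q)"
   unfolding formal_scheme_def by blast
  obtain B :: "'u set" and co where fr: "frame R C B co" using free_mod_frame[OF C] by blast
  interpret framed_module R C B co using C fr by (simp add: framed_module_def framed_def framed_axioms_def free_mod_def)
  obtain mul unt where fa: "formal_algebra R C B co Q mul unt" using vec_algebra_of_functor[OF inf Q _ ArQ] ObQ by blast
  interpret fa: formal_algebra R C B co Q mul unt by (rule fa)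
  have "functor_iso R (Spec_functor R Q) (Char_functor R True B mul unt)" by (rule functor_iso_sym[OF fa.Char_iso_Spec])
    (rule Char_functor_Ar Spec_functor_Ar[OF fa]; assumption)+
  from functor_iso_trans[OF iso this FA] fa.va
  show "\<exists>B mul unt. vec_algebra R True B mul unt \<and> functor_iso R F (Char_functor R True B mul unt)" by blast
 next
  assume "\<exists>B mul unt. vec_algebra R True B mul unt \<and> functor_iso R F (Char_functor R True B mul unt)"
  then obtain B mul unt where va: "vec_algebra R True B mul unt" and iso: "functor_iso R F (Char_functor R True B mul unt)"
   by blast
  obtain C co where fm: "framed_module R C B co" using vec_algebra.free_module_exists[OF va] by blast
  interpret framed_module R C B co by (rule fm)
  obtain Q where fa: "formal_algebra R C B co Q mul unt" using functor_of_vec_algebra[OF va] by blast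
  interpret fa: formal_algebra R C B co Q mul unt by (rule fa)
  have i: "functor_iso R F (Spec_functor R Q)" by (rule functor_iso_trans[OF iso fa.Char_iso_Spec FA])
  show "formal_scheme R F" unfolding formal_scheme_def using free fa.Q fa.ObQ fa.ArQ i by blast
 qed
qed

lemma reflexive_monoid_iff:
 "reflexive_monoid k R G \<longleftrightarrow> comm_monoid_functor R G \<and>
  (\<exists>B mul unt. vec_algebra R k B mul unt \<and> functor_iso R G (Char_functor R k B mul unt))"
proof
 assume "reflexive_monoid k R G"
 then obtain B mul unt pt where "dualizable R k B mul unt G pt" unfolding reflexive_monoid_def by blast
 then interpret dualizable R k B mul unt G pt .
 have "functor_iso R G (Char_functor R k B mul unt)" by (rule functor_isoI[where h = pt])
   (use pt_bij pt_natural Ar_closed in auto)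
 then show "comm_monoid_functor R G \<and>
  (\<exists>B mul unt. vec_algebra R k B mul unt \<and> functor_iso R G (Char_functor R k B mul unt))"
  using G vec_algebra_axioms by blast
next
 assume "comm_monoid_functor R G \<and>
  (\<exists>B mul unt. vec_algebra R k B mul unt \<and> functor_iso R G (Char_functor R k B mul unt))"
 then obtain B mul unt where G: "comm_monoid_functor R G" and va: "vec_algebra R k B mul unt"
  and iso: "functor_iso R G (Char_functor R k B mul unt)" by blast
 obtain pt where pt: "(\<forall>T\<in>Algs R. bij_betw (pt T) (vals G T) (vals (Char_functor R k B mul unt) T)) \<and>
  (\<forall>T\<in>Algs R. \<forall>U\<in>Algs R. \<forall>f\<in>alg_hom R T U. \<forall>x\<in>vals G T.
   pt U (Ar G T U f x) = Ar (Char_functor R k B mul unt) T U f (pt T x))" using functor_isoD[OF iso] ..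
 have "dualizable R k B mul unt G pt" using pt by (intro dualizable.intro va dualizable_axioms.intro G) auto
 then show "reflexive_monoid k R G" unfolding reflexive_monoid_def by blast
qed

theorem theorem8p17:
  fixes R :: "'u ring"
  assumes "cring R"
    and "infinite (UNIV :: 'u set)"
    and "\<exists>\<iota> :: ('u \<Rightarrow> 'u) \<Rightarrow> 'v. inj \<iota>"
  shows "anti_equivalence
           (affine_monoids R :: (('u, 'v monoid, 'v) alg_functor, 'u alg \<Rightarrow> 'v \<Rightarrow> 'v) cat)
           (formal_monoids R) (dual_monoid R) (dual_monoid_map R) \<and>
         anti_equivalence
           (formal_monoids R :: (('u, 'v monoid, 'v) alg_functor, 'u alg \<Rightarrow> 'v \<Rightarrow> 'v) cat)
           (affine_monoids R) (dual_monoid R) (dual_monoid_map R)"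
proof -
 \<comment> \<open>The type \<open>'w\<close> of values is left open, because each of the two
   equations is used both for \<open>'v\<close> and for the values of dual monoids.\<close>
 have affine: "affine_monoids R = monoid_functor_cat R {G :: ('u, 'w monoid, 'w) alg_functor. reflexive_monoid False R G}"
  unfolding affine_monoids_def reflexive_monoid_iff using affine_free_scheme_iff[OF assms(1,2)]
  by (intro arg_cong[of _ _ "monoid_functor_cat R"]) (auto simp: comm_monoid_functor_def)
 have formal: "formal_monoids R = monoid_functor_cat R {G :: ('u, 'w monoid, 'w) alg_functor. reflexive_monoid True R G}"
  unfolding formal_monoids_def reflexive_monoid_iff using formal_scheme_iff[OF assms(1,2)]
  by (intro arg_cong[of _ _ "monoid_functor_cat R"]) (auto simp: comm_monoid_functor_def)
 obtain \<iota> :: "('u => 'u) => 'v" where \<iota>: "inj \<iota>" using assms(3) by blast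
 show ?thesis
  using reflexive_duality[OF \<iota>, of R False] reflexive_duality[OF \<iota>, of R True] by (simp add: affine formal)
qed

end
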